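(* Let $R$ be a commutative Noetherian ring with identity, of finite Krull dimension, which is singular (i.e. not regular). Then the triangulated category $\mathrm{Perf}(R)$ of perfect complexes over $R$ admits no bounded t-structure.
   Context: $\mathrm{Perf}(R)$ is the full triangulated subcategory of the unbounded derived category $\mathrm{D}(R)$ of $R$-modules consisting of the complexes quasi-isomorphic to a bounded complex of finitely generated projective $R$-modules; $[1]$ is the suspension functor. A t-structure on a triangulated category $\mathscr{C}$ is a pair of full subcategories $(\mathscr{U},\mathscr{V})$ (closed under isomorphism) such that: (1) $\mathscr{U}[1]\subseteq\mathscr{U}$ and $\mathscr{V}\subseteq\mathscr{V}[1]$; (2) $\mathrm{Hom}_{\mathscr{C}}(X[1],Y)=0$ for all $X\in\mathscr{U}$, $Y\in\mathscr{V}$; (3) for every $X\in\mathscr{C}$ there is a distinguished triangle $A\to X\to B\to A[1]$ with $A\in\mathscr{U}$ and $B\in\mathscr{V}[-1]$. The t-structure is bounded if for every $X\in\mathscr{C}$ there are integers $m,n$ with $X\in\mathscr{U}[-m]$ and $X\in\mathscr{V}[-n]$. *)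

theory Defs
  imports "HOL-Algebra.Module" "HOL-Algebra.Ring_Divisibility" "HOL-Library.Extended_Nat"
begin

section \<open>Regular and singular rings\<close>

text \<open>Localization at a prime ideal \<open>P\<close>. A fraction is an equivalence class of pairs
  \<open>(r, s)\<close> with \<open>s \<notin> P\<close>; the operations return the full class of the representative formula.\<close>

definition fractions :: "('a, 'b) ring_scheme \<Rightarrow> 'a set \<Rightarrow> ('a \<times> 'a) set" where
  "fractions R P = carrier R \<times> (carrier R - P)"

definition frac_rel :: "('a, 'b) ring_scheme \<Rightarrow> 'a set \<Rightarrow> (('a \<times> 'a) \<times> ('a \<times> 'a)) set" where
  "frac_rel R P = {((r, s), (r', s')). (r, s) \<in> fractions R P \<and> (r', s') \<in> fractions R P \<and>
     (\<exists>t\<in>carrier R - P. t \<otimes>\<^bsub>R\<^esub> (s' \<otimes>\<^bsub>R\<^esub> r \<ominus>\<^bsub>R\<^esub> s \<otimes>\<^bsub>R\<^esub> r') = \<zero>\<^bsub>R\<^esub>)}"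

definition localization :: "('a, 'b) ring_scheme \<Rightarrow> 'a set \<Rightarrow> ('a \<times> 'a) set ring" where
  "localization R P =
    \<lparr>carrier = fractions R P // frac_rel R P,
     monoid.mult = (\<lambda>A B. \<Union>(r, s)\<in>A. \<Union>(r', s')\<in>B. frac_rel R P `` {(r \<otimes>\<^bsub>R\<^esub> r', s \<otimes>\<^bsub>R\<^esub> s')}),
     one = frac_rel R P `` {(\<one>\<^bsub>R\<^esub>, \<one>\<^bsub>R\<^esub>)},
     ring.zero = frac_rel R P `` {(\<zero>\<^bsub>R\<^esub>, \<one>\<^bsub>R\<^esub>)},
     add = (\<lambda>A B. \<Union>(r, s)\<in>A. \<Union>(r', s')\<in>B.
       frac_rel R P `` {(s' \<otimes>\<^bsub>R\<^esub> r \<oplus>\<^bsub>R\<^esub> s \<otimes>\<^bsub>R\<^esub> r', s \<otimes>\<^bsub>R\<^esub> s')})\<rparr>"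

text \<open>Supremum of the lengths of chains of prime ideals (it is \<open>0\<close>, rather than
  \<open>-\<infinity>\<close>, for the zero ring).\<close>

definition krull_dim :: "('a, 'b) ring_scheme \<Rightarrow> enat" where
  "krull_dim R = Sup {enat n | n. \<exists>p :: nat \<Rightarrow> 'a set.
     (\<forall>i\<le>n. primeideal (p i) R) \<and> (\<forall>i<n. p i \<subset> p (Suc i))}"

definition regular_local_ring :: "('a, 'b) ring_scheme \<Rightarrow> bool" where
  "regular_local_ring A \<longleftrightarrow> cring A \<and> noetherian_ring A \<and> (\<exists>!\<mm>. maximalideal \<mm> A) \<and>
     (\<exists>S \<subseteq> carrier A. finite S \<and> enat (card S) = krull_dim A \<and> maximalideal (Idl\<^bsub>A\<^esub> S) A)"

definition regular_ring :: "('a, 'b) ring_scheme \<Rightarrow> bool" where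
  "regular_ring R \<longleftrightarrow> cring R \<and> noetherian_ring R \<and>
     (\<forall>P. primeideal P R \<longrightarrow> regular_local_ring (localization R P))"


section \<open>t-structures\<close>

text \<open>The data of a triangulated category that enters the definition of a t-structure.
  Composition takes the three objects and is written in the order of function composition:
  \<open>comp_mor C X Y Z g f\<close> is \<open>g \<circ> f\<close> for \<open>f : X \<rightarrow> Y\<close>, \<open>g : Y \<rightarrow> Z\<close>. The shift \<open>[n]\<close> is given
  for all integers \<open>n\<close>.\<close>

record ('o, 'h) tri_cat =
  obj :: "'o set"
  hom_set :: "'o \<Rightarrow> 'o \<Rightarrow> 'h set"
  ident :: "'o \<Rightarrow> 'h"
  comp_mor :: "'o \<Rightarrow> 'o \<Rightarrow> 'o \<Rightarrow> 'h \<Rightarrow> 'h \<Rightarrow> 'h"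
  zero_mor :: "'o \<Rightarrow> 'o \<Rightarrow> 'h"
  shift :: "int \<Rightarrow> 'o \<Rightarrow> 'o"
  shift_mor :: "int \<Rightarrow> 'o \<Rightarrow> 'o \<Rightarrow> 'h \<Rightarrow> 'h"
  dist_tri :: "'o \<Rightarrow> 'o \<Rightarrow> 'o \<Rightarrow> 'h \<Rightarrow> 'h \<Rightarrow> 'h \<Rightarrow> bool"

definition iso_mor :: "('o, 'h) tri_cat \<Rightarrow> 'o \<Rightarrow> 'o \<Rightarrow> 'h \<Rightarrow> bool" where
  "iso_mor C X Y f \<longleftrightarrow> f \<in> hom_set C X Y \<and>
     (\<exists>g \<in> hom_set C Y X. comp_mor C X Y X g f = ident C X \<and> comp_mor C Y X Y f g = ident C Y)"

definition isomorphic :: "('o, 'h) tri_cat \<Rightarrow> 'o \<Rightarrow> 'o \<Rightarrow> bool" where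
  "isomorphic C X Y \<longleftrightarrow> (\<exists>f. iso_mor C X Y f)"

definition full_subcat :: "('o, 'h) tri_cat \<Rightarrow> 'o set \<Rightarrow> ('o, 'h) tri_cat" where
  "full_subcat C S = C\<lparr>obj := obj C \<inter> S,
     dist_tri := (\<lambda>X Y Z f g h. X \<in> S \<and> Y \<in> S \<and> Z \<in> S \<and> dist_tri C X Y Z f g h)\<rparr>"

text \<open>A full subcategory closed under isomorphism is given by its objects.\<close>

definition strictly_full :: "('o, 'h) tri_cat \<Rightarrow> 'o set \<Rightarrow> bool" where
  "strictly_full C U \<longleftrightarrow> U \<subseteq> obj C \<and> (\<forall>X\<in>U. \<forall>Y\<in>obj C. isomorphic C X Y \<longrightarrow> Y \<in> U)"

text \<open>The closed-under-isomorphism subcategory \<open>U[n]\<close>.\<close>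

definition translate :: "('o, 'h) tri_cat \<Rightarrow> int \<Rightarrow> 'o set \<Rightarrow> 'o set" where
  "translate C n U = {X \<in> obj C. \<exists>A\<in>U. isomorphic C X (shift C n A)}"

definition t_structure :: "('o, 'h) tri_cat \<Rightarrow> 'o set \<Rightarrow> 'o set \<Rightarrow> bool" where
  "t_structure C U V \<longleftrightarrow>
     strictly_full C U \<and> strictly_full C V \<and>
     translate C 1 U \<subseteq> U \<and> V \<subseteq> translate C 1 V \<and>
     (\<forall>X\<in>U. \<forall>Y\<in>V. hom_set C (shift C 1 X) Y = {zero_mor C (shift C 1 X) Y}) \<and>
     (\<forall>X\<in>obj C. \<exists>A\<in>U. \<exists>B\<in>translate C (-1) V. \<exists>f g h. dist_tri C A X B f g h)"

definition bounded_t_structure :: "('o, 'h) tri_cat \<Rightarrow> 'o set \<Rightarrow> 'o set \<Rightarrow> bool" where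
  "bounded_t_structure C U V \<longleftrightarrow> t_structure C U V \<and>
     (\<forall>X\<in>obj C. \<exists>m n. X \<in> translate C (-m) U \<and> X \<in> translate C (-n) V)"


section \<open>Modules\<close>

text \<open>The modules of the derived category are those with carrier in a type \<open>'m\<close>. If
  \<open>'m\<close> is infinite and contains a copy of the ring, then every finitely generated module has
  an isomorphic copy in \<open>'m\<close>, and these modules are closed, up to isomorphism, under
  submodules, quotients and finite direct sums.
  Homomorphisms are total functions that are only meaningful on the carrier; they are compared
  on carriers throughout. The type \<open>('a, 'm) module\<close> extends \<open>'m ring\<close>, but the
  fields \<open>mult\<close> and \<open>one\<close> play no role for a module.\<close>

definition mod_hom ::
  "('a, 'b) ring_scheme \<Rightarrow> ('a, 'm) module \<Rightarrow> ('a, 'n) module \<Rightarrow> ('m \<Rightarrow> 'n) set" where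
  "mod_hom R M N = {f \<in> hom (add_monoid M) (add_monoid N).
     \<forall>a\<in>carrier R. \<forall>x\<in>carrier M. f (a \<odot>\<^bsub>M\<^esub> x) = a \<odot>\<^bsub>N\<^esub> f x}"

definition finitely_generated_module :: "('a, 'b) ring_scheme \<Rightarrow> ('a, 'm) module \<Rightarrow> bool" where
  "finitely_generated_module R M \<longleftrightarrow> (\<exists>S \<subseteq> carrier M. finite S \<and>
     (\<forall>H. submodule H R M \<and> S \<subseteq> H \<longrightarrow> H = carrier M))"

text \<open>Lifting along surjections of modules in the same universe \<open>'m\<close>.\<close>

definition projective_module :: "('a, 'b) ring_scheme \<Rightarrow> ('a, 'm) module \<Rightarrow> bool" where
  "projective_module R P \<longleftrightarrow> module R P \<and>
     (\<forall>(M :: ('a, 'm) module) (N :: ('a, 'm) module) g f.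
        module R M \<and> module R N \<and> g \<in> mod_hom R M N \<and> g ` carrier M = carrier N \<and>
        f \<in> mod_hom R P N \<longrightarrow>
        (\<exists>h \<in> mod_hom R P M. \<forall>x\<in>carrier P. g (h x) = f x))"

definition direct_sum :: "('a, 'm) module \<Rightarrow> ('a, 'n) module \<Rightarrow> ('a, 'm \<times> 'n) module" where
  "direct_sum M N =
    \<lparr>carrier = carrier M \<times> carrier N,
     monoid.mult = (\<lambda>_ _. (\<zero>\<^bsub>M\<^esub>, \<zero>\<^bsub>N\<^esub>)),
     one = (\<zero>\<^bsub>M\<^esub>, \<zero>\<^bsub>N\<^esub>),
     ring.zero = (\<zero>\<^bsub>M\<^esub>, \<zero>\<^bsub>N\<^esub>),
     add = (\<lambda>(x, y) (x', y'). (x \<oplus>\<^bsub>M\<^esub> x', y \<oplus>\<^bsub>N\<^esub> y')),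
     smult = (\<lambda>a (x, y). (a \<odot>\<^bsub>M\<^esub> x, a \<odot>\<^bsub>N\<^esub> y))\<rparr>"


section \<open>Cochain complexes\<close>

record ('a, 'm) cochain_complex =
  module_at :: "int \<Rightarrow> ('a, 'm) module"
  diff :: "int \<Rightarrow> 'm \<Rightarrow> 'm"

definition is_complex :: "('a, 'b) ring_scheme \<Rightarrow> ('a, 'm) cochain_complex \<Rightarrow> bool" where
  "is_complex R X \<longleftrightarrow>
     (\<forall>i. module R (module_at X i) \<and>
          diff X i \<in> mod_hom R (module_at X i) (module_at X (i + 1)) \<and>
          (\<forall>x\<in>carrier (module_at X i). diff X (i + 1) (diff X i x) = \<zero>\<^bsub>module_at X (i + 2)\<^esub>))"

definition chain_maps :: "('a, 'b) ring_scheme \<Rightarrow> ('a, 'm) cochain_complex \<Rightarrow>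
    ('a, 'n) cochain_complex \<Rightarrow> (int \<Rightarrow> 'm \<Rightarrow> 'n) set" where
  "chain_maps R X Y = {f. \<forall>i. f i \<in> mod_hom R (module_at X i) (module_at Y i) \<and>
     (\<forall>x\<in>carrier (module_at X i). f (i + 1) (diff X i x) = diff Y i (f i x))}"

definition chain_comp :: "(int \<Rightarrow> 'n \<Rightarrow> 'p) \<Rightarrow> (int \<Rightarrow> 'm \<Rightarrow> 'n) \<Rightarrow> int \<Rightarrow> 'm \<Rightarrow> 'p" where
  "chain_comp g f = (\<lambda>i. g i \<circ> f i)"

definition chain_homotopic :: "('a, 'b) ring_scheme \<Rightarrow> ('a, 'm) cochain_complex \<Rightarrow>
    ('a, 'n) cochain_complex \<Rightarrow> (int \<Rightarrow> 'm \<Rightarrow> 'n) \<Rightarrow> (int \<Rightarrow> 'm \<Rightarrow> 'n) \<Rightarrow> bool" where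
  "chain_homotopic R X Y f g \<longleftrightarrow>
     (\<exists>s. (\<forall>i. s i \<in> mod_hom R (module_at X i) (module_at Y (i - 1))) \<and>
          (\<forall>i. \<forall>x\<in>carrier (module_at X i).
             f i x = g i x \<oplus>\<^bsub>module_at Y i\<^esub>
               (diff Y (i - 1) (s i x) \<oplus>\<^bsub>module_at Y i\<^esub> s (i + 1) (diff X i x))))"

definition cocycles :: "('a, 'm) cochain_complex \<Rightarrow> int \<Rightarrow> 'm set" where
  "cocycles X i = {x \<in> carrier (module_at X i). diff X i x = \<zero>\<^bsub>module_at X (i + 1)\<^esub>}"

definition coboundaries :: "('a, 'm) cochain_complex \<Rightarrow> int \<Rightarrow> 'm set" where
  "coboundaries X i = diff X (i - 1) ` carrier (module_at X (i - 1))"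

definition cohomology :: "('a, 'm) cochain_complex \<Rightarrow> int \<Rightarrow> 'm set monoid" where
  "cohomology X i =
     ((add_monoid (module_at X i))\<lparr>carrier := cocycles X i\<rparr>) Mod (coboundaries X i)"

text \<open>The induced map sends the coset of a cocycle \<open>x\<close> to the coset of \<open>f x\<close>.\<close>

definition cohomology_map :: "('a, 'n) cochain_complex \<Rightarrow> (int \<Rightarrow> 'm \<Rightarrow> 'n) \<Rightarrow>
    int \<Rightarrow> 'm set \<Rightarrow> 'n set" where
  "cohomology_map Y f i K = coboundaries Y i <+>\<^bsub>module_at Y i\<^esub> (f i ` K)"

definition quasi_iso :: "('a, 'b) ring_scheme \<Rightarrow> ('a, 'm) cochain_complex \<Rightarrow>
    ('a, 'n) cochain_complex \<Rightarrow> (int \<Rightarrow> 'm \<Rightarrow> 'n) \<Rightarrow> bool" where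
  "quasi_iso R X Y f \<longleftrightarrow> f \<in> chain_maps R X Y \<and>
     (\<forall>i. cohomology_map Y f i \<in> iso (cohomology X i) (cohomology Y i))"

definition shift_complex :: "int \<Rightarrow> ('a, 'm) cochain_complex \<Rightarrow> ('a, 'm) cochain_complex" where
  "shift_complex n X =
    \<lparr>module_at = (\<lambda>i. module_at X (i + n)),
     diff = (\<lambda>i x. if even n then diff X (i + n) x
                   else \<ominus>\<^bsub>module_at X (i + n + 1)\<^esub> diff X (i + n) x)\<rparr>"

definition shift_map :: "int \<Rightarrow> (int \<Rightarrow> 'm \<Rightarrow> 'n) \<Rightarrow> int \<Rightarrow> 'm \<Rightarrow> 'n" where
  "shift_map n f = (\<lambda>i. f (i + n))"

definition cone :: "('a, 'm) cochain_complex \<Rightarrow> ('a, 'n) cochain_complex \<Rightarrow>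
    (int \<Rightarrow> 'm \<Rightarrow> 'n) \<Rightarrow> ('a, 'm \<times> 'n) cochain_complex" where
  "cone X Y f =
    \<lparr>module_at = (\<lambda>i. direct_sum (module_at X (i + 1)) (module_at Y i)),
     diff = (\<lambda>i (x, y). (\<ominus>\<^bsub>module_at X (i + 2)\<^esub> diff X (i + 1) x,
                        f (i + 1) x \<oplus>\<^bsub>module_at Y (i + 1)\<^esub> diff Y i y))\<rparr>"

text \<open>The standard triangle \<open>X \<rightarrow> Y \<rightarrow> cone f \<rightarrow> X[1]\<close>. The cone has its elements in the type
  \<open>'m \<times> 'm\<close>, so it is replaced by an isomorphic complex \<open>Z\<close> over \<open>'m\<close>; the maps are the
  inclusion \<open>y \<mapsto> (0, y)\<close> and the projection \<open>(x, y) \<mapsto> x\<close>, transported along the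
  isomorphism \<open>\<phi>\<close>.\<close>

definition cone_triangle :: "('a, 'b) ring_scheme \<Rightarrow> ('a, 'm) cochain_complex \<Rightarrow>
    ('a, 'm) cochain_complex \<Rightarrow> ('a, 'm) cochain_complex \<Rightarrow>
    (int \<Rightarrow> 'm \<Rightarrow> 'm) \<Rightarrow> (int \<Rightarrow> 'm \<Rightarrow> 'm) \<Rightarrow> (int \<Rightarrow> 'm \<Rightarrow> 'm) \<Rightarrow> bool" where
  "cone_triangle R X Y Z f g h \<longleftrightarrow>
     is_complex R X \<and> is_complex R Y \<and> is_complex R Z \<and>
     f \<in> chain_maps R X Y \<and> g \<in> chain_maps R Y Z \<and> h \<in> chain_maps R Z (shift_complex 1 X) \<and>
     (\<exists>\<phi> \<in> chain_maps R (cone X Y f) Z.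
        (\<forall>i. bij_betw (\<phi> i) (carrier (module_at (cone X Y f) i)) (carrier (module_at Z i))) \<and>
        (\<forall>i. \<forall>y\<in>carrier (module_at Y i). g i y = \<phi> i (\<zero>\<^bsub>module_at X (i + 1)\<^esub>, y)) \<and>
        (\<forall>i. \<forall>(x, y)\<in>carrier (module_at (cone X Y f) i). h i (\<phi> i (x, y)) = x))"


section \<open>The derived category\<close>

text \<open>The derived category is the localization of the homotopy category at the
  quasi-isomorphisms, via the calculus of fractions. A morphism \<open>X \<rightarrow> Y\<close> is a class of roofs
  \<open>X \<leftarrow> W \<rightarrow> Y\<close> whose left leg is a quasi-isomorphism.\<close>

record ('a, 'm) roof =
  apex :: "('a, 'm) cochain_complex"
  left_leg :: "int \<Rightarrow> 'm \<Rightarrow> 'm"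
  right_leg :: "int \<Rightarrow> 'm \<Rightarrow> 'm"

definition roofs :: "('a, 'b) ring_scheme \<Rightarrow> ('a, 'm) cochain_complex \<Rightarrow>
    ('a, 'm) cochain_complex \<Rightarrow> ('a, 'm) roof set" where
  "roofs R X Y = {r. is_complex R (apex r) \<and> quasi_iso R (apex r) X (left_leg r) \<and>
     right_leg r \<in> chain_maps R (apex r) Y}"

text \<open>Two roofs are equivalent if a third one dominates both, up to homotopy.\<close>

definition roof_rel :: "('a, 'b) ring_scheme \<Rightarrow> ('a, 'm) cochain_complex \<Rightarrow>
    ('a, 'm) cochain_complex \<Rightarrow> (('a, 'm) roof \<times> ('a, 'm) roof) set" where
  "roof_rel R X Y = {(r, r'). r \<in> roofs R X Y \<and> r' \<in> roofs R X Y \<and>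
     (\<exists>(W :: ('a, 'm) cochain_complex) a b.
        is_complex R W \<and> a \<in> chain_maps R W (apex r) \<and> b \<in> chain_maps R W (apex r') \<and>
        quasi_iso R W X (chain_comp (left_leg r) a) \<and>
        chain_homotopic R W X (chain_comp (left_leg r) a) (chain_comp (left_leg r') b) \<and>
        chain_homotopic R W Y (chain_comp (right_leg r) a) (chain_comp (right_leg r') b))}"

definition derived_hom :: "('a, 'b) ring_scheme \<Rightarrow> ('a, 'm) cochain_complex \<Rightarrow>
    ('a, 'm) cochain_complex \<Rightarrow> ('a, 'm) roof set set" where
  "derived_hom R X Y = roofs R X Y // roof_rel R X Y"

text \<open>The image in the derived category of a chain map.\<close>

definition derived_of_chain :: "('a, 'b) ring_scheme \<Rightarrow> ('a, 'm) cochain_complex \<Rightarrow>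
    ('a, 'm) cochain_complex \<Rightarrow> (int \<Rightarrow> 'm \<Rightarrow> 'm) \<Rightarrow> ('a, 'm) roof set" where
  "derived_of_chain R X Y f =
     roof_rel R X Y `` {\<lparr>apex = X, left_leg = (\<lambda>_. id), right_leg = f\<rparr>}"

text \<open>To compose \<open>X \<leftarrow> apex r \<rightarrow> Y\<close> with \<open>Y \<leftarrow> apex r' \<rightarrow> Z\<close>, complete
  \<open>apex r \<rightarrow> Y \<leftarrow> apex r'\<close> to a square \<open>apex r \<leftarrow> W \<rightarrow> apex r'\<close> commuting up to homotopy,
  with \<open>W \<rightarrow> apex r\<close> a quasi-isomorphism. All choices give the same class.\<close>

definition derived_comp :: "('a, 'b) ring_scheme \<Rightarrow> ('a, 'm) cochain_complex \<Rightarrow>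
    ('a, 'm) cochain_complex \<Rightarrow> ('a, 'm) cochain_complex \<Rightarrow>
    ('a, 'm) roof set \<Rightarrow> ('a, 'm) roof set \<Rightarrow> ('a, 'm) roof set" where
  "derived_comp R X Y Z G F =
     roof_rel R X Z ``
       {\<lparr>apex = W, left_leg = chain_comp (left_leg r) t, right_leg = chain_comp (right_leg r') u\<rparr>
        | r r' W t u. r \<in> F \<and> r' \<in> G \<and> is_complex R W \<and>
            quasi_iso R W (apex r) t \<and> u \<in> chain_maps R W (apex r') \<and>
            chain_homotopic R W Y (chain_comp (right_leg r) t) (chain_comp (left_leg r') u)}"

definition derived_shift_mor :: "('a, 'b) ring_scheme \<Rightarrow> int \<Rightarrow> ('a, 'm) cochain_complex \<Rightarrow>
    ('a, 'm) cochain_complex \<Rightarrow> ('a, 'm) roof set \<Rightarrow> ('a, 'm) roof set" where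
  "derived_shift_mor R n X Y F =
     roof_rel R (shift_complex n X) (shift_complex n Y) ``
       ((\<lambda>r. \<lparr>apex = shift_complex n (apex r), left_leg = shift_map n (left_leg r),
              right_leg = shift_map n (right_leg r)\<rparr>) ` F)"

definition derived_zero :: "('a, 'b) ring_scheme \<Rightarrow> ('a, 'm) cochain_complex \<Rightarrow>
    ('a, 'm) cochain_complex \<Rightarrow> ('a, 'm) roof set" where
  "derived_zero R X Y = derived_of_chain R X Y (\<lambda>i x. \<zero>\<^bsub>module_at Y i\<^esub>)"

text \<open>The derived category without its triangles; the distinguished triangles are then those
  isomorphic, in this category, to a standard one.\<close>

definition derived_base ::
  "('a, 'b) ring_scheme \<Rightarrow> (('a, 'm) cochain_complex, ('a, 'm) roof set) tri_cat" where
  "derived_base R =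
    \<lparr>obj = {X. is_complex R X},
     hom_set = derived_hom R,
     ident = (\<lambda>X. derived_of_chain R X X (\<lambda>_. id)),
     comp_mor = derived_comp R,
     zero_mor = derived_zero R,
     shift = shift_complex,
     shift_mor = derived_shift_mor R,
     dist_tri = (\<lambda>_ _ _ _ _ _. False)\<rparr>"

definition derived_dist_tri :: "('a, 'b) ring_scheme \<Rightarrow>
    ('a, 'm) cochain_complex \<Rightarrow> ('a, 'm) cochain_complex \<Rightarrow> ('a, 'm) cochain_complex \<Rightarrow>
    ('a, 'm) roof set \<Rightarrow> ('a, 'm) roof set \<Rightarrow> ('a, 'm) roof set \<Rightarrow> bool" where
  "derived_dist_tri R X Y Z f g h \<longleftrightarrow>
     is_complex R X \<and> is_complex R Y \<and> is_complex R Z \<and>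
     f \<in> derived_hom R X Y \<and> g \<in> derived_hom R Y Z \<and>
     h \<in> derived_hom R Z (shift_complex 1 X) \<and>
     (\<exists>X' Y' Z' u v w \<alpha> \<beta> \<gamma>.
        cone_triangle R X' Y' Z' u v w \<and>
        iso_mor (derived_base R) X X' \<alpha> \<and>
        iso_mor (derived_base R) Y Y' \<beta> \<and>
        iso_mor (derived_base R) Z Z' \<gamma> \<and>
        derived_comp R X Y Y' \<beta> f = derived_comp R X X' Y' (derived_of_chain R X' Y' u) \<alpha> \<and>
        derived_comp R Y Z Z' \<gamma> g = derived_comp R Y Y' Z' (derived_of_chain R Y' Z' v) \<beta> \<and>
        derived_comp R Z (shift_complex 1 X) (shift_complex 1 X') (derived_shift_mor R 1 X X' \<alpha>) h
          = derived_comp R Z Z' (shift_complex 1 X')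
              (derived_of_chain R Z' (shift_complex 1 X') w) \<gamma>)"

definition derived_category ::
  "('a, 'b) ring_scheme \<Rightarrow> (('a, 'm) cochain_complex, ('a, 'm) roof set) tri_cat" where
  "derived_category R = (derived_base R)\<lparr>dist_tri := derived_dist_tri R\<rparr>"


section \<open>Perfect complexes\<close>

definition bounded_fg_projective ::
  "('a, 'b) ring_scheme \<Rightarrow> ('a, 'm) cochain_complex \<Rightarrow> bool" where
  "bounded_fg_projective R P \<longleftrightarrow> is_complex R P \<and>
     (\<forall>i. finitely_generated_module R (module_at P i) \<and> projective_module R (module_at P i)) \<and>
     (\<exists>a b. \<forall>i. i < a \<or> b < i \<longrightarrow> carrier (module_at P i) = {\<zero>\<^bsub>module_at P i\<^esub>})"

definition quasi_isomorphic :: "('a, 'b) ring_scheme \<Rightarrow> ('a, 'm) cochain_complex \<Rightarrow>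
    ('a, 'm) cochain_complex \<Rightarrow> bool" where
  "quasi_isomorphic R X Y \<longleftrightarrow> (\<exists>W :: ('a, 'm) cochain_complex. is_complex R W \<and>
     (\<exists>s. quasi_iso R W X s) \<and> (\<exists>t. quasi_iso R W Y t))"

definition perfect_complex :: "('a, 'b) ring_scheme \<Rightarrow> ('a, 'm) cochain_complex \<Rightarrow> bool" where
  "perfect_complex R X \<longleftrightarrow> is_complex R X \<and>
     (\<exists>P :: ('a, 'm) cochain_complex. bounded_fg_projective R P \<and> quasi_isomorphic R X P)"

definition Perf ::
  "('a, 'b) ring_scheme \<Rightarrow> (('a, 'm) cochain_complex, ('a, 'm) roof set) tri_cat" where
  "Perf R = full_subcat (derived_category R) {X. perfect_complex R X}"

end

theory Submission
  imports Defs
begin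

text \<open>Let \<open>(U, V)\<close> be a bounded t-structure. Since \<open>R\<close> lies in a shift of \<open>U\<close> and in a shift of \<open>V\<close>,
  the orthogonality of \<open>U[1]\<close> and \<open>V\<close> shows that the complexes in \<open>V\<close> have no cohomology below some
  degree, and that those in \<open>U\<close> have exact \<open>R\<close>-duals beyond some degree. As the dimension is finite,
  the latter have no cohomology above some degree. Now put the free resolution of a prime ideal \<open>P\<close> in a
  high top degree, cut it off in a low degree, and let \<open>A \<rightarrow> X \<rightarrow> B\<close> be the truncation triangle of the
  resulting perfect complex. Then \<open>B\<close> has the top cohomology of \<open>X\<close> but not the one that was created
  by cutting, so the resolution is a homotopy retract of a bounded complex, hence contractible in high
  homological degrees. The same follows for the maximal ideal of \<open>R\<^sub>P\<close>, and this property of a local ring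
  passes to the quotient by a regular element outside the square of the maximal ideal. If a longest
  regular sequence of this kind did not generate the maximal ideal, the quotient by it would have a
  nonzero socle, which is impossible as its minimal resolution vanishes in high degrees. So the maximal
  ideal of \<open>R\<^sub>P\<close> is generated by a regular sequence, whose length is the dimension by Krull's theorem.\<close>

text \<open>Contractibility in high degrees stands in for finite projective dimension because it is
  an identity between linear maps: it passes to homotopy retracts and is preserved by every ring
  homomorphism, in particular by reduction and by localization. The finite dimension enters at one
  place, as a bound for the length of regular sequences: each regular element that is divided out
  costs the dual complex one degree of exactness. From the derived category three facts about chain
  maps are extracted: isomorphic objects are quasi-isomorphic, a vanishing Hom set makes the right
  leg of each roof null-homotopic after a quasi-isomorphism, and a triangle gives bijections on
  cohomology where its first term is exact. Resolutions are unbounded and live over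
  \<open>nat => 'a\<close>; only their truncations are copied into the type \<open>'m\<close> of the
  derived category. Being outside the square of the maximal ideal m is replaced by being outside an
  ideal L that is maximal among the ideals over I properly contained in m: such an L contains the
  square, and m is generated by L and any further element of m.\<close>

notation module_at (infixl "$" 999)

abbreviation cx_elements (infixl "$$" 999) where
  "X$$i \<equiv> carrier (X$i)"

section \<open>Module homomorphisms\<close>

lemma moduleD:
  assumes "module R M"
  shows "cring R" "abelian_group M" "abelian_monoid M" "group (add_monoid M)"
proof -
  interpret module R M by fact
  show "cring R" "abelian_group M" "abelian_monoid M" by unfold_locales
  show "group (add_monoid M)" by (rule a_group)
qed

lemma (in module) module_minus_zero [simp]: "\<ominus>\<^bsub>M\<^esub> \<zero>\<^bsub>M\<^esub> = \<zero>\<^bsub>M\<^esub>"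
  using M.minus_equality[of "\<zero>\<^bsub>M\<^esub>" "\<zero>\<^bsub>M\<^esub>"] by simp

lemma (in module) module_diff_zero [simp]: "x \<in> carrier M ==> x \<ominus>\<^bsub>M\<^esub> \<zero>\<^bsub>M\<^esub> = x"
  by (simp add: a_minus_def)

lemma mod_homI:
  assumes "\<And>x. x \<in> carrier M ==> f x \<in> carrier N"
    and "\<And>x y. x \<in> carrier M ==> y \<in> carrier M ==> f (x \<oplus>\<^bsub>M\<^esub> y) = f x \<oplus>\<^bsub>N\<^esub> f y"
    and "\<And>a x. a \<in> carrier R ==> x \<in> carrier M ==> f (a \<odot>\<^bsub>M\<^esub> x) = a \<odot>\<^bsub>N\<^esub> f x"
  shows "f \<in> mod_hom R M N"
  using assms by (auto simp: mod_hom_def hom_def)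

lemma mod_hom_closed: "f \<in> mod_hom R M N ==> x \<in> carrier M ==> f x \<in> carrier N"
  by (auto simp: mod_hom_def hom_def)

lemma mod_hom_add: "f \<in> mod_hom R M N ==> x \<in> carrier M ==> y \<in> carrier M ==>
    f (x \<oplus>\<^bsub>M\<^esub> y) = f x \<oplus>\<^bsub>N\<^esub> f y"
  by (auto simp: mod_hom_def hom_def)

lemma mod_hom_smult: "f \<in> mod_hom R M N ==> a \<in> carrier R ==> x \<in> carrier M ==>
    f (a \<odot>\<^bsub>M\<^esub> x) = a \<odot>\<^bsub>N\<^esub> f x"
  by (auto simp: mod_hom_def)

lemma mod_hom_zero:
  assumes "module R M" "module R N" "f \<in> mod_hom R M N"
  shows "f \<zero>\<^bsub>M\<^esub> = \<zero>\<^bsub>N\<^esub>"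
proof -
  interpret M: module R M by fact
  interpret N: module R N by fact
  have "f \<zero>\<^bsub>M\<^esub> = f (\<zero>\<^bsub>R\<^esub> \<odot>\<^bsub>M\<^esub> \<zero>\<^bsub>M\<^esub>)" by simp
  also have "\<dots> = \<zero>\<^bsub>R\<^esub> \<odot>\<^bsub>N\<^esub> f \<zero>\<^bsub>M\<^esub>" using assms(3) by (intro mod_hom_smult) auto
  finally show ?thesis using assms(3) by (simp add: mod_hom_closed)
qed

lemma mod_hom_minus:
  assumes "module R M" "module R N" "f \<in> mod_hom R M N" "x \<in> carrier M"
  shows "f (\<ominus>\<^bsub>M\<^esub> x) = \<ominus>\<^bsub>N\<^esub> f x"
proof -
  interpret M: module R M by fact
  interpret N: module R N by fact
  have "f x \<oplus>\<^bsub>N\<^esub> f (\<ominus>\<^bsub>M\<^esub> x) = f (x \<oplus>\<^bsub>M\<^esub> \<ominus>\<^bsub>M\<^esub> x)"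
    using assms by (simp add: mod_hom_add)
  also have "\<dots> = \<zero>\<^bsub>N\<^esub>" using assms by (simp add: M.r_neg mod_hom_zero)
  finally show ?thesis
    using assms mod_hom_closed[OF assms(3)] by (metis M.a_inv_closed N.add.inv_comm N.add.inv_equality)
qed

lemma mod_hom_diff:
  assumes "module R M" "module R N" "f \<in> mod_hom R M N" "x \<in> carrier M" "y \<in> carrier M"
  shows "f (x \<ominus>\<^bsub>M\<^esub> y) = f x \<ominus>\<^bsub>N\<^esub> f y"
proof -
  interpret M: module R M by fact
  show ?thesis using assms by (simp add: a_minus_def mod_hom_add mod_hom_minus)
qed

lemma mod_hom_comp:
  assumes "f \<in> mod_hom R M N" "g \<in> mod_hom R N P"
  shows "(\<lambda>x. g (f x)) \<in> mod_hom R M P"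
  using assms by (auto simp: mod_hom_def hom_def Pi_def)

lemma mod_hom_comp': "f \<in> mod_hom R M N ==> g \<in> mod_hom R N P ==> g \<circ> f \<in> mod_hom R M P"
  using mod_hom_comp unfolding comp_def by blast

lemma mod_hom_ident: "(\<lambda>x. x) \<in> mod_hom R M M"
  by (auto simp: mod_hom_def hom_def)

lemma mod_hom_id: "id \<in> mod_hom R M M"
  by (auto simp: mod_hom_def hom_def)

lemma mod_hom_const_zero:
  assumes "module R N"
  shows "(\<lambda>x. \<zero>\<^bsub>N\<^esub>) \<in> mod_hom R M N"
proof -
  interpret N: module R N by fact
  show ?thesis by (intro mod_homI) auto
qed

lemma mod_hom_cong:
  assumes "module R M" "f \<in> mod_hom R M N" "\<And>x. x \<in> carrier M ==> g x = f x"
  shows "g \<in> mod_hom R M N"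
proof -
  interpret M: module R M by fact
  show ?thesis using assms by (intro mod_homI) (auto simp: mod_hom_add mod_hom_smult mod_hom_closed)
qed

lemma mod_hom_plus:
  assumes "module R N" "f \<in> mod_hom R M N" "g \<in> mod_hom R M N"
  shows "(\<lambda>x. f x \<oplus>\<^bsub>N\<^esub> g x) \<in> mod_hom R M N"
proof -
  interpret N: module R N by fact
  show ?thesis using assms
    by (intro mod_homI)
      (auto simp: mod_hom_add mod_hom_smult mod_hom_closed N.a_ac N.smult_r_distr)
qed

lemma mod_hom_uminus:
  assumes "module R N" "f \<in> mod_hom R M N"
  shows "(\<lambda>x. \<ominus>\<^bsub>N\<^esub> f x) \<in> mod_hom R M N"
proof -
  interpret N: module R N by fact
  show ?thesis using assms
    by (intro mod_homI)
      (auto simp: mod_hom_add mod_hom_smult mod_hom_closed N.minus_add N.smult_r_minus)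
qed

lemma mod_hom_sub:
  assumes "module R N" "f \<in> mod_hom R M N" "g \<in> mod_hom R M N"
  shows "(\<lambda>x. f x \<ominus>\<^bsub>N\<^esub> g x) \<in> mod_hom R M N"
  unfolding a_minus_def using assms by (intro mod_hom_plus mod_hom_uminus)

lemma mod_hom_scale:
  assumes "module R N" "f \<in> mod_hom R M N" "a \<in> carrier R"
  shows "(\<lambda>x. a \<odot>\<^bsub>N\<^esub> f x) \<in> mod_hom R M N"
proof -
  interpret N: module R N by fact
  show ?thesis using assms
    by (intro mod_homI)
      (auto simp: mod_hom_add mod_hom_smult mod_hom_closed N.smult_r_distr N.m_comm
        simp flip: N.smult_assoc1)
qed

lemma mod_hom_finsum:
  assumes M: "module R M" and N: "module R N" and f: "f \<in> mod_hom R M N"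
    and "finite A" "\<And>i. i \<in> A ==> g i \<in> carrier M"
  shows "f (finsum M g A) = finsum N (\<lambda>i. f (g i)) A"
proof -
  interpret M: module R M by fact
  interpret N: module R N by fact
  show ?thesis using assms(4,5)
  proof (induction rule: finite_induct)
    case empty
    then show ?case using mod_hom_zero[OF M N f] by simp
  next
    case (insert x F)
    then have "finsum M g (insert x F) = g x \<oplus>\<^bsub>M\<^esub> finsum M g F" by (intro M.finsum_insert) auto
    moreover have "finsum N (\<lambda>i. f (g i)) (insert x F) = f (g x) \<oplus>\<^bsub>N\<^esub> finsum N (\<lambda>i. f (g i)) F"
      using insert f by (intro N.finsum_insert) (auto simp: mod_hom_closed)
    ultimately show ?case using insert f by (simp add: mod_hom_add M.finsum_closed Pi_def)
  qed
qed

lemma hom_sum_mod_hom: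
  assumes M: "module R M" and N: "module R N" and "finite A"
    and g: "\<And>i. i \<in> A ==> g i \<in> mod_hom R M N"
  shows "(\<lambda>x. finsum N (\<lambda>i. g i x) A) \<in> mod_hom R M N"
proof -
  interpret N: module R N by fact
  have c: "g i x \<in> carrier N" if "i \<in> A" "x \<in> carrier M" for i x using mod_hom_closed[OF g] that by blast
  show ?thesis
  proof (rule mod_homI)
    fix x assume x: "x \<in> carrier M"
    show "finsum N (\<lambda>i. g i x) A \<in> carrier N" using x c by (intro N.finsum_closed) auto
    { fix y assume y: "y \<in> carrier M"
      have "finsum N (\<lambda>i. g i (x \<oplus>\<^bsub>M\<^esub> y)) A = finsum N (\<lambda>i. g i x \<oplus>\<^bsub>N\<^esub> g i y) A"
        using x y c by (intro N.finsum_cong') (auto simp: mod_hom_add[OF g])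
      then show "finsum N (\<lambda>i. g i (x \<oplus>\<^bsub>M\<^esub> y)) A = finsum N (\<lambda>i. g i x) A \<oplus>\<^bsub>N\<^esub> finsum N (\<lambda>i. g i y) A"
        using x y c by (simp add: N.finsum_addf Pi_def) }
    fix a assume a: "a \<in> carrier R"
    have "finsum N (\<lambda>i. g i (a \<odot>\<^bsub>M\<^esub> x)) A = finsum N (\<lambda>i. a \<odot>\<^bsub>N\<^esub> g i x) A"
      using x a c by (intro N.finsum_cong') (auto simp: mod_hom_smult[OF g])
    then show "finsum N (\<lambda>i. g i (a \<odot>\<^bsub>M\<^esub> x)) A = a \<odot>\<^bsub>N\<^esub> finsum N (\<lambda>i. g i x) A"
      using x a c assms(3) by (simp add: N.finsum_smult_ldistr Pi_def)
  qed
qed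

subsection \<open>The ring as a module and free modules\<close>

definition ring_mod :: "('a, 'b) ring_scheme => ('a, 'a) module" where
  "ring_mod R = \<lparr>carrier = carrier R, monoid.mult = mult R, one = one R, ring.zero = zero R,
     add = add R, smult = mult R\<rparr>"

lemma ring_mod_simps [simp]:
  "carrier (ring_mod R) = carrier R" "zero (ring_mod R) = zero R" "add (ring_mod R) = add R"
  "smult (ring_mod R) = mult R"
  by (simp_all add: ring_mod_def)

lemma module_ring_mod:
  assumes "cring R"
  shows "module R (ring_mod R)"
proof -
  interpret cring R by fact
  show ?thesis
    by (intro moduleI abelian_groupI)
      (auto simp: a_ac l_distr r_distr m_assoc intro: bexI[of _ "\<ominus>\<^bsub>R\<^esub> _"] l_neg assms)
qed

lemma ring_mod_a_inv [simp]: "a_inv (ring_mod R) = a_inv R"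
  by (simp add: fun_eq_iff a_inv_def m_inv_def)

lemma ring_mod_a_minus [simp]: "a_minus (ring_mod R) = a_minus R"
  by (simp add: fun_eq_iff a_minus_def)

text \<open>One type \<open>nat => 'a\<close> serves all ranks, so a resolution is a sequence of
  maps of a single type. Padding with zeros makes vectors with equal coordinates equal and nests the
  modules of different rank.\<close>

definition vec :: "('a, 'b) ring_scheme => nat => ('a, nat => 'a) module" where
  "vec R n = \<lparr>carrier = {v. (\<forall>i<n. v i \<in> carrier R) \<and> (\<forall>i\<ge>n. v i = \<zero>\<^bsub>R\<^esub>)},
     monoid.mult = (\<lambda>_ _ _. \<zero>\<^bsub>R\<^esub>), one = (\<lambda>_. \<zero>\<^bsub>R\<^esub>), ring.zero = (\<lambda>_. \<zero>\<^bsub>R\<^esub>),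
     add = (\<lambda>v w i. v i \<oplus>\<^bsub>R\<^esub> w i), smult = (\<lambda>a v i. a \<otimes>\<^bsub>R\<^esub> v i)\<rparr>"

abbreviation "vecs R n \<equiv> carrier (vec R n)"

lemma vec_mod_simps [simp]:
  "zero (vec R n) = (\<lambda>_. \<zero>\<^bsub>R\<^esub>)" "add (vec R n) = (\<lambda>v w i. v i \<oplus>\<^bsub>R\<^esub> w i)"
  "smult (vec R n) = (\<lambda>a v i. a \<otimes>\<^bsub>R\<^esub> v i)"
  by (simp_all add: vec_def)

lemma vec_mod_carrier:
  "v \<in> vecs R n \<longleftrightarrow> (\<forall>i<n. v i \<in> carrier R) \<and> (\<forall>i\<ge>n. v i = \<zero>\<^bsub>R\<^esub>)"
  by (simp add: vec_def)

lemma vec_mod_coord: "cring R ==> v \<in> vecs R n ==> v i \<in> carrier R"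
  by (metis cring.cring_simprules(2) vec_mod_carrier not_le)

lemma module_vec_mod:
  assumes "cring R"
  shows "module R (vec R n)"
proof -
  interpret cring R by fact
  note c = vec_mod_coord[OF assms]
  show ?thesis
  proof (intro moduleI abelian_groupI)
    fix v assume v: "v \<in> vecs R n"
    show "\<exists>w\<in>vecs R n. w \<oplus>\<^bsub>vec R n\<^esub> v = \<zero>\<^bsub>vec R n\<^esub>"
      using v c[OF v] by (intro bexI[of _ "\<lambda>i. \<ominus>\<^bsub>R\<^esub> v i"]) (auto simp: l_neg vec_mod_carrier)
  qed (auto simp: fun_eq_iff c l_distr r_distr m_assoc assms a_ac, auto simp: vec_mod_carrier)
qed

lemma vec_mod_a_inv:
  assumes "cring R" "v \<in> vecs R n"
  shows "\<ominus>\<^bsub>vec R n\<^esub> v = (\<lambda>i. \<ominus>\<^bsub>R\<^esub> v i)"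
proof -
  interpret cring R by fact
  interpret V: module R "vec R n" by (rule module_vec_mod) fact
  have "(\<lambda>i. \<ominus>\<^bsub>R\<^esub> v i) \<oplus>\<^bsub>vec R n\<^esub> v = \<zero>\<^bsub>vec R n\<^esub>"
    using vec_mod_coord[OF assms] by (simp add: fun_eq_iff l_neg)
  moreover have "(\<lambda>i. \<ominus>\<^bsub>R\<^esub> v i) \<in> vecs R n"
    using assms by (auto simp: vec_mod_carrier)
  ultimately show ?thesis using assms(2) by (intro V.minus_equality)
qed

lemma vec_mod_a_minus:
  assumes "cring R" "v \<in> vecs R n" "w \<in> vecs R n"
  shows "v \<ominus>\<^bsub>vec R n\<^esub> w = (\<lambda>i. v i \<ominus>\<^bsub>R\<^esub> w i)"
  using assms by (simp add: a_minus_def vec_mod_a_inv)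

lemma coord_mod_hom: "cring R ==> (\<lambda>v. v i) \<in> mod_hom R (vec R n) (ring_mod R)"
  by (intro mod_homI) (auto simp: vec_mod_coord)

definition unit_vec :: "('a, 'b) ring_scheme => nat => nat => 'a" where
  "unit_vec R i = (\<lambda>k. if k = i then \<one>\<^bsub>R\<^esub> else \<zero>\<^bsub>R\<^esub>)"

lemma unit_vec_carrier: "cring R ==> i < n ==> unit_vec R i \<in> vecs R n"
  by (auto simp: unit_vec_def vec_mod_carrier cring.cring_simprules)

subsection \<open>Dual bases\<close>

text \<open>The criterion of the dual basis lemma. \<open>projective_module\<close> only lifts along
  surjections of modules over one type, whereas a dual basis lifts along surjections over any type.
  This is what allows cones, whose elements are pairs, and complexes over
  \<open>nat => 'a\<close>.\<close>

definition dual_basis ::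
  "('a, 'b) ring_scheme => ('a, 'm) module => nat => (nat => 'm) => (nat => 'm => 'a) => bool" where
  "dual_basis R P n e \<phi> \<longleftrightarrow> (\<forall>i<n. e i \<in> carrier P \<and> \<phi> i \<in> mod_hom R P (ring_mod R)) \<and>
     (\<forall>x\<in>carrier P. x = finsum P (\<lambda>i. \<phi> i x \<odot>\<^bsub>P\<^esub> e i) {..<n})"

definition fg_proj :: "('a, 'b) ring_scheme => ('a, 'm) module => bool" where
  "fg_proj R P \<longleftrightarrow> module R P \<and> (\<exists>n e \<phi>. dual_basis R P n e \<phi>)"

lemma finsum_closed_rel:
  assumes "abelian_monoid M" "finite A" "\<And>i. i \<in> A ==> f i \<in> carrier M"
    and "Q \<zero>\<^bsub>M\<^esub>" "\<And>x y. x \<in> carrier M ==> y \<in> carrier M ==> Q x ==> Q y ==> Q (x \<oplus>\<^bsub>M\<^esub> y)"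
    and "\<And>i. i \<in> A ==> Q (f i)"
  shows "Q (finsum M f A)"
proof -
  interpret abelian_monoid M by fact
  show ?thesis using assms(2,3,6)
  proof (induction rule: finite_induct)
    case (insert x F)
    then have "finsum M f (insert x F) = f x \<oplus>\<^bsub>M\<^esub> finsum M f F" by (intro finsum_insert) auto
    then show ?case using insert by (auto intro!: assms(5) finsum_closed)
  qed (simp add: assms)
qed

lemma finsum_closed_rel2:
  assumes "abelian_monoid M" "abelian_monoid N" "finite A"
    "\<And>i. i \<in> A ==> f i \<in> carrier M" "\<And>i. i \<in> A ==> g i \<in> carrier N"
    and "Q \<zero>\<^bsub>M\<^esub> \<zero>\<^bsub>N\<^esub>"
    and "\<And>x y x' y'. x \<in> carrier M ==> y \<in> carrier N ==> x' \<in> carrier M ==> y' \<in> carrier N ==>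
      Q x y ==> Q x' y' ==> Q (x \<oplus>\<^bsub>M\<^esub> x') (y \<oplus>\<^bsub>N\<^esub> y')"
    and "\<And>i. i \<in> A ==> Q (f i) (g i)"
  shows "Q (finsum M f A) (finsum N g A)"
proof -
  interpret M: abelian_monoid M by fact
  interpret N: abelian_monoid N by fact
  show ?thesis using assms(3-5,8)
  proof (induction rule: finite_induct)
    case (insert x F)
    then have "finsum M f (insert x F) = f x \<oplus>\<^bsub>M\<^esub> finsum M f F"
      "finsum N g (insert x F) = g x \<oplus>\<^bsub>N\<^esub> finsum N g F"
      by (auto intro!: M.finsum_insert N.finsum_insert)
    then show ?case using insert by (auto intro!: assms(7) M.finsum_closed N.finsum_closed)
  qed (simp add: assms)
qed

text \<open>The projection of a submodule of \<open>P \<times> M\<close> onto \<open>P\<close> splits if it is surjective.\<close>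

lemma fg_proj_select:
  fixes M :: "('a, 'm) module"
  assumes P: "fg_proj R P" and M: "module R M"
    and total: "\<And>p. p \<in> carrier P ==> \<exists>m\<in>carrier M. Q p m"
    and add: "\<And>p m p' m'. p \<in> carrier P ==> m \<in> carrier M ==> p' \<in> carrier P ==> m' \<in> carrier M ==>
      Q p m ==> Q p' m' ==> Q (p \<oplus>\<^bsub>P\<^esub> p') (m \<oplus>\<^bsub>M\<^esub> m')"
    and smult: "\<And>a p m. a \<in> carrier R ==> p \<in> carrier P ==> m \<in> carrier M ==> Q p m ==>
      Q (a \<odot>\<^bsub>P\<^esub> p) (a \<odot>\<^bsub>M\<^esub> m)"
  shows "\<exists>h\<in>mod_hom R P M. \<forall>p\<in>carrier P. Q p (h p)"
proof -
  obtain n e \<phi> where mP: "module R P" and db: "dual_basis R P n e \<phi>"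
    using P by (auto simp: fg_proj_def)
  interpret P: module R P by fact
  interpret M: module R M by fact
  have e: "\<And>i. i < n ==> e i \<in> carrier P" and \<phi>: "\<And>i. i < n ==> \<phi> i \<in> mod_hom R P (ring_mod R)"
    and x: "\<And>x. x \<in> carrier P ==> x = finsum P (\<lambda>i. \<phi> i x \<odot>\<^bsub>P\<^esub> e i) {..<n}"
    using db by (auto simp: dual_basis_def)
  have "\<forall>i\<in>{..<n}. \<exists>m. m \<in> carrier M \<and> Q (e i) m" using total e by blast
  from bchoice[OF this] obtain y where y: "\<And>i. i < n ==> y i \<in> carrier M \<and> Q (e i) (y i)"
    by auto
  have \<phi>c: "\<phi> i x \<in> carrier R" if "i < n" "x \<in> carrier P" for i x
    using mod_hom_closed[OF \<phi>] that by simp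
  \<comment> \<open>Some \<open>m\<close> is related to zero; scaling this pair by the zero of the
    ring gives the pair of zeros.\<close>
  have zero: "Q \<zero>\<^bsub>P\<^esub> \<zero>\<^bsub>M\<^esub>"
    using total[OF P.zero_closed] smult[OF P.R.zero_closed P.zero_closed] by force
  have "(\<lambda>x. \<phi> i x \<odot>\<^bsub>M\<^esub> y i) \<in> mod_hom R P M" if "i < n" for i
    using \<phi>[OF that] y[OF that] that
    by (intro mod_homI) (auto simp: mod_hom_add mod_hom_smult \<phi>c M.smult_l_distr M.smult_assoc1)
  then have "(\<lambda>x. finsum M (\<lambda>i. \<phi> i x \<odot>\<^bsub>M\<^esub> y i) {..<n}) \<in> mod_hom R P M"
    by (intro hom_sum_mod_hom mP M) auto
  \<comment> \<open>The same coefficients combine the pairs \<open>(e i, y i)\<close>, and the first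
    components add up to \<open>p\<close> by the dual basis property.\<close>
  moreover have "Q p (finsum M (\<lambda>i. \<phi> i p \<odot>\<^bsub>M\<^esub> y i) {..<n})" if p: "p \<in> carrier P" for p
  proof -
    have "Q (finsum P (\<lambda>i. \<phi> i p \<odot>\<^bsub>P\<^esub> e i) {..<n}) (finsum M (\<lambda>i. \<phi> i p \<odot>\<^bsub>M\<^esub> y i) {..<n})"
    proof (rule finsum_closed_rel2[where Q = Q])
      fix i assume "i \<in> {..<n}"
      then show "\<phi> i p \<odot>\<^bsub>P\<^esub> e i \<in> carrier P" "\<phi> i p \<odot>\<^bsub>M\<^esub> y i \<in> carrier M"
        "Q (\<phi> i p \<odot>\<^bsub>P\<^esub> e i) (\<phi> i p \<odot>\<^bsub>M\<^esub> y i)"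
        using p e y \<phi>c smult by auto
    qed (use add zero in \<open>simp_all add: P.abelian_monoid_axioms M.abelian_monoid_axioms\<close>)
    then show ?thesis by (simp only: x[OF p, symmetric])
  qed
  ultimately show ?thesis by (intro bexI[where x = "\<lambda>x. finsum M (\<lambda>i. \<phi> i x \<odot>\<^bsub>M\<^esub> y i) {..<n}"]) simp_all
qed

lemma fg_proj_lift:
  assumes P: "fg_proj R P" and M: "module R M" and N: "module R N" and g: "g \<in> mod_hom R M N"
    and f: "f \<in> mod_hom R P N" and im: "\<And>p. p \<in> carrier P ==> f p \<in> g ` carrier M"
  shows "\<exists>h\<in>mod_hom R P M. \<forall>p\<in>carrier P. g (h p) = f p"
proof (rule fg_proj_select[OF P M, where Q = "\<lambda>p m. g m = f p"])
  fix p assume "p \<in> carrier P"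
  then obtain m where "m \<in> carrier M" "f p = g m" using im by blast
  then show "\<exists>m\<in>carrier M. g m = f p" by metis
qed (use f g in \<open>simp_all add: mod_hom_add mod_hom_smult\<close>)

lemma fg_proj_module: "fg_proj R P ==> module R P"
  by (simp add: fg_proj_def)

lemma dual_basis_vec_mod:
  assumes R: "cring R"
  shows "dual_basis R (vec R n) n (unit_vec R) (\<lambda>i v. v i)"
proof -
  interpret cring R by fact
  interpret V: module R "vec R n" by (rule module_vec_mod) fact
  have key: "finsum (vec R n) (\<lambda>i. v i \<odot>\<^bsub>vec R n\<^esub> unit_vec R i) {..<k}
      = (\<lambda>i. if i < k then v i else \<zero>\<^bsub>R\<^esub>)" if v: "v \<in> vecs R n" and "k \<le> n" for v k
    using that(2)
  proof (induction k)
    case (Suc k)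
    have c: "v i \<odot>\<^bsub>vec R n\<^esub> unit_vec R i \<in> vecs R n" if "i < Suc k" for i
      using that Suc v unit_vec_carrier[OF R] vec_mod_coord[OF R v] by (intro V.smult_closed) auto
    have "finsum (vec R n) (\<lambda>i. v i \<odot>\<^bsub>vec R n\<^esub> unit_vec R i) {..<Suc k}
        = (v k \<odot>\<^bsub>vec R n\<^esub> unit_vec R k) \<oplus>\<^bsub>vec R n\<^esub>
          finsum (vec R n) (\<lambda>i. v i \<odot>\<^bsub>vec R n\<^esub> unit_vec R i) {..<k}"
      unfolding lessThan_Suc using c by (intro V.finsum_insert) auto
    also have "\<dots> = (\<lambda>i. if i < Suc k then v i else \<zero>\<^bsub>R\<^esub>)"
      using Suc vec_mod_coord[OF R v]
      by (simp add: Suc.IH[OF Suc_leD[OF Suc.prems]]) (auto simp: fun_eq_iff unit_vec_def less_Suc_eq)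
    finally show ?case .
  qed simp
  show ?thesis
    unfolding dual_basis_def
  proof (intro conjI ballI allI impI)
    fix v assume v: "v \<in> vecs R n"
    then show "v = finsum (vec R n) (\<lambda>i. v i \<odot>\<^bsub>vec R n\<^esub> unit_vec R i) {..<n}"
      by (subst key) (auto simp: fun_eq_iff vec_mod_carrier)
  qed (auto simp: unit_vec_carrier coord_mod_hom R)
qed

lemma fg_proj_vec_mod: "cring R ==> fg_proj R (vec R n)"
  unfolding fg_proj_def using module_vec_mod dual_basis_vec_mod by blast

lemma vec_hom_eqI:
  assumes R: "cring R" and M: "module R M" and f: "f \<in> mod_hom R (vec R n) M" and g: "g \<in> mod_hom R (vec R n) M"
    and eq: "\<And>i. i < n ==> f (unit_vec R i) = g (unit_vec R i)" and v: "v \<in> vecs R n"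
  shows "f v = g v"
proof -
  interpret V: module R "vec R n" by (rule module_vec_mod) fact
  interpret M: module R M by fact
  have c: "v i \<odot>\<^bsub>vec R n\<^esub> unit_vec R i \<in> vecs R n" if "i < n" for i
    using that v unit_vec_carrier[OF R] vec_mod_coord[OF R v] by (intro V.smult_closed) auto
  have x: "v = finsum (vec R n) (\<lambda>i. v i \<odot>\<^bsub>vec R n\<^esub> unit_vec R i) {..<n}"
    using dual_basis_vec_mod[OF R] v unfolding dual_basis_def by blast
  have *: "h v = finsum M (\<lambda>i. v i \<odot>\<^bsub>M\<^esub> h (unit_vec R i)) {..<n}" if h: "h \<in> mod_hom R (vec R n) M" for h
  proof -
    have "h v = finsum M (\<lambda>i. h (v i \<odot>\<^bsub>vec R n\<^esub> unit_vec R i)) {..<n}"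
      using c by (subst x, intro mod_hom_finsum[OF V.module_axioms M h]) auto
    also have "\<dots> = finsum M (\<lambda>i. v i \<odot>\<^bsub>M\<^esub> h (unit_vec R i)) {..<n}"
      using mod_hom_smult[OF h vec_mod_coord[OF R v] unit_vec_carrier[OF R]]
        vec_mod_coord[OF R v] mod_hom_closed[OF h unit_vec_carrier[OF R]]
      by (intro M.finsum_cong') auto
    finally show ?thesis .
  qed
  show ?thesis
    unfolding *[OF f] *[OF g] using vec_mod_coord[OF R v] mod_hom_closed[OF g unit_vec_carrier[OF R]]
    by (intro M.finsum_cong') (auto simp: eq)
qed

lemma vec_hom_exists:
  assumes R: "cring R" and M: "module R M" and y: "\<And>i. i < n ==> y i \<in> carrier M"
  shows "\<exists>h\<in>mod_hom R (vec R n) M. \<forall>i<n. h (unit_vec R i) = y i"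
proof -
  interpret V: module R "vec R n" by (rule module_vec_mod) fact
  interpret M: module R M by fact
  define h where "h v = finsum M (\<lambda>i. v i \<odot>\<^bsub>M\<^esub> y i) {..<n}" for v :: "nat => 'a"
  have "(\<lambda>v. v i \<odot>\<^bsub>M\<^esub> y i) \<in> mod_hom R (vec R n) M" if "i < n" for i
    using y[OF that] by (intro mod_homI) (auto simp: vec_mod_coord[OF R] M.smult_l_distr M.smult_assoc1)
  then have "h \<in> mod_hom R (vec R n) M"
    unfolding h_def by (intro hom_sum_mod_hom V.module_axioms M) auto
  moreover have "h (unit_vec R k) = y k" if k: "k < n" for k
  proof -
    have "h (unit_vec R k) = finsum M (\<lambda>i. if k = i then y i else \<zero>\<^bsub>M\<^esub>) {..<n}"
      unfolding h_def using y by (intro M.finsum_cong') (auto simp: unit_vec_def)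
    also have "\<dots> = y k" using k y by (intro M.finsum_singleton) auto
    finally show ?thesis .
  qed
  ultimately show ?thesis by blast
qed

text \<open>A dual basis moves along a retraction: the vectors are mapped by \<open>f\<close>, the
  functionals are composed with \<open>g\<close>.\<close>

lemma fg_proj_retract:
  assumes P: "fg_proj R P" and Q: "module R Q" and f: "f \<in> mod_hom R P Q" and g: "g \<in> mod_hom R Q P"
    and fg: "\<And>y. y \<in> carrier Q ==> f (g y) = y"
  shows "fg_proj R Q"
proof -
  obtain n e \<phi> where mP: "module R P" and db: "dual_basis R P n e \<phi>"
    using P by (auto simp: fg_proj_def)
  interpret P: module R P by fact
  interpret Q: module R Q by fact
  have e: "\<And>i. i < n ==> e i \<in> carrier P" and \<phi>: "\<And>i. i < n ==> \<phi> i \<in> mod_hom R P (ring_mod R)"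
    and x: "\<And>x. x \<in> carrier P ==> x = finsum P (\<lambda>i. \<phi> i x \<odot>\<^bsub>P\<^esub> e i) {..<n}"
    using db by (auto simp: dual_basis_def)
  have \<phi>c: "\<phi> i x \<in> carrier R" if "i < n" "x \<in> carrier P" for i x
    using mod_hom_closed[OF \<phi>] that by simp
  have "dual_basis R Q n (\<lambda>i. f (e i)) (\<lambda>i y. \<phi> i (g y))"
    unfolding dual_basis_def
  proof (intro conjI allI ballI impI)
    fix y assume y: "y \<in> carrier Q"
    have gy: "g y \<in> carrier P" by (rule mod_hom_closed[OF g y])
    have "y = f (finsum P (\<lambda>i. \<phi> i (g y) \<odot>\<^bsub>P\<^esub> e i) {..<n})" using fg[OF y] x[OF gy] by simp
    also have "\<dots> = finsum Q (\<lambda>i. f (\<phi> i (g y) \<odot>\<^bsub>P\<^esub> e i)) {..<n}"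
      using e \<phi>c gy by (intro mod_hom_finsum[OF mP Q f]) auto
    also have "\<dots> = finsum Q (\<lambda>i. \<phi> i (g y) \<odot>\<^bsub>Q\<^esub> f (e i)) {..<n}"
      using e \<phi>c gy mod_hom_closed[OF f] by (intro Q.finsum_cong') (auto simp: mod_hom_smult[OF f])
    finally show "y = finsum Q (\<lambda>i. \<phi> i (g y) \<odot>\<^bsub>Q\<^esub> f (e i)) {..<n}" .
  qed (use e mod_hom_closed[OF f] mod_hom_comp[OF g \<phi>] in auto)
  then show ?thesis using Q unfolding fg_proj_def by blast
qed

subsection \<open>Copies of a module along an injection\<close>

text \<open>Serves to bring free modules, whose elements are functions on \<open>nat\<close>, into
  the type \<open>'m\<close> over which the derived category is formed.\<close>

definition copy_mod :: "('m => 'n) => ('a, 'm) module => ('a, 'n) module" where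
  "copy_mod j M = \<lparr>carrier = j ` carrier M, monoid.mult = (\<lambda>_ _. j \<zero>\<^bsub>M\<^esub>), one = j \<zero>\<^bsub>M\<^esub>,
     ring.zero = j \<zero>\<^bsub>M\<^esub>,
     add = (\<lambda>x y. j (inv_into (carrier M) j x \<oplus>\<^bsub>M\<^esub> inv_into (carrier M) j y)),
     smult = (\<lambda>a x. j (a \<odot>\<^bsub>M\<^esub> inv_into (carrier M) j x))\<rparr>"

lemma copy_mod_simps [simp]:
  "carrier (copy_mod j M) = j ` carrier M" "zero (copy_mod j M) = j \<zero>\<^bsub>M\<^esub>"
  "add (copy_mod j M) x y = j (inv_into (carrier M) j x \<oplus>\<^bsub>M\<^esub> inv_into (carrier M) j y)"
  "smult (copy_mod j M) a x = j (a \<odot>\<^bsub>M\<^esub> inv_into (carrier M) j x)"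
  by (simp_all add: copy_mod_def)

lemma copy_mod_hom:
  assumes M: "module R M" and j: "inj_on j (carrier M)"
  shows "module R (copy_mod j M)" "j \<in> mod_hom R M (copy_mod j M)"
    "inv_into (carrier M) j \<in> mod_hom R (copy_mod j M) M"
proof -
  interpret M: module R M by fact
  note inv = inv_into_f_f[OF j]
  show "module R (copy_mod j M)"
  proof (intro moduleI abelian_groupI)
    fix x assume "x \<in> carrier (copy_mod j M)"
    then obtain y where "y \<in> carrier M" "x = j y" by auto
    then show "\<exists>z\<in>carrier (copy_mod j M). z \<oplus>\<^bsub>copy_mod j M\<^esub> x = \<zero>\<^bsub>copy_mod j M\<^esub>"
      by (intro bexI[of _ "j (\<ominus>\<^bsub>M\<^esub> y)"]) (auto simp: inv M.l_neg)
  qed (auto simp: inv M.a_ac M.smult_l_distr M.smult_r_distr M.smult_assoc1 M.R.cring_axioms)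
  show "j \<in> mod_hom R M (copy_mod j M)" "inv_into (carrier M) j \<in> mod_hom R (copy_mod j M) M"
    by (auto intro!: mod_homI simp: inv)
qed

section \<open>Complexes and their cohomology\<close>

lemma cx_module: "is_complex R X ==> module R (X$i)"
  by (auto simp: is_complex_def)

lemma cx_diff: "is_complex R X ==> j = i + 1 ==> diff X i \<in> mod_hom R (X$i) (X$j)"
  by (auto simp: is_complex_def)

lemma cx_diff_closed:
  "is_complex R X ==> j = i + 1 ==> x \<in> X$$i ==> diff X i x \<in> X$$j"
  by (rule mod_hom_closed[OF cx_diff])

lemma cx_dd: "is_complex R X ==> j = i + 1 ==> k = i + 2 ==> x \<in> X$$i ==>
    diff X j (diff X i x) = \<zero>\<^bsub>X$k\<^esub>"
  by (auto simp: is_complex_def)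

lemma chain_hom: "f \<in> chain_maps R X Y ==> f i \<in> mod_hom R (X$i) (Y$i)"
  by (auto simp: chain_maps_def)

lemma chain_closed: "f \<in> chain_maps R X Y ==> x \<in> X$$i ==> f i x \<in> Y$$i"
  by (rule mod_hom_closed[OF chain_hom])

lemma chain_diff: "f \<in> chain_maps R X Y ==> j = i + 1 ==> x \<in> X$$i ==>
    f j (diff X i x) = diff Y i (f i x)"
  by (auto simp: chain_maps_def)

lemma chain_comp_maps:
  assumes f: "f \<in> chain_maps R X Y" and g: "g \<in> chain_maps R Y Z"
  shows "chain_comp g f \<in> chain_maps R X Z"
  using mod_hom_comp'[OF chain_hom[OF f] chain_hom[OF g]] chain_diff[OF f refl]
    chain_diff[OF g refl chain_closed[OF f]]
  by (simp add: chain_maps_def chain_comp_def)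

lemma chain_id: "(\<lambda>_. id) \<in> chain_maps R X X"
  by (auto simp: chain_maps_def mod_hom_id)

section \<open>Exactness, injectivity and surjectivity on cohomology, in terms of
  representatives\<close>

definition exact_at :: "('a, 'm) cochain_complex => int => bool" where
  "exact_at X i \<longleftrightarrow> cocycles X i \<subseteq> coboundaries X i"

text \<open>The two halves of a quasi-isomorphism are kept apart and are stated for a single degree,
  because the truncation map of a t-structure is controlled in high degrees only.\<close>

definition coh_inj :: "('a, 'm) cochain_complex => ('a, 'n) cochain_complex =>
    (int => 'm => 'n) => int => bool" where
  "coh_inj X Y f i \<longleftrightarrow> (\<forall>x\<in>cocycles X i. f i x \<in> coboundaries Y i --> x \<in> coboundaries X i)"

definition coh_surj :: "('a, 'm) cochain_complex => ('a, 'n) cochain_complex =>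
    (int => 'm => 'n) => int => bool" where
  "coh_surj X Y f i \<longleftrightarrow>
     (\<forall>y\<in>cocycles Y i. \<exists>x\<in>cocycles X i. y \<ominus>\<^bsub>Y$i\<^esub> f i x \<in> coboundaries Y i)"

lemma cobE:
  assumes "y \<in> coboundaries X i"
  obtains x where "x \<in> X$$(i - 1)" "y = diff X (i - 1) x"
  using assms by (auto simp: coboundaries_def)

lemma cobI: "x \<in> X$$j ==> i = j + 1 ==> y = diff X j x ==> y \<in> coboundaries X i"
  by (auto simp: coboundaries_def)

lemma cocycles_carrier: "x \<in> cocycles X i ==> x \<in> X$$i"
  by (simp add: cocycles_def)

lemma cob_carrier: "is_complex R X ==> x \<in> coboundaries X i ==> x \<in> X$$i"
  by (auto elim!: cobE intro!: cx_diff_closed)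

lemma cob_cocycles: "is_complex R X ==> x \<in> coboundaries X i ==> x \<in> cocycles X i"
  by (auto elim!: cobE simp: cocycles_def add.commute intro!: cx_diff_closed cx_dd)

lemma cob_zero:
  assumes "is_complex R X"
  shows "\<zero>\<^bsub>X$i\<^esub> \<in> coboundaries X i"
proof -
  interpret A: module R "X$(i - 1)" by (rule cx_module) fact
  have "\<zero>\<^bsub>X$i\<^esub> = diff X (i - 1) \<zero>\<^bsub>X$(i - 1)\<^esub>"
    using mod_hom_zero[OF cx_module[OF assms] cx_module[OF assms] cx_diff[OF assms], of i "i - 1"] by simp
  then show ?thesis by (intro cobI[of "\<zero>\<^bsub>X$(i - 1)\<^esub>" X "i - 1"]) auto
qed

lemma cob_add:
  assumes "is_complex R X" "x \<in> coboundaries X i" "y \<in> coboundaries X i"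
  shows "x \<oplus>\<^bsub>X$i\<^esub> y \<in> coboundaries X i"
proof -
  interpret A: module R "X$(i - 1)" by (rule cx_module) fact
  obtain x' y' where "x' \<in> X$$(i - 1)" "x = diff X (i - 1) x'"
    "y' \<in> X$$(i - 1)" "y = diff X (i - 1) y'"
    using assms by (auto elim!: cobE)
  then show ?thesis using mod_hom_add[OF cx_diff[OF assms(1)], of i "i - 1" x' y']
    by (intro cobI[of "x' \<oplus>\<^bsub>X$(i - 1)\<^esub> y'" X "i - 1"]) auto
qed

lemma cob_smult:
  assumes "is_complex R X" "x \<in> coboundaries X i" "a \<in> carrier R"
  shows "a \<odot>\<^bsub>X$i\<^esub> x \<in> coboundaries X i"
proof -
  interpret A: module R "X$(i - 1)" by (rule cx_module) fact
  obtain x' where "x' \<in> X$$(i - 1)" "x = diff X (i - 1) x'"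
    using assms by (auto elim!: cobE)
  then show ?thesis using mod_hom_smult[OF cx_diff[OF assms(1)], of i "i - 1" a x'] assms
    by (intro cobI[of "a \<odot>\<^bsub>X$(i - 1)\<^esub> x'" X "i - 1"]) auto
qed

lemma cob_minus:
  assumes "is_complex R X" "x \<in> coboundaries X i"
  shows "\<ominus>\<^bsub>X$i\<^esub> x \<in> coboundaries X i"
proof -
  interpret A: module R "X$(i - 1)" by (rule cx_module) fact
  obtain x' where "x' \<in> X$$(i - 1)" "x = diff X (i - 1) x'"
    using assms by (auto elim!: cobE)
  then show ?thesis
    using mod_hom_minus[OF cx_module[OF assms(1)] cx_module[OF assms(1)] cx_diff[OF assms(1)], of i "i - 1" x'] assms
    by (intro cobI[of "\<ominus>\<^bsub>X$(i - 1)\<^esub> x'" X "i - 1"]) auto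
qed

lemma cob_diff: "is_complex R X ==> x \<in> coboundaries X i ==> y \<in> coboundaries X i ==>
    x \<ominus>\<^bsub>X$i\<^esub> y \<in> coboundaries X i"
  unfolding a_minus_def by (intro cob_add cob_minus)

lemma cocycles_add:
  assumes "is_complex R X" "x \<in> cocycles X i" "y \<in> cocycles X i"
  shows "x \<oplus>\<^bsub>X$i\<^esub> y \<in> cocycles X i"
proof -
  interpret A: module R "X$i" by (rule cx_module) fact
  interpret B: module R "X$(i + 1)" by (rule cx_module) fact
  show ?thesis using assms mod_hom_add[OF cx_diff[OF assms(1) refl]] by (auto simp: cocycles_def)
qed

lemma cocycles_smult:
  assumes "is_complex R X" "x \<in> cocycles X i" "a \<in> carrier R"
  shows "a \<odot>\<^bsub>X$i\<^esub> x \<in> cocycles X i"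
proof -
  interpret A: module R "X$i" by (rule cx_module) fact
  interpret B: module R "X$(i + 1)" by (rule cx_module) fact
  show ?thesis using assms mod_hom_smult[OF cx_diff[OF assms(1) refl]] by (auto simp: cocycles_def)
qed

lemma cocycles_minus:
  assumes "is_complex R X" "x \<in> cocycles X i"
  shows "\<ominus>\<^bsub>X$i\<^esub> x \<in> cocycles X i"
proof -
  interpret A: module R "X$i" by (rule cx_module) fact
  interpret B: module R "X$(i + 1)" by (rule cx_module) fact
  show ?thesis using assms mod_hom_minus[OF A.module_axioms B.module_axioms cx_diff[OF assms(1) refl]]
    by (auto simp: cocycles_def)
qed

lemma cocycles_diff: "is_complex R X ==> x \<in> cocycles X i ==> y \<in> cocycles X i ==>
    x \<ominus>\<^bsub>X$i\<^esub> y \<in> cocycles X i"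
  unfolding a_minus_def by (intro cocycles_add cocycles_minus)

lemma chain_cocycles:
  assumes "is_complex R X" "is_complex R Y" "f \<in> chain_maps R X Y" "x \<in> cocycles X i"
  shows "f i x \<in> cocycles Y i"
  using assms(4) chain_diff[OF assms(3) refl, of x i]
    mod_hom_zero[OF cx_module[OF assms(1)] cx_module[OF assms(2)] chain_hom[OF assms(3)], of "i + 1"]
  by (auto simp: cocycles_def chain_closed[OF assms(3)])

lemma chain_cob:
  assumes "f \<in> chain_maps R X Y" "x \<in> coboundaries X i"
  shows "f i x \<in> coboundaries Y i"
  using assms(2) chain_diff[OF assms(1), of i "i - 1"] chain_closed[OF assms(1)]
  by (auto simp: coboundaries_def)

section \<open>Cohomology classes as cosets of coboundaries\<close>

definition coh_class :: "('a, 'm) cochain_complex => int => 'm => 'm set" where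
  "coh_class X i z = {b \<oplus>\<^bsub>X$i\<^esub> z | b. b \<in> coboundaries X i}"

lemma cohomology_carrier: "carrier (cohomology X i) = coh_class X i ` cocycles X i"
  by (auto simp: cohomology_def FactGroup_def RCOSETS_def r_coset_def coh_class_def image_iff)

lemma coh_class_eq_iff:
  assumes X: "is_complex R X" and z: "z \<in> X$$i" and w: "w \<in> X$$i"
  shows "coh_class X i z = coh_class X i w \<longleftrightarrow> z \<ominus>\<^bsub>X$i\<^esub> w \<in> coboundaries X i"
proof -
  interpret A: module R "X$i" by (rule cx_module) fact
  note c = cob_carrier[OF X]
  show ?thesis
  proof
    assume "coh_class X i z = coh_class X i w"
    moreover have "z \<in> coh_class X i z"
      using cob_zero[OF X, of i] z by (force simp: coh_class_def)
    ultimately obtain b where b: "b \<in> coboundaries X i" "z = b \<oplus>\<^bsub>X$i\<^esub> w"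
      by (auto simp: coh_class_def)
    then have "z \<ominus>\<^bsub>X$i\<^esub> w = b"
      using c[OF b(1)] w by (simp add: A.minus_eq A.a_assoc A.r_neg)
    then show "z \<ominus>\<^bsub>X$i\<^esub> w \<in> coboundaries X i" using b by simp
  next
    assume d: "z \<ominus>\<^bsub>X$i\<^esub> w \<in> coboundaries X i"
    have "b \<oplus>\<^bsub>X$i\<^esub> z = (b \<oplus>\<^bsub>X$i\<^esub> (z \<ominus>\<^bsub>X$i\<^esub> w)) \<oplus>\<^bsub>X$i\<^esub> w"
      "b \<oplus>\<^bsub>X$i\<^esub> w = (b \<ominus>\<^bsub>X$i\<^esub> (z \<ominus>\<^bsub>X$i\<^esub> w)) \<oplus>\<^bsub>X$i\<^esub> z"
      if "b \<in> coboundaries X i" for b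
      using c[OF that] z w
      using A.r_neg1[of z w] A.a_comm[of w z] by (simp_all add: A.minus_eq A.minus_add A.a_assoc A.l_neg)
    then show "coh_class X i z = coh_class X i w"
      using cob_add[OF X _ d] cob_diff[OF X _ d] unfolding coh_class_def by blast
  qed
qed

lemma coh_class_mult:
  assumes X: "is_complex R X" and z: "z \<in> cocycles X i" and w: "w \<in> cocycles X i"
  shows "coh_class X i z \<otimes>\<^bsub>cohomology X i\<^esub> coh_class X i w = coh_class X i (z \<oplus>\<^bsub>X$i\<^esub> w)"
proof -
  interpret A: module R "X$i" by (rule cx_module) fact
  note c = cob_carrier[OF X]
  have [simp]: "z \<in> X$$i" "w \<in> X$$i"
    using z w by (auto simp: cocycles_def)
  have "coh_class X i z \<otimes>\<^bsub>cohomology X i\<^esub> coh_class X i w =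
    {(b \<oplus>\<^bsub>X$i\<^esub> z) \<oplus>\<^bsub>X$i\<^esub> (b' \<oplus>\<^bsub>X$i\<^esub> w) | b b'. b \<in> coboundaries X i \<and> b' \<in> coboundaries X i}"
    by (auto simp: cohomology_def FactGroup_def set_mult_def coh_class_def)
  also have "\<dots> = {(b \<oplus>\<^bsub>X$i\<^esub> b') \<oplus>\<^bsub>X$i\<^esub> (z \<oplus>\<^bsub>X$i\<^esub> w) | b b'. b \<in> coboundaries X i \<and> b' \<in> coboundaries X i}"
    using c by (intro Collect_cong ex_cong1) (auto simp: A.a_ac)
  also have "\<dots> = coh_class X i (z \<oplus>\<^bsub>X$i\<^esub> w)"
  proof
    show "{(b \<oplus>\<^bsub>X$i\<^esub> b') \<oplus>\<^bsub>X$i\<^esub> (z \<oplus>\<^bsub>X$i\<^esub> w) | b b'. b \<in> coboundaries X i \<and> b' \<in> coboundaries X i}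
      \<subseteq> coh_class X i (z \<oplus>\<^bsub>X$i\<^esub> w)"
      using cob_add[OF X] by (auto simp: coh_class_def)
    have "b \<oplus>\<^bsub>X$i\<^esub> (z \<oplus>\<^bsub>X$i\<^esub> w)
      = (b \<oplus>\<^bsub>X$i\<^esub> \<zero>\<^bsub>X$i\<^esub>) \<oplus>\<^bsub>X$i\<^esub> (z \<oplus>\<^bsub>X$i\<^esub> w)"
      if "b \<in> coboundaries X i" for b using c[OF that] by simp
    then show "coh_class X i (z \<oplus>\<^bsub>X$i\<^esub> w) \<subseteq>
      {(b \<oplus>\<^bsub>X$i\<^esub> b') \<oplus>\<^bsub>X$i\<^esub> (z \<oplus>\<^bsub>X$i\<^esub> w) | b b'. b \<in> coboundaries X i \<and> b' \<in> coboundaries X i}"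
      using cob_zero[OF X, of i] unfolding coh_class_def by blast
  qed
  finally show ?thesis .
qed

lemma cohomology_map_class:
  assumes X: "is_complex R X" and Y: "is_complex R Y" and f: "f \<in> chain_maps R X Y" and z: "z \<in> cocycles X i"
  shows "cohomology_map Y f i (coh_class X i z) = coh_class Y i (f i z)"
proof -
  interpret B: module R "Y$i" by (rule cx_module) fact
  have zc: "z \<in> X$$i" using z by (simp add: cocycles_def)
  note c = cob_carrier[OF X] cob_carrier[OF Y]
  have fz: "f i z \<in> Y$$i" using chain_closed[OF f zc] .
  have fa: "f i (b \<oplus>\<^bsub>X$i\<^esub> z) = f i b \<oplus>\<^bsub>Y$i\<^esub> f i z" if "b \<in> coboundaries X i" for b
    using mod_hom_add[OF chain_hom[OF f] c(1)[OF that] zc] .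
  have "cohomology_map Y f i (coh_class X i z) =
    {h \<oplus>\<^bsub>Y$i\<^esub> f i (b \<oplus>\<^bsub>X$i\<^esub> z) | h b. h \<in> coboundaries Y i \<and> b \<in> coboundaries X i}"
    by (auto simp: cohomology_map_def coh_class_def set_add_def set_mult_def)
  also have "\<dots> = {(h \<oplus>\<^bsub>Y$i\<^esub> f i b) \<oplus>\<^bsub>Y$i\<^esub> f i z | h b. h \<in> coboundaries Y i \<and> b \<in> coboundaries X i}"
    using c fz chain_closed[OF f] by (intro Collect_cong ex_cong1) (auto simp: B.a_assoc fa)
  also have "\<dots> = coh_class Y i (f i z)"
  proof
    show "{(h \<oplus>\<^bsub>Y$i\<^esub> f i b) \<oplus>\<^bsub>Y$i\<^esub> f i z | h b. h \<in> coboundaries Y i \<and> b \<in> coboundaries X i}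
      \<subseteq> coh_class Y i (f i z)"
      using cob_add[OF Y] chain_cob[OF f] by (auto simp: coh_class_def)
    have "h \<oplus>\<^bsub>Y$i\<^esub> f i z = (h \<oplus>\<^bsub>Y$i\<^esub> f i \<zero>\<^bsub>X$i\<^esub>) \<oplus>\<^bsub>Y$i\<^esub> f i z"
      if "h \<in> coboundaries Y i" for h
      using c(2)[OF that] mod_hom_zero[OF cx_module[OF X] cx_module[OF Y] chain_hom[OF f]] by simp
    then show "coh_class Y i (f i z) \<subseteq>
      {(h \<oplus>\<^bsub>Y$i\<^esub> f i b) \<oplus>\<^bsub>Y$i\<^esub> f i z | h b. h \<in> coboundaries Y i \<and> b \<in> coboundaries X i}"
      using cob_zero[OF X, of i] unfolding coh_class_def by blast
  qed
  finally show ?thesis .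
qed

text \<open>The bridge from quotient groups to representatives: a homomorphism on cosets is
  injective when its kernel is trivial. From here on quasi-isomorphisms are handled with cocycles
  and coboundaries alone.\<close>

lemma quasi_iso_iff:
  assumes X: "is_complex R X" and Y: "is_complex R Y"
  shows "quasi_iso R X Y f \<longleftrightarrow> f \<in> chain_maps R X Y \<and> (\<forall>i. coh_inj X Y f i \<and> coh_surj X Y f i)"
proof -
  have "cohomology_map Y f i \<in> iso (cohomology X i) (cohomology Y i) \<longleftrightarrow> coh_inj X Y f i \<and> coh_surj X Y f i"
    if f: "f \<in> chain_maps R X Y" for i
  proof -
    interpret A: module R "X$i" by (rule cx_module) fact
    interpret B: module R "Y$i" by (rule cx_module) fact
    note cm = cohomology_map_class[OF X Y f] and fz = chain_cocycles[OF X Y f]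
    have "cohomology_map Y f i \<in> hom (cohomology X i) (cohomology Y i)"
    proof (rule homI)
      fix K assume "K \<in> carrier (cohomology X i)"
      then obtain z where z: "z \<in> cocycles X i" "K = coh_class X i z"
        by (auto simp: cohomology_carrier)
      then show "cohomology_map Y f i K \<in> carrier (cohomology Y i)"
        using cm[of z] fz by (simp add: cohomology_carrier)
      fix L assume "L \<in> carrier (cohomology X i)"
      then obtain w where w: "w \<in> cocycles X i" "L = coh_class X i w"
        by (auto simp: cohomology_carrier)
      show "cohomology_map Y f i (K \<otimes>\<^bsub>cohomology X i\<^esub> L) =
        cohomology_map Y f i K \<otimes>\<^bsub>cohomology Y i\<^esub> cohomology_map Y f i L"
        using z w cocycles_add[OF X] mod_hom_add[OF chain_hom[OF f]]
        by (simp add: coh_class_mult[OF X] coh_class_mult[OF Y] cm fz cocycles_carrier)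
    qed
    moreover have "inj_on (cohomology_map Y f i) (carrier (cohomology X i)) \<longleftrightarrow> coh_inj X Y f i"
    proof -
      have "inj_on (cohomology_map Y f i) (carrier (cohomology X i)) \<longleftrightarrow>
        (\<forall>z\<in>cocycles X i. \<forall>w\<in>cocycles X i. coh_class Y i (f i z) = coh_class Y i (f i w) --> coh_class X i z = coh_class X i w)"
        by (simp add: inj_on_def cohomology_carrier cm)
      also have "\<dots> \<longleftrightarrow> (\<forall>z\<in>cocycles X i. \<forall>w\<in>cocycles X i.
        f i (z \<ominus>\<^bsub>X$i\<^esub> w) \<in> coboundaries Y i --> z \<ominus>\<^bsub>X$i\<^esub> w \<in> coboundaries X i)"
        using mod_hom_diff[OF cx_module[OF X] cx_module[OF Y] chain_hom[OF f]] chain_closed[OF f]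
        by (simp add: coh_class_eq_iff[OF X] coh_class_eq_iff[OF Y] cocycles_carrier)
      also have "\<dots> \<longleftrightarrow> coh_inj X Y f i"
      proof
        assume L: "\<forall>z\<in>cocycles X i. \<forall>w\<in>cocycles X i.
          f i (z \<ominus>\<^bsub>X$i\<^esub> w) \<in> coboundaries Y i --> z \<ominus>\<^bsub>X$i\<^esub> w \<in> coboundaries X i"
        have "z \<ominus>\<^bsub>X$i\<^esub> \<zero>\<^bsub>X$i\<^esub> = z" if "z \<in> cocycles X i" for z
          using cocycles_carrier[OF that] by (simp add: A.minus_eq)
        then show "coh_inj X Y f i"
          using L cob_cocycles[OF X cob_zero[OF X]] unfolding coh_inj_def by (metis (no_types, lifting))
      qed (simp add: coh_inj_def cocycles_diff[OF X])
      finally show ?thesis .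
    qed
    moreover have "cohomology_map Y f i ` carrier (cohomology X i) = carrier (cohomology Y i) \<longleftrightarrow> coh_surj X Y f i"
    proof -
      have "cohomology_map Y f i ` carrier (cohomology X i) = (\<lambda>z. coh_class Y i (f i z)) ` cocycles X i"
        by (auto simp: cohomology_carrier cm image_iff)
      also have "\<dots> \<subseteq> carrier (cohomology Y i)"
        using fz by (auto simp: cohomology_carrier)
      finally have "cohomology_map Y f i ` carrier (cohomology X i) = carrier (cohomology Y i) \<longleftrightarrow>
        (\<forall>y\<in>cocycles Y i. \<exists>z\<in>cocycles X i. coh_class Y i y = coh_class Y i (f i z))"
        using \<open>cohomology_map Y f i ` carrier (cohomology X i) = (\<lambda>z. coh_class Y i (f i z)) ` cocycles X i\<close>
        unfolding cohomology_carrier by (smt (verit) image_iff subset_antisym subsetI)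
      then show ?thesis
        by (simp add: coh_surj_def coh_class_eq_iff[OF Y] cocycles_carrier chain_closed[OF f])
    qed
    ultimately show ?thesis by (auto simp: iso_def bij_betw_def)
  qed
  then show ?thesis by (auto simp: quasi_iso_def)
qed

lemma quasi_iso_chain: "quasi_iso R X Y f ==> f \<in> chain_maps R X Y"
  by (simp add: quasi_iso_def)

lemma quasi_iso_id: "is_complex R X ==> quasi_iso R X X (\<lambda>_. id)"
proof -
  assume X: "is_complex R X"
  have "coh_surj X X (\<lambda>_. id) i" for i
    unfolding coh_surj_def
  proof
    fix y assume y: "y \<in> cocycles X i"
    interpret A: module R "X$i" by (rule cx_module) fact
    show "\<exists>x\<in>cocycles X i. y \<ominus>\<^bsub>X$i\<^esub> id x \<in> coboundaries X i"
      using y cocycles_carrier[OF y] cob_zero[OF X] by (intro bexI[of _ y]) (simp_all add: A.minus_eq A.r_neg)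
  qed
  then show ?thesis using X by (auto simp: quasi_iso_iff chain_id coh_inj_def)
qed

section \<open>Homotopies and lifting along quasi-isomorphisms\<close>

text \<open>Dependent choice along \<open>k\<close>, \<open>k - 1\<close>, and so on. Differentials
  raise the degree, so homotopies and chain maps out of projective terms are built
  downwards.\<close>

lemma int_descending_choice:
  fixes k :: int
  assumes "\<Phi> k x0" and step: "\<And>i x. i \<le> k ==> \<Phi> i x ==> \<exists>y. \<Phi> (i - 1) y \<and> \<Psi> i x y"
  shows "\<exists>f. f k = x0 \<and> (\<forall>i\<le>k. \<Phi> i (f i) \<and> \<Psi> i (f i) (f (i - 1)))"
proof -
  have "\<exists>g. \<forall>n. (\<Phi> (k - int n) (g n) \<and> (n = 0 --> g n = x0)) \<and> \<Psi> (k - int n) (g n) (g (Suc n))"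
  proof (rule dependent_nat_choice)
    fix x n assume "\<Phi> (k - int n) x \<and> (n = 0 --> x = x0)"
    then obtain y where "\<Phi> (k - int n - 1) y" "\<Psi> (k - int n) x y" using step[of "k - int n" x] by auto
    then show "\<exists>y. (\<Phi> (k - int (Suc n)) y \<and> (Suc n = 0 --> y = x0)) \<and> \<Psi> (k - int n) x y"
      by (intro exI[of _ y]) (simp add: algebra_simps)
  qed (use assms(1) in auto)
  then obtain g where g: "\<And>n. \<Phi> (k - int n) (g n)" "g 0 = x0" "\<And>n. \<Psi> (k - int n) (g n) (g (Suc n))"
    by auto
  have "\<Phi> i (g (nat (k - i))) \<and> \<Psi> i (g (nat (k - i))) (g (nat (k - (i - 1))))" if "i \<le> k" for i
    using g(1)[of "nat (k - i)"] g(3)[of "nat (k - i)"] that by (simp add: Suc_nat_eq_nat_zadd1 algebra_simps)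
  then show ?thesis using g(2) by (intro exI[of _ "\<lambda>i. g (nat (k - i))"]) auto
qed

definition null_homotopic :: "('a, 'b) ring_scheme => ('a, 'm) cochain_complex =>
    ('a, 'n) cochain_complex => (int => 'm => 'n) => bool" where
  "null_homotopic R X Y f \<longleftrightarrow>
     (\<exists>s. (\<forall>i. s i \<in> mod_hom R (X$i) (Y$(i - 1))) \<and>
          (\<forall>i. \<forall>x\<in>X$$i.
             f i x = diff Y (i - 1) (s i x) \<oplus>\<^bsub>Y$i\<^esub> s (i + 1) (diff X i x)))"

text \<open>Given \<open>s\<^sub>i\<close>, the map \<open>g - s\<^sub>i d\<close> has values in coboundaries, so it lifts along the differential;
  the first such value is provided by the hypothesis on \<open>g k\<close>, the later ones by exactness.\<close>

lemma null_homotopicI: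
  assumes P: "is_complex R P" and C: "is_complex R C" and proj: "\<And>i. fg_proj R (P$i)"
    and top: "\<And>i. k < i ==> P$$i = {\<zero>\<^bsub>P$i\<^esub>}"
    and g: "g \<in> chain_maps R P C"
    and gk: "\<And>x. x \<in> P$$k ==> g k x \<in> coboundaries C k"
    and ex: "\<And>i. i < k ==> exact_at C i"
  shows "null_homotopic R P C g"
proof -
  \<comment> \<open>\<open>\<Phi> i s\<close> says that \<open>s\<close> can be continued as a
    homotopy from degree \<open>i\<close> on: the error that it leaves in degree
    \<open>i - 1\<close> is a coboundary, hence can be lifted. \<open>\<Psi> i s t\<close> is the
    homotopy identity in degree \<open>i - 1\<close>.\<close>
  define \<Phi> where "\<Phi> i s \<longleftrightarrow> s \<in> mod_hom R (P$i) (C$(i - 1)) \<and>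
    (\<forall>x\<in>P$$(i - 1).
      g (i - 1) x \<ominus>\<^bsub>C$(i - 1)\<^esub> s (diff P (i - 1) x) \<in> coboundaries C (i - 1))" for i s
  define \<Psi> where "\<Psi> i s t \<longleftrightarrow> (\<forall>x\<in>P$$(i - 1).
    g (i - 1) x = diff C (i - 2) (t x) \<oplus>\<^bsub>C$(i - 1)\<^esub> s (diff P (i - 1) x))" for i s t
  have mC: "module R (C$i)" and mP: "module R (P$i)" for i
    using P C by (auto intro: cx_module)
  note gc = chain_closed[OF g] and Pd = cx_diff_closed[OF P]
  \<comment> \<open>The start is the zero map in degree \<open>k + 1\<close>; the error that it
    leaves in degree \<open>k\<close> is \<open>g k\<close> itself.\<close>
  have "\<exists>s. s (k + 1) = (\<lambda>x. \<zero>\<^bsub>C$k\<^esub>) \<and> (\<forall>i\<le>k + 1. \<Phi> i (s i) \<and> \<Psi> i (s i) (s (i - 1)))"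
  proof (rule int_descending_choice)
    interpret C: module R "C$k" by (rule mC)
    show "\<Phi> (k + 1) (\<lambda>x. \<zero>\<^bsub>C$k\<^esub>)"
      unfolding \<Phi>_def
    proof (intro conjI ballI)
      show "(\<lambda>x. \<zero>\<^bsub>C$k\<^esub>) \<in> mod_hom R (P$(k + 1)) (C$(k + 1 - 1))"
        using mod_hom_const_zero[OF mC[of k]] by simp
    qed (use gk gc[of _ k] in \<open>simp\<close>)
  next
    fix i s assume i: "i \<le> k + 1" and s: "\<Phi> i s"
    interpret C: module R "C$(i - 1)" by (rule mC)
    interpret C2: module R "C$(i - 2)" by (rule mC)
    have sh: "s \<in> mod_hom R (P$i) (C$(i - 1))"
      and sb: "\<And>x. x \<in> P$$(i - 1) ==>
        g (i - 1) x \<ominus>\<^bsub>C$(i - 1)\<^esub> s (diff P (i - 1) x) \<in> coboundaries C (i - 1)"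
      using s by (auto simp: \<Phi>_def)
    have dh: "diff C (i - 2) \<in> mod_hom R (C$(i - 2)) (C$(i - 1))"
      "diff P (i - 1) \<in> mod_hom R (P$(i - 1)) (P$i)"
      by (rule cx_diff[OF C] cx_diff[OF P]; simp)+
    have "\<exists>t\<in>mod_hom R (P$(i - 1)) (C$(i - 2)). \<forall>p\<in>P$$(i - 1).
        diff C (i - 2) (t p) = g (i - 1) p \<ominus>\<^bsub>C$(i - 1)\<^esub> s (diff P (i - 1) p)"
    proof (rule fg_proj_lift[OF proj mC mC dh(1)])
      show "(\<lambda>p. g (i - 1) p \<ominus>\<^bsub>C$(i - 1)\<^esub> s (diff P (i - 1) p)) \<in>
        mod_hom R (P$(i - 1)) (C$(i - 1))"
        by (rule mod_hom_sub[OF mC chain_hom[OF g] mod_hom_comp[OF dh(2) sh]])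
      fix p assume "p \<in> P$$(i - 1)"
      from sb[OF this] show "g (i - 1) p \<ominus>\<^bsub>C$(i - 1)\<^esub> s (diff P (i - 1) p)
        \<in> diff C (i - 2) ` C$$(i - 2)"
        by (simp add: coboundaries_def)
    qed
    then obtain t where th: "t \<in> mod_hom R (P$(i - 1)) (C$(i - 2))"
      and t: "\<And>p. p \<in> P$$(i - 1) ==>
        diff C (i - 2) (t p) = g (i - 1) p \<ominus>\<^bsub>C$(i - 1)\<^esub> s (diff P (i - 1) p)"
      by auto
    have sc: "s (diff P (i - 1) x) \<in> C$$(i - 1)" if "x \<in> P$$(i - 1)" for x
      using mod_hom_closed[OF sh] Pd[OF _ that, of i] by simp
    have "\<Psi> i s t"
      using t gc[of _ "i - 1"] sc by (auto simp: \<Psi>_def C.minus_eq C.a_assoc C.l_neg)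
    moreover have "\<Phi> (i - 1) t"
      unfolding \<Phi>_def
    proof (intro conjI ballI)
      fix x assume "x \<in> P$$(i - 1 - 1)"
      then have x: "x \<in> P$$(i - 2)" by simp
      then have dx: "diff P (i - 2) x \<in> P$$(i - 1)" using Pd[OF _ x, of "i - 1"] by simp
      have gx: "g (i - 2) x \<in> C$$(i - 2)" using gc x by blast
      have tx: "t (diff P (i - 2) x) \<in> C$$(i - 2)" using mod_hom_closed[OF th dx] .
      have "diff C (i - 2) (g (i - 2) x \<ominus>\<^bsub>C$(i - 2)\<^esub> t (diff P (i - 2) x))
        = diff C (i - 2) (g (i - 2) x) \<ominus>\<^bsub>C$(i - 1)\<^esub> diff C (i - 2) (t (diff P (i - 2) x))"
        using mod_hom_diff[OF mC mC dh(1) gx tx] .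
      also have "diff C (i - 2) (g (i - 2) x) = g (i - 1) (diff P (i - 2) x)"
        using chain_diff[OF g _ x, of "i - 1"] by simp
      also have "diff C (i - 2) (t (diff P (i - 2) x)) = g (i - 1) (diff P (i - 2) x) \<ominus>\<^bsub>C$(i - 1)\<^esub> \<zero>\<^bsub>C$(i - 1)\<^esub>"
        using t[OF dx] cx_dd[OF P _ _ x, of "i - 1" i] mod_hom_zero[OF mP mC sh] by simp
      finally have z: "diff C (i - 2) (g (i - 2) x \<ominus>\<^bsub>C$(i - 2)\<^esub> t (diff P (i - 2) x)) = \<zero>\<^bsub>C$(i - 1)\<^esub>"
        using gc[OF dx] by (simp add: C.minus_eq C.r_neg)
      then have "g (i - 2) x \<ominus>\<^bsub>C$(i - 2)\<^esub> t (diff P (i - 2) x) \<in> cocycles C (i - 2)"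
        using gx tx by (simp add: cocycles_def)
      \<comment> \<open>As \<open>i \<le> k + 1\<close>, the degree \<open>i - 2\<close> is below
        \<open>k\<close>, where exactness is assumed; degree \<open>k\<close> was served by the
        hypothesis on \<open>g k\<close>.\<close>
      moreover have "exact_at C (i - 2)" using ex i by simp
      ultimately show "g (i - 1 - 1) x \<ominus>\<^bsub>C$(i - 1 - 1)\<^esub> t (diff P (i - 1 - 1) x) \<in> coboundaries C (i - 1 - 1)"
        by (auto simp: exact_at_def)
    qed (use th in simp)
    ultimately show "\<exists>t. \<Phi> (i - 1) t \<and> \<Psi> i s t" by blast
  qed
  then obtain s where s: "\<And>i. i \<le> k + 1 ==> \<Phi> i (s i)" "\<And>i. i \<le> k + 1 ==> \<Psi> i (s i) (s (i - 1))"
    by auto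
  define t where "t i = (if i \<le> k + 1 then s i else (\<lambda>x. \<zero>\<^bsub>C$(i - 1)\<^esub>))" for i
  have th: "t i \<in> mod_hom R (P$i) (C$(i - 1))" for i
    using s(1) mod_hom_const_zero[OF mC] by (auto simp: t_def \<Phi>_def)
  moreover have "g i x = diff C (i - 1) (t i x) \<oplus>\<^bsub>C$i\<^esub> t (i + 1) (diff P i x)"
    if x: "x \<in> P$$i" for i x
  proof (cases "i \<le> k")
    case True
    then show ?thesis using s(2)[of "i + 1"] x by (auto simp: t_def \<Psi>_def)
  next
    case False
    then have x0: "x = \<zero>\<^bsub>P$i\<^esub>" using top[of i] x by auto
    interpret C: module R "C$i" by (rule mC)
    have "diff P i x = \<zero>\<^bsub>P$(i + 1)\<^esub>"
      using mod_hom_zero[OF mP mP cx_diff[OF P refl]] x0 by simp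
    moreover have "t i x = \<zero>\<^bsub>C$(i - 1)\<^esub>" using mod_hom_zero[OF mP mC th] x0 by simp
    ultimately show ?thesis
      using mod_hom_zero[OF mP mC th[of "i + 1"]] mod_hom_zero[OF mC mC cx_diff[OF C], of i "i - 1"]
        mod_hom_zero[OF mP mC chain_hom[OF g]] x0 by simp
  qed
  ultimately show ?thesis unfolding null_homotopic_def by blast
qed

text \<open>Existence in the comparison theorem. In each degree the composite with the differential
  has values in cocycles; exactness makes these coboundaries, and projectivity lifts them. In degree
  \<open>k\<close> the hypothesis \<open>fk\<close> takes the place of exactness.\<close>

lemma chain_extension:
  assumes F: "is_complex R F" and C: "is_complex R C" and proj: "\<And>i. i < k ==> fg_proj R (F$i)"
    and f: "\<And>i. k \<le> i ==> f i \<in> mod_hom R (F$i) (C$i)"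
    and fd: "\<And>i x. k \<le> i ==> x \<in> F$$i ==> f (i + 1) (diff F i x) = diff C i (f i x)"
    and fk: "\<And>x. x \<in> F$$(k - 1) ==> f k (diff F (k - 1) x) \<in> coboundaries C k"
    and ex: "\<And>i. i < k ==> exact_at C i"
  shows "\<exists>g\<in>chain_maps R F C. \<forall>i\<ge>k. g i = f i"
proof -
  define \<Phi> where "\<Phi> i s \<longleftrightarrow> s \<in> mod_hom R (F$i) (C$i) \<and>
    (\<forall>x\<in>F$$(i - 1). s (diff F (i - 1) x) \<in> coboundaries C i)" for i s
  define \<Psi> where "\<Psi> i s t \<longleftrightarrow> (\<forall>x\<in>F$$(i - 1).
    s (diff F (i - 1) x) = diff C (i - 1) (t x))" for i s t
  have mC: "module R (C$i)" and mF: "module R (F$i)" for i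
    using F C by (auto intro: cx_module)
  note Fd = cx_diff_closed[OF F]
  have "\<exists>s. s k = f k \<and> (\<forall>i\<le>k. \<Phi> i (s i) \<and> \<Psi> i (s i) (s (i - 1)))"
  proof (rule int_descending_choice)
    show "\<Phi> k (f k)" using f fk by (simp add: \<Phi>_def)
  next
    fix i s assume i: "i \<le> k" and s: "\<Phi> i s"
    have sh: "s \<in> mod_hom R (F$i) (C$i)"
      and sb: "\<And>x. x \<in> F$$(i - 1) ==> s (diff F (i - 1) x) \<in> coboundaries C i"
      using s by (auto simp: \<Phi>_def)
    have dh: "diff C (i - 1) \<in> mod_hom R (C$(i - 1)) (C$i)"
      "diff F (i - 1) \<in> mod_hom R (F$(i - 1)) (F$i)"
      by (rule cx_diff[OF C] cx_diff[OF F]; simp)+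
    have pr: "fg_proj R (F$(i - 1))" using proj i by simp
    obtain t where th: "t \<in> mod_hom R (F$(i - 1)) (C$(i - 1))"
      and t: "\<And>p. p \<in> F$$(i - 1) ==> diff C (i - 1) (t p) = s (diff F (i - 1) p)"
      using fg_proj_lift[OF pr mC mC dh(1) mod_hom_comp[OF dh(2) sh]] sb
      by (force simp: coboundaries_def)
    have "\<Psi> i s t" using t by (simp add: \<Psi>_def)
    moreover have "\<Phi> (i - 1) t"
      unfolding \<Phi>_def
    proof (intro conjI ballI)
      fix x assume "x \<in> F$$(i - 1 - 1)"
      then have x: "x \<in> F$$(i - 2)" by simp
      then have dx: "diff F (i - 2) x \<in> F$$(i - 1)" using Fd[OF _ x, of "i - 1"] by simp
      have "diff C (i - 1) (t (diff F (i - 2) x)) = \<zero>\<^bsub>C$i\<^esub>"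
        using t[OF dx] cx_dd[OF F _ _ x, of "i - 1" i] mod_hom_zero[OF mF mC sh] by simp
      then have "t (diff F (i - 2) x) \<in> cocycles C (i - 1)"
        using mod_hom_closed[OF th dx] by (simp add: cocycles_def)
      moreover have "exact_at C (i - 1)" using ex i by simp
      ultimately show "t (diff F (i - 1 - 1) x) \<in> coboundaries C (i - 1)"
        by (auto simp: exact_at_def)
    qed (use th in simp)
    ultimately show "\<exists>t. \<Phi> (i - 1) t \<and> \<Psi> i s t" by blast
  qed
  then obtain s where sk: "s k = f k" and s: "\<And>i. i \<le> k ==> \<Phi> i (s i)" "\<And>i. i \<le> k ==> \<Psi> i (s i) (s (i - 1))"
    by auto
  define g where "g i = (if i \<le> k then s i else f i)" for i
  have "g \<in> chain_maps R F C"
    unfolding chain_maps_def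
  proof (intro CollectI allI conjI ballI)
    fix i
    show "g i \<in> mod_hom R (F$i) (C$i)"
      using s(1)[of i] f by (auto simp: g_def \<Phi>_def)
    fix x assume x: "x \<in> F$$i"
    show "g (i + 1) (diff F i x) = diff C i (g i x)"
    proof (cases "i < k")
      case True
      then show ?thesis using s(2)[of "i + 1"] x by (auto simp: g_def \<Psi>_def)
    next
      case False
      then have "g i = f i" "g (i + 1) = f (i + 1)" using sk by (auto simp: g_def)
      then show ?thesis using fd False x by simp
    qed
  qed
  moreover have "g i = f i" if "k \<le> i" for i using that sk by (auto simp: g_def)
  ultimately show ?thesis by blast
qed

lemma null_homotopic_cocycle:
  assumes Y: "is_complex R Y" "is_complex R X" and "null_homotopic R X Y f" and x: "x \<in> cocycles X i"
  shows "f i x \<in> coboundaries Y i"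
proof -
  obtain s where s: "\<And>i. s i \<in> mod_hom R (X$i) (Y$(i - 1))"
    "\<And>i x. x \<in> X$$i ==>
             f i x = diff Y (i - 1) (s i x) \<oplus>\<^bsub>Y$i\<^esub> s (i + 1) (diff X i x)"
    using assms(3) by (auto simp: null_homotopic_def)
  interpret Y: module R "Y$i" by (rule cx_module) fact
  have c: "s i x \<in> Y$$(i - 1)" using mod_hom_closed[OF s(1) cocycles_carrier[OF x]] .
  have "s (i + 1) \<zero>\<^bsub>X$(i + 1)\<^esub> = \<zero>\<^bsub>Y$i\<^esub>"
    using mod_hom_zero[OF cx_module[OF Y(2)] cx_module[OF Y(1)] s(1), of "i + 1"] by simp
  then have "f i x = diff Y (i - 1) (s i x)"
    using s(2)[OF cocycles_carrier[OF x]] x cx_diff_closed[OF Y(1) _ c, of i] by (simp add: cocycles_def)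
  then show ?thesis using c by (auto simp: coboundaries_def)
qed

lemma chain_homotopic_null:
  assumes Y: "is_complex R Y" "is_complex R X" and f: "f \<in> chain_maps R X Y" and g: "g \<in> chain_maps R X Y"
    and h: "chain_homotopic R X Y f g"
  shows "null_homotopic R X Y (\<lambda>i x. f i x \<ominus>\<^bsub>Y$i\<^esub> g i x)"
proof -
  obtain s where s: "\<And>i. s i \<in> mod_hom R (X$i) (Y$(i - 1))"
    "\<And>i x. x \<in> X$$i ==>
       f i x = g i x \<oplus>\<^bsub>Y$i\<^esub> (diff Y (i - 1) (s i x) \<oplus>\<^bsub>Y$i\<^esub> s (i + 1) (diff X i x))"
    using h by (auto simp: chain_homotopic_def)
  have "f i x \<ominus>\<^bsub>Y$i\<^esub> g i x = diff Y (i - 1) (s i x) \<oplus>\<^bsub>Y$i\<^esub> s (i + 1) (diff X i x)"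
    if x: "x \<in> X$$i" for i x
  proof -
    interpret Y: module R "Y$i" by (rule cx_module) fact
    have "diff Y (i - 1) (s i x) \<oplus>\<^bsub>Y$i\<^esub> s (i + 1) (diff X i x) \<in> Y$$i"
      using cx_diff_closed[OF Y(1) _ mod_hom_closed[OF s(1) x], of i]
        mod_hom_closed[OF s(1)[of "i + 1"] cx_diff_closed[OF Y(2) refl x]] by simp
    then show ?thesis using s(2)[OF x] chain_closed[OF g x]
      by (simp add: Y.minus_eq Y.a_ac Y.r_neg1 Y.r_neg2)
  qed
  then show ?thesis using s(1) unfolding null_homotopic_def by blast
qed

lemma chain_homotopic_cocycle:
  assumes Y: "is_complex R Y" "is_complex R X" and f: "f \<in> chain_maps R X Y" and g: "g \<in> chain_maps R X Y"
    and h: "chain_homotopic R X Y f g" and x: "x \<in> cocycles X i"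
  shows "f i x \<ominus>\<^bsub>Y$i\<^esub> g i x \<in> coboundaries Y i"
  using null_homotopic_cocycle[OF Y chain_homotopic_null[OF Y f g h] x] .

lemma cob_cong:
  assumes X: "is_complex R X" and "x \<in> X$$i" "y \<in> X$$i"
    and "x \<ominus>\<^bsub>X$i\<^esub> y \<in> coboundaries X i"
  shows "x \<in> coboundaries X i \<longleftrightarrow> y \<in> coboundaries X i"
proof -
  interpret X: module R "X$i" by (rule cx_module) fact
  have "x = (x \<ominus>\<^bsub>X$i\<^esub> y) \<oplus>\<^bsub>X$i\<^esub> y" "y = x \<ominus>\<^bsub>X$i\<^esub> (x \<ominus>\<^bsub>X$i\<^esub> y)"
    using assms by (simp_all add: X.minus_eq X.a_assoc X.l_neg X.minus_add X.r_neg2)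
  then show ?thesis using assms cob_add[OF X] cob_diff[OF X] by metis
qed

lemma cob_trans:
  assumes X: "is_complex R X" and "x \<in> X$$i" "y \<in> X$$i"
     "z \<in> X$$i"
    and "x \<ominus>\<^bsub>X$i\<^esub> y \<in> coboundaries X i" "y \<ominus>\<^bsub>X$i\<^esub> z \<in> coboundaries X i"
  shows "x \<ominus>\<^bsub>X$i\<^esub> z \<in> coboundaries X i"
proof -
  interpret X: module R "X$i" by (rule cx_module) fact
  have "x \<ominus>\<^bsub>X$i\<^esub> z = (x \<ominus>\<^bsub>X$i\<^esub> y) \<oplus>\<^bsub>X$i\<^esub> (y \<ominus>\<^bsub>X$i\<^esub> z)"
    using assms by (simp add: X.minus_eq X.a_assoc X.r_neg1)
  then show ?thesis using assms cob_add[OF X] by metis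
qed

section \<open>Behaviour of injectivity and surjectivity on cohomology under homotopy and
  composition\<close>

lemma coh_inj_homotopic:
  assumes Y: "is_complex R Y" "is_complex R X" and f: "f \<in> chain_maps R X Y" and g: "g \<in> chain_maps R X Y"
    and h: "chain_homotopic R X Y f g"
  shows "coh_inj X Y f i \<longleftrightarrow> coh_inj X Y g i"
  using cob_cong[OF Y(1) chain_closed[OF f] chain_closed[OF g] chain_homotopic_cocycle[OF Y f g h]]
  by (auto simp: coh_inj_def cocycles_carrier)

lemma coh_surj_homotopic:
  assumes Y: "is_complex R Y" "is_complex R X" and f: "f \<in> chain_maps R X Y" and g: "g \<in> chain_maps R X Y"
    and h: "chain_homotopic R X Y f g"
  shows "coh_surj X Y f i \<longleftrightarrow> coh_surj X Y g i"
proof -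
  interpret Y: module R "Y$i" by (rule cx_module) fact
  have "y \<ominus>\<^bsub>Y$i\<^esub> f i x \<in> coboundaries Y i \<longleftrightarrow> y \<ominus>\<^bsub>Y$i\<^esub> g i x \<in> coboundaries Y i"
    if "x \<in> cocycles X i" "y \<in> cocycles Y i" for x y
  proof (rule cob_cong[OF Y(1)])
    have c: "x \<in> X$$i" "y \<in> Y$$i" "f i x \<in> Y$$i"
      "g i x \<in> Y$$i"
      using that chain_closed[OF f] chain_closed[OF g] by (auto simp: cocycles_carrier)
    then show "y \<ominus>\<^bsub>Y$i\<^esub> f i x \<in> Y$$i" "y \<ominus>\<^bsub>Y$i\<^esub> g i x \<in> Y$$i"
      by auto
    have "y \<ominus>\<^bsub>Y$i\<^esub> f i x \<ominus>\<^bsub>Y$i\<^esub> (y \<ominus>\<^bsub>Y$i\<^esub> g i x) =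
      \<ominus>\<^bsub>Y$i\<^esub> (f i x \<ominus>\<^bsub>Y$i\<^esub> g i x)"
      using c Y.r_neg2[of y "\<ominus>\<^bsub>Y$i\<^esub> f i x \<oplus>\<^bsub>Y$i\<^esub> g i x"]
      by (simp add: Y.minus_eq Y.a_lcomm Y.minus_add Y.a_assoc)
    then show "y \<ominus>\<^bsub>Y$i\<^esub> f i x \<ominus>\<^bsub>Y$i\<^esub> (y \<ominus>\<^bsub>Y$i\<^esub> g i x) \<in> coboundaries Y i"
      using cob_minus[OF Y(1) chain_homotopic_cocycle[OF Y f g h that(1)]] by simp
  qed
  then show ?thesis by (simp add: coh_surj_def)
qed

lemma quasi_iso_homotopic:
  assumes Y: "is_complex R Y" "is_complex R X" and f: "f \<in> chain_maps R X Y" and g: "g \<in> chain_maps R X Y"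
    and h: "chain_homotopic R X Y f g"
  shows "quasi_iso R X Y f \<longleftrightarrow> quasi_iso R X Y g"
  using assms coh_inj_homotopic[OF assms] coh_surj_homotopic[OF assms] by (auto simp: quasi_iso_iff)

lemma coh_inj_comp:
  assumes X: "is_complex R X" "is_complex R Y" and f: "f \<in> chain_maps R X Y"
    and "coh_inj X Y f i" "coh_inj Y Z g i"
  shows "coh_inj X Z (chain_comp g f) i"
  using assms(4,5) chain_cocycles[OF X f] by (auto simp: coh_inj_def chain_comp_def)

lemma coh_inj_compD:
  assumes f: "f \<in> chain_maps R X Y" and g: "g \<in> chain_maps R Y Z"
    and "coh_inj X Z (chain_comp g f) i"
  shows "coh_inj X Y f i"
  using assms(3) chain_cob[OF g] by (auto simp: coh_inj_def chain_comp_def)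

lemma coh_inj_compD2:
  assumes X: "is_complex R X" "is_complex R Y" "is_complex R Z"
    and f: "f \<in> chain_maps R X Y" and g: "g \<in> chain_maps R Y Z"
    and "coh_inj X Z (chain_comp g f) i" "coh_surj X Y f i"
  shows "coh_inj Y Z g i"
  unfolding coh_inj_def
proof (intro ballI impI)
  fix y assume y: "y \<in> cocycles Y i" and gy: "g i y \<in> coboundaries Z i"
  obtain x where x: "x \<in> cocycles X i" "y \<ominus>\<^bsub>Y$i\<^esub> f i x \<in> coboundaries Y i"
    using assms(7) y by (auto simp: coh_surj_def)
  note c = cocycles_carrier[OF y] chain_closed[OF f cocycles_carrier[OF x(1)]]
  have "g i y \<ominus>\<^bsub>Z$i\<^esub> g i (f i x) \<in> coboundaries Z i"
    using chain_cob[OF g x(2)] mod_hom_diff[OF cx_module[OF X(2)] cx_module[OF X(3)] chain_hom[OF g] c] by simp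
  then have "g i (f i x) \<in> coboundaries Z i"
    using cob_cong[OF X(3) chain_closed[OF g c(1)] chain_closed[OF g c(2)]] gy by blast
  then have "x \<in> coboundaries X i" using assms(6) x(1) by (auto simp: coh_inj_def chain_comp_def)
  then have "f i x \<in> coboundaries Y i" by (rule chain_cob[OF f])
  then show "y \<in> coboundaries Y i" using cob_cong[OF X(2) c x(2)] by blast
qed

lemma coh_surj_comp:
  assumes X: "is_complex R X" "is_complex R Y" "is_complex R Z"
    and f: "f \<in> chain_maps R X Y" and g: "g \<in> chain_maps R Y Z"
    and "coh_surj X Y f i" "coh_surj Y Z g i"
  shows "coh_surj X Z (chain_comp g f) i"
  unfolding coh_surj_def
proof
  fix z assume z: "z \<in> cocycles Z i"
  obtain y where y: "y \<in> cocycles Y i" "z \<ominus>\<^bsub>Z$i\<^esub> g i y \<in> coboundaries Z i"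
    using assms(7) z by (auto simp: coh_surj_def)
  obtain x where x: "x \<in> cocycles X i" "y \<ominus>\<^bsub>Y$i\<^esub> f i x \<in> coboundaries Y i"
    using assms(6) y by (auto simp: coh_surj_def)
  note c = cocycles_carrier[OF y(1)] chain_closed[OF f cocycles_carrier[OF x(1)]]
  have "g i y \<ominus>\<^bsub>Z$i\<^esub> g i (f i x) \<in> coboundaries Z i"
    using chain_cob[OF g x(2)] mod_hom_diff[OF cx_module[OF X(2)] cx_module[OF X(3)] chain_hom[OF g] c] by simp
  then have "z \<ominus>\<^bsub>Z$i\<^esub> g i (f i x) \<in> coboundaries Z i"
    using cob_trans[OF X(3) cocycles_carrier[OF z] chain_closed[OF g c(1)] chain_closed[OF g c(2)] y(2)] by blast
  then show "\<exists>x\<in>cocycles X i. z \<ominus>\<^bsub>Z$i\<^esub> chain_comp g f i x \<in> coboundaries Z i"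
    using x(1) by (auto simp: chain_comp_def)
qed

lemma coh_surj_compD:
  assumes X: "is_complex R X" "is_complex R Y" and f: "f \<in> chain_maps R X Y"
    and "coh_surj X Z (chain_comp g f) i"
  shows "coh_surj Y Z g i"
  using assms(4) chain_cocycles[OF X f] by (fastforce simp: coh_surj_def chain_comp_def)

lemma coh_surj_compD2:
  assumes X: "is_complex R X" "is_complex R Y" "is_complex R Z"
    and f: "f \<in> chain_maps R X Y" and g: "g \<in> chain_maps R Y Z"
    and "coh_surj X Z (chain_comp g f) i" "coh_inj Y Z g i"
  shows "coh_surj X Y f i"
  unfolding coh_surj_def
proof
  fix y assume y: "y \<in> cocycles Y i"
  obtain x where x: "x \<in> cocycles X i" "g i y \<ominus>\<^bsub>Z$i\<^esub> g i (f i x) \<in> coboundaries Z i"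
    using assms(6) chain_cocycles[OF X(2,3) g y] by (auto simp: coh_surj_def chain_comp_def)
  note c = cocycles_carrier[OF y(1)] chain_closed[OF f cocycles_carrier[OF x(1)]]
  have "g i (y \<ominus>\<^bsub>Y$i\<^esub> f i x) \<in> coboundaries Z i"
    using x(2) mod_hom_diff[OF cx_module[OF X(2)] cx_module[OF X(3)] chain_hom[OF g] c] by simp
  then show "\<exists>x\<in>cocycles X i. y \<ominus>\<^bsub>Y$i\<^esub> f i x \<in> coboundaries Y i"
    using assms(7) cocycles_diff[OF X(2) y chain_cocycles[OF X(1,2) f x(1)]] x(1) by (auto simp: coh_inj_def)
qed

lemma quasi_iso_comp:
  assumes X: "is_complex R X" "is_complex R Y" "is_complex R Z"
    and f: "quasi_iso R X Y f" and g: "quasi_iso R Y Z g"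
  shows "quasi_iso R X Z (chain_comp g f)"
  unfolding quasi_iso_iff[OF X(1,3)]
  using chain_comp_maps[OF quasi_iso_chain[OF f] quasi_iso_chain[OF g]]
    coh_inj_comp[OF X(1,2) quasi_iso_chain[OF f], where Z = Z and g = g] coh_surj_comp[OF X quasi_iso_chain[OF f] quasi_iso_chain[OF g]]
    f g X by (simp add: quasi_iso_iff)

lemma quasi_iso_cancel_left:
  assumes X: "is_complex R X" "is_complex R Y" "is_complex R Z"
    and f: "f \<in> chain_maps R X Y" and g: "quasi_iso R Y Z g" and gf: "quasi_iso R X Z (chain_comp g f)"
  shows "quasi_iso R X Y f"
  unfolding quasi_iso_iff[OF X(1,2)]
  using coh_inj_compD[OF f quasi_iso_chain[OF g]] coh_surj_compD2[OF X f quasi_iso_chain[OF g]] g gf f X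
  by (simp add: quasi_iso_iff)

section \<open>Direct sums and mapping cones\<close>

lemma direct_sum_simps [simp]:
  "carrier (direct_sum M N) = carrier M \<times> carrier N"
  "zero (direct_sum M N) = (\<zero>\<^bsub>M\<^esub>, \<zero>\<^bsub>N\<^esub>)"
  "add (direct_sum M N) (x, y) (x', y') = (x \<oplus>\<^bsub>M\<^esub> x', y \<oplus>\<^bsub>N\<^esub> y')"
  "smult (direct_sum M N) a (x, y) = (a \<odot>\<^bsub>M\<^esub> x, a \<odot>\<^bsub>N\<^esub> y)"
  by (simp_all add: direct_sum_def)

lemma module_direct_sum:
  assumes M: "module R M" and N: "module R N"
  shows "module R (direct_sum M N)"
proof -
  interpret M: module R M by fact
  interpret N: module R N by fact
  show ?thesis
  proof (intro moduleI abelian_groupI)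
    fix p assume "p \<in> carrier (direct_sum M N)"
    then show "\<exists>q\<in>carrier (direct_sum M N). q \<oplus>\<^bsub>direct_sum M N\<^esub> p = \<zero>\<^bsub>direct_sum M N\<^esub>"
      by (cases p) (force intro!: bexI[of _ "(\<ominus>\<^bsub>M\<^esub> fst p, \<ominus>\<^bsub>N\<^esub> snd p)"] simp: M.l_neg N.l_neg)
  qed (auto simp: M.a_ac N.a_ac M.smult_l_distr N.smult_l_distr M.smult_r_distr N.smult_r_distr
      M.smult_assoc1 N.smult_assoc1 M.R.cring_axioms)
qed

lemma direct_sum_a_inv:
  assumes M: "module R M" and N: "module R N" and "x \<in> carrier M" "y \<in> carrier N"
  shows "\<ominus>\<^bsub>direct_sum M N\<^esub> (x, y) = (\<ominus>\<^bsub>M\<^esub> x, \<ominus>\<^bsub>N\<^esub> y)"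
proof -
  interpret M: module R M by fact
  interpret N: module R N by fact
  interpret S: module R "direct_sum M N" by (rule module_direct_sum) fact+
  show ?thesis using assms(3,4) by (intro S.M.minus_equality) (auto simp: M.l_neg N.l_neg)
qed

lemma cone_simps [simp]:
  "(cone X Y f)$i = direct_sum (X$(i + 1)) (Y$i)"
  "diff (cone X Y f) i (x, y) = (\<ominus>\<^bsub>X$(i + 2)\<^esub> diff X (i + 1) x,
                        f (i + 1) x \<oplus>\<^bsub>Y$(i + 1)\<^esub> diff Y i y)"
  by (simp_all add: cone_def)

lemma cone_complex:
  assumes X: "is_complex R X" and Y: "is_complex R Y" and f: "f \<in> chain_maps R X Y"
  shows "is_complex R (cone X Y f)"
  unfolding is_complex_def
proof (intro allI conjI ballI)
  fix i
  have mX: "module R (X$i)" and mY: "module R (Y$i)" for i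
    using X Y by (auto intro: cx_module)
  show "module R ((cone X Y f)$i)" using mX mY by (simp add: module_direct_sum)
  interpret X1: module R "X$(i + 1)" by (rule mX)
  interpret X2: module R "X$(i + 2)" by (rule mX)
  interpret X3: module R "X$(i + 3)" by (rule mX)
  interpret Y0: module R "Y$i" by (rule mY)
  interpret Y1: module R "Y$(i + 1)" by (rule mY)
  interpret Y2: module R "Y$(i + 2)" by (rule mY)
  have e: "i + 1 + 1 = i + 2" "i + 1 + 2 = i + 3" "i + 2 + 1 = i + 3" by simp_all
  have dX1: "diff X (i + 1) \<in> mod_hom R (X$(i + 1)) (X$(i + 2))"
    and dX2: "diff X (i + 2) \<in> mod_hom R (X$(i + 2)) (X$(i + 3))"
    and dY0: "diff Y i \<in> mod_hom R (Y$i) (Y$(i + 1))"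
    and dY1: "diff Y (i + 1) \<in> mod_hom R (Y$(i + 1)) (Y$(i + 2))"
    by (rule cx_diff[OF X] cx_diff[OF Y]; simp)+
  have f1: "f (i + 1) \<in> mod_hom R (X$(i + 1)) (Y$(i + 1))"
    and f2: "f (i + 2) \<in> mod_hom R (X$(i + 2)) (Y$(i + 2))"
    by (rule chain_hom[OF f])+
  note c = mod_hom_closed[OF dX1] mod_hom_closed[OF dX2] mod_hom_closed[OF dY0] mod_hom_closed[OF dY1]
    mod_hom_closed[OF f1] mod_hom_closed[OF f2]
  show "diff (cone X Y f) i \<in> mod_hom R ((cone X Y f)$i) ((cone X Y f)$(i + 1))"
    unfolding cone_simps e
    by (rule mod_homI)
      (auto simp: c e mod_hom_add[OF dX1] mod_hom_add[OF dY0] mod_hom_add[OF f1] mod_hom_smult[OF dX1]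
        mod_hom_smult[OF dY0] mod_hom_smult[OF f1] X2.minus_add X2.smult_r_minus Y1.smult_r_distr Y1.a_ac)
  fix p assume "p \<in> (cone X Y f)$$i"
  then obtain x y where p: "p = (x, y)" and x: "x \<in> X$$(i + 1)" and y: "y \<in> Y$$i"
    by auto
  have dfx: "f (i + 2) (diff X (i + 1) x) = diff Y (i + 1) (f (i + 1) x)"
    using chain_diff[OF f _ x, of "i + 2"] by simp
  show "diff (cone X Y f) (i + 1) (diff (cone X Y f) i p) = \<zero>\<^bsub>(cone X Y f)$(i + 2)\<^esub>"
    using x y c cx_dd[OF X _ _ x, of "i + 2" "i + 3"] cx_dd[OF Y _ _ y, of "i + 1" "i + 2"]
    by (simp add: p e mod_hom_minus[OF mX mX dX2] mod_hom_minus[OF mX mY f2] mod_hom_add[OF dY1] dfx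
        Y2.l_neg)
qed

text \<open>Injectivity and surjectivity on cohomology are used in the degrees in which they are needed
  for the exactness of the cone in one fixed degree.\<close>

lemma cone_exact:
  assumes X: "is_complex R X" and Y: "is_complex R Y" and f: "f \<in> chain_maps R X Y"
    and inj: "coh_inj X Y f (i + 1)" and surj: "coh_surj X Y f i"
  shows "exact_at (cone X Y f) i"
  unfolding exact_at_def
proof
  fix p assume p: "p \<in> cocycles (cone X Y f) i"
  have mX: "module R (X$i)" and mY: "module R (Y$i)" for i
    using X Y by (auto intro: cx_module)
  interpret X0: module R "X$i" by (rule mX)
  interpret X1: module R "X$(i + 1)" by (rule mX)
  interpret X2: module R "X$(i + 2)" by (rule mX)
  interpret Y0: module R "Y$i" by (rule mY)
  interpret Y1: module R "Y$(i + 1)" by (rule mY)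
  have e: "i + 1 + 1 = i + 2" "i - 1 + 1 = i" "i - 1 + 2 = i + 1" by simp_all
  obtain x y where pxy: "p = (x, y)" and x: "x \<in> X$$(i + 1)" and y: "y \<in> Y$$i"
    and dx0: "\<ominus>\<^bsub>X$(i + 2)\<^esub> diff X (i + 1) x = \<zero>\<^bsub>X$(i + 2)\<^esub>"
    and fx: "f (i + 1) x \<oplus>\<^bsub>Y$(i + 1)\<^esub> diff Y i y = \<zero>\<^bsub>Y$(i + 1)\<^esub>"
    using p by (auto simp: cocycles_def e)
  have c: "f (i + 1) x \<in> Y$$(i + 1)" "diff Y i y \<in> Y$$(i + 1)"
    "diff X (i + 1) x \<in> X$$(i + 2)"
    using chain_closed[OF f x] cx_diff_closed[OF Y refl y] cx_diff_closed[OF X _ x, of "i + 2"] by auto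
  have dx: "diff X (i + 1) x = \<zero>\<^bsub>X$(i + 2)\<^esub>"
    using dx0 c(3) by (metis X2.minus_minus X2.module_minus_zero)
  then have xz: "x \<in> cocycles X (i + 1)" using x by (simp add: cocycles_def e)
  have "f (i + 1) x = \<ominus>\<^bsub>Y$(i + 1)\<^esub> diff Y i y"
    using fx c Y1.minus_equality by metis
  then have "f (i + 1) x \<in> coboundaries Y (i + 1)"
    using cob_minus[OF Y cobI[OF y refl refl]] by simp
  then have "x \<in> coboundaries X (i + 1)" using inj xz by (auto simp: coh_inj_def)
  then obtain x' where x': "x' \<in> X$$i" and xx': "x = diff X i x'"
    by (auto elim: cobE)
  have fx': "f i x' \<in> Y$$i" by (rule chain_closed[OF f x'])
  have "diff Y i (y \<oplus>\<^bsub>Y$i\<^esub> f i x') = diff Y i y \<oplus>\<^bsub>Y$(i + 1)\<^esub> f (i + 1) x"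
    using mod_hom_add[OF cx_diff[OF Y refl] y fx'] chain_diff[OF f refl x'] xx' by simp
  then have "y \<oplus>\<^bsub>Y$i\<^esub> f i x' \<in> cocycles Y i"
    using fx c y fx' by (simp add: cocycles_def Y1.a_comm)
  then obtain w where w: "w \<in> cocycles X i"
    and wy: "(y \<oplus>\<^bsub>Y$i\<^esub> f i x') \<ominus>\<^bsub>Y$i\<^esub> f i w \<in> coboundaries Y i"
    using surj by (auto simp: coh_surj_def)
  then obtain y' where y': "y' \<in> Y$$(i - 1)"
    and yy': "(y \<oplus>\<^bsub>Y$i\<^esub> f i x') \<ominus>\<^bsub>Y$i\<^esub> f i w = diff Y (i - 1) y'"
    by (auto elim: cobE)
  have wc: "w \<in> X$$i" and dw: "diff X i w = \<zero>\<^bsub>X$(i + 1)\<^esub>"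
    using w by (auto simp: cocycles_def)
  have fw: "f i w \<in> Y$$i" by (rule chain_closed[OF f wc])
  \<comment> \<open>\<open>x'\<close> accounts for the first component of \<open>p\<close> and
    leaves \<open>y + f x'\<close> in the second, which surjectivity writes as \<open>f w\<close>
    plus the coboundary of \<open>y'\<close>. Hence \<open>(w - x', y')\<close> is a preimage; the
    sign in the differential of the cone turns the differential of \<open>- x'\<close> into
    \<open>x\<close>.\<close>
  define u where "u = w \<ominus>\<^bsub>X$i\<^esub> x'"
  have u: "u \<in> X$$i" using wc x' by (simp add: u_def)
  have "diff X i u = \<ominus>\<^bsub>X$(i + 1)\<^esub> x"
    using mod_hom_diff[OF mX mX cx_diff[OF X refl] wc x'] dw xx' x by (simp add: u_def X1.minus_eq)
  moreover have "f i u \<oplus>\<^bsub>Y$i\<^esub> diff Y (i - 1) y' = y"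
    using mod_hom_diff[OF mX mY chain_hom[OF f] wc x'] fw fx' y
    by (simp add: u_def flip: yy')
      (simp add: Y0.minus_eq Y0.a_ac Y0.r_neg1 Y0.r_neg2 Y0.l_neg Y0.r_neg)
  ultimately have "p = diff (cone X Y f) (i - 1) (u, y')"
    using x by (simp add: pxy e)
  then show "p \<in> coboundaries (cone X Y f) i"
    using u y' by (intro cobI[of "(u, y')" _ "i - 1"]) (auto simp: e)
qed

lemma quasi_iso_cone_exact:
  assumes X: "is_complex R X" and Y: "is_complex R Y" and f: "quasi_iso R X Y f"
  shows "exact_at (cone X Y f) i"
  using cone_exact[OF X Y quasi_iso_chain[OF f]] f X Y by (simp add: quasi_iso_iff)

subsection \<open>Shifts\<close>

lemma shift_simps [simp]:
  "(shift_complex n X)$i = X$(i + n)"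
  "diff (shift_complex n X) i x = (if even n then diff X (i + n) x
                   else \<ominus>\<^bsub>X$(i + n + 1)\<^esub> diff X (i + n) x)"
  by (simp_all add: shift_complex_def)

lemma shift_complex_complex:
  assumes X: "is_complex R X"
  shows "is_complex R (shift_complex n X)"
  unfolding is_complex_def
proof (intro allI conjI ballI)
  fix i
  have mX: "module R (X$i)" for i using X by (auto intro: cx_module)
  show "module R ((shift_complex n X)$i)" using mX by simp
  interpret X1: module R "X$(i + n + 1)" by (rule mX)
  interpret X2: module R "X$(i + n + 2)" by (rule mX)
  have e: "i + 1 + n = i + n + 1" "i + 2 + n = i + n + 2" "i + n + 1 + 1 = i + n + 2" by simp_all
  have d: "diff X (i + n) \<in> mod_hom R (X$(i + n)) (X$(i + n + 1))"
    by (rule cx_diff[OF X]) simp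
  have d2: "diff X (i + n + 1) \<in> mod_hom R (X$(i + n + 1)) (X$(i + n + 2))"
    by (rule cx_diff[OF X]) simp
  show "diff (shift_complex n X) i \<in> mod_hom R ((shift_complex n X)$i) ((shift_complex n X)$(i + 1))"
    using d mod_hom_uminus[OF X1.module_axioms d] mod_hom_cong[OF mX d] mod_hom_cong[OF mX mod_hom_uminus[OF X1.module_axioms d]]
    by (cases "even n") (simp_all add: e)
  fix x assume "x \<in> (shift_complex n X)$$i"
  then have x: "x \<in> X$$(i + n)" by simp
  have "diff X (i + n + 1) (diff X (i + n) x) = \<zero>\<^bsub>X$(i + n + 2)\<^esub>"
    by (rule cx_dd[OF X _ _ x]) simp_all
  then show "diff (shift_complex n X) (i + 1) (diff (shift_complex n X) i x) = \<zero>\<^bsub>(shift_complex n X)$(i + 2)\<^esub>"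
    using mod_hom_closed[OF d x] mod_hom_minus[OF mX mX d2] by (simp add: e)
qed

lemma shift_cocycles:
  assumes X: "is_complex R X"
  shows "cocycles (shift_complex n X) i = cocycles X (i + n)"
proof -
  interpret X1: module R "X$(i + n + 1)" by (rule cx_module) fact
  have e: "i + 1 + n = i + n + 1" by simp
  have "\<ominus>\<^bsub>X$(i + n + 1)\<^esub> diff X (i + n) x = \<zero>\<^bsub>X$(i + n + 1)\<^esub> \<longleftrightarrow>
    diff X (i + n) x = \<zero>\<^bsub>X$(i + n + 1)\<^esub>" if "x \<in> X$$(i + n)" for x
    using cx_diff_closed[OF X refl that] by (metis X1.minus_minus X1.module_minus_zero)
  then show ?thesis by (auto simp: cocycles_def e)
qed

lemma shift_coboundaries:
  assumes X: "is_complex R X"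
  shows "coboundaries (shift_complex n X) i = coboundaries X (i + n)"
proof -
  interpret X1: module R "X$(i + n)" by (rule cx_module) fact
  have e: "i - 1 + n = i + n - 1" "i + n - 1 + 1 = i + n" by simp_all
  have "(\<lambda>x. \<ominus>\<^bsub>X$(i + n)\<^esub> diff X (i + n - 1) x) ` X$$(i + n - 1) = coboundaries X (i + n)"
    (is "?L = _")
  proof
    show "?L \<subseteq> coboundaries X (i + n)" using cob_minus[OF X] by (auto simp: coboundaries_def)
    show "coboundaries X (i + n) \<subseteq> ?L"
    proof
      fix x assume x: "x \<in> coboundaries X (i + n)"
      obtain y where y: "y \<in> X$$(i + n - 1)" "\<ominus>\<^bsub>X$(i + n)\<^esub> x = diff X (i + n - 1) y"
        using cob_minus[OF X x] by (auto elim: cobE)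
      then have "x = \<ominus>\<^bsub>X$(i + n)\<^esub> diff X (i + n - 1) y"
        using cob_carrier[OF X x] by (metis X1.minus_minus)
      then show "x \<in> ?L" using y by blast
    qed
  qed
  then show ?thesis unfolding coboundaries_def[of "shift_complex n X"] by (cases "even n") (simp_all add: e coboundaries_def)
qed

lemma shift_exact_at: "is_complex R X ==> exact_at (shift_complex n X) i \<longleftrightarrow> exact_at X (i + n)"
  by (simp add: exact_at_def shift_cocycles shift_coboundaries)

lemma shift_chain:
  assumes X: "is_complex R X" "is_complex R Y" and f: "f \<in> chain_maps R X Y"
  shows "shift_map n f \<in> chain_maps R (shift_complex n X) (shift_complex n Y)"
  unfolding chain_maps_def
proof (intro CollectI allI conjI ballI)
  fix i
  show "shift_map n f i \<in> mod_hom R ((shift_complex n X)$i) ((shift_complex n Y)$i)"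
    using chain_hom[OF f] by (simp add: shift_map_def)
  have e: "i + 1 + n = i + n + 1" by simp
  fix x assume "x \<in> (shift_complex n X)$$i"
  then have x: "x \<in> X$$(i + n)" by simp
  show "shift_map n f (i + 1) (diff (shift_complex n X) i x) = diff (shift_complex n Y) i (shift_map n f i x)"
    using chain_diff[OF f refl x] mod_hom_minus[OF cx_module[OF X(1)] cx_module[OF X(2)] chain_hom[OF f] cx_diff_closed[OF X(1) refl x]]
    by (simp add: shift_map_def e)
qed

lemma shift_quasi_iso:
  assumes X: "is_complex R X" "is_complex R Y" and f: "quasi_iso R X Y f"
  shows "quasi_iso R (shift_complex n X) (shift_complex n Y) (shift_map n f)"
  using shift_chain[OF X quasi_iso_chain[OF f]] f X
  by (simp add: quasi_iso_iff shift_complex_complex coh_inj_def coh_surj_def shift_cocycles shift_coboundaries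
      shift_map_def)

subsection \<open>Lifting\<close>

text \<open>The counterpart of \<open>bounded_fg_projective\<close> with dual bases, meaningful for
  elements of any type and in particular for truncated resolutions over
  \<open>nat => 'a\<close>.\<close>

definition fp_complex :: "('a, 'b) ring_scheme => ('a, 'm) cochain_complex => bool" where
  "fp_complex R P \<longleftrightarrow> is_complex R P \<and> (\<forall>i. fg_proj R (P$i)) \<and>
     (\<exists>a b. \<forall>i. i < a \<or> b < i --> P$$i = {\<zero>\<^bsub>P$i\<^esub>})"

lemma null_homotopic_acyclic:
  assumes P: "fp_complex R P" and C: "is_complex R C" and g: "g \<in> chain_maps R P C" and ex: "\<And>i. exact_at C i"
  shows "null_homotopic R P C g"
proof -
  obtain b where top: "\<And>i. b < i ==> P$$i = {\<zero>\<^bsub>P$i\<^esub>}"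
    and P': "is_complex R P" and pr: "\<And>i. fg_proj R (P$i)"
    using P by (auto simp: fp_complex_def)
  \<comment> \<open>\<open>P\<close> vanishes in degree \<open>b + 1\<close>, so the descent can
    start there for an arbitrary chain map \<open>g\<close>.\<close>
  have "g (b + 1) x \<in> coboundaries C (b + 1)" if "x \<in> P$$(b + 1)" for x
    using that top[of "b + 1"] mod_hom_zero[OF cx_module[OF P'] cx_module[OF C] chain_hom[OF g]] cob_zero[OF C]
    by simp
  then show ?thesis using null_homotopicI[OF P' C pr _ g, of "b + 1"] top ex by auto
qed

lemma fst_mod_hom: "f \<in> mod_hom R P (direct_sum M N) ==> (\<lambda>x. fst (f x)) \<in> mod_hom R P M"
  and snd_mod_hom: "f \<in> mod_hom R P (direct_sum M N) ==> (\<lambda>x. snd (f x)) \<in> mod_hom R P N"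
proof -
  assume f: "f \<in> mod_hom R P (direct_sum M N)"
  have c: "fst (f x) \<in> carrier M" "snd (f x) \<in> carrier N" if "x \<in> carrier P" for x
    using mod_hom_closed[OF f that] by (auto simp: mem_Times_iff)
  have e: "add (direct_sum M N) p q = (fst p \<oplus>\<^bsub>M\<^esub> fst q, snd p \<oplus>\<^bsub>N\<^esub> snd q)"
    "smult (direct_sum M N) r p = (r \<odot>\<^bsub>M\<^esub> fst p, r \<odot>\<^bsub>N\<^esub> snd p)" for p q r
    by (cases p; cases q; simp)+
  show "(\<lambda>x. fst (f x)) \<in> mod_hom R P M" "(\<lambda>x. snd (f x)) \<in> mod_hom R P N"
    using c by (auto intro!: mod_homI simp: mod_hom_add[OF f] mod_hom_smult[OF f] e)
qed

lemma pair_mod_hom: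
  "f \<in> mod_hom R P M ==> g \<in> mod_hom R P N ==> (\<lambda>x. (f x, g x)) \<in> mod_hom R P (direct_sum M N)"
  by (intro mod_homI) (auto simp: mod_hom_add mod_hom_smult mod_hom_closed)

text \<open>A null homotopy of the composite of \<open>g\<close> with the inclusion of \<open>B\<close> into the acyclic cone of
  \<open>q\<close> consists of a lift of \<open>g\<close> and a homotopy.\<close>

lemma lift_quasi_iso:
  assumes P: "fp_complex R P" and W: "is_complex R W" and B: "is_complex R B"
    and q: "quasi_iso R W B q" and g: "g \<in> chain_maps R P B"
  shows "\<exists>a\<in>chain_maps R P W. chain_homotopic R P B g (chain_comp q a)"
proof -
  have P': "is_complex R P" using P by (simp add: fp_complex_def)
  note qc = quasi_iso_chain[OF q]
  define G where "G = (\<lambda>i x. (\<zero>\<^bsub>W$(i + 1)\<^esub>, g i x))"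
  have mW: "module R (W$i)" and mB: "module R (B$i)" and mP: "module R (P$i)" for i
    using W B P' by (auto intro: cx_module)
  have "G \<in> chain_maps R P (cone W B q)"
    unfolding chain_maps_def
  proof (intro CollectI allI conjI ballI)
    fix i
    show "G i \<in> mod_hom R (P$i) ((cone W B q)$i)"
      unfolding G_def cone_simps by (rule pair_mod_hom[OF mod_hom_const_zero[OF mW] chain_hom[OF g]])
    fix x assume x: "x \<in> P$$i"
    interpret W2: module R "W$(i + 2)" by (rule mW)
    interpret B1: module R "B$(i + 1)" by (rule mB)
    have "diff W (i + 1) \<zero>\<^bsub>W$(i + 1)\<^esub> = \<zero>\<^bsub>W$(i + 2)\<^esub>"
      by (rule mod_hom_zero[OF mW mW cx_diff[OF W]]) simp
    moreover have "q (i + 1) \<zero>\<^bsub>W$(i + 1)\<^esub> = \<zero>\<^bsub>B$(i + 1)\<^esub>"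
      by (rule mod_hom_zero[OF mW mB chain_hom[OF qc]])
    moreover have "diff B i (g i x) \<in> B$$(i + 1)"
      by (rule cx_diff_closed[OF B refl chain_closed[OF g x]])
    ultimately show "G (i + 1) (diff P i x) = diff (cone W B q) i (G i x)"
      using chain_diff[OF g refl x] by (simp add: G_def add.assoc)
  qed
  then have "null_homotopic R P (cone W B q) G"
    by (rule null_homotopic_acyclic[OF P cone_complex[OF W B qc] _ quasi_iso_cone_exact[OF W B q]])
  then obtain s where sh: "\<And>i. s i \<in> mod_hom R (P$i) ((cone W B q)$(i - 1))"
    and s: "\<And>i x. x \<in> P$$i ==>
      G i x = diff (cone W B q) (i - 1) (s i x) \<oplus>\<^bsub>(cone W B q)$i\<^esub> s (i + 1) (diff P i x)"
    unfolding null_homotopic_def by blast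
  define a where "a i x = fst (s i x)" for i x
  define b where "b i x = snd (s i x)" for i x
  have sh': "s i \<in> mod_hom R (P$i) (direct_sum (W$i) (B$(i - 1)))" for i
    using sh[of i] by simp
  have ah: "a i \<in> mod_hom R (P$i) (W$i)"
    and bh: "b i \<in> mod_hom R (P$i) (B$(i - 1))" for i
    using fst_mod_hom[OF sh'] snd_mod_hom[OF sh'] unfolding a_def b_def by blast+
  have sab: "s i x = (a i x, b i x)" for i x by (simp add: a_def b_def)
  have key: "diff W i (a i x) = a (i + 1) (diff P i x)"
    "g i x = q i (a i x) \<oplus>\<^bsub>B$i\<^esub> (diff B (i - 1) (b i x) \<oplus>\<^bsub>B$i\<^esub> b (i + 1) (diff P i x))"
    if x: "x \<in> P$$i" for i x
  proof -
    interpret W1: module R "W$(i + 1)" by (rule mW)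
    interpret B0: module R "B$i" by (rule mB)
    have e: "i - 1 + 1 = i" "i - 1 + 2 = i + 1" by simp_all
    have dx: "diff P i x \<in> P$$(i + 1)" by (rule cx_diff_closed[OF P' refl x])
    have c: "diff W i (a i x) \<in> W$$(i + 1)" "a (i + 1) (diff P i x) \<in> W$$(i + 1)"
      "q i (a i x) \<in> B$$i" "diff B (i - 1) (b i x) \<in> B$$i"
      "b (i + 1) (diff P i x) \<in> B$$i"
      using cx_diff_closed[OF W refl mod_hom_closed[OF ah x]] mod_hom_closed[OF ah dx]
        chain_closed[OF qc mod_hom_closed[OF ah x]] cx_diff_closed[OF B _ mod_hom_closed[OF bh x], of i]
        mod_hom_closed[OF bh dx] by simp_all
    have "\<zero>\<^bsub>W$(i + 1)\<^esub> = \<ominus>\<^bsub>W$(i + 1)\<^esub> diff W i (a i x) \<oplus>\<^bsub>W$(i + 1)\<^esub> a (i + 1) (diff P i x)"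
      "g i x = q i (a i x) \<oplus>\<^bsub>B$i\<^esub> diff B (i - 1) (b i x) \<oplus>\<^bsub>B$i\<^esub> b (i + 1) (diff P i x)"
      using s[OF x] by (simp_all add: sab G_def e)
    then show "diff W i (a i x) = a (i + 1) (diff P i x)"
      "g i x = q i (a i x) \<oplus>\<^bsub>B$i\<^esub> (diff B (i - 1) (b i x) \<oplus>\<^bsub>B$i\<^esub> b (i + 1) (diff P i x))"
      using c by (metis W1.minus_minus W1.a_inv_closed W1.minus_equality W1.a_comm, simp add: B0.a_assoc)
  qed
  have "a \<in> chain_maps R P W" using ah key(1) by (simp add: chain_maps_def)
  moreover have "chain_homotopic R P B g (chain_comp q a)"
    unfolding chain_homotopic_def using bh key(2) by (intro exI[of _ b]) (simp add: chain_comp_def)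
  ultimately show ?thesis by blast
qed

text \<open>Injectivity of Hom(P, X) \<rightarrow> Hom(P, Y) up to homotopy. A homotopy
  \<open>h\<close> for \<open>j g\<close> is the same as a chain map \<open>(g, - h)\<close> into
  the cone shifted by -1. That complex is acyclic, so the map is null-homotopic, and the first
  component of a null homotopy is one for \<open>g\<close>.\<close>

lemma null_homotopic_reflect:
  assumes P: "fp_complex R P" and X: "is_complex R X" and Y: "is_complex R Y"
    and j: "quasi_iso R X Y j" and g: "g \<in> chain_maps R P X"
    and null: "null_homotopic R P Y (chain_comp j g)"
  shows "null_homotopic R P X g"
proof -
  have P': "is_complex R P" using P by (simp add: fp_complex_def)
  note jc = quasi_iso_chain[OF j]
  have mX: "module R (X$i)" and mY: "module R (Y$i)" and mP: "module R (P$i)" for i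
    using X Y P' by (auto intro: cx_module)
  obtain h where hh: "\<And>i. h i \<in> mod_hom R (P$i) (Y$(i - 1))"
    and h: "\<And>i x. x \<in> P$$i ==>
      j i (g i x) = diff Y (i - 1) (h i x) \<oplus>\<^bsub>Y$i\<^esub> h (i + 1) (diff P i x)"
    using null by (auto simp: null_homotopic_def chain_comp_def)
  define C where "C = shift_complex (-1) (cone X Y j)"
  have C: "is_complex R C" unfolding C_def by (rule shift_complex_complex[OF cone_complex[OF X Y jc]])
  have exC: "exact_at C i" for i
    unfolding C_def shift_exact_at[OF cone_complex[OF X Y jc]] by (rule quasi_iso_cone_exact[OF X Y j])
  have C_at: "C$i = direct_sum (X$i) (Y$(i - 1))" for i
    by (simp add: C_def)
  have C_diff: "diff C i (x, y) = (diff X i x,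
      \<ominus>\<^bsub>Y$i\<^esub> (j i x \<oplus>\<^bsub>Y$i\<^esub> diff Y (i - 1) y))"
    if x: "x \<in> X$$i" and y: "y \<in> Y$$(i - 1)" for i x y
  proof -
    interpret X1: module R "X$(i + 1)" by (rule mX)
    interpret Y0: module R "Y$i" by (rule mY)
    have e: "i - 1 + 1 = i" "i - 1 + 2 = i + 1" "i + -1 = i - 1" by simp_all
    have c: "diff X i x \<in> X$$(i + 1)" "j i x \<in> Y$$i"
      "diff Y (i - 1) y \<in> Y$$i"
      using cx_diff_closed[OF X refl x] chain_closed[OF jc x] cx_diff_closed[OF Y _ y, of i] by simp_all
    then show ?thesis
      by (simp add: C_def e direct_sum_a_inv[OF mX mY])
  qed
  define G where "G = (\<lambda>i x. (g i x, \<ominus>\<^bsub>Y$(i - 1)\<^esub> h i x))"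
  have "G \<in> chain_maps R P C"
    unfolding chain_maps_def
  proof (intro CollectI allI conjI ballI)
    fix i
    show "G i \<in> mod_hom R (P$i) (C$i)"
      unfolding G_def C_at by (rule pair_mod_hom[OF chain_hom[OF g] mod_hom_uminus[OF mY hh]])
    fix x assume x: "x \<in> P$$i"
    interpret Y0: module R "Y$i" by (rule mY)
    interpret Y1: module R "Y$(i - 1)" by (rule mY)
    have dx: "diff P i x \<in> P$$(i + 1)" by (rule cx_diff_closed[OF P' refl x])
    have hx: "h i x \<in> Y$$(i - 1)" by (rule mod_hom_closed[OF hh x])
    have c: "diff Y (i - 1) (h i x) \<in> Y$$i" "h (i + 1) (diff P i x) \<in> Y$$i"
      using cx_diff_closed[OF Y _ hx, of i] mod_hom_closed[OF hh dx] by simp_all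
    have "diff Y (i - 1) (\<ominus>\<^bsub>Y$(i - 1)\<^esub> h i x) = \<ominus>\<^bsub>Y$i\<^esub> diff Y (i - 1) (h i x)"
      by (rule mod_hom_minus[OF mY mY cx_diff[OF Y] hx]) simp
    then show "G (i + 1) (diff P i x) = diff C i (G i x)"
      using chain_diff[OF g refl x] c hx h[OF x] chain_closed[OF g x]
      by (simp add: G_def C_diff Y0.minus_add Y0.a_ac Y0.r_neg1 Y0.r_neg2)
  qed
  then have "null_homotopic R P C G" by (rule null_homotopic_acyclic[OF P C _ exC])
  then obtain s where sh: "\<And>i. s i \<in> mod_hom R (P$i) (C$(i - 1))"
    and s: "\<And>i x. x \<in> P$$i ==>
      G i x = diff C (i - 1) (s i x) \<oplus>\<^bsub>C$i\<^esub> s (i + 1) (diff P i x)"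
    unfolding null_homotopic_def by blast
  have ah: "(\<lambda>x. fst (s i x)) \<in> mod_hom R (P$i) (X$(i - 1))" for i
    by (rule fst_mod_hom) (use sh[of i] C_at in simp)
  have "g i x = diff X (i - 1) (fst (s i x)) \<oplus>\<^bsub>X$i\<^esub> fst (s (i + 1) (diff P i x))"
    if x: "x \<in> P$$i" for i x
  proof -
    obtain u v where uv: "s i x = (u, v)" by (cases "s i x")
    obtain u' v' where uv': "s (i + 1) (diff P i x) = (u', v')" by (cases "s (i + 1) (diff P i x)")
    have "u \<in> X$$(i - 1)" "v \<in> Y$$(i - 1 - 1)"
      using mod_hom_closed[OF sh x] by (simp_all add: uv C_at)
    then have "G i x = (diff X (i - 1) u \<oplus>\<^bsub>X$i\<^esub> u',
       \<ominus>\<^bsub>Y$(i - 1)\<^esub> (j (i - 1) u \<oplus>\<^bsub>Y$(i - 1)\<^esub> diff Y (i - 1 - 1) v) \<oplus>\<^bsub>Y$(i - 1)\<^esub> v')"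
      using s[OF x] C_diff[of u "i - 1" v] by (simp add: uv uv' C_at)
    then show ?thesis by (simp add: G_def uv uv')
  qed
  then show ?thesis unfolding null_homotopic_def using ah by (intro exI[of _ "\<lambda>i x. fst (s i x)"]) blast
qed

text \<open>\<open>Q\<close> is lifted through one leg of the roof between \<open>X\<close> and
  \<open>Y\<close> and then composed with the other leg. \<open>Q\<close> may have elements of
  another type than \<open>X\<close> and \<open>Y\<close>, which is used for truncated
  resolutions.\<close>

lemma cover_transfer:
  fixes X Y :: "('a, 'm) cochain_complex"
  assumes Q: "fp_complex R Q" and X: "is_complex R X" and Y: "is_complex R Y"
    and q: "quasi_iso R Q X q" and XY: "quasi_isomorphic R X Y"
  shows "\<exists>q'. quasi_iso R Q Y q'"
proof -
  obtain W :: "('a, 'm) cochain_complex" and s t where W: "is_complex R W" and s: "quasi_iso R W X s" and t: "quasi_iso R W Y t"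
    using XY by (auto simp: quasi_isomorphic_def)
  have Q': "is_complex R Q" using Q by (simp add: fp_complex_def)
  obtain a where a: "a \<in> chain_maps R Q W" and h: "chain_homotopic R Q X q (chain_comp s a)"
    using lift_quasi_iso[OF Q W X s quasi_iso_chain[OF q]] by auto
  have "quasi_iso R Q X (chain_comp s a)"
    using quasi_iso_homotopic[OF X Q' quasi_iso_chain[OF q] chain_comp_maps[OF a quasi_iso_chain[OF s]] h] q by blast
  then have "quasi_iso R Q W a" by (rule quasi_iso_cancel_left[OF Q' W X a s])
  then have "quasi_iso R Q Y (chain_comp t a)" using quasi_iso_comp[OF Q' W Y] t by blast
  then show ?thesis by blast
qed

lemma quasi_isomorphic_sym: "quasi_isomorphic R X Y ==> quasi_isomorphic R Y X"
  by (auto simp: quasi_isomorphic_def)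

section \<open>The derived category\<close>

lemma chain_homotopic_refl:
  assumes X: "is_complex R X" and Y: "is_complex R Y" and f: "f \<in> chain_maps R X Y"
  shows "chain_homotopic R X Y f f"
  unfolding chain_homotopic_def
proof (intro exI[of _ "\<lambda>i x. \<zero>\<^bsub>Y$(i - 1)\<^esub>"] conjI allI ballI)
  fix i
  show "(\<lambda>x. \<zero>\<^bsub>Y$(i - 1)\<^esub>) \<in> mod_hom R (X$i) (Y$(i - 1))"
    by (rule mod_hom_const_zero[OF cx_module[OF Y]])
  fix x assume x: "x \<in> X$$i"
  interpret Y: module R "Y$i" by (rule cx_module) fact
  have "diff Y (i - 1) \<zero>\<^bsub>Y$(i - 1)\<^esub> = \<zero>\<^bsub>Y$i\<^esub>"
    by (rule mod_hom_zero[OF cx_module[OF Y] cx_module[OF Y] cx_diff[OF Y]]) simp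
  then show "f i x = f i x \<oplus>\<^bsub>Y$i\<^esub> (diff Y (i - 1) \<zero>\<^bsub>Y$(i - 1)\<^esub> \<oplus>\<^bsub>Y$i\<^esub>
      \<zero>\<^bsub>Y$(i + 1 - 1)\<^esub>)"
    using chain_closed[OF f x] by simp
qed

lemma chain_comp_id [simp]: "chain_comp f (\<lambda>_. id) = f" "chain_comp (\<lambda>_. id) f = f"
  by (simp_all add: chain_comp_def fun_eq_iff)

lemma roofD:
  assumes "r \<in> roofs R X Y"
  shows "is_complex R (apex r)" "quasi_iso R (apex r) X (left_leg r)" "right_leg r \<in> chain_maps R (apex r) Y"
    "left_leg r \<in> chain_maps R (apex r) X"
  using assms by (auto simp: roofs_def quasi_iso_chain)

lemma roof_rel_refl:
  fixes X Y :: "('a, 'm) cochain_complex"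
  assumes X: "is_complex R X" and Y: "is_complex R Y" and r: "r \<in> roofs R X Y"
  shows "(r, r) \<in> roof_rel R X Y"
  unfolding roof_rel_def
  using r roofD[OF r] chain_homotopic_refl[OF roofD(1)[OF r] X roofD(4)[OF r]]
    chain_homotopic_refl[OF roofD(1)[OF r] Y roofD(3)[OF r]]
  by (auto intro!: exI[of _ "apex r"] exI[of _ "\<lambda>_. id"] simp: chain_id)

lemma coh_pre_quasi_iso:
  assumes X: "is_complex R W" "is_complex R X" "is_complex R Y"
    and a: "quasi_iso R W X a" and f: "f \<in> chain_maps R X Y"
  shows "coh_inj W Y (chain_comp f a) i \<longleftrightarrow> coh_inj X Y f i"
    "coh_surj W Y (chain_comp f a) i \<longleftrightarrow> coh_surj X Y f i"
proof -
  note ac = quasi_iso_chain[OF a]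
  have ai: "coh_inj W X a i" and as: "coh_surj W X a i" using a X by (auto simp: quasi_iso_iff)
  show "coh_inj W Y (chain_comp f a) i \<longleftrightarrow> coh_inj X Y f i"
    using coh_inj_comp[OF X(1,2) ac ai] coh_inj_compD2[OF X ac f _ as] by blast
  show "coh_surj W Y (chain_comp f a) i \<longleftrightarrow> coh_surj X Y f i"
    using coh_surj_comp[OF X ac f as] coh_surj_compD[OF X(1,2) ac] by blast
qed

text \<open>The dominating complex maps to both apexes by quasi-isomorphisms, hence the effect of
  the right leg on cohomology is an invariant of the class of the roof.\<close>

lemma roof_rel_coh:
  fixes X Y :: "('a, 'm) cochain_complex"
  assumes X: "is_complex R X" and Y: "is_complex R Y" and rr: "(r, r') \<in> roof_rel R X Y"
  shows "coh_inj (apex r) Y (right_leg r) i \<longleftrightarrow> coh_inj (apex r') Y (right_leg r') i"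
    "coh_surj (apex r) Y (right_leg r) i \<longleftrightarrow> coh_surj (apex r') Y (right_leg r') i"
proof -
  obtain W :: "('a, 'm) cochain_complex" and a b where r: "r \<in> roofs R X Y" and r': "r' \<in> roofs R X Y"
    and W: "is_complex R W" and a: "a \<in> chain_maps R W (apex r)" and b: "b \<in> chain_maps R W (apex r')"
    and q: "quasi_iso R W X (chain_comp (left_leg r) a)"
    and h1: "chain_homotopic R W X (chain_comp (left_leg r) a) (chain_comp (left_leg r') b)"
    and h2: "chain_homotopic R W Y (chain_comp (right_leg r) a) (chain_comp (right_leg r') b)"
    using rr unfolding roof_rel_def by auto
  note d = roofD[OF r] and d' = roofD[OF r']
  have qa: "quasi_iso R W (apex r) a" by (rule quasi_iso_cancel_left[OF W d(1) X a d(2) q])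
  have "quasi_iso R W X (chain_comp (left_leg r') b)"
    using q quasi_iso_homotopic[OF X W chain_comp_maps[OF a d(4)] chain_comp_maps[OF b d'(4)] h1] by blast
  then have qb: "quasi_iso R W (apex r') b" by (rule quasi_iso_cancel_left[OF W d'(1) X b d'(2)])
  note c = chain_comp_maps[OF a d(3)] chain_comp_maps[OF b d'(3)]
  show "coh_inj (apex r) Y (right_leg r) i \<longleftrightarrow> coh_inj (apex r') Y (right_leg r') i"
    using coh_pre_quasi_iso(1)[OF W d(1) Y qa d(3)] coh_pre_quasi_iso(1)[OF W d'(1) Y qb d'(3)]
      coh_inj_homotopic[OF Y W c h2] by blast
  show "coh_surj (apex r) Y (right_leg r) i \<longleftrightarrow> coh_surj (apex r') Y (right_leg r') i"
    using coh_pre_quasi_iso(2)[OF W d(1) Y qa d(3)] coh_pre_quasi_iso(2)[OF W d'(1) Y qb d'(3)]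
      coh_surj_homotopic[OF Y W c h2] by blast
qed

text \<open>If G after F is the identity, then F is injective and G surjective on cohomology. The
  composite consists of the roofs equivalent to one obtained from some choice of representatives and
  of a square, so that the identity roof singles out particular \<open>r\<close> and
  \<open>r'\<close>.\<close>

lemma derived_comp_ident:
  fixes X Y :: "('a, 'm) cochain_complex"
  assumes X: "is_complex R X" and Y: "is_complex R Y" and F: "F \<in> derived_hom R X Y" and G: "G \<in> derived_hom R Y X"
    and c: "derived_comp R X Y X G F = derived_of_chain R X X (\<lambda>_. id)"
  shows "\<exists>r\<in>F. \<exists>r'\<in>G. \<forall>i. coh_inj (apex r) Y (right_leg r) i \<and> coh_surj (apex r') X (right_leg r') i"
proof -
  have Fr: "r \<in> roofs R X Y" if "r \<in> F" for r using F that by (auto simp: derived_hom_def quotient_def roof_rel_def)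
  have Gr: "r \<in> roofs R Y X" if "r \<in> G" for r using G that by (auto simp: derived_hom_def quotient_def roof_rel_def)
  define e :: "('a, 'm) roof" where "e = \<lparr>apex = X, left_leg = (\<lambda>_. id), right_leg = (\<lambda>_. id)\<rparr>"
  have e: "e \<in> roofs R X X" using X by (simp add: e_def roofs_def quasi_iso_id chain_id)
  have "e \<in> derived_of_chain R X X (\<lambda>_. id)"
    using roof_rel_refl[OF X X e] by (simp add: derived_of_chain_def e_def)
  then have "e \<in> derived_comp R X Y X G F" using c by simp
  then obtain r r' W t u where r: "r \<in> F" and r': "r' \<in> G" and W: "is_complex R W"
    and t: "quasi_iso R W (apex r) t" and u: "u \<in> chain_maps R W (apex r')"
    and h: "chain_homotopic R W Y (chain_comp (right_leg r) t) (chain_comp (left_leg r') u)"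
    and ce: "(\<lparr>apex = W, left_leg = chain_comp (left_leg r) t, right_leg = chain_comp (right_leg r') u\<rparr>, e)
      \<in> roof_rel R X X"
    unfolding derived_comp_def by blast
  note d = roofD[OF Fr[OF r]] and d' = roofD[OF Gr[OF r']] and tc = quasi_iso_chain[OF t]
  have "coh_inj X X (\<lambda>_. id) i \<and> coh_surj X X (\<lambda>_. id) i" for i
    using quasi_iso_id[OF X] X by (simp add: quasi_iso_iff)
  then have ru: "coh_inj W X (chain_comp (right_leg r') u) i" "coh_surj W X (chain_comp (right_leg r') u) i" for i
    using roof_rel_coh[OF X X ce] by (auto simp: e_def)
  have s': "coh_surj (apex r') X (right_leg r') i" for i by (rule coh_surj_compD[OF W d'(1) u ru(2)])
  have "coh_inj W (apex r') u i" for i by (rule coh_inj_compD[OF u d'(3) ru(1)])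
  then have "coh_inj W Y (chain_comp (left_leg r') u) i" for i
    using coh_inj_comp[OF W d'(1) u, where Z = Y and g = "left_leg r'"] d'(1,2) Y by (simp add: quasi_iso_iff)
  then have "coh_inj W Y (chain_comp (right_leg r) t) i" for i
    using coh_inj_homotopic[OF Y W chain_comp_maps[OF tc d(3)] chain_comp_maps[OF u d'(4)] h] by blast
  then have "coh_inj (apex r) Y (right_leg r) i" for i
    using coh_pre_quasi_iso(1)[OF W d(1) Y t d(3)] by blast
  then show ?thesis using r r' s' by blast
qed

text \<open>The two equations of an isomorphism may yield different roofs \<open>r\<close> and
  \<open>r'\<close> of the class \<open>F\<close>, one injective and one surjective on cohomology;
  both properties are moved to the single representative \<open>r0\<close>.\<close>

lemma derived_iso_quasi_isomorphic:
  fixes X Y :: "('a, 'm) cochain_complex"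
  assumes X: "is_complex R X" and Y: "is_complex R Y" and F: "iso_mor (derived_base R) X Y F"
  shows "quasi_isomorphic R X Y"
proof -
  obtain G where FX: "F \<in> derived_hom R X Y" and GX: "G \<in> derived_hom R Y X"
    and c1: "derived_comp R X Y X G F = derived_of_chain R X X (\<lambda>_. id)"
    and c2: "derived_comp R Y X Y F G = derived_of_chain R Y Y (\<lambda>_. id)"
    using F by (auto simp: iso_mor_def derived_base_def)
  obtain r where r: "r \<in> F" "\<And>i. coh_inj (apex r) Y (right_leg r) i"
    using derived_comp_ident[OF X Y FX GX c1] by blast
  obtain r' where r': "r' \<in> F" "\<And>i. coh_surj (apex r') Y (right_leg r') i"
    using derived_comp_ident[OF Y X GX FX c2] by blast
  obtain r0 where r0: "F = roof_rel R X Y `` {r0}" using FX by (auto simp: derived_hom_def quotient_def)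
  have rel: "(r0, r) \<in> roof_rel R X Y" "(r0, r') \<in> roof_rel R X Y" using r(1) r'(1) r0 by auto
  then have rr: "r0 \<in> roofs R X Y" by (auto simp: roof_rel_def)
  note d = roofD[OF rr]
  have "quasi_iso R (apex r0) Y (right_leg r0)"
    using roof_rel_coh(1)[OF X Y rel(1)] roof_rel_coh(2)[OF X Y rel(2)] r(2) r'(2) d Y
    by (simp add: quasi_iso_iff)
  then show ?thesis using d unfolding quasi_isomorphic_def by blast
qed

text \<open>The chain level content of a vanishing Hom set. A roof equivalent to the zero roof is
  dominated together with it by some \<open>W\<close>; the left legs force \<open>W\<close> to be
  quasi-isomorphic to the apex, and the right legs give the homotopy.\<close>

lemma derived_hom_zero_null:
  fixes X Y :: "('a, 'm) cochain_complex"
  assumes X: "is_complex R X" and Y: "is_complex R Y" and z: "derived_hom R X Y = {derived_zero R X Y}"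
    and r: "r \<in> roofs R X Y"
  shows "\<exists>(W :: ('a, 'm) cochain_complex) b. is_complex R W \<and> quasi_iso R W (apex r) b \<and>
     null_homotopic R W Y (chain_comp (right_leg r) b)"
proof -
  define e :: "('a, 'm) roof" where
    "e = \<lparr>apex = X, left_leg = (\<lambda>_. id), right_leg = (\<lambda>i x. \<zero>\<^bsub>Y$i\<^esub>)\<rparr>"
  have "roof_rel R X Y `` {r} \<in> derived_hom R X Y" using r by (auto simp: derived_hom_def quotient_def)
  then have "roof_rel R X Y `` {r} = roof_rel R X Y `` {e}"
    using z by (simp add: derived_zero_def derived_of_chain_def e_def)
  then have "(e, r) \<in> roof_rel R X Y" using roof_rel_refl[OF X Y r] by auto
  then obtain W :: "('a, 'm) cochain_complex" and a b where e: "e \<in> roofs R X Y"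
    and W: "is_complex R W" and a: "a \<in> chain_maps R W X" and b: "b \<in> chain_maps R W (apex r)"
    and q: "quasi_iso R W X a"
    and h1: "chain_homotopic R W X a (chain_comp (left_leg r) b)"
    and h2: "chain_homotopic R W Y (chain_comp (right_leg e) a) (chain_comp (right_leg r) b)"
    unfolding roof_rel_def by (auto simp: e_def)
  note d = roofD[OF r]
  note c = chain_comp_maps[OF b d(4)] chain_comp_maps[OF b d(3)]
  have "quasi_iso R W X (chain_comp (left_leg r) b)" using q quasi_iso_homotopic[OF X W a c(1) h1] by blast
  then have qb: "quasi_iso R W (apex r) b" by (rule quasi_iso_cancel_left[OF W d(1) X b d(2)])
  have "null_homotopic R W Y (\<lambda>i x. chain_comp (right_leg e) a i x \<ominus>\<^bsub>Y$i\<^esub> chain_comp (right_leg r) b i x)"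
    using chain_homotopic_null[OF Y W _ c(2) h2] chain_comp_maps[OF a, of "right_leg e" Y] roofD(3)[OF e]
    by (simp add: e_def)
  then obtain s where sh: "\<And>i. s i \<in> mod_hom R (W$i) (Y$(i - 1))"
    and s: "\<And>i x. x \<in> W$$i ==>
      \<zero>\<^bsub>Y$i\<^esub> \<ominus>\<^bsub>Y$i\<^esub> chain_comp (right_leg r) b i x =
      diff Y (i - 1) (s i x) \<oplus>\<^bsub>Y$i\<^esub> s (i + 1) (diff W i x)"
    unfolding null_homotopic_def by (auto simp: e_def chain_comp_def)
  have mY: "module R (Y$i)" for i by (rule cx_module[OF Y])
  \<comment> \<open>The homotopy at hand belongs to zero minus the right leg, hence the
    sign.\<close>
  have "null_homotopic R W Y (chain_comp (right_leg r) b)"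
    unfolding null_homotopic_def
  proof (intro exI[of _ "\<lambda>i x. \<ominus>\<^bsub>Y$(i - 1)\<^esub> s i x"] conjI allI ballI)
    fix i
    show "(\<lambda>x. \<ominus>\<^bsub>Y$(i - 1)\<^esub> s i x) \<in> mod_hom R (W$i) (Y$(i - 1))"
      by (rule mod_hom_uminus[OF mY sh])
    fix x assume x: "x \<in> W$$i"
    interpret Y0: module R "Y$i" by (rule mY)
    have sx: "s i x \<in> Y$$(i - 1)" by (rule mod_hom_closed[OF sh x])
    have c': "chain_comp (right_leg r) b i x \<in> Y$$i" by (rule chain_closed[OF c(2) x])
    have c'': "diff Y (i - 1) (s i x) \<in> Y$$i" "s (i + 1) (diff W i x) \<in> Y$$i"
      using cx_diff_closed[OF Y _ sx, of i] mod_hom_closed[OF sh[of "i + 1"] cx_diff_closed[OF W refl x]] by simp_all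
    have "\<ominus>\<^bsub>Y$i\<^esub> chain_comp (right_leg r) b i x =
      diff Y (i - 1) (s i x) \<oplus>\<^bsub>Y$i\<^esub> s (i + 1) (diff W i x)"
      using s[OF x] c' by (simp add: a_minus_def)
    then have "chain_comp (right_leg r) b i x =
      \<ominus>\<^bsub>Y$i\<^esub> (diff Y (i - 1) (s i x) \<oplus>\<^bsub>Y$i\<^esub> s (i + 1) (diff W i x))"
      using c' by (metis Y0.minus_minus)
    moreover have "diff Y (i - 1) (\<ominus>\<^bsub>Y$(i - 1)\<^esub> s i x) = \<ominus>\<^bsub>Y$i\<^esub> diff Y (i - 1) (s i x)"
      by (rule mod_hom_minus[OF mY mY cx_diff[OF Y] sx]) simp
    ultimately show "chain_comp (right_leg r) b i x = diff Y (i - 1) (\<ominus>\<^bsub>Y$(i - 1)\<^esub> s i x)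
      \<oplus>\<^bsub>Y$i\<^esub> \<ominus>\<^bsub>Y$(i + 1 - 1)\<^esub> s (i + 1) (diff W i x)"
      using c'' by (simp add: Y0.minus_add)
  qed
  then show ?thesis using W qb by blast
qed

lemma exact_at_quasi_iso:
  assumes X: "is_complex R X" "is_complex R Y" and f: "quasi_iso R X Y f"
  shows "exact_at X i \<longleftrightarrow> exact_at Y i"
proof -
  note fc = quasi_iso_chain[OF f]
  have fi: "coh_inj X Y f i" and fs: "coh_surj X Y f i" using f X by (auto simp: quasi_iso_iff)
  show ?thesis
  proof
    assume "exact_at X i"
    show "exact_at Y i"
      unfolding exact_at_def
    proof
      fix y assume y: "y \<in> cocycles Y i"
      then obtain x where x: "x \<in> cocycles X i" "y \<ominus>\<^bsub>Y$i\<^esub> f i x \<in> coboundaries Y i"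
        using fs by (auto simp: coh_surj_def)
      then have "f i x \<in> coboundaries Y i" using \<open>exact_at X i\<close> chain_cob[OF fc] by (auto simp: exact_at_def)
      then show "y \<in> coboundaries Y i"
        using cob_cong[OF X(2) cocycles_carrier[OF y] chain_closed[OF fc cocycles_carrier[OF x(1)]] x(2)] by blast
    qed
  next
    assume "exact_at Y i"
    then show "exact_at X i" using fi chain_cocycles[OF X fc] by (auto simp: exact_at_def coh_inj_def)
  qed
qed

lemma exact_at_quasi_isomorphic:
  assumes "is_complex R X" "is_complex R Y" and "quasi_isomorphic R X Y"
  shows "exact_at X i \<longleftrightarrow> exact_at Y i"
  using assms unfolding quasi_isomorphic_def by (metis exact_at_quasi_iso)

lemma null_homotopic_comp:
  assumes W: "is_complex R W" and f: "null_homotopic R X Y f" and a: "a \<in> chain_maps R W X"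
  shows "null_homotopic R W Y (chain_comp f a)"
proof -
  obtain s where s: "\<And>i. s i \<in> mod_hom R (X$i) (Y$(i - 1))"
    "\<And>i x. x \<in> X$$i ==>
             f i x = diff Y (i - 1) (s i x) \<oplus>\<^bsub>Y$i\<^esub> s (i + 1) (diff X i x)"
    using f by (auto simp: null_homotopic_def)
  show ?thesis
    unfolding null_homotopic_def
    using mod_hom_comp[OF chain_hom[OF a] s(1)] s(2)[OF chain_closed[OF a]] chain_diff[OF a refl]
    by (intro exI[of _ "\<lambda>i x. s i (a i x)"]) (simp add: chain_comp_def)
qed

text \<open>\<open>F\<close> is homotopic to \<open>F e\<close>, hence to zero, with
  \<open>t\<close> plus \<open>F s\<close> as homotopy. With \<open>e\<close> a lift followed by a
  quasi-isomorphism, this removes the detour through another complex.\<close>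

lemma null_homotopic_retract:
  assumes X: "is_complex R X" and Y: "is_complex R Y" and F: "F \<in> chain_maps R X Y"
    and e: "e \<in> chain_maps R X X" and h: "chain_homotopic R X X (\<lambda>_. id) e"
    and n: "null_homotopic R X Y (chain_comp F e)"
  shows "null_homotopic R X Y F"
proof -
  have mY: "module R (Y$i)" and mX: "module R (X$i)" for i using X Y by (auto intro: cx_module)
  obtain s where sh: "\<And>i. s i \<in> mod_hom R (X$i) (X$(i - 1))"
    and s: "\<And>i x. x \<in> X$$i ==>
       x = e i x \<oplus>\<^bsub>X$i\<^esub> (diff X (i - 1) (s i x) \<oplus>\<^bsub>X$i\<^esub> s (i + 1) (diff X i x))"
    using h by (auto simp: chain_homotopic_def)
  obtain t where th: "\<And>i. t i \<in> mod_hom R (X$i) (Y$(i - 1))"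
    and t: "\<And>i x. x \<in> X$$i ==>
        F i (e i x) = diff Y (i - 1) (t i x) \<oplus>\<^bsub>Y$i\<^esub> t (i + 1) (diff X i x)"
    using n by (auto simp: null_homotopic_def chain_comp_def)
  note Fh = chain_hom[OF F]
  show ?thesis
    unfolding null_homotopic_def
  proof (intro exI[of _ "\<lambda>i x. t i x \<oplus>\<^bsub>Y$(i - 1)\<^esub> F (i - 1) (s i x)"] conjI allI ballI)
    fix i
    show "(\<lambda>x. t i x \<oplus>\<^bsub>Y$(i - 1)\<^esub> F (i - 1) (s i x)) \<in> mod_hom R (X$i) (Y$(i - 1))"
      by (rule mod_hom_plus[OF mY th mod_hom_comp[OF sh Fh]])
    fix x assume x: "x \<in> X$$i"
    interpret Y0: module R "Y$i" by (rule mY)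
    interpret X0: module R "X$i" by (rule mX)
    have dx: "diff X i x \<in> X$$(i + 1)" by (rule cx_diff_closed[OF X refl x])
    have sx: "s i x \<in> X$$(i - 1)" and sdx: "s (i + 1) (diff X i x) \<in> X$$i"
      using mod_hom_closed[OF sh x] mod_hom_closed[OF sh dx] by simp_all
    have dsx: "diff X (i - 1) (s i x) \<in> X$$i" using cx_diff_closed[OF X _ sx, of i] by simp
    have tx: "t i x \<in> Y$$(i - 1)" and tdx: "t (i + 1) (diff X i x) \<in> Y$$i"
      using mod_hom_closed[OF th x] mod_hom_closed[OF th dx] by simp_all
    have dtx: "diff Y (i - 1) (t i x) \<in> Y$$i" using cx_diff_closed[OF Y _ tx, of i] by simp
    have Fsx: "F (i - 1) (s i x) \<in> Y$$(i - 1)" by (rule chain_closed[OF F sx])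
    have Fdsx: "diff Y (i - 1) (F (i - 1) (s i x)) \<in> Y$$i" using cx_diff_closed[OF Y _ Fsx, of i] by simp
    have "F i x = F i (e i x) \<oplus>\<^bsub>Y$i\<^esub> (F i (diff X (i - 1) (s i x)) \<oplus>\<^bsub>Y$i\<^esub> F i (s (i + 1) (diff X i x)))"
      using chain_closed[OF e x] dsx sdx by (subst s[OF x]) (simp add: mod_hom_add[OF Fh])
    also have "F i (diff X (i - 1) (s i x)) = diff Y (i - 1) (F (i - 1) (s i x))"
      using chain_diff[OF F _ sx, of i] by simp
    finally have 1: "F i x = (diff Y (i - 1) (t i x) \<oplus>\<^bsub>Y$i\<^esub> t (i + 1) (diff X i x)) \<oplus>\<^bsub>Y$i\<^esub>
        (diff Y (i - 1) (F (i - 1) (s i x)) \<oplus>\<^bsub>Y$i\<^esub> F i (s (i + 1) (diff X i x)))"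
      using t[OF x] by simp
    have 2: "diff Y (i - 1) (t i x \<oplus>\<^bsub>Y$(i - 1)\<^esub> F (i - 1) (s i x)) =
      diff Y (i - 1) (t i x) \<oplus>\<^bsub>Y$i\<^esub> diff Y (i - 1) (F (i - 1) (s i x))"
      using mod_hom_add[OF cx_diff[OF Y] tx Fsx, of i] by simp
    show "F i x = diff Y (i - 1) (t i x \<oplus>\<^bsub>Y$(i - 1)\<^esub> F (i - 1) (s i x)) \<oplus>\<^bsub>Y$i\<^esub>
      (t (i + 1) (diff X i x) \<oplus>\<^bsub>Y$(i + 1 - 1)\<^esub> F (i + 1 - 1) (s (i + 1) (diff X i x)))"
      using dtx tdx Fdsx chain_closed[OF F sdx] by (simp add: 1 2 Y0.a_ac)
  qed
qed

subsection \<open>Stalk complexes\<close>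

text \<open>Away from degree \<open>c\<close> only the carrier of \<open>M\<close> shrinks, while
  its operations stay. This makes a shift of a stalk complex equal to a stalk complex and not just
  isomorphic to one.\<close>

definition stalk :: "('a, 'm) module => int => ('a, 'm) cochain_complex" where
  "stalk M c = \<lparr>module_at = (\<lambda>i. if i = c then M else M\<lparr>carrier := {\<zero>\<^bsub>M\<^esub>}\<rparr>), diff = (\<lambda>_ _. \<zero>\<^bsub>M\<^esub>)\<rparr>"

lemma stalk_simps [simp]:
  "(stalk M c)$i = (if i = c then M else M\<lparr>carrier := {\<zero>\<^bsub>M\<^esub>}\<rparr>)"
  "diff (stalk M c) = (\<lambda>_ _. \<zero>\<^bsub>M\<^esub>)"
  by (simp_all add: stalk_def)

lemma module_zero_sub:
  assumes "module R M"
  shows "module R (M\<lparr>carrier := {\<zero>\<^bsub>M\<^esub>}\<rparr>)"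
proof -
  interpret module R M by fact
  have "submodule {\<zero>\<^bsub>M\<^esub>} R M" by (rule submoduleI) auto
  then show ?thesis using assms by (rule submodule.submodule_is_module)
qed

lemma stalk_complex: "module R M ==> is_complex R (stalk M c)"
proof -
  assume M: "module R M"
  interpret module R M by fact
  show ?thesis
    unfolding is_complex_def
    using M module_zero_sub[OF M] by (auto intro!: mod_homI)
qed

lemma stalk_cocycles: "module R M ==> cocycles (stalk M c) i = (if i = c then carrier M else {\<zero>\<^bsub>M\<^esub>})"
  by (auto simp: cocycles_def)

lemma stalk_coboundaries: "module R M ==> coboundaries (stalk M c) i = {\<zero>\<^bsub>M\<^esub>}"
proof -
  assume "module R M"
  interpret module R M by fact
  show ?thesis by (auto simp: coboundaries_def)
qed

lemma shift_stalk:
  assumes "module R M"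
  shows "shift_complex n (stalk M c) = stalk M (c - n)"
proof -
  interpret M: module R M by fact
  interpret Z: module R "M\<lparr>carrier := {\<zero>\<^bsub>M\<^esub>}\<rparr>" by (rule module_zero_sub) fact
  have [simp]: "\<ominus>\<^bsub>M\<lparr>carrier := {\<zero>\<^bsub>M\<^esub>}\<rparr>\<^esub> \<zero>\<^bsub>M\<^esub> = \<zero>\<^bsub>M\<^esub>" using Z.module_minus_zero by simp
  have "i + n = c \<longleftrightarrow> i = c - n" for i by auto
  then show ?thesis by (simp add: shift_complex_def stalk_def fun_eq_iff)
qed

lemma fg_proj_zero:
  assumes M: "module R M" and z: "carrier M = {\<zero>\<^bsub>M\<^esub>}"
  shows "fg_proj R M"
proof -
  interpret M: module R M by fact
  have "dual_basis R M 0 e \<phi>" for e \<phi> using z by (simp add: dual_basis_def)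
  then show ?thesis using M unfolding fg_proj_def by blast
qed

lemma fp_stalk: "fg_proj R M ==> fp_complex R (stalk M c)"
  by (auto simp: fp_complex_def stalk_complex fg_proj_module intro!: exI[of _ c] fg_proj_zero module_zero_sub)

lemma chain_to_stalk:
  assumes X: "is_complex R X" and M: "module R M" and f: "f \<in> mod_hom R (X$c) M"
    and fd: "\<And>x. x \<in> X$$(c - 1) ==> f (diff X (c - 1) x) = \<zero>\<^bsub>M\<^esub>"
  shows "(\<lambda>i x. if i = c then f x else \<zero>\<^bsub>M\<^esub>) \<in> chain_maps R X (stalk M c)"
proof -
  have "(\<lambda>x. \<zero>\<^bsub>M\<^esub>) \<in> mod_hom R (X$i) (M\<lparr>carrier := {\<zero>\<^bsub>M\<^esub>}\<rparr>)" for i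
    using mod_hom_const_zero[OF module_zero_sub[OF M]] by simp
  moreover have "f (diff X i x) = \<zero>\<^bsub>M\<^esub>" if "i + 1 = c" "x \<in> X$$i" for i x
    using fd that by (metis add_diff_cancel_right')
  ultimately show ?thesis using f by (auto simp: chain_maps_def)
qed

text \<open>Represents the cohomology class of \<open>z\<close> by a morphism: for a copy of the
  ring with coordinate \<open>\<kappa>\<close>, the generator goes to \<open>z\<close>.\<close>

lemma chain_from_stalk:
  assumes Y: "is_complex R Y" and M: "module R M" and k: "\<kappa> \<in> mod_hom R M (ring_mod R)" and z: "z \<in> cocycles Y c"
  shows "(\<lambda>i x. if i = c then \<kappa> x \<odot>\<^bsub>Y$c\<^esub> z else \<zero>\<^bsub>Y$i\<^esub>) \<in> chain_maps R (stalk M c) Y"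
proof -
  interpret M: module R M by fact
  have mY: "module R (Y$i)" for i by (rule cx_module[OF Y])
  interpret Y0: module R "Y$c" by (rule mY)
  interpret Y1: module R "Y$(c + 1)" by (rule mY)
  have zc: "z \<in> Y$$c" and dz: "diff Y c z = \<zero>\<^bsub>Y$(c + 1)\<^esub>"
    using z by (auto simp: cocycles_def)
  have kc: "\<kappa> x \<in> carrier R" if "x \<in> carrier M" for x using mod_hom_closed[OF k that] by simp
  have k0: "\<kappa> \<zero>\<^bsub>M\<^esub> = \<zero>\<^bsub>R\<^esub>" using mod_hom_zero[OF M module_ring_mod[OF M.R.cring_axioms] k] by simp
  have 1: "(\<lambda>x. \<kappa> x \<odot>\<^bsub>Y$c\<^esub> z) \<in> mod_hom R M (Y$c)"
    using zc by (intro mod_homI) (auto simp: kc mod_hom_add[OF k] mod_hom_smult[OF k] Y0.smult_l_distr Y0.smult_assoc1)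
  have 3: "diff Y i \<zero>\<^bsub>Y$i\<^esub> = \<zero>\<^bsub>Y$(i + 1)\<^esub>" for i
    by (rule mod_hom_zero[OF mY mY cx_diff[OF Y refl]])
  show ?thesis
    using 1 3 zc dz k0 mod_hom_smult[OF cx_diff[OF Y refl], of _ z c] kc
    by (auto simp: chain_maps_def intro: mod_hom_const_zero[OF mY])
qed

text \<open>For odd \<open>n\<close> the differential comes back with two signs, which cancel on
  carriers only; hence a quasi-isomorphism in place of an equality.\<close>

lemma unshift_quasi_iso:
  assumes Y: "is_complex R Y"
  shows "quasi_iso R (shift_complex (-n) (shift_complex n Y)) Y (\<lambda>_. id)"
proof -
  let ?S = "shift_complex (-n) (shift_complex n Y)"
  have S: "is_complex R ?S" by (intro shift_complex_complex Y)
  have "diff ?S i x = diff Y i x" if "x \<in> Y$$i" for i x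
  proof -
    interpret Y: module R "Y$(i + 1)" by (rule cx_module) fact
    show ?thesis using cx_diff_closed[OF Y refl that] by simp
  qed
  then have "(\<lambda>_. id) \<in> chain_maps R ?S Y" by (simp add: chain_maps_def mod_hom_id)
  moreover have e: "cocycles ?S i = cocycles Y i" "coboundaries ?S i = coboundaries Y i" for i
    using shift_cocycles[OF shift_complex_complex[OF Y], of "-n" n] shift_coboundaries[OF shift_complex_complex[OF Y], of "-n" n]
      shift_cocycles[OF Y, of n] shift_coboundaries[OF Y, of n] by simp_all
  ultimately show ?thesis
    using quasi_iso_id[OF Y]
    by (simp add: quasi_iso_iff[OF S Y] quasi_iso_iff[OF Y Y] coh_inj_def coh_surj_def e)
qed

lemma stalk_unshift:
  assumes M: "module R M" and Y: "is_complex R Y" and q: "quasi_iso R (stalk M c) (shift_complex n Y) q"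
  shows "\<exists>q. quasi_iso R (stalk M (c + n)) Y q"
  using quasi_iso_comp[OF _ _ Y shift_quasi_iso[OF stalk_complex[OF M] shift_complex_complex[OF Y] q, of "-n"]
      unshift_quasi_iso[OF Y, of n]] M Y
  by (auto simp: shift_stalk stalk_complex shift_complex_complex)

lemma fp_shift:
  assumes "fp_complex R Q"
  shows "fp_complex R (shift_complex n Q)"
proof -
  obtain a b where ab: "\<And>i. i < a \<or> b < i ==> Q$$i = {\<zero>\<^bsub>Q$i\<^esub>}"
    using assms unfolding fp_complex_def by blast
  have "\<forall>i. i < a - n \<or> b - n < i --> Q$$(i + n) = {\<zero>\<^bsub>Q$(i + n)\<^esub>}"
    by (intro allI impI ab) auto
  then show ?thesis using assms by (auto simp: fp_complex_def shift_complex_complex)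
qed

section \<open>Perfect complexes\<close>

locale module_universe =
  fixes R :: "('a, 'b) ring_scheme" and \<iota> :: "'a => 'm"
  assumes R: "cring R" and infinite_universe: "infinite (UNIV :: 'm set)" and inj_\<iota>: "inj_on \<iota> (carrier R)"
begin

text \<open>An infinite type has an injective pairing. A vector is encoded by the pair of the code
  of its initial part and the image of its last coordinate under \<open>\<iota>\<close>.\<close>

lemma vec_mod_embeds: "\<exists>j :: (nat => 'a) => 'm. inj_on j (vecs R n)"
proof (induction n)
  case 0
  have "vecs R 0 = {\<lambda>_. \<zero>\<^bsub>R\<^esub>}" by (auto simp: vec_mod_carrier)
  then show ?case by (intro exI[of _ "\<lambda>_. undefined"]) simp
next
  case (Suc n)
  then obtain j :: "(nat => 'a) => 'm" where j: "inj_on j (vecs R n)" by blast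
  obtain p :: "'m \<times> 'm => 'm" where "bij_betw p (UNIV \<times> UNIV) UNIV"
    using card_of_Times_same_infinite[OF infinite_universe] card_of_ordIso by blast
  then have p: "inj p" by (simp add: bij_betw_def)
  have "inj_on (\<lambda>v. p (j (v(n := \<zero>\<^bsub>R\<^esub>)), \<iota> (v n))) (vecs R (Suc n))"
  proof (rule inj_onI)
    fix v w assume v: "v \<in> vecs R (Suc n)" and w: "w \<in> vecs R (Suc n)"
      and eq: "p (j (v(n := \<zero>\<^bsub>R\<^esub>)), \<iota> (v n)) = p (j (w(n := \<zero>\<^bsub>R\<^esub>)), \<iota> (w n))"
    have vw: "v(n := \<zero>\<^bsub>R\<^esub>) \<in> vecs R n" "w(n := \<zero>\<^bsub>R\<^esub>) \<in> vecs R n"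
      using v w by (auto simp: vec_mod_carrier)
    have e: "j (v(n := \<zero>\<^bsub>R\<^esub>)) = j (w(n := \<zero>\<^bsub>R\<^esub>))" "\<iota> (v n) = \<iota> (w n)" using injD[OF p eq] by auto
    have "v(n := \<zero>\<^bsub>R\<^esub>) = w(n := \<zero>\<^bsub>R\<^esub>)" using inj_onD[OF j e(1) vw] .
    moreover have "v n = w n" using inj_onD[OF inj_\<iota> e(2)] vec_mod_coord[OF R v] vec_mod_coord[OF R w] by blast
    ultimately show "v = w" by (metis fun_upd_triv fun_upd_upd)
  qed
  then show ?case by blast
qed

definition vec_embed :: "nat => (nat => 'a) => 'm" where
  "vec_embed n = (SOME j. inj_on j (vecs R n))"

lemma inj_vec_embed: "inj_on (vec_embed n) (vecs R n)"
  unfolding vec_embed_def using vec_mod_embeds by (rule someI_ex)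

definition fvec :: "nat => ('a, 'm) module" where
  "fvec n = copy_mod (vec_embed n) (vec R n)"

definition vec_coord :: "nat => 'm => nat => 'a" where
  "vec_coord n = inv_into (vecs R n) (vec_embed n)"

lemma fvec: "module R (fvec n)" "vec_embed n \<in> mod_hom R (vec R n) (fvec n)"
    "vec_coord n \<in> mod_hom R (fvec n) (vec R n)"
    "\<And>v. v \<in> vecs R n ==> vec_coord n (vec_embed n v) = v"
    "\<And>x. x \<in> carrier (fvec n) ==> vec_embed n (vec_coord n x) = x"
  unfolding fvec_def vec_coord_def using copy_mod_hom[OF module_vec_mod[OF R] inj_vec_embed]
  by (auto simp: inj_vec_embed f_inv_into_f)

lemma fg_proj_fvec: "fg_proj R (fvec n)"
  by (rule fg_proj_retract[where f = "vec_embed n" and g = "vec_coord n", OF fg_proj_vec_mod[OF R] fvec(1,2,3,5)])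

text \<open>The identity of \<open>P\<close> is lifted along a surjection from the free module
  \<open>fvec n\<close>. Since \<open>fvec n\<close> lies in the same universe as \<open>P\<close>,
  the definition of projectivity applies, and \<open>P\<close> becomes a retract of a free
  module.\<close>

lemma fg_proj_of_projective:
  fixes P :: "('a, 'm) module"
  assumes fg: "finitely_generated_module R P" and pr: "projective_module R P"
  shows "fg_proj R P"
proof -
  have P: "module R P" using pr by (simp add: projective_module_def)
  interpret P: module R P by fact
  obtain S where S: "S \<subseteq> carrier P" "finite S" "\<And>H. submodule H R P ==> S \<subseteq> H ==> H = carrier P"
    using fg by (auto simp: finitely_generated_module_def)
  obtain n and y :: "nat => 'm" where y: "S = y ` {..<n}"
    using finite_imp_nat_seg_image_inj_on[OF S(2)] by (auto simp: lessThan_def)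
  obtain h where h: "h \<in> mod_hom R (vec R n) P" and hy: "\<And>i. i < n ==> h (unit_vec R i) = y i"
    using vec_hom_exists[OF R P, of n y] S(1) y by auto
  interpret V: module R "vec R n" by (rule module_vec_mod[OF R])
  have "submodule (h ` vecs R n) R P"
  proof (rule P.submoduleI)
    show "h ` vecs R n \<subseteq> carrier P" using mod_hom_closed[OF h] by auto
    show "\<zero>\<^bsub>P\<^esub> \<in> h ` vecs R n"
      using mod_hom_zero[OF V.module_axioms P h] V.zero_closed by (metis imageI)
  next
    fix a assume "a \<in> h ` vecs R n"
    then obtain v where "v \<in> vecs R n" "a = h v" by blast
    then show "\<ominus>\<^bsub>P\<^esub> a \<in> h ` vecs R n"
      using mod_hom_minus[OF V.module_axioms P h, of v] V.M.a_inv_closed[of v] by (metis imageI)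
  next
    fix a b assume "a \<in> h ` vecs R n" "b \<in> h ` vecs R n"
    then obtain v w where "v \<in> vecs R n" "w \<in> vecs R n" "a = h v" "b = h w" by blast
    then show "a \<oplus>\<^bsub>P\<^esub> b \<in> h ` vecs R n"
      using mod_hom_add[OF h, of v w] V.M.a_closed[of v w] by (metis imageI)
  next
    fix a x assume "a \<in> carrier R" "x \<in> h ` vecs R n"
    then obtain v where "v \<in> vecs R n" "x = h v" by blast
    then show "a \<odot>\<^bsub>P\<^esub> x \<in> h ` vecs R n"
      using mod_hom_smult[OF h, of a v] V.smult_closed[of a v] \<open>a \<in> carrier R\<close> by (metis imageI)
  qed
  moreover have "S \<subseteq> h ` vecs R n"
    using unit_vec_carrier[OF R] hy by (auto simp: y image_iff) metis
  ultimately have hs: "h ` vecs R n = carrier P" by (rule S(3))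
  have hc: "(\<lambda>x. h (vec_coord n x)) \<in> mod_hom R (fvec n) P" by (rule mod_hom_comp[OF fvec(3) h])
  have sur: "(\<lambda>x. h (vec_coord n x)) ` carrier (fvec n) = carrier P"
  proof
    show "(\<lambda>x. h (vec_coord n x)) ` carrier (fvec n) \<subseteq> carrier P" using mod_hom_closed[OF hc] by auto
    show "carrier P \<subseteq> (\<lambda>x. h (vec_coord n x)) ` carrier (fvec n)"
    proof
      fix x assume "x \<in> carrier P"
      then obtain v where v: "v \<in> vecs R n" "x = h v" using hs by auto
      then show "x \<in> (\<lambda>x. h (vec_coord n x)) ` carrier (fvec n)"
        using fvec(4)[OF v(1)] mod_hom_closed[OF fvec(2) v(1)] by (intro image_eqI[of _ _ "vec_embed n v"]) auto
    qed
  qed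
  have "\<exists>g\<in>mod_hom R P (fvec n). \<forall>x\<in>carrier P. h (vec_coord n (g x)) = id x"
    using pr fvec(1) P hc sur mod_hom_id unfolding projective_module_def by blast
  then obtain g where "g \<in> mod_hom R P (fvec n)" "\<And>x. x \<in> carrier P ==> h (vec_coord n (g x)) = x" by auto
  then show ?thesis using fg_proj_retract[OF fg_proj_fvec P hc] by blast
qed

end

lemma projective_of_fg_proj:
  assumes "fg_proj R P"
  shows "finitely_generated_module R P" "projective_module R P"
proof -
  have P: "module R P" using assms by (rule fg_proj_module)
  interpret P: module R P by fact
  obtain n e \<phi> where db: "dual_basis R P n e \<phi>" using assms by (auto simp: fg_proj_def)
  have e: "\<And>i. i < n ==> e i \<in> carrier P" and \<phi>: "\<And>i. i < n ==> \<phi> i \<in> mod_hom R P (ring_mod R)"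
    and x: "\<And>x. x \<in> carrier P ==> x = finsum P (\<lambda>i. \<phi> i x \<odot>\<^bsub>P\<^esub> e i) {..<n}"
    using db by (auto simp: dual_basis_def)
  have \<phi>c: "\<phi> i x \<in> carrier R" if "i < n" "x \<in> carrier P" for i x
    using mod_hom_closed[OF \<phi>] that by simp
  have "H = carrier P" if H: "submodule H R P" and eH: "e ` {..<n} \<subseteq> H" for H
  proof -
    note HE = P.submoduleE[OF H]
    have "x \<in> H" if "x \<in> carrier P" for x
    proof -
      have "finsum P (\<lambda>i. \<phi> i x \<odot>\<^bsub>P\<^esub> e i) {..<n} \<in> H"
      proof (rule finsum_closed_rel[where Q = "\<lambda>y. y \<in> H"])
        show "\<zero>\<^bsub>P\<^esub> \<in> H" using HE(2,3,5) P.r_neg HE(1) by (metis ex_in_conv subsetD)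
      qed (use P.abelian_monoid_axioms e \<phi>c that eH HE in auto)
      then show ?thesis by (simp only: x[OF that, symmetric])
    qed
    then show ?thesis using HE(1) by auto
  qed
  moreover have "e ` {..<n} \<subseteq> carrier P" using e by auto
  ultimately show "finitely_generated_module R P"
    unfolding finitely_generated_module_def by (intro exI[of _ "e ` {..<n}"]) auto
  show "projective_module R P"
    unfolding projective_module_def
  proof (intro conjI P allI impI)
    fix M N :: "('a, 'c) module" and g f
    assume *: "module R M \<and> module R N \<and> g \<in> mod_hom R M N \<and> g ` carrier M = carrier N \<and> f \<in> mod_hom R P N"
    then show "\<exists>h\<in>mod_hom R P M. \<forall>x\<in>carrier P. g (h x) = f x"
      using mod_hom_closed[of f R P N] by (intro fg_proj_lift[OF assms, of M N]) auto
  qed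
qed

context module_universe begin

lemma bounded_fg_projective_iff:
  fixes P :: "('a, 'm) cochain_complex"
  shows "bounded_fg_projective R P \<longleftrightarrow> fp_complex R P"
  unfolding bounded_fg_projective_def fp_complex_def
  using projective_of_fg_proj fg_proj_of_projective by blast

lemma perfect_cover:
  fixes X :: "('a, 'm) cochain_complex"
  assumes "perfect_complex R X"
  shows "\<exists>(Q :: ('a, 'm) cochain_complex) q. fp_complex R Q \<and> quasi_iso R Q X q"
proof -
  obtain Q :: "('a, 'm) cochain_complex" where X: "is_complex R X" and Q: "fp_complex R Q"
    and XQ: "quasi_isomorphic R X Q"
    using assms bounded_fg_projective_iff unfolding perfect_complex_def by blast
  have "is_complex R Q" using Q by (simp add: fp_complex_def)
  then show ?thesis
    using cover_transfer[OF Q _ X quasi_iso_id quasi_isomorphic_sym[OF XQ]] Q by blast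
qed

lemma fp_perfect:
  fixes Q :: "('a, 'm) cochain_complex"
  assumes "fp_complex R Q"
  shows "perfect_complex R Q"
proof -
  have "is_complex R Q" using assms by (simp add: fp_complex_def)
  then show ?thesis
    using assms quasi_iso_id bounded_fg_projective_iff unfolding perfect_complex_def quasi_isomorphic_def by blast
qed

end

lemma Perf_simps [simp]:
  "obj (Perf R) = {X. is_complex R X \<and> perfect_complex R X}"
  "hom_set (Perf R) = derived_hom R" "ident (Perf R) = (\<lambda>X. derived_of_chain R X X (\<lambda>_. id))"
  "comp_mor (Perf R) = derived_comp R" "zero_mor (Perf R) = derived_zero R" "shift (Perf R) = shift_complex"
  by (auto simp: Perf_def full_subcat_def derived_category_def derived_base_def)

lemma Perf_dist_tri: "dist_tri (Perf R) X Y Z f g h ==> derived_dist_tri R X Y Z f g h"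
  by (simp add: Perf_def full_subcat_def derived_category_def)

lemma Perf_isomorphic:
  assumes "isomorphic (Perf R) X Y" "is_complex R X" "is_complex R Y"
  shows "quasi_isomorphic R X Y"
proof -
  obtain f where "iso_mor (Perf R) X Y f" using assms(1) by (auto simp: isomorphic_def)
  then have "iso_mor (derived_base R) X Y f" by (simp add: iso_mor_def) (simp add: derived_base_def)
  then show ?thesis using derived_iso_quasi_isomorphic assms by blast
qed

section \<open>Consequences of a bounded t-structure\<close>

text \<open>Exactness of \<open>Hom(Q, R)\<close> in degree \<open>- s\<close>.\<close>

definition dual_exact :: "('a, 'b) ring_scheme => ('a, 'm) cochain_complex => int => bool" where
  "dual_exact R Q s \<longleftrightarrow> (\<forall>f\<in>mod_hom R (Q$s) (ring_mod R).
     (\<forall>x\<in>Q$$(s - 1). f (diff Q (s - 1) x) = \<zero>\<^bsub>R\<^esub>) -->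
     (\<exists>g\<in>mod_hom R (Q$(s + 1)) (ring_mod R). \<forall>x\<in>Q$$s. f x = g (diff Q s x)))"

locale perf_t_structure = module_universe R \<iota> for R :: "('a, 'b) ring_scheme" and \<iota> :: "'a => 'm" +
  fixes U V :: "('a, 'm) cochain_complex set"
  assumes bts: "bounded_t_structure (Perf R) U V"
begin

lemma UV_obj:
  "X \<in> U ==> is_complex R X" "X \<in> U ==> perfect_complex R X"
  "X \<in> V ==> is_complex R X" "X \<in> V ==> perfect_complex R X"
  using bts by (auto simp: bounded_t_structure_def t_structure_def strictly_full_def)

lemma translateD:
  assumes X: "X \<in> translate (Perf R) n S" and S: "S \<subseteq> {X. is_complex R X}"
  shows "is_complex R X" "perfect_complex R X" "\<exists>A\<in>S. quasi_isomorphic R X (shift_complex n A)"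
  using X S Perf_isomorphic[of R X] shift_complex_complex by (auto simp: translate_def) blast

text \<open>V \<subseteq> V[1], iterated: an object of V is a k-fold shift of another one for every
  k. So what holds for all of V in one degree spreads to all lower degrees.\<close>

lemma V_seq:
  assumes "Y \<in> V"
  shows "\<exists>y. y 0 = Y \<and> (\<forall>k::nat. y k \<in> V \<and> quasi_isomorphic R (y k) (shift_complex 1 (y (Suc k))))"
proof -
  have "V \<subseteq> translate (Perf R) 1 V" using bts by (auto simp: bounded_t_structure_def t_structure_def)
  then have st: "\<exists>Z\<in>V. quasi_isomorphic R X (shift_complex 1 Z)" if "X \<in> V" for X
    using that translateD(3)[of X 1 V] UV_obj(3) by blast
  have "\<exists>y. \<forall>k::nat. (y k \<in> V \<and> (k = 0 --> y k = Y)) \<and> quasi_isomorphic R (y k) (shift_complex 1 (y (Suc k)))"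
    by (rule dependent_nat_choice) (use assms st in auto)
  then show ?thesis by blast
qed

abbreviation rmod :: "('a, 'm) module" where "rmod \<equiv> fvec (Suc 0)"

lemma rmod_perfect: "stalk rmod 0 \<in> obj (Perf R)"
  using fp_perfect[OF fp_stalk[OF fg_proj_fvec]] stalk_complex[OF fvec(1)] by simp

text \<open>The isomorphisms that boundedness provides for the ring are replaced by
  quasi-isomorphisms out of a free stalk complex, which can be used as legs of roofs.\<close>

lemma stalk_from_U: "\<exists>A\<in>U. \<exists>m q. quasi_iso R (stalk rmod m) A q"
  and stalk_from_V: "\<exists>Y\<in>V. \<exists>m q. quasi_iso R (stalk rmod m) Y q"
proof -
  have *: "\<exists>A\<in>S. \<exists>m q. quasi_iso R (stalk rmod m) A q"
    if "stalk rmod 0 \<in> translate (Perf R) n S" and S: "S \<subseteq> {X. is_complex R X}" for n S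
  proof -
    note mem = that
    obtain A where A: "A \<in> S" "quasi_isomorphic R (stalk rmod 0) (shift_complex n A)"
      using translateD(3)[OF mem] by blast
    have A': "is_complex R A" using A S by blast
    obtain q where "quasi_iso R (stalk rmod 0) (shift_complex n A) q"
      using cover_transfer[OF fp_stalk[OF fg_proj_fvec] stalk_complex[OF fvec(1)] shift_complex_complex[OF A']
          quasi_iso_id[OF stalk_complex[OF fvec(1)]] A(2)] by blast
    then show ?thesis using stalk_unshift[OF fvec(1) A'] A(1) by blast
  qed
  obtain m n where "stalk rmod 0 \<in> translate (Perf R) (-m) U" "stalk rmod 0 \<in> translate (Perf R) (-n) V"
    using bts rmod_perfect unfolding bounded_t_structure_def by blast
  then show "\<exists>A\<in>U. \<exists>m q. quasi_iso R (stalk rmod m) A q" "\<exists>Y\<in>V. \<exists>m q. quasi_iso R (stalk rmod m) Y q"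
    using *[of "-m" U] *[of "-n" V] UV_obj by blast+
qed

lemma hom_zero:
  assumes "X \<in> U" "Y \<in> V"
  shows "derived_hom R (shift_complex 1 X) Y = {derived_zero R (shift_complex 1 X) Y}"
  using bts assms by (auto simp: bounded_t_structure_def t_structure_def)

definition ring_coord :: "'m => 'a" where "ring_coord x = vec_coord (Suc 0) x 0"
definition ring_embed :: "'a => 'm" where "ring_embed a = vec_embed (Suc 0) (\<lambda>i. if i = 0 then a else \<zero>\<^bsub>R\<^esub>)"

lemma ring_coord: "ring_coord \<in> mod_hom R rmod (ring_mod R)"
  using mod_hom_comp[OF fvec(3) coord_mod_hom[OF R]] unfolding ring_coord_def .

lemma ring_embed: "ring_embed \<in> mod_hom R (ring_mod R) rmod"
proof -
  interpret R: cring R by (rule R)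
  have "(\<lambda>a i. if i = 0 then a else \<zero>\<^bsub>R\<^esub>) \<in> mod_hom R (ring_mod R) (vec R (Suc 0))"
    by (rule mod_homI) (auto simp: vec_mod_carrier fun_eq_iff)
  from mod_hom_comp[OF this fvec(2)] show ?thesis unfolding ring_embed_def .
qed

lemma ring_coord_embed: "a \<in> carrier R ==> ring_coord (ring_embed a) = a"
proof -
  assume "a \<in> carrier R"
  then have "(\<lambda>i. if i = 0 then a else \<zero>\<^bsub>R\<^esub>) \<in> vecs R (Suc 0)" by (auto simp: vec_mod_carrier)
  from fvec(4)[OF this] show ?thesis by (simp add: ring_coord_def ring_embed_def)
qed

text \<open>If the ring sits in U in degree \<open>m\<close>, then orthogonality with its shift
  kills the maps from the ring in degree \<open>m - 1\<close> to objects of V, that is, their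
  cohomology in that degree. \<open>V_seq\<close> passes on to lower degrees.\<close>

lemma V_exact: "\<exists>l. \<forall>Y\<in>V. \<forall>i\<le>l. exact_at Y i"
proof -
  obtain A m p where A: "A \<in> U" and p: "quasi_iso R (stalk rmod m) A p" using stalk_from_U by blast
  have Ac: "is_complex R A" by (rule UV_obj(1)[OF A])
  have sc: "is_complex R (stalk rmod c)" for c by (rule stalk_complex[OF fvec(1)])
  \<comment> \<open>One less than \<open>m\<close>, because orthogonality speaks of the shift of
    \<open>A\<close>.\<close>
  define l where "l = m - 1"
  have p1: "quasi_iso R (stalk rmod l) (shift_complex 1 A) (shift_map 1 p)"
    using shift_quasi_iso[OF sc Ac p, of 1] by (simp add: shift_stalk[OF fvec(1)] l_def)
  interpret M: module R rmod by (rule fvec(1))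
  have ex: "exact_at Y l" if Y: "Y \<in> V" for Y
    unfolding exact_at_def
  proof
    fix z assume z: "z \<in> cocycles Y l"
    have Yc: "is_complex R Y" by (rule UV_obj(3)[OF Y])
    define f where "f = (\<lambda>i x. if i = l then ring_coord x \<odot>\<^bsub>Y$l\<^esub> z else \<zero>\<^bsub>Y$i\<^esub>)"
    have f: "f \<in> chain_maps R (stalk rmod l) Y"
      unfolding f_def by (rule chain_from_stalk[OF Yc fvec(1) ring_coord z])
    define r where "r = \<lparr>apex = stalk rmod l, left_leg = shift_map 1 p, right_leg = f\<rparr>"
    have "r \<in> roofs R (shift_complex 1 A) Y" using p1 f sc by (simp add: roofs_def r_def)
    from derived_hom_zero_null[OF shift_complex_complex[OF Ac] Yc hom_zero[OF A Y] this]
    obtain W :: "('a, 'm) cochain_complex" and b where W: "is_complex R W"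
      and b: "quasi_iso R W (stalk rmod l) b" and n: "null_homotopic R W Y (chain_comp f b)"
      by (auto simp: r_def)
    have one: "ring_embed \<one>\<^bsub>R\<^esub> \<in> carrier rmod" using mod_hom_closed[OF ring_embed] by simp
    then have "ring_embed \<one>\<^bsub>R\<^esub> \<in> cocycles (stalk rmod l) l" by (simp add: stalk_cocycles[OF fvec(1)])
    \<comment> \<open>The null homotopy is available on \<open>W\<close> only, so the generator is
      lifted to a cocycle of \<open>W\<close>. The lift is exact, as the stalk complex has no
      nonzero coboundaries.\<close>
    then obtain w where w: "w \<in> cocycles W l"
      and bw: "ring_embed \<one>\<^bsub>R\<^esub> \<ominus>\<^bsub>rmod\<^esub> b l w \<in> coboundaries (stalk rmod l) l"
      using b W sc by (force simp: quasi_iso_iff coh_surj_def)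
    have bc: "b l w \<in> carrier rmod" using chain_closed[OF quasi_iso_chain[OF b] cocycles_carrier[OF w]] by simp
    have "ring_embed \<one>\<^bsub>R\<^esub> \<ominus>\<^bsub>rmod\<^esub> b l w = \<zero>\<^bsub>rmod\<^esub>" using bw by (simp add: stalk_coboundaries[OF fvec(1)])
    then have "b l w = ring_embed \<one>\<^bsub>R\<^esub>"
      using one bc by (metis M.M.minus_equality a_minus_def M.M.minus_minus M.a_comm M.M.a_inv_closed)
    then have "chain_comp f b l w = z"
      using ring_coord_embed z cx_module[OF Yc, of l] by (simp add: chain_comp_def f_def cocycles_def module.smult_one)
    then show "z \<in> coboundaries Y l"
      using null_homotopic_cocycle[OF Yc W n w] by simp
  qed
  have "exact_at Y i" if Y: "Y \<in> V" and i: "i \<le> l" for Y i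
  proof -
    obtain y where y0: "y 0 = Y" and y: "\<And>k::nat. y k \<in> V" "\<And>k. quasi_isomorphic R (y k) (shift_complex 1 (y (Suc k)))"
      using V_seq[OF Y] by blast
    have yc: "is_complex R (y k)" for k by (rule UV_obj(3)[OF y(1)])
    have st: "exact_at (y k) i \<longleftrightarrow> exact_at (y (Suc k)) (i + 1)" for k i
      using exact_at_quasi_isomorphic[OF yc shift_complex_complex[OF yc] y(2)[of k]]
        shift_exact_at[OF yc[of "Suc k"], of 1] by simp
    have "exact_at (y 0) (l - int k) \<longleftrightarrow> exact_at (y k) l" for k
    proof (induction k arbitrary: l)
      case (Suc k)
      show ?case using Suc.IH[of "l - 1"] st[of k "l - 1"] by (simp add: diff_diff_eq add.commute)
    qed simp
    from this[of "nat (l - i)"] show ?thesis using ex[OF y(1)] i y0 by simp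
  qed
  then show ?thesis by blast
qed

text \<open>By iterating V \<subseteq> V[1], the ring placed in any degree \<ge> \<open>c\<close> is
  quasi-isomorphic to an object of V. Orthogonality then makes all maps from the shifted resolution
  of an object of U to such a copy of the ring null-homotopic; the null homotopy is the
  factorization through the differential.\<close>

lemma U_factor:
  "\<exists>s0. \<forall>X\<in>U. \<forall>(Q :: ('a, 'm) cochain_complex) q. fp_complex R Q --> quasi_iso R Q X q -->
     (\<forall>s\<ge>s0. dual_exact R Q s)"
proof -
  obtain Y c p where Y: "Y \<in> V" and p: "quasi_iso R (stalk rmod c) Y p" using stalk_from_V by blast
  obtain y where y0: "y 0 = Y" and y: "\<And>k::nat. y k \<in> V" "\<And>k. quasi_isomorphic R (y k) (shift_complex 1 (y (Suc k)))"
    using V_seq[OF Y] by blast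
  have yc: "is_complex R (y k)" for k by (rule UV_obj(3)[OF y(1)])
  have sc: "is_complex R (stalk rmod c)" for c by (rule stalk_complex[OF fvec(1)])
  have cov: "\<exists>j. quasi_iso R (stalk rmod (c + int k)) (y k) j" for k
  proof (induction k)
    case 0
    then show ?case using p y0 by auto
  next
    case (Suc k)
    then obtain j where "quasi_iso R (stalk rmod (c + int k)) (y k) j" by blast
    then obtain j' where "quasi_iso R (stalk rmod (c + int k)) (shift_complex 1 (y (Suc k))) j'"
      using cover_transfer[OF fp_stalk[OF fg_proj_fvec] yc shift_complex_complex[OF yc] _ y(2)] by blast
    from stalk_unshift[OF fvec(1) yc this] show ?case by (simp add: algebra_simps)
  qed
  interpret R: cring R by (rule R)
  interpret M: module R rmod by (rule fvec(1))
  have "\<exists>g\<in>mod_hom R (Q$(s + 1)) (ring_mod R). \<forall>x\<in>Q$$s. f x = g (diff Q s x)"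
    if X: "X \<in> U" and Q: "fp_complex R Q" and q: "quasi_iso R Q X q" and s: "c + 1 \<le> s"
      and f: "f \<in> mod_hom R (Q$s) (ring_mod R)"
      and fd: "\<And>x. x \<in> Q$$(s - 1) ==> f (diff Q (s - 1) x) = \<zero>\<^bsub>R\<^esub>"
    for X and Q :: "('a, 'm) cochain_complex" and q s f
  proof -
    have Xc: "is_complex R X" by (rule UV_obj(1)[OF X])
    have Qc: "is_complex R Q" using Q by (simp add: fp_complex_def)
    \<comment> \<open>The term of \<open>Q\<close> in degree \<open>s\<close> has degree
      \<open>s - 1\<close> in the shifted complex, so the copy of the ring is wanted in degree
      \<open>s - 1 = c + k\<close>.\<close>
    define k where "k = nat (s - 1 - c)"
    have ck: "c + int k = s - 1" using s by (simp add: k_def)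
    obtain j where j: "quasi_iso R (stalk rmod (s - 1)) (y k) j" using cov[of k] ck by auto
    note jc = quasi_iso_chain[OF j]
    define T where "T = shift_complex 1 Q"
    have T: "fp_complex R T" "is_complex R T" unfolding T_def by (rule fp_shift[OF Q] shift_complex_complex[OF Qc])+
    define F where "F = (\<lambda>i x. if i = s - 1 then ring_embed (f x) else \<zero>\<^bsub>rmod\<^esub>)"
    have F: "F \<in> chain_maps R T (stalk rmod (s - 1))"
      unfolding F_def
    proof (rule chain_to_stalk[OF T(2) fvec(1)])
      show "(\<lambda>x. ring_embed (f x)) \<in> mod_hom R (T$(s - 1)) rmod"
        using mod_hom_comp[OF f ring_embed] by (simp add: T_def)
      fix x assume "x \<in> T$$(s - 1 - 1)"
      then have x: "x \<in> Q$$(s - 1)" by (simp add: T_def)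
      have dx: "diff Q (s - 1) x \<in> Q$$s" using cx_diff_closed[OF Qc _ x, of s] by simp
      have "f (diff T (s - 1 - 1) x) = f (\<ominus>\<^bsub>Q$s\<^esub> diff Q (s - 1) x)" by (simp add: T_def)
      also have "\<dots> = \<zero>\<^bsub>R\<^esub>"
        using mod_hom_minus[OF cx_module[OF Qc] module_ring_mod[OF R] f dx] fd[OF x] by simp
      finally show "ring_embed (f (diff T (s - 1 - 1) x)) = \<zero>\<^bsub>rmod\<^esub>"
        using mod_hom_zero[OF module_ring_mod[OF R] fvec(1) ring_embed] by simp
    qed
    define r where "r = \<lparr>apex = T, left_leg = shift_map 1 q, right_leg = chain_comp j F\<rparr>"
    have jF: "chain_comp j F \<in> chain_maps R T (y k)" by (rule chain_comp_maps[OF F jc])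
    have "r \<in> roofs R (shift_complex 1 X) (y k)"
      using shift_quasi_iso[OF Qc Xc q, of 1] jF T(2) by (simp add: roofs_def r_def T_def)
    from derived_hom_zero_null[OF shift_complex_complex[OF Xc] yc hom_zero[OF X y(1)] this]
    obtain W :: "('a, 'm) cochain_complex" and b where W: "is_complex R W"
      and b: "quasi_iso R W T b" and n: "null_homotopic R W (y k) (chain_comp (chain_comp j F) b)"
      by (auto simp: r_def)
    note bc = quasi_iso_chain[OF b]
    \<comment> \<open>A section of \<open>b\<close> up to homotopy. It carries the null homotopy
      from \<open>W\<close> back to \<open>T\<close>.\<close>
    obtain a where a: "a \<in> chain_maps R T W" and h: "chain_homotopic R T T (\<lambda>_. id) (chain_comp b a)"
      using lift_quasi_iso[OF T(1) W T(2) b chain_id] by blast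
    have "null_homotopic R T (y k) (chain_comp (chain_comp j F) (chain_comp b a))"
      using null_homotopic_comp[OF T(2) n a] by (simp add: chain_comp_def comp_assoc)
    then have "null_homotopic R T (y k) (chain_comp j F)"
      by (rule null_homotopic_retract[OF T(2) yc jF chain_comp_maps[OF a bc] h])
    then have "null_homotopic R T (stalk rmod (s - 1)) F"
      by (rule null_homotopic_reflect[OF T(1) sc yc j F])
    then obtain t where th: "\<And>i. t i \<in> mod_hom R (T$i) ((stalk rmod (s - 1))$(i - 1))"
      and t: "\<And>i x. x \<in> T$$i ==>
        F i x = \<zero>\<^bsub>rmod\<^esub> \<oplus>\<^bsub>(stalk rmod (s - 1))$i\<^esub> t (i + 1) (diff T i x)"
      by (auto simp: null_homotopic_def)
    have ts: "t s \<in> mod_hom R (Q$(s + 1)) rmod" using th[of s] by (simp add: T_def)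
    \<comment> \<open>The sign compensates for that of the differential of the shifted complex
      \<open>T\<close>.\<close>
    define g where "g x = ring_coord (\<ominus>\<^bsub>rmod\<^esub> t s x)" for x
    have g: "g \<in> mod_hom R (Q$(s + 1)) (ring_mod R)"
      unfolding g_def by (rule mod_hom_comp[OF mod_hom_uminus[OF fvec(1) ts] ring_coord])
    have "f x = g (diff Q s x)" if x: "x \<in> Q$$s" for x
    proof -
      have dx: "diff Q s x \<in> Q$$(s + 1)" by (rule cx_diff_closed[OF Qc refl x])
      have "ring_embed (f x) = \<zero>\<^bsub>rmod\<^esub> \<oplus>\<^bsub>rmod\<^esub> t s (\<ominus>\<^bsub>Q$(s + 1)\<^esub> diff Q s x)"
        using t[of x "s - 1"] x by (simp add: F_def T_def)
      also have "\<dots> = \<ominus>\<^bsub>rmod\<^esub> t s (diff Q s x)"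
        using mod_hom_minus[OF cx_module[OF Qc] fvec(1) ts dx] mod_hom_closed[OF ts dx] by simp
      finally have "ring_coord (ring_embed (f x)) = g (diff Q s x)" by (simp add: g_def)
      then show ?thesis using ring_coord_embed mod_hom_closed[OF f x] by simp
    qed
    then show ?thesis using g by blast
  qed
  then show ?thesis unfolding dual_exact_def by (intro exI[of _ "c + 1"]) blast
qed

end

section \<open>Ideals and chains of primes in Noetherian rings\<close>

context cring begin

lemma idealD:
  assumes "ideal I R"
  shows "\<And>x. x \<in> I ==> x \<in> carrier R" "\<zero> \<in> I" "\<And>x y. x \<in> I ==> y \<in> I ==> x \<oplus> y \<in> I"
    "\<And>x. x \<in> I ==> \<ominus> x \<in> I" "\<And>x y. x \<in> I ==> y \<in> I ==> x \<ominus> y \<in> I"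
    "\<And>a x. a \<in> carrier R ==> x \<in> I ==> a \<otimes> x \<in> I"
    "\<And>a x. a \<in> carrier R ==> x \<in> I ==> x \<otimes> a \<in> I"
proof -
  interpret ideal I R by fact
  show "\<And>x. x \<in> I ==> x \<in> carrier R" "\<zero> \<in> I" "\<And>x y. x \<in> I ==> y \<in> I ==> x \<oplus> y \<in> I"
    "\<And>x. x \<in> I ==> \<ominus> x \<in> I" "\<And>x y. x \<in> I ==> y \<in> I ==> x \<ominus> y \<in> I"
    "\<And>a x. a \<in> carrier R ==> x \<in> I ==> a \<otimes> x \<in> I"
    "\<And>a x. a \<in> carrier R ==> x \<in> I ==> x \<otimes> a \<in> I"
    using I_l_closed I_r_closed by (auto simp: a_minus_def)
qed

lemma ideal_ofI:
  assumes "I \<subseteq> carrier R" "\<zero> \<in> I" "\<And>x y. x \<in> I ==> y \<in> I ==> x \<oplus> y \<in> I"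
    "\<And>a x. a \<in> carrier R ==> x \<in> I ==> a \<otimes> x \<in> I"
  shows "ideal I R"
proof -
  have m: "\<ominus> x \<in> I" if "x \<in> I" for x
  proof -
    have "\<ominus> x = (\<ominus> \<one>) \<otimes> x" using that assms(1) by (simp add: l_minus subsetD)
    then show ?thesis using assms(4)[of "\<ominus> \<one>" x] that by simp
  qed
  show ?thesis
  proof (intro idealI ring_axioms)
    show "subgroup I (add_monoid R)"
      using assms m by (intro add.subgroupI) auto
    show "x \<otimes> a \<in> I" "a \<otimes> x \<in> I" if "a \<in> I" "x \<in> carrier R" for a x
      using assms(1,4) that m_comm[of x a] by (metis subsetD)+
  qed
qed

text \<open>The ideal I + (x), in explicit form.\<close>

definition adjoin :: "'a set => 'a => 'a set" where
  "adjoin I x = {i \<oplus> a \<otimes> x | i a. i \<in> I \<and> a \<in> carrier R}"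

text \<open>The ideal quotient (I : c), which is the annihilator of the class of \<open>c\<close> in
  R/I.\<close>

definition colon :: "'a set => 'a => 'a set" where
  "colon I c = {a \<in> carrier R. a \<otimes> c \<in> I}"

lemma adjoin_ideal:
  assumes I: "ideal I R" and x: "x \<in> carrier R"
  shows "ideal (adjoin I x) R"
proof (rule ideal_ofI)
  note D = idealD[OF I]
  show "adjoin I x \<subseteq> carrier R" using D(1) x by (auto simp: adjoin_def)
  have "\<zero> = \<zero> \<oplus> \<zero> \<otimes> x" using x by simp
  then show "\<zero> \<in> adjoin I x" using D(2) unfolding adjoin_def by blast
  show "p \<oplus> q \<in> adjoin I x" if p: "p \<in> adjoin I x" and q: "q \<in> adjoin I x" for p q
  proof -
    obtain i a j b where *: "i \<in> I" "a \<in> carrier R" "p = i \<oplus> a \<otimes> x" "j \<in> I" "b \<in> carrier R" "q = j \<oplus> b \<otimes> x"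
      using p q by (auto simp: adjoin_def)
    have ij: "i \<in> carrier R" "j \<in> carrier R" using D(1) * by auto
    have "p \<oplus> q = (i \<oplus> j) \<oplus> (a \<oplus> b) \<otimes> x" using * ij x by algebra
    then show ?thesis using * D(3) unfolding adjoin_def by blast
  qed
  show "c \<otimes> p \<in> adjoin I x" if c: "c \<in> carrier R" and p: "p \<in> adjoin I x" for c p
  proof -
    obtain i a where *: "i \<in> I" "a \<in> carrier R" "p = i \<oplus> a \<otimes> x" using p by (auto simp: adjoin_def)
    have i: "i \<in> carrier R" using D(1) * by auto
    have "c \<otimes> p = (c \<otimes> i) \<oplus> (c \<otimes> a) \<otimes> x" using * i x c by algebra
    then show ?thesis using * c D(6)[OF c] m_closed[OF c] unfolding adjoin_def by blast
  qed
qed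

lemma adjoin_sup: assumes "ideal I R" "x \<in> carrier R" shows "I \<subseteq> adjoin I x" "x \<in> adjoin I x"
proof -
  have "i = i \<oplus> \<zero> \<otimes> x" if "i \<in> I" for i using idealD(1)[OF assms(1) that] assms(2) by simp
  then show "I \<subseteq> adjoin I x" unfolding adjoin_def by blast
  have "x = \<zero> \<oplus> \<one> \<otimes> x" using assms by simp
  then show "x \<in> adjoin I x" using idealD(2)[OF assms(1)] unfolding adjoin_def by blast
qed

lemma adjoin_least: "ideal J R ==> I \<subseteq> J ==> x \<in> J ==> adjoin I x \<subseteq> J"
  using idealD[of J] by (auto simp: adjoin_def)

lemma adjoin_mono: "I \<subseteq> J ==> adjoin I x \<subseteq> adjoin J x"
  by (auto simp: adjoin_def)

lemma colon_ideal:
  assumes I: "ideal I R" and c: "c \<in> carrier R"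
  shows "ideal (colon I c) R"
proof (rule ideal_ofI)
  note D = idealD[OF I]
  show "x \<oplus> y \<in> colon I c" if "x \<in> colon I c" "y \<in> colon I c" for x y
    using that D(3) c by (auto simp: colon_def l_distr)
  show "a \<otimes> x \<in> colon I c" if "a \<in> carrier R" "x \<in> colon I c" for a x
    using that D(6) c by (auto simp: colon_def m_assoc)
qed (use idealD(2)[OF I] c in \<open>auto simp: colon_def\<close>)

lemma colon_sup: "ideal I R ==> c \<in> carrier R ==> I \<subseteq> colon I c"
  using idealD(1,7) by (auto simp: colon_def)

lemma primeD:
  assumes "primeideal P R"
  shows "ideal P R" "\<one> \<notin> P" "P \<subseteq> carrier R"
    "\<And>a b. a \<in> carrier R ==> b \<in> carrier R ==> a \<otimes> b \<in> P ==> a \<in> P \<or> b \<in> P"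
proof -
  interpret primeideal P R by fact
  show "ideal P R" "\<one> \<notin> P" "P \<subseteq> carrier R"
    "\<And>a b. a \<in> carrier R ==> b \<in> carrier R ==> a \<otimes> b \<in> P ==> a \<in> P \<or> b \<in> P"
    using is_ideal I_notcarr one_imp_carrier I_prime Icarr by auto
qed

lemma primeI:
  assumes "ideal P R" "\<one> \<notin> P" "\<And>a b. a \<in> carrier R ==> b \<in> carrier R ==> a \<otimes> b \<in> P ==> a \<in> P \<or> b \<in> P"
  shows "primeideal P R"
  using assms one_closed by (intro primeidealI cring_axioms) auto

lemma one_in_ideal: "ideal I R ==> \<one> \<in> I ==> I = carrier R"
  using ideal.one_imp_carrier by blast

lemma prime_pow:
  assumes P: "primeideal P R" and x: "x \<in> carrier R" "x \<notin> P"
  shows "x [^] (n::nat) \<notin> P"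
proof (induction n)
  case (Suc n)
  then show ?case using primeD(4)[OF P, of "x [^] n" x] x by auto
qed (use primeD(2)[OF P] in simp)

text \<open>If \<open>a b\<close> kills \<open>c\<close> modulo \<open>I\<close> and
  \<open>b\<close> does not, then \<open>b c\<close> is nonzero and its annihilator contains that of
  \<open>c\<close>. By maximality both are equal, and \<open>a\<close> belongs to it.\<close>

lemma colon_max_prime:
  assumes I: "ideal I R" and c: "c \<in> carrier R" "c \<notin> I"
    and max: "\<And>d. d \<in> carrier R ==> d \<notin> I ==> colon I c \<subseteq> colon I d ==> colon I d = colon I c"
  shows "primeideal (colon I c) R"
proof (rule primeI[OF colon_ideal[OF I c(1)]])
  show "\<one> \<notin> colon I c" using c by (simp add: colon_def)
  fix a b assume a: "a \<in> carrier R" and b: "b \<in> carrier R" and ab: "a \<otimes> b \<in> colon I c"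
  show "a \<in> colon I c \<or> b \<in> colon I c"
  proof (rule ccontr)
    assume n: "\<not> (a \<in> colon I c \<or> b \<in> colon I c)"
    then have bc: "b \<otimes> c \<in> carrier R" "b \<otimes> c \<notin> I" using b c by (auto simp: colon_def)
    have "y \<otimes> (b \<otimes> c) \<in> I" if "y \<in> carrier R" "y \<otimes> c \<in> I" for y
    proof -
      have "y \<otimes> (b \<otimes> c) = b \<otimes> (y \<otimes> c)" using that b c by algebra
      then show ?thesis using idealD(6)[OF I b that(2)] by simp
    qed
    then have "colon I c \<subseteq> colon I (b \<otimes> c)" by (auto simp: colon_def)
    then have "colon I (b \<otimes> c) = colon I c" by (rule max[OF bc])
    moreover have "a \<in> colon I (b \<otimes> c)" using ab a b c by (simp add: colon_def m_assoc)
    ultimately show False using n by simp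
  qed
qed

section \<open>Prime avoidance\<close>

lemma prime_product_avoid:
  assumes p: "primeideal p R" and K: "ideal K R" and "finite S"
    and "\<And>q. q \<in> S ==> ideal q R \<and> \<not> q \<subseteq> p" and k: "\<not> K \<subseteq> p"
  shows "\<exists>y\<in>K. y \<notin> p \<and> (\<forall>q\<in>S. y \<in> q)"
  using assms(3,4)
proof (induction rule: finite_induct)
  case empty
  then show ?case using k by auto
next
  case (insert q S)
  then obtain y where y: "y \<in> K" "y \<notin> p" "\<forall>q\<in>S. y \<in> q" by auto
  obtain z where z: "z \<in> q" "z \<notin> p" and q: "ideal q R" using insert.prems[of q] by auto
  have c: "y \<in> carrier R" "z \<in> carrier R" using y z idealD(1)[OF K] idealD(1)[OF q] by auto
  have "y \<otimes> z \<in> K" by (rule idealD(7)[OF K c(2) y(1)])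
  moreover have "y \<otimes> z \<notin> p" using primeD(4)[OF p c] y z by auto
  moreover have "y \<otimes> z \<in> q'" if "q' \<in> insert q S" for q'
    using that y(3) z(1) idealD(6)[OF q c(1)] idealD(7)[of q' z y] insert.prems[of q'] c by auto
  ultimately show ?case by blast
qed

text \<open>The element is found inside the coset of \<open>x0\<close> modulo \<open>K\<close>. If
  \<open>x\<close> falls into the new prime, add some \<open>y\<close> in \<open>K\<close> that lies
  in all earlier primes but not in the new one; the primes are pairwise incomparable in order that
  such a \<open>y\<close> exists.\<close>

lemma prime_avoidance:
  assumes a: "ideal a R" and K: "ideal K R" "K \<subseteq> a" and x0: "x0 \<in> a" and "finite S"
    and "\<And>p. p \<in> S ==> primeideal p R \<and> \<not> K \<subseteq> p"
    and "\<And>p q. p \<in> S ==> q \<in> S ==> p \<subseteq> q ==> p = q"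
  shows "\<exists>x\<in>a. x \<ominus> x0 \<in> K \<and> (\<forall>p\<in>S. x \<notin> p)"
  using assms(5,6,7)
proof (induction rule: finite_induct)
  case empty
  have "x0 \<ominus> x0 = \<zero>" using idealD(1)[OF a x0] by (simp add: a_minus_def r_neg)
  then show ?case using x0 idealD(2)[OF K(1)] by (intro bexI[of _ x0]) auto
next
  case (insert p S)
  obtain x where x: "x \<in> a" "x \<ominus> x0 \<in> K" "\<forall>p\<in>S. x \<notin> p"
  proof -
    have "\<exists>x\<in>a. x \<ominus> x0 \<in> K \<and> (\<forall>p\<in>S. x \<notin> p)"
      by (rule insert.IH) (use insert.prems in \<open>simp_all\<close>)
    then show ?thesis using that by blast
  qed
  show ?case
  proof (cases "x \<in> p")
    case False
    then show ?thesis using x by auto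
  next
    case True
    have p: "primeideal p R" "\<not> K \<subseteq> p" using insert.prems(1)[of p] by auto
    have "\<not> q \<subseteq> p" if "q \<in> S" for q using insert.prems(2)[of q p] insert.hyps(2) that by blast
    then have "\<exists>y\<in>K. y \<notin> p \<and> (\<forall>q\<in>S. y \<in> q)"
      using insert.prems(1) primeD(1) by (intro prime_product_avoid[OF p(1) K(1) insert.hyps(1)] p(2)) auto
    then obtain y where y: "y \<in> K" "y \<notin> p" "\<forall>q\<in>S. y \<in> q" by blast
    have c: "x \<in> carrier R" "y \<in> carrier R" "x0 \<in> carrier R"
      using idealD(1)[OF a] x x0 y(1) K(2) by auto
    have "x \<oplus> y \<in> a" using idealD(3)[OF a x(1)] y(1) K(2) by auto
    moreover have "(x \<oplus> y) \<ominus> x0 \<in> K"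
    proof -
      have "(x \<oplus> y) \<ominus> x0 = (x \<ominus> x0) \<oplus> y" using c by algebra
      then show ?thesis using idealD(3)[OF K(1) x(2) y(1)] by simp
    qed
    moreover have "x \<oplus> y \<notin> q" if "q \<in> insert p S" for q
    proof
      assume xy: "x \<oplus> y \<in> q"
      have qi: "ideal q R" using insert.prems(1)[OF that] primeD(1) by blast
      have "y = (x \<oplus> y) \<ominus> x" "x = (x \<oplus> y) \<ominus> y" using c by algebra+
      then show False using xy that True x(3) y(2,3) idealD(5)[OF qi] by (metis insertE)
    qed
    ultimately show ?thesis by blast
  qed
qed

text \<open>Ideals generated by a regular sequence of the given length. Nothing excludes the unit ideal:
  every element is regular modulo it.\<close>

inductive reg_ideal :: "nat => 'a set => bool" where
  zero: "reg_ideal 0 {\<zero>}"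
| adjoin: "reg_ideal k I ==> x \<in> carrier R ==> (\<And>a. a \<in> carrier R ==> a \<otimes> x \<in> I ==> a \<in> I) ==>
    reg_ideal (Suc k) (adjoin I x)"

lemma reg_ideal_ideal: "reg_ideal k I ==> ideal I R"
  by (induction rule: reg_ideal.induct) (auto simp: zeroideal adjoin_ideal)

text \<open>Properness makes the generators distinct: a regular element that already lies in
  \<open>I\<close> would force \<open>\<one> \<in> I\<close>. The exact number matters for the
  comparison with the dimension.\<close>

lemma reg_ideal_generators:
  "reg_ideal k I ==> \<one> \<notin> I ==> \<exists>S\<subseteq>carrier R. finite S \<and> card S = k \<and> Idl S = I"
proof (induction rule: reg_ideal.induct)
  case zero
  have "Idl {} = {\<zero>}" using genideal_minimal[OF zeroideal, of "{}"] idealD(2)[OF genideal_ideal[of "{}"]] by auto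
  then show ?case by (intro exI[of _ "{}"]) auto
next
  case (adjoin k I x)
  have I: "ideal I R" by (rule reg_ideal_ideal[OF adjoin.hyps(1)])
  note sup = adjoin_sup[OF I adjoin.hyps(2)]
  then obtain S where S: "S \<subseteq> carrier R" "finite S" "card S = k" "Idl S = I"
    using adjoin.IH adjoin.prems by blast
  have "x \<notin> I" using adjoin.hyps(3)[of \<one>] adjoin.hyps(2) sup adjoin.prems by auto
  then have "x \<notin> S" using genideal_self[OF S(1)] S(4) by auto
  moreover have "Idl (insert x S) = adjoin I x"
  proof
    have "insert x S \<subseteq> adjoin I x" using sup genideal_self[OF S(1)] S(4) by auto
    then show "Idl (insert x S) \<subseteq> adjoin I x" by (rule genideal_minimal[OF adjoin_ideal[OF I adjoin.hyps(2)]])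
    have c: "insert x S \<subseteq> carrier R" using S adjoin.hyps by auto
    have "I \<subseteq> Idl (insert x S)"
      using genideal_minimal[OF genideal_ideal[OF c], of S] genideal_self[OF c] S(4) by auto
    then show "adjoin I x \<subseteq> Idl (insert x S)"
      using genideal_self[OF c] by (intro adjoin_least[OF genideal_ideal[OF c]]) auto
  qed
  ultimately show ?case using S adjoin.hyps(2) by (intro exI[of _ "insert x S"]) auto
qed

section \<open>Chains of prime ideals\<close>

definition prime_chain :: "nat => (nat => 'a set) => bool" where
  "prime_chain n p \<longleftrightarrow> (\<forall>i\<le>n. primeideal (p i) R) \<and> (\<forall>i<n. p i \<subset> p (Suc i))"

lemma prime_chain_krull_dim: "prime_chain n p ==> enat n \<le> krull_dim R"
  unfolding krull_dim_def prime_chain_def by (intro Sup_upper) blast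

lemma krull_dim_le: "(\<And>n p. prime_chain n p ==> n \<le> k) ==> krull_dim R \<le> enat k"
  unfolding krull_dim_def prime_chain_def by (intro Sup_least) auto

lemma prime_chain_cons:
  assumes "prime_chain n p" "primeideal q R" "q \<subset> p 0"
  shows "prime_chain (Suc n) (\<lambda>i. case i of 0 => q | Suc j => p j)"
  using assms by (auto simp: prime_chain_def split: nat.splits)

lemma prime_chain_snoc:
  assumes "prime_chain n p" "primeideal q R" "p n \<subset> q"
  shows "prime_chain (Suc n) (p(Suc n := q))"
  using assms by (auto simp: prime_chain_def less_Suc_eq le_Suc_eq)

end

section \<open>Noetherian rings: maximal annihilators and regular elements\<close>

locale noetherian_cring = cring R + noetherian_ring R for R (structure)
begin

lemma ideal_max:
  assumes "S \<noteq> {}" "\<And>I. I \<in> S ==> ideal I R"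
  shows "\<exists>M\<in>S. \<forall>I\<in>S. M \<subseteq> I --> I = M"
proof (rule subset_Zorn_nonempty[OF assms(1)])
  fix C assume C: "C \<noteq> {}" "subset.chain S C"
  then have "subset.chain {I. ideal I R} C" using assms(2) by (auto simp: subset_chain_def)
  then have "\<Union>C \<in> C" using ideal_chain_is_trivial C(1) by blast
  then show "\<Union>C \<in> S" using C(2) by (auto simp: subset_chain_def)
qed

lemma ideal_max_ex:
  assumes "P I" "\<And>I. P I ==> ideal I R"
  shows "\<exists>M. P M \<and> (\<forall>J. P J --> M \<subseteq> J --> J = M)"
  using ideal_max[of "Collect P"] assms by auto

lemma exists_maximal_ideal:
  assumes "ideal I R" "\<one> \<notin> I"
  shows "\<exists>M. maximalideal M R \<and> I \<subseteq> M"
proof -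
  have "\<exists>M. (ideal M R \<and> \<one> \<notin> M \<and> I \<subseteq> M) \<and> (\<forall>J. ideal J R \<and> \<one> \<notin> J \<and> I \<subseteq> J --> M \<subseteq> J --> J = M)"
    by (rule ideal_max_ex[where I = I]) (use assms in auto)
  then obtain M where M: "ideal M R \<and> \<one> \<notin> M \<and> I \<subseteq> M"
    and max: "\<And>J. ideal J R \<and> \<one> \<notin> J \<and> I \<subseteq> J ==> M \<subseteq> J ==> J = M"
    by blast
  have "maximalideal M R"
  proof (rule maximalidealI)
    show "carrier R \<noteq> M" using M by auto
    fix J assume "ideal J R" "M \<subseteq> J" "J \<subseteq> carrier R"
    then show "J = M \<or> J = carrier R" using M max[of J] one_in_ideal[of J] by blast
  qed (use M in simp)
  then show ?thesis using M by blast
qed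

text \<open>\<open>colon I c\<close> is maximal among the annihilators of nonzero elements of R/I,
  hence an associated prime. These primes cover the zero divisors on R/I.\<close>

definition max_colon :: "'a set => 'a => bool" where
  "max_colon I c \<longleftrightarrow> c \<in> carrier R \<and> c \<notin> I \<and>
     (\<forall>d\<in>carrier R - I. colon I c \<subseteq> colon I d --> colon I d = colon I c)"

lemma max_colon_exists:
  assumes I: "ideal I R" and a: "a \<in> carrier R" "a \<notin> I"
  shows "\<exists>c. max_colon I c \<and> colon I a \<subseteq> colon I c"
proof -
  have "\<exists>M. (\<exists>c\<in>carrier R - I. M = colon I c \<and> colon I a \<subseteq> M) \<and>
    (\<forall>J. (\<exists>c\<in>carrier R - I. J = colon I c \<and> colon I a \<subseteq> J) --> M \<subseteq> J --> J = M)"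
  proof (rule ideal_max_ex[where I = "colon I a"])
    show "\<exists>c\<in>carrier R - I. colon I a = colon I c \<and> colon I a \<subseteq> colon I a" using a by blast
  qed (auto intro: colon_ideal[OF I])
  then obtain M where M: "\<exists>c\<in>carrier R - I. M = colon I c \<and> colon I a \<subseteq> M"
    and max: "\<And>J. \<exists>c\<in>carrier R - I. J = colon I c \<and> colon I a \<subseteq> J ==> M \<subseteq> J ==> J = M"
    by blast
  obtain c where c: "c \<in> carrier R - I" "M = colon I c" "colon I a \<subseteq> M" using M by blast
  have "colon I d = colon I c" if "d \<in> carrier R - I" "colon I c \<subseteq> colon I d" for d
    using max[of "colon I d"] that c by blast
  then show ?thesis using c by (intro exI[of _ c]) (simp add: max_colon_def)
qed

lemma max_colon_prime: "ideal I R ==> max_colon I c ==> primeideal (colon I c) R"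
  by (rule colon_max_prime) (auto simp: max_colon_def)

lemma prime_Inter:
  assumes p: "primeideal p R" and "finite F" and "\<And>q. q \<in> F ==> ideal q R"
    and sub: "{a \<in> carrier R. \<forall>q\<in>F. a \<in> q} \<subseteq> p"
  shows "\<exists>q\<in>F. q \<subseteq> p"
proof (rule ccontr)
  assume "\<not> ?thesis"
  then have "\<exists>y\<in>carrier R. y \<notin> p \<and> (\<forall>q\<in>F. y \<in> q)"
    using assms primeD(2)[OF p] one_closed by (intro prime_product_avoid[OF p oneideal]) auto
  then show False using sub by auto
qed

text \<open>Choose a finite set \<open>F\<close> of such elements for which I + (F) is maximal. Any
  further \<open>c\<close> lies in this ideal, so a common annihilator of \<open>F\<close> also
  annihilates \<open>c\<close>; the prime \<open>colon I c\<close> thus contains the intersection of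
  the \<open>colon I f\<close>, hence one of them, and equals it by maximality.\<close>

lemma finite_max_colon:
  assumes I: "ideal I R"
  shows "finite {colon I c | c. max_colon I c}"
proof -
  define P where "P J \<longleftrightarrow> (\<exists>F. finite F \<and> F \<subseteq> Collect (max_colon I) \<and> J = Idl (I \<union> F))" for J
  have "\<exists>M. P M \<and> (\<forall>J. P J --> M \<subseteq> J --> J = M)"
  proof (rule ideal_max_ex[where I = "Idl (I \<union> {})"])
    show "P (Idl (I \<union> {}))" unfolding P_def by blast
  next
    fix J assume "P J"
    then obtain F where "F \<subseteq> Collect (max_colon I)" "J = Idl (I \<union> F)" unfolding P_def by blast
    then show "ideal J R" using idealD(1)[OF I] by (auto simp: max_colon_def intro!: genideal_ideal)
  qed
  then obtain M where M: "P M" and Mmax: "\<And>J. P J ==> M \<subseteq> J ==> J = M" by blast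
  obtain F where F: "finite F" "F \<subseteq> Collect (max_colon I)" "M = Idl (I \<union> F)" using M by (auto simp: P_def)
  have max: "Idl (I \<union> G) = Idl (I \<union> F)"
    if "finite G" "G \<subseteq> Collect (max_colon I)" "Idl (I \<union> F) \<subseteq> Idl (I \<union> G)" for G
    using Mmax[of "Idl (I \<union> G)"] that F(3) by (auto simp: P_def)
  have "colon I c \<in> colon I ` F" if c: "max_colon I c" for c
  proof -
    have sub: "I \<union> insert c F \<subseteq> carrier R" "I \<union> F \<subseteq> carrier R"
      using idealD(1)[OF I] F c by (auto simp: max_colon_def)
    have "Idl (I \<union> F) \<subseteq> Idl (I \<union> insert c F)"
      using subset_Idl_subset[OF sub(1)] by auto
    then have "Idl (I \<union> insert c F) = Idl (I \<union> F)" using max[of "insert c F"] F c by auto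
    then have cF: "c \<in> Idl (I \<union> F)" using genideal_self[OF sub(1)] by auto
    define W where "W = {j \<in> carrier R. \<forall>a\<in>carrier R. (\<forall>f\<in>F. a \<in> colon I f) --> a \<otimes> j \<in> I}"
    have "ideal W R"
    proof (rule ideal_ofI)
      show "x \<oplus> y \<in> W" if "x \<in> W" "y \<in> W" for x y
        using that idealD(3)[OF I] by (auto simp: W_def r_distr)
      show "r \<otimes> x \<in> W" if r: "r \<in> carrier R" and x: "x \<in> W" for r x
      proof -
        have "a \<otimes> (r \<otimes> x) = r \<otimes> (a \<otimes> x)" if "a \<in> carrier R" for a
          using that r x by (auto simp: W_def intro: m_lcomm)
        then show ?thesis using r x idealD(6)[OF I r] by (auto simp: W_def)
      qed
    qed (use idealD(2)[OF I] in \<open>auto simp: W_def\<close>)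
    moreover have "I \<union> F \<subseteq> W" using sub(2) idealD(6)[OF I] by (auto simp: W_def colon_def)
    ultimately have "c \<in> W" using genideal_minimal[of W "I \<union> F"] cF by auto
    then have "{a \<in> carrier R. \<forall>q\<in>colon I ` F. a \<in> q} \<subseteq> colon I c" by (auto simp: W_def colon_def)
    moreover have "ideal q R" if "q \<in> colon I ` F" for q
      using that F(2) colon_ideal[OF I] by (auto simp: max_colon_def)
    ultimately obtain f where f: "f \<in> F" "colon I f \<subseteq> colon I c"
      using prime_Inter[OF max_colon_prime[OF I c], of "colon I ` F"] F(1) by auto
    then have "colon I c = colon I f" using F(2) c unfolding max_colon_def by blast
    then show ?thesis using f(1) by blast
  qed
  then have "{colon I c | c. max_colon I c} \<subseteq> colon I ` F" by auto
  then show ?thesis using F(1) finite_surj by blast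
qed

text \<open>Either \<open>M\<close> annihilates a nonzero element of R/I, or no maximal annihilator
  contains \<open>K\<close>, as \<open>M\<close> is the only prime over \<open>K\<close>. In the
  second case the coset of \<open>x0\<close> modulo \<open>K\<close> has an element of
  \<open>M\<close> outside all of them, which is a nonzerodivisor on R/I. The coset gives control
  over more than regularity.\<close>

lemma regular_or_socle:
  assumes I: "ideal I R" and M: "ideal M R" and K: "ideal K R" "K \<subseteq> M"
    and KM: "\<And>p. primeideal p R ==> K \<subseteq> p ==> p = M" and x0: "x0 \<in> M"
  shows "(\<exists>c\<in>carrier R - I. \<forall>m\<in>M. m \<otimes> c \<in> I) \<or>
    (\<exists>x\<in>M. x \<ominus> x0 \<in> K \<and> (\<forall>a\<in>carrier R. a \<otimes> x \<in> I --> a \<in> I))"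
proof (cases "\<exists>c. max_colon I c \<and> colon I c = M")
  case True
  then show ?thesis by (auto simp: max_colon_def colon_def)
next
  case False
  have "\<exists>x\<in>M. x \<ominus> x0 \<in> K \<and> (\<forall>p\<in>{colon I c | c. max_colon I c}. x \<notin> p)"
  proof (rule prime_avoidance[OF M K x0 finite_max_colon[OF I]])
    show "primeideal p R \<and> \<not> K \<subseteq> p" if "p \<in> {colon I c | c. max_colon I c}" for p
      using that max_colon_prime[OF I] KM False by blast
    show "p = q" if "p \<in> {colon I c | c. max_colon I c}" "q \<in> {colon I c | c. max_colon I c}" "p \<subseteq> q" for p q
      using that by (auto simp: max_colon_def)
  qed
  then obtain x where x: "x \<in> M" "x \<ominus> x0 \<in> K" "\<And>c. max_colon I c ==> x \<notin> colon I c" by blast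
  have "a \<in> I" if "a \<in> carrier R" "a \<otimes> x \<in> I" for a
  proof (rule ccontr)
    assume "a \<notin> I"
    from max_colon_exists[OF I that(1) this] obtain c where c: "max_colon I c" "colon I a \<subseteq> colon I c" by blast
    have "x \<in> colon I a" using that idealD(1)[OF M x(1)] by (simp add: colon_def m_comm)
    then show False using c x(3) by auto
  qed
  then show ?thesis using x by blast
qed

lemma maximal_prime: "maximalideal M R ==> primeideal M R"
  by (rule maximalideal_prime)

lemma maximal_sup: "maximalideal M R ==> ideal J R ==> M \<subseteq> J ==> \<one> \<notin> J ==> J = M"
  using maximalideal.I_maximal[of M R J] idealD(1)[of J] by auto

text \<open>Take \<open>I\<close> maximal among the ideals in \<open>M\<close> generated by regular
  sequences. A further regular element would not enlarge \<open>I\<close>, so it would lie in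
  \<open>I\<close>, and regularity would give \<open>\<one> \<in> I\<close>. The other alternative
  of \<open>regular_or_socle\<close> remains.\<close>

lemma exists_regular_socle:
  assumes M: "maximalideal M R"
  shows "\<exists>k I c. reg_ideal k I \<and> I \<subseteq> M \<and> c \<in> carrier R \<and> c \<notin> I \<and> (\<forall>m\<in>M. m \<otimes> c \<in> I)"
proof -
  have Mp: "primeideal M R" by (rule maximal_prime[OF M])
  note MD = primeD[OF Mp]
  have "\<exists>I. (I \<subseteq> M \<and> (\<exists>k. reg_ideal k I)) \<and> (\<forall>J. J \<subseteq> M \<and> (\<exists>k. reg_ideal k J) --> I \<subseteq> J --> J = I)"
  proof (rule ideal_max_ex[where I = "{\<zero>}"])
    show "{\<zero>} \<subseteq> M \<and> (\<exists>k. reg_ideal k {\<zero>})" using reg_ideal.zero idealD(2)[OF MD(1)] by blast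
  qed (auto simp: reg_ideal_ideal)
  then obtain I where IM: "I \<subseteq> M \<and> (\<exists>k. reg_ideal k I)"
    and Imax: "\<And>J. J \<subseteq> M \<and> (\<exists>k. reg_ideal k J) ==> I \<subseteq> J ==> J = I" by blast
  then obtain k where I: "I \<subseteq> M" "reg_ideal k I" by blast
  have max: "J = I" if "J \<subseteq> M" "reg_ideal l J" "I \<subseteq> J" for J l using Imax[of J] that by blast
  have Ii: "ideal I R" by (rule reg_ideal_ideal[OF I(2)])
  have "\<not> (\<exists>x\<in>M. x \<ominus> \<zero> \<in> M \<and> (\<forall>a\<in>carrier R. a \<otimes> x \<in> I --> a \<in> I))"
  proof
    assume "\<exists>x\<in>M. x \<ominus> \<zero> \<in> M \<and> (\<forall>a\<in>carrier R. a \<otimes> x \<in> I --> a \<in> I)"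
    then obtain x where x: "x \<in> M" "\<And>a. a \<in> carrier R ==> a \<otimes> x \<in> I ==> a \<in> I" by blast
    have xc: "x \<in> carrier R" using x MD by auto
    have "adjoin I x = I"
      using max[OF adjoin_least[OF MD(1) I(1) x(1)] reg_ideal.adjoin[OF I(2) xc x(2)] adjoin_sup(1)[OF Ii xc]] by simp
    then have "\<one> \<in> I" using adjoin_sup(2)[OF Ii xc] x(2)[of \<one>] xc by simp
    then show False using I MD by auto
  qed
  moreover have "p = M" if "primeideal p R" "M \<subseteq> p" for p using maximal_sup[OF M] that primeD by blast
  ultimately have "\<exists>c\<in>carrier R - I. \<forall>m\<in>M. m \<otimes> c \<in> I"
    using regular_or_socle[OF Ii MD(1) MD(1) subset_refl _ idealD(2)[OF MD(1)]] by blast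
  then show ?thesis using I by blast
qed

text \<open>The set \<open>S\<close> is multiplicative, generated by the complement of
  \<open>p\<close> and the powers of \<open>x\<close>. It misses \<open>I\<close> because
  \<open>x\<close> is regular modulo \<open>I\<close> and \<open>I \<subseteq> p\<close>; an ideal
  over \<open>I\<close> maximal among those missing \<open>S\<close> is prime.\<close>

lemma prime_below_regular:
  assumes I: "ideal I R" and p: "primeideal p R" "I \<subseteq> p" and x: "x \<in> carrier R"
    and reg: "\<And>a. a \<in> carrier R ==> a \<otimes> x \<in> I ==> a \<in> I"
  shows "\<exists>q. primeideal q R \<and> I \<subseteq> q \<and> q \<subseteq> p \<and> x \<notin> q"
proof -
  define S where "S = {s \<otimes> x [^] n | s n. s \<in> carrier R - p \<and> n \<in> (UNIV :: nat set)}"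
  have xn: "x [^] (n::nat) \<in> carrier R" for n using x by simp
  have regn: "a \<in> I" if "a \<in> carrier R" "a \<otimes> x [^] n \<in> I" for a and n :: nat
    using that
  proof (induction n arbitrary: a)
    case (Suc n)
    have "(a \<otimes> x [^] n) \<otimes> x \<in> I" using Suc.prems xn x by (simp add: m_assoc)
    then have "a \<otimes> x [^] n \<in> I" using reg[of "a \<otimes> x [^] n"] Suc.prems(1) xn by blast
    then show ?case by (rule Suc.IH[OF Suc.prems(1)])
  qed simp
  have IS: "I \<inter> S = {}" using regn p(2) by (auto simp: S_def)
  have "\<exists>q. (ideal q R \<and> I \<subseteq> q \<and> q \<inter> S = {}) \<and>
    (\<forall>J. ideal J R \<and> I \<subseteq> J \<and> J \<inter> S = {} --> q \<subseteq> J --> J = q)"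
  proof (rule ideal_max_ex[where I = I])
    show "ideal I R \<and> I \<subseteq> I \<and> I \<inter> S = {}" using I IS by blast
  qed auto
  then obtain q where q': "ideal q R \<and> I \<subseteq> q \<and> q \<inter> S = {}"
    and max': "\<And>J. ideal J R \<and> I \<subseteq> J \<and> J \<inter> S = {} ==> q \<subseteq> J ==> J = q"
    by blast
  have q: "ideal q R" "I \<subseteq> q" "q \<inter> S = {}" using q' by auto
  have max: "J = q" if "ideal J R" "I \<subseteq> J" "J \<inter> S = {}" "q \<subseteq> J" for J using max' that by blast
  have Sm: "s \<otimes> t \<in> S" if "s \<in> S" "t \<in> S" for s t
  proof -
    note st = that
    obtain s' t' and n m :: nat where *: "s' \<in> carrier R - p" "t' \<in> carrier R - p" "s = s' \<otimes> x [^] n" "t = t' \<otimes> x [^] m"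
      using st unfolding S_def by blast
    have "s \<otimes> t = (s' \<otimes> t') \<otimes> x [^] (n + m)"
    proof -
      have "(s' \<otimes> u) \<otimes> (t' \<otimes> v) = (s' \<otimes> t') \<otimes> (u \<otimes> v)" if "u \<in> carrier R" "v \<in> carrier R" for u v
        using that *(1,2) by (simp add: m_ac)
      from this[OF xn[of n] xn[of m]] show ?thesis by (simp only: *(3,4) nat_pow_mult[OF x])
    qed
    moreover have "s' \<otimes> t' \<in> carrier R - p" using * primeD(4)[OF p(1), of s' t'] by auto
    ultimately show ?thesis by (auto simp: S_def)
  qed
  have pS: "s \<in> S" if "s \<in> carrier R - p" for s
  proof -
    have "s = s \<otimes> x [^] (0::nat)" using that by simp
    then show ?thesis using that unfolding S_def by blast
  qed
  have Sc: "S \<subseteq> carrier R" using xn by (auto simp: S_def)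
  have one: "\<one> \<in> S" using pS primeD(2)[OF p(1)] by auto
  have xS: "x \<in> S"
  proof -
    have "x = \<one> \<otimes> x [^] (1::nat)" using x by simp
    moreover have "\<one> \<in> carrier R - p" using primeD(2)[OF p(1)] by auto
    ultimately show ?thesis unfolding S_def by blast
  qed
  have "primeideal q R"
  proof (rule primeI[OF q(1)])
    show "\<one> \<notin> q" using one q(3) by auto
    fix a b assume a: "a \<in> carrier R" and b: "b \<in> carrier R" and ab: "a \<otimes> b \<in> q"
    have hit: "\<exists>s\<in>S. s \<in> adjoin q y" if y: "y \<in> carrier R" "y \<notin> q" for y
      using max[OF adjoin_ideal[OF q(1) y(1)]] adjoin_sup[OF q(1) y(1)] q(2) y(2) by blast
    show "a \<in> q \<or> b \<in> q"
    proof (rule ccontr)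
      assume "\<not> (a \<in> q \<or> b \<in> q)"
      then obtain s t where s: "s \<in> S" "s \<in> adjoin q a" and t: "t \<in> S" "t \<in> adjoin q b" using hit a b by blast
      then obtain i r j u where *: "i \<in> q" "r \<in> carrier R" "s = i \<oplus> r \<otimes> a" "j \<in> q" "u \<in> carrier R" "t = j \<oplus> u \<otimes> b"
        by (auto simp: adjoin_def)
      have c: "i \<in> carrier R" "j \<in> carrier R" using * idealD(1)[OF q(1)] by auto
      have "s \<otimes> t = (t \<otimes> i \<oplus> (r \<otimes> a) \<otimes> j) \<oplus> (r \<otimes> u) \<otimes> (a \<otimes> b)" using * c a b by algebra
      moreover have "(t \<otimes> i \<oplus> (r \<otimes> a) \<otimes> j) \<oplus> (r \<otimes> u) \<otimes> (a \<otimes> b) \<in> q"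
        using * c a b ab t(1) Sc idealD(3,6)[OF q(1)] by auto
      ultimately show False using Sm[OF s(1) t(1)] q(3) by auto
    qed
  qed
  moreover have "q \<subseteq> p" using pS q(3) idealD(1)[OF q(1)] by blast
  ultimately show ?thesis using q xS by blast
qed

text \<open>Each element of the regular sequence, taken from the last to the first, is avoided by a
  prime below the bottom of the chain, so the chain grows downwards by one.\<close>

lemma reg_ideal_chain:
  "reg_ideal k I ==> prime_chain n p ==> I \<subseteq> p 0 ==> \<exists>p'. prime_chain (n + k) p'"
proof (induction arbitrary: n p rule: reg_ideal.induct)
  case (adjoin k I x)
  have I: "ideal I R" by (rule reg_ideal_ideal[OF adjoin.hyps(1)])
  have p0: "primeideal (p 0) R" using adjoin.prems(1) by (auto simp: prime_chain_def)
  note sup = adjoin_sup[OF I adjoin.hyps(2)]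
  obtain q where q: "primeideal q R" "I \<subseteq> q" "q \<subseteq> p 0" "x \<notin> q"
    using prime_below_regular[OF I p0 _ adjoin.hyps(2,3)] sup adjoin.prems(2) by auto
  have "x \<in> p 0" using sup adjoin.prems(2) by auto
  then have "prime_chain (Suc n) (\<lambda>i. case i of 0 => q | Suc j => p j)"
    using prime_chain_cons[OF adjoin.prems(1) q(1)] q by blast
  then show ?case using adjoin.IH[of "Suc n"] q(2) by auto
qed auto

lemma reg_ideal_le_krull_dim:
  assumes "reg_ideal k I" "primeideal p R" "I \<subseteq> p"
  shows "enat k \<le> krull_dim R"
proof -
  have "prime_chain 0 (\<lambda>_. p)" using assms(2) by (simp add: prime_chain_def)
  from reg_ideal_chain[OF assms(1) this] assms(3) show ?thesis using prime_chain_krull_dim by auto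
qed

end

section \<open>Krull's principal ideal theorem\<close>

context cring begin

text \<open>The contraction to R of the extension of \<open>J\<close> to the localization at
  \<open>P\<close>. Statements about the localization are phrased in this way without constructing
  it.\<close>

definition saturation :: "'a set => 'a set => 'a set" where
  "saturation P J = {a \<in> carrier R. \<exists>t\<in>carrier R - P. t \<otimes> a \<in> J}"

lemma saturation_ideal:
  assumes P: "primeideal P R" and J: "ideal J R"
  shows "ideal (saturation P J) R"
proof (rule ideal_ofI)
  note D = idealD[OF J]
  have "\<one> \<in> carrier R - P" using primeD(2)[OF P] by simp
  then show "\<zero> \<in> saturation P J" using D(2) by (auto simp: saturation_def intro!: bexI[of _ \<one>])
  show "x \<oplus> y \<in> saturation P J" if x: "x \<in> saturation P J" and y: "y \<in> saturation P J" for x y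
  proof -
    obtain s t where st: "s \<in> carrier R - P" "s \<otimes> x \<in> J" "t \<in> carrier R - P" "t \<otimes> y \<in> J"
      using x y by (auto simp: saturation_def)
    have c: "x \<in> carrier R" "y \<in> carrier R" "s \<in> carrier R" "t \<in> carrier R" using x y st by (auto simp: saturation_def)
    have "(s \<otimes> t) \<otimes> (x \<oplus> y) = t \<otimes> (s \<otimes> x) \<oplus> s \<otimes> (t \<otimes> y)" using c by algebra
    then have "(s \<otimes> t) \<otimes> (x \<oplus> y) \<in> J" using st D(3,6) c by simp
    moreover have "s \<otimes> t \<in> carrier R - P" using st primeD(4)[OF P, of s t] by auto
    ultimately show ?thesis using c by (auto simp: saturation_def)
  qed
  show "r \<otimes> x \<in> saturation P J" if r: "r \<in> carrier R" and x: "x \<in> saturation P J" for r x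
  proof -
    obtain s where st: "s \<in> carrier R - P" "s \<otimes> x \<in> J" using x by (auto simp: saturation_def)
    have c: "x \<in> carrier R" using x by (auto simp: saturation_def)
    have "s \<otimes> (r \<otimes> x) = r \<otimes> (s \<otimes> x)" using c st r by (auto intro: m_lcomm)
    then show ?thesis using st D(6)[OF r st(2)] c r by (auto simp: saturation_def intro!: bexI[of _ s])
  qed
qed (auto simp: saturation_def)

lemma saturation_sup:
  assumes P: "primeideal P R" and J: "J \<subseteq> carrier R"
  shows "J \<subseteq> saturation P J"
proof
  fix x assume "x \<in> J"
  moreover have "\<one> \<in> carrier R - P" using primeD(2)[OF P] by simp
  ultimately show "x \<in> saturation P J" using J by (auto simp: saturation_def intro!: bexI[of _ \<one>])
qed

lemma saturation_sat:
  assumes P: "primeideal P R" and a: "a \<in> carrier R" and t: "t \<in> carrier R - P" "t \<otimes> a \<in> saturation P J"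
  shows "a \<in> saturation P J"
proof -
  obtain s where s: "s \<in> carrier R - P" "s \<otimes> (t \<otimes> a) \<in> J" using t by (auto simp: saturation_def)
  have "(s \<otimes> t) \<otimes> a \<in> J" using s t a by (simp add: m_assoc)
  moreover have "s \<otimes> t \<in> carrier R - P" using s t primeD(4)[OF P, of s t] by auto
  ultimately show ?thesis using a unfolding saturation_def by blast
qed

end

context noetherian_cring begin

text \<open>Replaces the descending chain condition of the Artinian ring \<open>(R/B)\<^sub>P\<close>.\<close>

lemma saturated_descending_chain:
  assumes P: "primeideal P R" and B: "ideal B R"
    and H: "\<And>p. primeideal p R ==> B \<subseteq> p ==> p \<subseteq> P ==> p = P"
    and J: "\<And>n::nat. ideal (J n) R" "\<And>n. B \<subseteq> J n" "\<And>n. J (Suc n) \<subseteq> J n"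
  shows "\<exists>n. \<forall>m\<ge>n. J n \<subseteq> saturation P (J m)"
proof -
  \<comment> \<open>Noetherian induction: \<open>C I\<close> says that the descending chains above
    \<open>I\<close> become stationary after localization at \<open>P\<close>. For a maximal
    counterexample \<open>I\<close> one adjoins an element \<open>c\<close> whose annihilator modulo
    \<open>I\<close> is prime.\<close>
  define C where "C I \<longleftrightarrow> (\<forall>J. (\<forall>n::nat. ideal (J n) R \<and> I \<subseteq> J n \<and> J (Suc n) \<subseteq> J n) -->
    (\<exists>n. \<forall>m\<ge>n. J n \<subseteq> saturation P (J m)))" for I
  have "C B"
  proof (rule ccontr)
    assume "\<not> C B"
    define good where "good I \<longleftrightarrow> ideal I R \<and> B \<subseteq> I \<and> \<not> C I" for I
    have "\<exists>I. good I \<and> (\<forall>J. good J --> I \<subseteq> J --> J = I)"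
      by (rule ideal_max_ex[where I = B]) (use B \<open>\<not> C B\<close> in \<open>simp_all add: good_def\<close>)
    then obtain I where gI: "good I" and gmax: "\<And>J. good J ==> I \<subseteq> J ==> J = I" by blast
    then have I: "ideal I R" "B \<subseteq> I" "\<not> C I" by (simp_all add: good_def)
    have max: "C J" if "ideal J R" "B \<subseteq> J" "I \<subseteq> J" "J \<noteq> I" for J using gmax that by (auto simp: good_def)
    have "C I"
      unfolding C_def
    proof (intro allI impI)
      fix J assume "\<forall>n::nat. ideal (J n) R \<and> I \<subseteq> J n \<and> J (Suc n) \<subseteq> J n"
      then have J: "\<And>n. ideal (J n) R" "\<And>n. I \<subseteq> J n" and JS: "\<And>n. J (Suc n) \<subseteq> J n" by auto
      have dec: "J m \<subseteq> J n" if "n \<le> m" for n m using lift_Suc_antimono_le[of J, OF JS that] .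
      have Jc: "J n \<subseteq> carrier R" for n using idealD(1)[OF J(1)] by auto
      show "\<exists>n. \<forall>m\<ge>n. J n \<subseteq> saturation P (J m)"
      proof (cases "\<one> \<in> I")
        case True
        then have "J m = carrier R" for m using one_in_ideal[OF J(1)] J(2) by auto
        then show ?thesis using saturation_sup[OF P Jc] by auto
      next
        case False
        obtain c where mc: "max_colon I c" using max_colon_exists[OF I(1) one_closed False] by blast
        have c: "c \<in> carrier R" "c \<notin> I" using mc by (auto simp: max_colon_def)
        have pr: "primeideal (colon I c) R" by (rule max_colon_prime[OF I(1) mc])
        note sup = adjoin_sup[OF I(1) c(1)]
        have CI: "C (adjoin I c)" by (rule max[OF adjoin_ideal[OF I(1) c(1)]]) (use sup I(2) c(2) in auto)
        have "\<forall>n. ideal (adjoin (J n) c) R \<and> adjoin I c \<subseteq> adjoin (J n) c \<and> adjoin (J (Suc n)) c \<subseteq> adjoin (J n) c"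
          using adjoin_ideal[OF J(1) c(1)] adjoin_mono[OF J(2)] adjoin_mono[OF dec] by simp
        then have "\<exists>n. \<forall>m\<ge>n. adjoin (J n) c \<subseteq> saturation P (adjoin (J m) c)"
          using spec[OF CI[unfolded C_def], of "\<lambda>n. adjoin (J n) c"] by simp
        then obtain n0 where n0: "\<And>m. n0 \<le> m ==> adjoin (J n0) c \<subseteq> saturation P (adjoin (J m) c)"
          by blast
        have split: "\<exists>t j r. t \<in> carrier R - P \<and> j \<in> J m \<and> r \<in> carrier R \<and> t \<otimes> a = j \<oplus> r \<otimes> c"
          if "n0 \<le> m" "a \<in> J n0" for a m
        proof -
          have "a \<in> saturation P (adjoin (J m) c)" using n0[OF that(1)] adjoin_sup(1)[OF J(1)[of n0] c(1)] that(2) by blast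
          then show ?thesis unfolding saturation_def adjoin_def mem_Collect_eq by blast
        qed
        \<comment> \<open>If \<open>c\<close> lies in all \<open>J n\<close> up to factors outside
          \<open>P\<close>, the chain agrees with the one obtained by adjoining \<open>c\<close>.
          Otherwise the annihilator of \<open>c\<close> modulo \<open>I\<close> is contained in
          \<open>P\<close>, hence equals \<open>P\<close>, and the multiples \<open>r c\<close> that
          occur in \<open>J n1\<close> have \<open>r \<in> P\<close> and so lie in
          \<open>I\<close>.\<close>
        show ?thesis
        proof (cases "\<forall>n. c \<in> saturation P (J n)")
          case True
          have "a \<in> saturation P (J m)" if m: "n0 \<le> m" and a: "a \<in> J n0" for a m
          proof -
            obtain t j r where *: "t \<in> carrier R - P" "j \<in> J m" "r \<in> carrier R" "t \<otimes> a = j \<oplus> r \<otimes> c"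
              using split[OF m a] by blast
            have "r \<otimes> c \<in> saturation P (J m)" "j \<in> saturation P (J m)"
              using True idealD(6)[OF saturation_ideal[OF P J(1)]] * saturation_sup[OF P Jc] by blast+
            then have "t \<otimes> a \<in> saturation P (J m)"
              using idealD(3)[OF saturation_ideal[OF P J(1)]] *(4) by simp
            then show ?thesis using saturation_sat[OF P _ *(1)] a Jc by blast
          qed
          then show ?thesis by blast
        next
          case False
          then obtain n1 where n1: "c \<notin> saturation P (J n1)" by blast
          have cP: "r \<in> P" if "r \<in> carrier R" "r \<otimes> c \<in> J n1" for r
            using n1 that c(1) by (auto simp: saturation_def)
          then have "colon I c \<subseteq> P" using J(2) by (auto simp: colon_def)
          moreover have "B \<subseteq> colon I c" using colon_sup[OF I(1) c(1)] I(2) by auto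
          ultimately have PI: "colon I c = P" by (intro H[OF pr])
          have "a \<in> saturation P (J m)" if m: "max n0 n1 \<le> m" and a: "a \<in> J (max n0 n1)" for a m
          proof -
            have a': "a \<in> J n0" "a \<in> J n1" using a dec[of n0 "max n0 n1"] dec[of n1 "max n0 n1"] by auto
            obtain t j r where *: "t \<in> carrier R - P" "j \<in> J m" "r \<in> carrier R" "t \<otimes> a = j \<oplus> r \<otimes> c"
              using split[OF _ a'(1), of m] m by auto
            have j1: "j \<in> J n1" using *(2) dec[of n1 m] m by auto
            have cc: "j \<in> carrier R" "a \<in> carrier R" using j1 a'(2) Jc by auto
            have "r \<otimes> c = (j \<oplus> r \<otimes> c) \<ominus> j" using cc c(1) *(3) by algebra
            also have "\<dots> \<in> J n1"
              using idealD(5)[OF J(1) idealD(6)[OF J(1) _ a'(2), of t] j1] *(1,4) by simp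
            finally have "r \<in> P" by (rule cP[OF *(3)])
            then have "r \<otimes> c \<in> J m" using PI J(2) by (auto simp: colon_def)
            then have "t \<otimes> a \<in> J m" using idealD(3)[OF J(1) *(2)] *(4) by simp
            then show ?thesis using *(1) cc by (auto simp: saturation_def)
          qed
          then show ?thesis by blast
        qed
      qed
    qed
    then show False using I(3) by simp
  qed
  then show ?thesis using J unfolding C_def by simp
qed

text \<open>Nakayama's lemma in the localization, by a maximal counterexample: a saturated ideal
  \<open>I\<close> over \<open>q'\<close> that does not contain \<open>q\<close>. If
  \<open>a x\<close> were outside \<open>I\<close> for some \<open>a\<close> in \<open>q\<close>,
  the larger saturated ideal would contain \<open>a\<close>, and \<open>(t - r x) a \<in> I\<close>
  would follow with a factor outside \<open>P\<close>.\<close>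

lemma nakayama_saturation:
  assumes P: "primeideal P R" and x: "x \<in> P" and q: "ideal q R" and q': "ideal q' R"
    and split: "\<And>a. a \<in> q ==> \<exists>t\<in>carrier R - P. \<exists>b\<in>q'. \<exists>r\<in>q. t \<otimes> a = b \<oplus> r \<otimes> x"
  shows "q \<subseteq> saturation P q'"
proof (rule ccontr)
  assume nq: "\<not> q \<subseteq> saturation P q'"
  define good where "good I \<longleftrightarrow> ideal I R \<and> q' \<subseteq> I \<and> (\<forall>a\<in>carrier R. \<forall>t\<in>carrier R - P. t \<otimes> a \<in> I --> a \<in> I) \<and> \<not> q \<subseteq> I" for I
  have "\<exists>I. good I \<and> (\<forall>J. good J --> I \<subseteq> J --> J = I)"
  proof (rule ideal_max_ex[where I = "saturation P q'"])
    have "q' \<subseteq> carrier R" using idealD(1)[OF q'] by auto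
    then show "good (saturation P q')"
      using saturation_ideal[OF P q'] saturation_sup[OF P] saturation_sat[OF P] nq unfolding good_def by blast
  qed (simp add: good_def)
  then obtain I where gI: "good I" and max: "\<And>J. good J ==> I \<subseteq> J ==> J = I" by blast
  have I: "ideal I R" "q' \<subseteq> I" "\<not> q \<subseteq> I" and sat: "\<And>a t. a \<in> carrier R ==> t \<in> carrier R - P ==> t \<otimes> a \<in> I ==> a \<in> I"
    using gI by (auto simp: good_def)
  have xc: "x \<in> carrier R" using primeD(3)[OF P] x by auto
  have qc: "a \<in> carrier R" if "a \<in> q" for a using idealD(1)[OF q that] .
  have xa: "a \<otimes> x \<in> I" if a: "a \<in> q" for a
  proof (rule ccontr)
    assume n: "a \<otimes> x \<notin> I"
    have ac: "a \<in> carrier R" "a \<otimes> x \<in> carrier R" using qc[OF a] xc by auto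
    define J where "J = saturation P (adjoin I (a \<otimes> x))"
    have ai: "ideal (adjoin I (a \<otimes> x)) R" by (rule adjoin_ideal[OF I(1) ac(2)])
    have aJ: "adjoin I (a \<otimes> x) \<subseteq> J" unfolding J_def using idealD(1)[OF ai] by (intro saturation_sup[OF P]) auto
    have "J \<noteq> I" "I \<subseteq> J" using adjoin_sup[OF I(1) ac(2)] aJ n by auto
    then have "\<not> good J" using max by blast
    moreover have "ideal J R" "q' \<subseteq> J" using saturation_ideal[OF P ai] \<open>I \<subseteq> J\<close> I(2) by (auto simp: J_def)
    moreover have "\<forall>a\<in>carrier R. \<forall>t\<in>carrier R - P. t \<otimes> a \<in> J --> a \<in> J" using saturation_sat[OF P] by (auto simp: J_def)
    ultimately have "a \<in> J" using a by (auto simp: good_def)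
    then obtain t i r where *: "t \<in> carrier R - P" "i \<in> I" "r \<in> carrier R" "t \<otimes> a = i \<oplus> r \<otimes> (a \<otimes> x)"
      by (auto simp: J_def saturation_def adjoin_def)
    have ic: "i \<in> carrier R" using idealD(1)[OF I(1)] * by auto
    \<comment> \<open>The place of the usual unit \<open>1 - r x\<close>: subtracting an element of
      \<open>P\<close> cannot bring \<open>t\<close> into \<open>P\<close>.\<close>
    have tr: "t \<ominus> r \<otimes> x \<in> carrier R - P"
    proof -
      have "t = (t \<ominus> r \<otimes> x) \<oplus> r \<otimes> x" using * xc by (auto simp: a_minus_def a_assoc l_neg)
      then show ?thesis using * xc x idealD(3,6)[OF primeD(1)[OF P]] by (metis Diff_iff m_closed minus_closed)
    qed
    have "(t \<ominus> r \<otimes> x) \<otimes> a = t \<otimes> a \<ominus> r \<otimes> (a \<otimes> x)"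
    proof -
      have "t \<in> carrier R" using *(1) by simp
      then show ?thesis using *(3) ac xc by algebra
    qed
    also have "\<dots> = i" unfolding *(4) using ic *(3) ac by (simp add: a_minus_def a_assoc r_neg)
    finally have "(t \<ominus> r \<otimes> x) \<otimes> a \<in> I" using *(2) by simp
    then have "a \<in> I" by (rule sat[OF ac(1) tr])
    then show False using n idealD(7)[OF I(1) xc] by blast
  qed
  have "a \<in> I" if a: "a \<in> q" for a
  proof -
    obtain t b r where *: "t \<in> carrier R - P" "b \<in> q'" "r \<in> q" "t \<otimes> a = b \<oplus> r \<otimes> x" using split[OF a] by blast
    then have "t \<otimes> a \<in> I" using idealD(3)[OF I(1)] I(2) xa by auto
    then show ?thesis by (rule sat[OF qc[OF a] *(1)])
  qed
  then show False using I(3) by auto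
qed

text \<open>If \<open>P\<close> were minimal over \<open>P0 + (x)\<close>, the symbolic powers of an element \<open>y\<close> of \<open>P1\<close> would be
  stationary modulo \<open>x\<close>, hence stationary.\<close>

lemma prime_between:
  assumes P0: "primeideal P0 R" and P1: "primeideal P1 R" and P: "primeideal P R"
    and sub: "P0 \<subset> P1" "P1 \<subset> P" and x: "x \<in> P"
  shows "\<exists>p. primeideal p R \<and> P0 \<subseteq> p \<and> x \<in> p \<and> p \<subset> P"
proof (rule ccontr)
  assume no: "\<not> ?thesis"
  have xc: "x \<in> carrier R" using primeD(3)[OF P] x by auto
  note P0i = primeD(1)[OF P0]
  define B where "B = adjoin P0 x"
  have B: "ideal B R" unfolding B_def by (rule adjoin_ideal[OF P0i xc])
  note Bsup = adjoin_sup[OF P0i xc, folded B_def]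
  have H: "p = P" if "primeideal p R" "B \<subseteq> p" "p \<subseteq> P" for p using no that Bsup by blast
  have xP1: "x \<notin> P1" using no P1 sub by blast
  obtain y where y: "y \<in> P1" "y \<notin> P0" using sub by blast
  have yc: "y \<in> carrier R" using primeD(3)[OF P1] y by auto
  have ync: "y [^] n \<in> carrier R" for n :: nat using yc by simp
  \<comment> \<open>Modulo \<open>P0\<close> these are the contractions of the powers of
    \<open>y\<close> from the localization at \<open>P1\<close>.\<close>
  define q where "q n = saturation P1 (adjoin P0 (y [^] n))" for n :: nat
  have ai: "ideal (adjoin P0 (y [^] n)) R" for n :: nat by (rule adjoin_ideal[OF P0i ync])
  have aic: "adjoin P0 (y [^] n) \<subseteq> carrier R" for n :: nat using idealD(1)[OF ai] by auto
  have qi: "ideal (q n) R" for n unfolding q_def by (rule saturation_ideal[OF P1 ai])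
  have qsup: "adjoin P0 (y [^] n) \<subseteq> q n" for n unfolding q_def by (rule saturation_sup[OF P1 aic])
  have yq: "y [^] n \<in> q n" for n using adjoin_sup(2)[OF P0i ync] qsup by blast
  have P0q: "P0 \<subseteq> q n" for n using adjoin_sup(1)[OF P0i ync] qsup by blast
  have qdec: "q (Suc n) \<subseteq> q n" for n
  proof -
    have "y [^] Suc n \<in> adjoin P0 (y [^] n)"
      using idealD(6)[OF ai yc adjoin_sup(2)[OF P0i ync]] yc by (simp add: m_comm)
    then have "adjoin P0 (y [^] Suc n) \<subseteq> adjoin P0 (y [^] n)"
      by (intro adjoin_least[OF ai adjoin_sup(1)[OF P0i ync]])
    then show ?thesis unfolding q_def saturation_def by blast
  qed
  have qsat: "a \<in> q n" if "a \<in> carrier R" "t \<in> carrier R - P1" "t \<otimes> a \<in> q n" for a t n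
    using saturation_sat[OF P1 that(1,2)] that(3) by (simp add: q_def)
  define J where "J n = adjoin (q n) x" for n
  have Ji: "ideal (J n) R" for n unfolding J_def by (rule adjoin_ideal[OF qi xc])
  have "\<exists>n. \<forall>m\<ge>n. J n \<subseteq> saturation P (J m)"
  proof (rule saturated_descending_chain[OF P B])
    show "B \<subseteq> J n" for n unfolding B_def J_def by (rule adjoin_mono[OF P0q])
    show "J (Suc n) \<subseteq> J n" for n unfolding J_def by (rule adjoin_mono[OF qdec])
  qed (use H Ji in auto)
  then obtain n where n: "J n \<subseteq> saturation P (J (Suc n))" by (metis Suc_leD order_refl le_SucI)
  have "q n \<subseteq> saturation P (q (Suc n))"
  proof (rule nakayama_saturation[OF P x qi qi])
    fix a assume a: "a \<in> q n"
    have "a \<in> J n" using adjoin_sup(1)[OF qi xc] a by (auto simp: J_def)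
    then obtain t b r where *: "t \<in> carrier R - P" "b \<in> q (Suc n)" "r \<in> carrier R" "t \<otimes> a = b \<oplus> r \<otimes> x"
    proof -
      have "a \<in> saturation P (adjoin (q (Suc n)) x)" using n \<open>a \<in> J n\<close> by (auto simp: J_def)
      then show ?thesis using that unfolding saturation_def adjoin_def mem_Collect_eq by blast
    qed
    have bc: "b \<in> carrier R" using idealD(1)[OF qi *(2)] .
    \<comment> \<open>\<open>r x\<close> lies in \<open>q n\<close>, and \<open>x\<close> is outside
      \<open>P1\<close>, for which \<open>q n\<close> is saturated; hence \<open>r\<close> lies in
      \<open>q n\<close>, as Nakayama's lemma demands.\<close>
    have "x \<otimes> r = (b \<oplus> r \<otimes> x) \<ominus> b" using bc xc *(3) by algebra
    also have "\<dots> = t \<otimes> a \<ominus> b" using *(4) by simp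
    also have "\<dots> \<in> q n" using idealD(5)[OF qi idealD(6)[OF qi _ a]] *(1,2) qdec by blast
    finally have "r \<in> q n" using qsat[OF *(3), of x n] xc xP1 by simp
    then show "\<exists>t\<in>carrier R - P. \<exists>b\<in>q (Suc n). \<exists>r\<in>q n. t \<otimes> a = b \<oplus> r \<otimes> x" using * by blast
  qed
  \<comment> \<open>Stationarity puts the n-th power of \<open>y\<close> into \<open>P0\<close> plus
    the multiples of the next power, up to factors outside \<open>P1\<close>. Cancelling this power
    modulo the prime \<open>P0\<close> leaves \<open>s t \<in> P1\<close>, although neither factor
    lies in \<open>P1\<close>.\<close>
  then obtain t where t: "t \<in> carrier R - P" "t \<otimes> y [^] n \<in> q (Suc n)" using yq[of n] by (auto simp: saturation_def)
  then obtain s p r where s: "s \<in> carrier R - P1" "p \<in> P0" "r \<in> carrier R" "s \<otimes> (t \<otimes> y [^] n) = p \<oplus> r \<otimes> y [^] Suc n"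
    by (auto simp: q_def saturation_def adjoin_def)
  have pc: "p \<in> carrier R" using idealD(1)[OF P0i s(2)] .
  have e: "(s \<otimes> t \<ominus> r \<otimes> y) \<otimes> u = p" if "u \<in> carrier R" "s \<otimes> (t \<otimes> u) = p \<oplus> r \<otimes> (u \<otimes> y)" for u
  proof -
    have "(s \<otimes> t \<ominus> r \<otimes> y) \<otimes> u = s \<otimes> (t \<otimes> u) \<ominus> r \<otimes> (u \<otimes> y)"
    proof -
      have "s \<in> carrier R" "t \<in> carrier R" using s t by auto
      then show ?thesis using s(3) yc that(1) by algebra
    qed
    also have "\<dots> = p" unfolding that(2) using pc s(3) yc that(1) by (simp add: a_minus_def a_assoc r_neg)
    finally show ?thesis .
  qed
  have "(s \<otimes> t \<ominus> r \<otimes> y) \<otimes> y [^] n \<in> P0" using e[OF ync] s(2,4) by simp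
  then have "s \<otimes> t \<ominus> r \<otimes> y \<in> P0"
    using primeD(4)[OF P0 _ ync[of n], of "s \<otimes> t \<ominus> r \<otimes> y"] prime_pow[OF P0 yc y(2), of n] s(1,3) t(1) yc by simp
  then have 1: "s \<otimes> t \<ominus> r \<otimes> y \<in> P1" using sub by auto
  have "s \<otimes> t = (s \<otimes> t \<ominus> r \<otimes> y) \<oplus> r \<otimes> y" using s t yc by (auto simp: a_minus_def a_assoc l_neg)
  then have "s \<otimes> t \<in> P1" using idealD(3)[OF primeD(1)[OF P1] 1 idealD(6)[OF primeD(1)[OF P1] s(3) y(1)]] by simp
  then show False using primeD(4)[OF P1, of s t] s t sub by auto
qed

text \<open>The step of Krull's height theorem: \<open>x\<close> is moved down the chain at the cost
  of one prime. Whenever the prime below the top misses \<open>x\<close>, it is exchanged by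
  \<open>prime_between\<close> for one that contains \<open>x\<close>.\<close>

lemma prime_chain_through:
  "prime_chain (Suc n) p ==> x \<in> p (Suc n) ==>
    \<exists>p'. prime_chain n p' \<and> p' n = p (Suc n) \<and> p 0 \<subseteq> p' 0 \<and> x \<in> p' 0"
proof (induction n arbitrary: p)
  case 0
  then show ?case by (intro exI[of _ "\<lambda>_. p 1"]) (auto simp: prime_chain_def)
next
  case (Suc n)
  have *: "\<exists>p'. prime_chain (Suc n) p' \<and> p' (Suc n) = p (Suc (Suc n)) \<and> p 0 \<subseteq> p' 0 \<and> x \<in> p' 0"
    if r: "prime_chain (Suc n) r" "x \<in> r (Suc n)" "r (Suc n) \<subset> p (Suc (Suc n))" "r 0 = p 0" for r
  proof -
    obtain r' where r': "prime_chain n r'" "r' n = r (Suc n)" "r 0 \<subseteq> r' 0" "x \<in> r' 0"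
      using Suc.IH[OF r(1,2)] by blast
    have "primeideal (p (Suc (Suc n))) R" using Suc.prems(1) by (simp add: prime_chain_def)
    then have "prime_chain (Suc n) (r'(Suc n := p (Suc (Suc n))))"
      using prime_chain_snoc[OF r'(1)] r(3) r'(2) by simp
    then show ?thesis using r' r(4) by (intro exI[of _ "r'(Suc n := p (Suc (Suc n)))"]) simp
  qed
  have pr: "\<And>i. i \<le> Suc (Suc n) ==> primeideal (p i) R" "\<And>i. i < Suc (Suc n) ==> p i \<subset> p (Suc i)"
    using Suc.prems(1) by (auto simp: prime_chain_def)
  show ?case
  proof (cases "x \<in> p (Suc n)")
    case True
    have "prime_chain (Suc n) p" using Suc.prems(1) by (auto simp: prime_chain_def)
    then show ?thesis using *[of p] True pr(2)[of "Suc n"] by simp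
  next
    case False
    \<comment> \<open>Applied to three consecutive primes at the top of the chain; \<open>w\<close>
      takes the place of the middle one.\<close>
    obtain w where w: "primeideal w R" "p n \<subseteq> w" "x \<in> w" "w \<subset> p (Suc (Suc n))"
      using prime_between[OF pr(1) pr(1) pr(1) pr(2) pr(2) Suc.prems(2)] by auto
    have "p n \<subset> w" using w False pr(2)[of n] by auto
    then have "prime_chain (Suc n) (p(Suc n := w))"
      using w(1) pr by (auto simp: prime_chain_def less_Suc_eq)
    then show ?thesis using *[of "p(Suc n := w)"] w by simp
  qed
qed

text \<open>One generator after the other is moved to the bottom of the chain, each costing at most
  one prime. The subtraction is the truncated one of natural numbers.\<close>

lemma reg_ideal_chain_through:
  "reg_ideal k I ==> I \<subseteq> M ==> prime_chain n p ==> p n = M ==>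
    \<exists>p'. prime_chain (n - k) p' \<and> p' (n - k) = M \<and> I \<subseteq> p' 0"
proof (induction arbitrary: n p rule: reg_ideal.induct)
  case zero
  then have "ideal (p 0) R" by (auto simp: prime_chain_def primeD)
  then show ?case using zero idealD(2) by (intro exI[of _ p]) auto
next
  case (adjoin k I x)
  have I: "ideal I R" by (rule reg_ideal_ideal[OF adjoin.hyps(1)])
  note sup = adjoin_sup[OF I adjoin.hyps(2)]
  obtain p' where p': "prime_chain (n - k) p'" "p' (n - k) = M" "I \<subseteq> p' 0"
    using adjoin.IH[OF _ adjoin.prems(2,3)] sup adjoin.prems(1) by blast
  show ?case
  proof (cases "n - k")
    case 0
    \<comment> \<open>The chain has already shrunk to \<open>M\<close> alone, which contains all
      generators.\<close>
    then have "n - Suc k = 0" by simp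
    then show ?thesis using p' 0 adjoin.prems(1) by (intro exI[of _ p']) auto
  next
    case (Suc m)
    have xM: "x \<in> M" using sup adjoin.prems(1) by auto
    obtain r where r: "prime_chain m r" "r m = p' (Suc m)" "p' 0 \<subseteq> r 0" "x \<in> r 0"
      using prime_chain_through[of m p' x] p' xM Suc by auto
    have ri: "ideal (r 0) R" using r(1) by (auto simp: prime_chain_def primeD)
    have "adjoin I x \<subseteq> r 0" by (rule adjoin_least[OF ri]) (use p' r in auto)
    moreover have "n - Suc k = m" using Suc by simp
    ultimately show ?thesis using r p' Suc by (intro exI[of _ r]) auto
  qed
qed

text \<open>A regular sequence of length \<open>k\<close> produces a chain of that length. A chain
  that ends in \<open>M\<close> and is longer than \<open>k\<close> would leave, after moving all
  generators to its bottom, a prime over \<open>M\<close> that is strictly below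
  \<open>M\<close>.\<close>

theorem regular_local_krull_dim:
  assumes M: "maximalideal M R" and loc: "\<And>p. primeideal p R ==> p \<subseteq> M" and reg: "reg_ideal k M"
  shows "krull_dim R = enat k"
proof (rule antisym)
  have Mp: "primeideal M R" by (rule maximal_prime[OF M])
  show "enat k \<le> krull_dim R" by (rule reg_ideal_le_krull_dim[OF reg Mp subset_refl])
  have top: "n \<le> k" if ch: "prime_chain n p" "p n = M" for n p
  proof (rule ccontr)
    assume "\<not> n \<le> k"
    obtain p' where p': "prime_chain (n - k) p'" "p' (n - k) = M" "M \<subseteq> p' 0"
      using reg_ideal_chain_through[OF reg subset_refl ch] by blast
    have "p' 0 \<subset> p' (Suc i)" if "i < n - k" for i
      using that
    proof (induction i)
      case (Suc i)
      then have "p' (Suc i) \<subset> p' (Suc (Suc i))" using p'(1) by (simp add: prime_chain_def)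
      then show ?case using Suc by auto
    qed (use p'(1) in \<open>simp add: prime_chain_def\<close>)
    moreover have "n - k - 1 < n - k" "Suc (n - k - 1) = n - k" using \<open>\<not> n \<le> k\<close> by auto
    ultimately have "p' 0 \<subset> p' (n - k)" by metis
    then show False using p' by auto
  qed
  show "krull_dim R \<le> enat k"
  proof (rule krull_dim_le)
    fix n p assume ch: "prime_chain n p"
    show "n \<le> k"
    proof (cases "p n = M")
      case True
      then show ?thesis using top ch by blast
    next
      case False
      then have "p n \<subset> M" using loc[of "p n"] ch by (auto simp: prime_chain_def)
      then show ?thesis using top[OF prime_chain_snoc[OF ch Mp]] by simp
    qed
  qed
qed

end

section \<open>Cohomological bounds for the aisle\<close>

text \<open>Above degree \<open>i\<close> the complex splits. A retraction onto the cocycles in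
  degree \<open>i + 1\<close>, which are coboundaries, lifts along the differential to some
  \<open>\<sigma>\<close>, and subtracting from each \<open>x\<close> the image under
  \<open>\<sigma>\<close> of its differential is a retraction in degree \<open>i\<close>. Its
  consequence is that these cocycles are finitely generated.\<close>

lemma cocycle_retraction:
  assumes Q: "fp_complex R Q" and ex: "\<And>k. i < k ==> exact_at Q k"
  shows "\<exists>\<rho>\<in>mod_hom R (Q$i) (Q$i).
    (\<forall>x\<in>Q$$i. \<rho> x \<in> cocycles Q i) \<and> (\<forall>z\<in>cocycles Q i. \<rho> z = z)"
proof -
  have Qc: "is_complex R Q" and pr: "fg_proj R (Q$j)" for j using Q by (auto simp: fp_complex_def)
  have mQ: "module R (Q$j)" for j by (rule cx_module[OF Qc])
  obtain b where top: "\<And>j. b < j ==> Q$$j = {\<zero>\<^bsub>Q$j\<^esub>}"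
    using Q unfolding fp_complex_def by blast
  have "\<exists>\<rho>\<in>mod_hom R (Q$i) (Q$i).
    (\<forall>x\<in>Q$$i. \<rho> x \<in> cocycles Q i) \<and> (\<forall>z\<in>cocycles Q i. \<rho> z = z)"
    if "\<And>k. i < k ==> exact_at Q k" "b + 1 - i \<le> int m" for i and m :: nat
    using that
  proof (induction m arbitrary: i)
    case 0
    then have "x \<in> cocycles Q i" if "x \<in> Q$$i" for x
      using top[of i] that cob_cocycles[OF Qc cob_zero[OF Qc, of i]] by auto
    then show ?case by (intro bexI[of _ "\<lambda>x. x"] mod_hom_ident) auto
  next
    case (Suc m)
    have "\<exists>\<rho>\<in>mod_hom R (Q$(i + 1)) (Q$(i + 1)).
      (\<forall>x\<in>Q$$(i + 1). \<rho> x \<in> cocycles Q (i + 1)) \<and> (\<forall>z\<in>cocycles Q (i + 1). \<rho> z = z)"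
      using Suc.prems by (intro Suc.IH) auto
    then obtain \<rho> where \<rho>h: "\<rho> \<in> mod_hom R (Q$(i + 1)) (Q$(i + 1))"
      and \<rho>Z: "\<And>x. x \<in> Q$$(i + 1) ==> \<rho> x \<in> cocycles Q (i + 1)"
      and \<rho>z: "\<And>z. z \<in> cocycles Q (i + 1) ==> \<rho> z = z" by blast
    have dh: "diff Q i \<in> mod_hom R (Q$i) (Q$(i + 1))" by (rule cx_diff[OF Qc refl])
    have "\<rho> x \<in> diff Q i ` Q$$i" if "x \<in> Q$$(i + 1)" for x
      using \<rho>Z[OF that] Suc.prems(1)[of "i + 1"] by (auto simp: exact_at_def coboundaries_def)
    then obtain \<sigma> where \<sigma>h: "\<sigma> \<in> mod_hom R (Q$(i + 1)) (Q$i)"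
      and \<sigma>: "\<And>x. x \<in> Q$$(i + 1) ==> diff Q i (\<sigma> x) = \<rho> x"
      using fg_proj_lift[OF pr mQ mQ dh \<rho>h] by blast
    interpret Q0: module R "Q$i" by (rule mQ)
    interpret Q1: module R "Q$(i + 1)" by (rule mQ)
    define \<tau> where "\<tau> x = x \<ominus>\<^bsub>Q$i\<^esub> \<sigma> (diff Q i x)" for x
    have "\<tau> \<in> mod_hom R (Q$i) (Q$i)"
      unfolding \<tau>_def by (rule mod_hom_sub[OF mQ mod_hom_ident mod_hom_comp[OF dh \<sigma>h]])
    moreover have "\<tau> x \<in> cocycles Q i" if x: "x \<in> Q$$i" for x
    proof -
      have dx: "diff Q i x \<in> Q$$(i + 1)" by (rule mod_hom_closed[OF dh x])
      have sx: "\<sigma> (diff Q i x) \<in> Q$$i" by (rule mod_hom_closed[OF \<sigma>h dx])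
      have "diff Q i x \<in> cocycles Q (i + 1)" by (rule cob_cocycles[OF Qc cobI[OF x refl refl]])
      then have "diff Q i (\<tau> x) = \<zero>\<^bsub>Q$(i + 1)\<^esub>"
        using mod_hom_diff[OF mQ mQ dh x sx] \<sigma>[OF dx] \<rho>z dx by (simp add: \<tau>_def a_minus_def Q1.r_neg)
      then show ?thesis using x sx by (simp add: cocycles_def \<tau>_def)
    qed
    moreover have "\<tau> z = z" if z: "z \<in> cocycles Q i" for z
      using z mod_hom_zero[OF mQ mQ \<sigma>h] by (simp add: \<tau>_def cocycles_def)
    ultimately show ?case by blast
  qed
  from this[of i "nat (b + 1 - i)"] show ?thesis using ex by auto
qed

text \<open>Exactness of the complex of maps to R/I, with maps represented by lifts to the ring. The
  induction is the long exact sequence of multiplication by \<open>x\<close> on R/I, carried out by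
  hand, and loses one degree for each element of the regular sequence.\<close>

lemma dual_exact_mod_regular:
  fixes R (structure)
  assumes nr: "noetherian_cring R" and Q: "fp_complex R Q" and dual: "\<And>s. s0 \<le> s ==> dual_exact R Q s"
    and reg: "cring.reg_ideal R k I"
  shows "s0 + int k \<le> s ==> f \<in> mod_hom R (Q$s) (ring_mod R) ==>
      (\<And>x. x \<in> Q$$(s - 1) ==> f (diff Q (s - 1) x) \<in> I) ==>
      \<exists>g\<in>mod_hom R (Q$(s + 1)) (ring_mod R). \<forall>x\<in>Q$$s. f x \<ominus>\<^bsub>R\<^esub> g (diff Q s x) \<in> I"
proof -
  interpret noetherian_cring R by fact
  have rm: "module R (ring_mod R)" by (rule module_ring_mod[OF cring_axioms])
  have Qc: "is_complex R Q" and pr: "fg_proj R (Q$j)" for j using Q by (auto simp: fp_complex_def)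
  have mQ: "module R (Q$j)" for j by (rule cx_module[OF Qc])
  show "s0 + int k \<le> s ==> f \<in> mod_hom R (Q$s) (ring_mod R) ==>
      (\<And>x. x \<in> Q$$(s - 1) ==> f (diff Q (s - 1) x) \<in> I) ==>
      \<exists>g\<in>mod_hom R (Q$(s + 1)) (ring_mod R). \<forall>x\<in>Q$$s. f x \<ominus>\<^bsub>R\<^esub> g (diff Q s x) \<in> I"
    using reg
  proof (induction arbitrary: s f rule: reg_ideal.induct)
    case zero
    obtain g where g: "g \<in> mod_hom R (Q$(s + 1)) (ring_mod R)" "\<And>x. x \<in> Q$$s ==> f x = g (diff Q s x)"
      using dual[of s] zero unfolding dual_exact_def by auto
    have "g (diff Q s x) \<in> carrier R" if "x \<in> Q$$s" for x
      using mod_hom_closed[OF g(1) cx_diff_closed[OF Qc refl that]] by simp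
    then show ?case using g by (intro bexI[of _ g]) (auto simp: a_minus_def r_neg)
  next
    case (adjoin k I x)
    have I: "ideal I R" by (rule reg_ideal_ideal[OF adjoin.hyps(1)])
    note x = adjoin.hyps(2) and f = adjoin.prems(2)
    have dh: "diff Q (s - 1) \<in> mod_hom R (Q$(s - 1)) (Q$s)"
      "diff Q (s - 2) \<in> mod_hom R (Q$(s - 2)) (Q$(s - 1))"
      by (rule cx_diff[OF Qc]; simp)+
    have fc: "f y \<in> carrier R" if "y \<in> Q$$s" for y using mod_hom_closed[OF f that] by simp
    have fdc: "f (diff Q (s - 1) y) \<in> carrier R" if "y \<in> Q$$(s - 1)" for y
      using fc mod_hom_closed[OF dh(1) that] by simp
    \<comment> \<open>The connecting map: \<open>f\<close> composed with the differential is
      divisible by \<open>x\<close> modulo \<open>I\<close>. As \<open>x\<close> is regular modulo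
      \<open>I\<close>, the quotient \<open>h\<close> is a cocycle modulo \<open>I\<close> in degree
      \<open>s - 1\<close>.\<close>
    have "\<exists>h\<in>mod_hom R (Q$(s - 1)) (ring_mod R).
        \<forall>y\<in>Q$$(s - 1). f (diff Q (s - 1) y) \<ominus> h y \<otimes> x \<in> I"
    proof (rule fg_proj_select[OF pr rm, where Q = "\<lambda>y a. f (diff Q (s - 1) y) \<ominus> a \<otimes> x \<in> I"])
      fix y assume y: "y \<in> Q$$(s - 1)"
      obtain i a where ia: "i \<in> I" "a \<in> carrier R" "f (diff Q (s - 1) y) = i \<oplus> a \<otimes> x"
        using adjoin.prems(3)[OF y] by (auto simp: adjoin_def)
      have ic: "i \<in> carrier R" by (rule idealD(1)[OF I ia(1)])
      have "(i \<oplus> a \<otimes> x) \<ominus> a \<otimes> x = i" using ic ia(2) x by algebra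
      then show "\<exists>m\<in>carrier (ring_mod R). f (diff Q (s - 1) y) \<ominus> m \<otimes> x \<in> I" using ia by (intro bexI[of _ a]) simp_all
    next
      fix p m p' m' assume *: "p \<in> Q$$(s - 1)" "m \<in> carrier (ring_mod R)"
        "p' \<in> Q$$(s - 1)" "m' \<in> carrier (ring_mod R)"
        "f (diff Q (s - 1) p) \<ominus> m \<otimes> x \<in> I" "f (diff Q (s - 1) p') \<ominus> m' \<otimes> x \<in> I"
      have "f (diff Q (s - 1) (p \<oplus>\<^bsub>Q$(s - 1)\<^esub> p')) = f (diff Q (s - 1) p) \<oplus> f (diff Q (s - 1) p')"
        using * mod_hom_add[OF dh(1)] mod_hom_add[OF f] mod_hom_closed[OF dh(1)] by simp
      moreover have "(u \<oplus> u') \<ominus> (m \<oplus> m') \<otimes> x = (u \<ominus> m \<otimes> x) \<oplus> (u' \<ominus> m' \<otimes> x)"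
        if "u \<in> carrier R" "u' \<in> carrier R" for u u'
      proof -
        have "m \<in> carrier R" "m' \<in> carrier R" using * by auto
        then show ?thesis using that x by algebra
      qed
      ultimately show "f (diff Q (s - 1) (p \<oplus>\<^bsub>Q$(s - 1)\<^esub> p')) \<ominus> (m \<oplus>\<^bsub>ring_mod R\<^esub> m') \<otimes> x \<in> I"
        using idealD(3)[OF I *(5,6)] fdc * by simp
    next
      fix a p m assume *: "a \<in> carrier R" "p \<in> Q$$(s - 1)" "m \<in> carrier (ring_mod R)"
        "f (diff Q (s - 1) p) \<ominus> m \<otimes> x \<in> I"
      have "f (diff Q (s - 1) (a \<odot>\<^bsub>Q$(s - 1)\<^esub> p)) = a \<otimes> f (diff Q (s - 1) p)"
        using * mod_hom_smult[OF dh(1)] mod_hom_smult[OF f] mod_hom_closed[OF dh(1)] by simp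
      moreover have "a \<otimes> u \<ominus> (a \<otimes> m) \<otimes> x = a \<otimes> (u \<ominus> m \<otimes> x)" if "u \<in> carrier R" for u
      proof -
        have "m \<in> carrier R" using * by auto
        then show ?thesis using that x *(1) by algebra
      qed
      ultimately show "f (diff Q (s - 1) (a \<odot>\<^bsub>Q$(s - 1)\<^esub> p)) \<ominus> (a \<odot>\<^bsub>ring_mod R\<^esub> m) \<otimes> x \<in> I"
        using idealD(6)[OF I *(1,4)] fdc * by simp
    qed
    then obtain h where h: "h \<in> mod_hom R (Q$(s - 1)) (ring_mod R)"
      and hx: "\<And>y. y \<in> Q$$(s - 1) ==> f (diff Q (s - 1) y) \<ominus> h y \<otimes> x \<in> I" by blast
    have hc: "h y \<in> carrier R" if "y \<in> Q$$(s - 1)" for y using mod_hom_closed[OF h that] by simp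
    have hd: "h (diff Q (s - 2) y) \<in> I" if y: "y \<in> Q$$(s - 2)" for y
    proof -
      have dy: "diff Q (s - 2) y \<in> Q$$(s - 1)" by (rule mod_hom_closed[OF dh(2) y])
      have "f (diff Q (s - 1) (diff Q (s - 2) y)) = \<zero>"
        using cx_dd[OF Qc _ _ y, of "s - 1" s] mod_hom_zero[OF mQ rm f] by simp
      then have "\<zero> \<ominus> h (diff Q (s - 2) y) \<otimes> x \<in> I" using hx[OF dy] by simp
      then have "\<ominus> (\<zero> \<ominus> h (diff Q (s - 2) y) \<otimes> x) \<in> I" by (rule idealD(4)[OF I])
      then have "h (diff Q (s - 2) y) \<otimes> x \<in> I" using hc[OF dy] x by (simp add: a_minus_def)
      then show ?thesis by (rule adjoin.hyps(3)[OF hc[OF dy]])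
    qed
    \<comment> \<open>The use of degree \<open>s - 1\<close> is what raises the bound by
      one.\<close>
    obtain g' where g': "g' \<in> mod_hom R (Q$s) (ring_mod R)"
      and hg: "\<And>y. y \<in> Q$$(s - 1) ==> h y \<ominus> g' (diff Q (s - 1) y) \<in> I"
      using adjoin.IH[of "s - 1" h] h hd adjoin.prems(1) by auto
    have g'c: "g' y \<in> carrier R" if "y \<in> Q$$s" for y using mod_hom_closed[OF g' that] by simp
    \<comment> \<open>Unchanged modulo I + (x), but now a cocycle modulo \<open>I\<close>, so the
      hypothesis for \<open>I\<close> applies in degree \<open>s\<close>.\<close>
    define f' where "f' y = f y \<ominus> x \<otimes> g' y" for y
    have f'h: "f' \<in> mod_hom R (Q$s) (ring_mod R)"
      using mod_hom_sub[OF rm f mod_hom_scale[OF rm g' x]] unfolding f'_def by simp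
    have "f' (diff Q (s - 1) y) \<in> I" if y: "y \<in> Q$$(s - 1)" for y
    proof -
      have dy: "diff Q (s - 1) y \<in> Q$$s" by (rule mod_hom_closed[OF dh(1) y])
      have "f' (diff Q (s - 1) y) = (f (diff Q (s - 1) y) \<ominus> h y \<otimes> x) \<oplus> x \<otimes> (h y \<ominus> g' (diff Q (s - 1) y))"
        unfolding f'_def using fdc[OF y] hc[OF y] g'c[OF dy] x by algebra
      then show ?thesis using idealD(3)[OF I hx[OF y] idealD(6)[OF I x hg[OF y]]] by simp
    qed
    then obtain g where g: "g \<in> mod_hom R (Q$(s + 1)) (ring_mod R)"
      and fg: "\<And>y. y \<in> Q$$s ==> f' y \<ominus> g (diff Q s y) \<in> I"
      using adjoin.IH[of s f'] f'h adjoin.prems(1) by auto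
    have "f y \<ominus> g (diff Q s y) \<in> adjoin I x" if y: "y \<in> Q$$s" for y
    proof -
      have gc: "g (diff Q s y) \<in> carrier R" using mod_hom_closed[OF g cx_diff_closed[OF Qc refl y]] by simp
      have "f y \<ominus> g (diff Q s y) = (f' y \<ominus> g (diff Q s y)) \<oplus> g' y \<otimes> x"
        unfolding f'_def using fc[OF y] gc g'c[OF y] x by algebra
      then show ?thesis using fg[OF y] g'c[OF y] unfolding adjoin_def by blast
    qed
    then show ?case using g by blast
  qed
qed

text \<open>Adding the generators to \<open>B\<close> one by one gives a filtration that reaches
  \<open>Z\<close>. At a step where it passes from a proper submodule \<open>N\<close> to
  \<open>Z\<close>, the generator just added generates Z/N.\<close>

lemma cyclic_quotient:
  assumes M: "module R M" and B: "submodule B R M" and Z: "submodule Z R M" "B \<subset> Z"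
    and z: "\<And>k. k < (n :: nat) ==> z k \<in> Z"
    and gen: "\<And>y. y \<in> Z ==> \<exists>r. (\<forall>k<n. r k \<in> carrier R) \<and> y = finsum M (\<lambda>k. r k \<odot>\<^bsub>M\<^esub> z k) {..<n}"
  shows "\<exists>N w. submodule N R M \<and> B \<subseteq> N \<and> N \<subseteq> Z \<and> w \<in> Z \<and> w \<notin> N \<and>
    (\<forall>y\<in>Z. \<exists>a\<in>carrier R. y \<ominus>\<^bsub>M\<^esub> a \<odot>\<^bsub>M\<^esub> w \<in> N)"
proof -
  interpret M: module R M by fact
  note Bs = M.submoduleE[OF B] and Zs = M.submoduleE[OF Z(1)]
  have zc: "z k \<in> carrier M" if "k < n" for k using z[OF that] Zs(1) by auto
  define N where "N = rec_nat B (\<lambda>l N. {y \<oplus>\<^bsub>M\<^esub> a \<odot>\<^bsub>M\<^esub> z l | y a. y \<in> N \<and> a \<in> carrier R})"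
  have N0: "N 0 = B" and NS: "N (Suc l) = {y \<oplus>\<^bsub>M\<^esub> a \<odot>\<^bsub>M\<^esub> z l | y a. y \<in> N l \<and> a \<in> carrier R}" for l
    by (simp_all add: N_def)
  have sub: "submodule (N l) R M \<and> B \<subseteq> N l \<and> N l \<subseteq> Z" if "l \<le> n" for l
    using that
  proof (induction l)
    case 0
    then show ?case using B Z N0 by auto
  next
    case (Suc l)
    then have IH: "submodule (N l) R M" "B \<subseteq> N l" "N l \<subseteq> Z" by auto
    note Ns = M.submoduleE[OF IH(1)]
    have zl: "z l \<in> carrier M" "z l \<in> Z" using zc z Suc.prems by auto
    have inc: "y \<in> N (Suc l)" if "y \<in> N l" for y
    proof -
      have "y = y \<oplus>\<^bsub>M\<^esub> \<zero>\<^bsub>R\<^esub> \<odot>\<^bsub>M\<^esub> z l" using that Ns(1) zl by auto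
      then show ?thesis using that unfolding NS by blast
    qed
    have "submodule (N (Suc l)) R M"
    proof (rule M.submoduleI)
      show "N (Suc l) \<subseteq> carrier M" using Ns(1) zl by (auto simp: NS)
      show "\<zero>\<^bsub>M\<^esub> \<in> N (Suc l)" using inc submodule.axioms(1)[OF IH(1)] subgroup.one_closed by fastforce
      fix p assume p: "p \<in> N (Suc l)"
      then obtain y a where ya: "y \<in> N l" "a \<in> carrier R" "p = y \<oplus>\<^bsub>M\<^esub> a \<odot>\<^bsub>M\<^esub> z l" unfolding NS by blast
      have yc: "y \<in> carrier M" using ya Ns(1) by auto
      have "\<ominus>\<^bsub>M\<^esub> p = \<ominus>\<^bsub>M\<^esub> y \<oplus>\<^bsub>M\<^esub> (\<ominus>\<^bsub>R\<^esub> a) \<odot>\<^bsub>M\<^esub> z l"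
        using ya yc zl by (simp add: M.minus_add M.smult_l_minus)
      then show "\<ominus>\<^bsub>M\<^esub> p \<in> N (Suc l)" using Ns(3)[OF ya(1)] ya(2) unfolding NS by blast
      { fix q assume "q \<in> N (Suc l)"
        then obtain y' a' where ya': "y' \<in> N l" "a' \<in> carrier R" "q = y' \<oplus>\<^bsub>M\<^esub> a' \<odot>\<^bsub>M\<^esub> z l" unfolding NS by blast
        have y'c: "y' \<in> carrier M" using ya' Ns(1) by auto
        have "p \<oplus>\<^bsub>M\<^esub> q = (y \<oplus>\<^bsub>M\<^esub> y') \<oplus>\<^bsub>M\<^esub> (a \<oplus>\<^bsub>R\<^esub> a') \<odot>\<^bsub>M\<^esub> z l"
          using ya ya' yc y'c zl by (simp add: M.smult_l_distr M.M.a_ac)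
        then show "p \<oplus>\<^bsub>M\<^esub> q \<in> N (Suc l)" using Ns(5)[OF ya(1) ya'(1)] ya(2) ya'(2) unfolding NS by blast }
      fix r assume r: "r \<in> carrier R"
      have "r \<odot>\<^bsub>M\<^esub> p = r \<odot>\<^bsub>M\<^esub> y \<oplus>\<^bsub>M\<^esub> (r \<otimes>\<^bsub>R\<^esub> a) \<odot>\<^bsub>M\<^esub> z l"
        using ya yc zl r by (simp add: M.smult_r_distr M.smult_assoc1)
      then show "r \<odot>\<^bsub>M\<^esub> p \<in> N (Suc l)" using Ns(4)[OF r ya(1)] ya(2) r unfolding NS by blast
    qed
    moreover have "N (Suc l) \<subseteq> Z" using IH(3) Zs(4,5) zl by (auto simp: NS)
    ultimately show ?case using inc IH by auto
  qed
  have part: "finsum M (\<lambda>k. r k \<odot>\<^bsub>M\<^esub> z k) {..<l} \<in> N l" if "l \<le> n" and r: "\<And>k. k < n ==> r k \<in> carrier R" for r l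
    using that(1)
  proof (induction l)
    case 0
    have "\<zero>\<^bsub>M\<^esub> \<in> B" using submodule.axioms(1)[OF B] subgroup.one_closed by fastforce
    then show ?case by (simp add: N0)
  next
    case (Suc l)
    have "finsum M (\<lambda>k. r k \<odot>\<^bsub>M\<^esub> z k) {..<Suc l} = r l \<odot>\<^bsub>M\<^esub> z l \<oplus>\<^bsub>M\<^esub> finsum M (\<lambda>k. r k \<odot>\<^bsub>M\<^esub> z k) {..<l}"
      unfolding lessThan_Suc using r zc Suc.prems by (intro M.M.finsum_insert) auto
    also have "\<dots> = finsum M (\<lambda>k. r k \<odot>\<^bsub>M\<^esub> z k) {..<l} \<oplus>\<^bsub>M\<^esub> r l \<odot>\<^bsub>M\<^esub> z l"
      using r zc Suc.prems by (intro M.M.a_comm M.M.finsum_closed) auto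
    finally show ?case using Suc r[of l] unfolding NS by auto
  qed
  have Nn: "N n = Z"
  proof
    show "Z \<subseteq> N n"
    proof
      fix y assume "y \<in> Z"
      then obtain r where "\<forall>k<n. r k \<in> carrier R" "y = finsum M (\<lambda>k. r k \<odot>\<^bsub>M\<^esub> z k) {..<n}" using gen by blast
      then show "y \<in> N n" using part[of n r] by auto
    qed
  qed (use sub[of n] in auto)
  have "\<exists>l<n. N l \<noteq> Z \<and> N (Suc l) = Z"
  proof (rule ccontr)
    assume no: "\<not> ?thesis"
    have "N l \<noteq> Z" if "l \<le> n" for l using that
    proof (induction l)
      case 0
      then show ?case using Z(2) N0 by auto
    next
      case (Suc l)
      have "N l \<noteq> Z" "l < n" using Suc by simp_all
      then show ?case using no by blast
    qed
    then show False using Nn by auto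
  qed
  then obtain l where l: "l < n" "N l \<noteq> Z" "N (Suc l) = Z" by blast
  have Nl: "submodule (N l) R M" "B \<subseteq> N l" "N l \<subseteq> Z" using sub l by auto
  note Ns = M.submoduleE[OF Nl(1)]
  have "z l \<notin> N l"
  proof
    assume "z l \<in> N l"
    then have "N (Suc l) \<subseteq> N l" using Ns(4,5) by (auto simp: NS)
    then show False using l Nl(3) by auto
  qed
  moreover have "\<exists>a\<in>carrier R. y \<ominus>\<^bsub>M\<^esub> a \<odot>\<^bsub>M\<^esub> z l \<in> N l" if "y \<in> Z" for y
  proof -
    have "y \<in> N (Suc l)" using that l(3) by simp
    then obtain u a where ua: "u \<in> N l" "a \<in> carrier R" "y = u \<oplus>\<^bsub>M\<^esub> a \<odot>\<^bsub>M\<^esub> z l" unfolding NS by blast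
    have "u \<in> carrier M" using ua Ns(1) by auto
    then have "y \<ominus>\<^bsub>M\<^esub> a \<odot>\<^bsub>M\<^esub> z l = u" using ua zc[OF l(1)] by (simp add: a_minus_def M.M.a_assoc M.M.r_neg)
    then show ?thesis using ua by (intro bexI[of _ a]) auto
  qed
  ultimately show ?thesis using Nl z[OF l(1)] by (intro exI[of _ "N l"] exI[of _ "z l"]) auto
qed

text \<open>A nonzero top cohomology module would have a residue field \<open>R/\<mm>\<close> as a quotient. Mapping that
  field to the socle of \<open>R/I\<close>, with \<open>I \<subseteq> \<mm>\<close> generated by a maximal regular sequence, contradicts the
  exactness of the dual complex modulo \<open>I\<close>.\<close>

lemma exact_of_dual_exact:
  fixes R (structure)
  assumes nr: "noetherian_cring R" and kd: "krull_dim R \<le> enat d" and Q: "fp_complex R Q"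
    and dual: "\<And>s. s0 \<le> s ==> dual_exact R Q s"
    and s: "s0 + int d \<le> s" and ex: "\<And>i. s < i ==> exact_at Q i"
  shows "exact_at Q s"
proof (rule ccontr)
  interpret noetherian_cring R by fact
  have rm: "module R (ring_mod R)" by (rule module_ring_mod[OF cring_axioms])
  have Qc: "is_complex R Q" and pr: "fg_proj R (Q$j)" for j using Q by (auto simp: fp_complex_def)
  have mQ: "module R (Q$j)" for j by (rule cx_module[OF Qc])
  interpret M: module R "Q$s" by (rule mQ)
  let ?M = "Q$s"
  let ?B = "coboundaries Q s" and ?Z = "cocycles Q s"
  assume "\<not> exact_at Q s"
  then have BZ: "?B \<subset> ?Z" using cob_cocycles[OF Qc] by (auto simp: exact_at_def)
  have Bs: "submodule ?B R ?M"
    using cob_carrier[OF Qc] cob_zero[OF Qc] cob_minus[OF Qc] cob_add[OF Qc] cob_smult[OF Qc]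
    by (intro M.submoduleI) auto
  have Zs: "submodule ?Z R ?M"
    using cocycles_carrier cob_cocycles[OF Qc cob_zero[OF Qc]] cocycles_minus[OF Qc] cocycles_add[OF Qc] cocycles_smult[OF Qc]
    by (intro M.submoduleI) auto
  obtain \<rho> where \<rho>h: "\<rho> \<in> mod_hom R ?M ?M" and \<rho>Z: "\<And>x. x \<in> carrier ?M ==> \<rho> x \<in> ?Z" and \<rho>z: "\<And>z. z \<in> ?Z ==> \<rho> z = z"
    using cocycle_retraction[OF Q ex] by blast
  obtain n e \<phi> where db: "dual_basis R ?M n e \<phi>" using pr[of s] by (auto simp: fg_proj_def)
  have e: "\<And>i. i < n ==> e i \<in> carrier ?M" and \<phi>: "\<And>i. i < n ==> \<phi> i \<in> mod_hom R ?M (ring_mod R)"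
    and x: "\<And>x. x \<in> carrier ?M ==> x = finsum ?M (\<lambda>i. \<phi> i x \<odot>\<^bsub>?M\<^esub> e i) {..<n}"
    using db by (auto simp: dual_basis_def)
  have \<phi>c: "\<phi> i x \<in> carrier R" if "i < n" "x \<in> carrier ?M" for i x
    using mod_hom_closed[OF \<phi>] that by simp
  have gen: "\<exists>r. (\<forall>k<n. r k \<in> carrier R) \<and> y = finsum ?M (\<lambda>k. r k \<odot>\<^bsub>?M\<^esub> \<rho> (e k)) {..<n}" if y: "y \<in> ?Z" for y
  proof (intro exI conjI)
    have yc: "y \<in> carrier ?M" by (rule cocycles_carrier[OF y])
    show "\<forall>k<n. \<phi> k y \<in> carrier R" using \<phi>c yc by auto
    have "y = \<rho> y" using \<rho>z[OF y] by simp
    also have "\<dots> = \<rho> (finsum ?M (\<lambda>i. \<phi> i y \<odot>\<^bsub>?M\<^esub> e i) {..<n})" using arg_cong[OF x[OF yc], of \<rho>] .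
    also have "\<dots> = finsum ?M (\<lambda>i. \<rho> (\<phi> i y \<odot>\<^bsub>?M\<^esub> e i)) {..<n}"
      using e \<phi>c yc by (intro mod_hom_finsum[OF mQ mQ \<rho>h]) auto
    also have "\<dots> = finsum ?M (\<lambda>k. \<phi> k y \<odot>\<^bsub>?M\<^esub> \<rho> (e k)) {..<n}"
      using e \<phi>c yc mod_hom_closed[OF \<rho>h] by (intro M.M.finsum_cong') (auto simp: mod_hom_smult[OF \<rho>h])
    finally show "y = finsum ?M (\<lambda>k. \<phi> k y \<odot>\<^bsub>?M\<^esub> \<rho> (e k)) {..<n}" .
  qed
  have "\<exists>N w. submodule N R ?M \<and> ?B \<subseteq> N \<and> N \<subseteq> ?Z \<and> w \<in> ?Z \<and> w \<notin> N \<and>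
      (\<forall>y\<in>?Z. \<exists>a\<in>carrier R. y \<ominus>\<^bsub>?M\<^esub> a \<odot>\<^bsub>?M\<^esub> w \<in> N)"
    by (rule cyclic_quotient[OF mQ Bs Zs BZ _ gen]) (simp_all add: \<rho>Z e)
  then obtain N w where N: "submodule N R ?M" "?B \<subseteq> N" "N \<subseteq> ?Z" and w: "w \<in> ?Z" "w \<notin> N"
    and cyc: "\<And>y. y \<in> ?Z ==> \<exists>a\<in>carrier R. y \<ominus>\<^bsub>?M\<^esub> a \<odot>\<^bsub>?M\<^esub> w \<in> N"
    by blast
  note Ns = M.submoduleE[OF N(1)]
  have wc: "w \<in> carrier ?M" by (rule cocycles_carrier[OF w(1)])
  have N0: "\<zero>\<^bsub>?M\<^esub> \<in> N" using N(2) cob_zero[OF Qc] by auto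
  \<comment> \<open>The annihilator of the generator \<open>w\<close> of the cyclic module Z/N,
    which is thus R/A.\<close>
  define A where "A = {a \<in> carrier R. a \<odot>\<^bsub>?M\<^esub> w \<in> N}"
  have A: "ideal A R"
  proof (rule ideal_ofI)
    show "p \<oplus> q \<in> A" if "p \<in> A" "q \<in> A" for p q
      using that Ns(5) wc by (auto simp: A_def M.smult_l_distr)
    show "p \<otimes> q \<in> A" if "p \<in> carrier R" "q \<in> A" for p q
      using that Ns(4) wc by (auto simp: A_def M.smult_assoc1)
  qed (use N0 wc in \<open>auto simp: A_def\<close>)
  have "\<one> \<notin> A" using w(2) wc by (simp add: A_def)
  then obtain m where m: "maximalideal m R" "A \<subseteq> m" using exists_maximal_ideal[OF A] by blast
  obtain k I c where I: "reg_ideal k I" "I \<subseteq> m" and c: "c \<in> carrier R" "c \<notin> I" "\<And>a. a \<in> m ==> a \<otimes> c \<in> I"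
    using exists_regular_socle[OF m(1)] by blast
  have Ii: "ideal I R" by (rule reg_ideal_ideal[OF I(1)])
  \<comment> \<open>The length of the regular sequence depends on the maximal ideal
    \<open>m\<close>; the dimension bounds it uniformly.\<close>
  have "enat k \<le> krull_dim R" by (rule reg_ideal_le_krull_dim[OF I(1) maximal_prime[OF m(1)] I(2)])
  then have "enat k \<le> enat d" using kd by (rule order_trans)
  then have kd': "k \<le> d" by simp
  \<comment> \<open>A lift to the ring of the composite of \<open>\<rho>\<close>, the projection to
    Z/N = R/A, the projection to R/m and the map to R/I that sends one to the socle element
    \<open>c\<close>.\<close>
  have "\<exists>f\<in>mod_hom R ?M (ring_mod R). \<forall>y\<in>carrier ?M. \<exists>a\<in>carrier R. \<rho> y \<ominus>\<^bsub>?M\<^esub> a \<odot>\<^bsub>?M\<^esub> w \<in> N \<and> f y = a \<otimes> c"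
  proof (rule fg_proj_select[OF pr rm, where Q = "\<lambda>y r. \<exists>a\<in>carrier R. \<rho> y \<ominus>\<^bsub>?M\<^esub> a \<odot>\<^bsub>?M\<^esub> w \<in> N \<and> r = a \<otimes> c"])
    fix y assume "y \<in> carrier ?M"
    then obtain a where "a \<in> carrier R" "\<rho> y \<ominus>\<^bsub>?M\<^esub> a \<odot>\<^bsub>?M\<^esub> w \<in> N" using cyc[OF \<rho>Z] by blast
    then show "\<exists>m\<in>carrier (ring_mod R). \<exists>a\<in>carrier R. \<rho> y \<ominus>\<^bsub>?M\<^esub> a \<odot>\<^bsub>?M\<^esub> w \<in> N \<and> m = a \<otimes> c" using c(1) by auto
  next
    fix p r p' r' assume p: "p \<in> carrier ?M" "p' \<in> carrier ?M"
      and "\<exists>a\<in>carrier R. \<rho> p \<ominus>\<^bsub>?M\<^esub> a \<odot>\<^bsub>?M\<^esub> w \<in> N \<and> r = a \<otimes> c" "\<exists>a\<in>carrier R. \<rho> p' \<ominus>\<^bsub>?M\<^esub> a \<odot>\<^bsub>?M\<^esub> w \<in> N \<and> r' = a \<otimes> c"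
    then obtain a a' where a: "a \<in> carrier R" "\<rho> p \<ominus>\<^bsub>?M\<^esub> a \<odot>\<^bsub>?M\<^esub> w \<in> N" "r = a \<otimes> c"
      "a' \<in> carrier R" "\<rho> p' \<ominus>\<^bsub>?M\<^esub> a' \<odot>\<^bsub>?M\<^esub> w \<in> N" "r' = a' \<otimes> c" by blast
    have "\<rho> (p \<oplus>\<^bsub>?M\<^esub> p') \<ominus>\<^bsub>?M\<^esub> (a \<oplus> a') \<odot>\<^bsub>?M\<^esub> w = (\<rho> p \<ominus>\<^bsub>?M\<^esub> a \<odot>\<^bsub>?M\<^esub> w) \<oplus>\<^bsub>?M\<^esub> (\<rho> p' \<ominus>\<^bsub>?M\<^esub> a' \<odot>\<^bsub>?M\<^esub> w)"
      using a p wc mod_hom_closed[OF \<rho>h] by (simp add: mod_hom_add[OF \<rho>h] M.smult_l_distr M.M.minus_eq M.M.minus_add M.M.a_ac)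
    then have "\<rho> (p \<oplus>\<^bsub>?M\<^esub> p') \<ominus>\<^bsub>?M\<^esub> (a \<oplus> a') \<odot>\<^bsub>?M\<^esub> w \<in> N" using Ns(5)[OF a(2,5)] by simp
    then show "\<exists>a\<in>carrier R. \<rho> (p \<oplus>\<^bsub>?M\<^esub> p') \<ominus>\<^bsub>?M\<^esub> a \<odot>\<^bsub>?M\<^esub> w \<in> N \<and> r \<oplus>\<^bsub>ring_mod R\<^esub> r' = a \<otimes> c"
      using a c(1) by (intro bexI[of _ "a \<oplus> a'"]) (auto simp: l_distr)
  next
    fix b p r assume b: "b \<in> carrier R" and p: "p \<in> carrier ?M" and "\<exists>a\<in>carrier R. \<rho> p \<ominus>\<^bsub>?M\<^esub> a \<odot>\<^bsub>?M\<^esub> w \<in> N \<and> r = a \<otimes> c"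
    then obtain a where a: "a \<in> carrier R" "\<rho> p \<ominus>\<^bsub>?M\<^esub> a \<odot>\<^bsub>?M\<^esub> w \<in> N" "r = a \<otimes> c" by blast
    have "\<rho> (b \<odot>\<^bsub>?M\<^esub> p) \<ominus>\<^bsub>?M\<^esub> (b \<otimes> a) \<odot>\<^bsub>?M\<^esub> w = b \<odot>\<^bsub>?M\<^esub> (\<rho> p \<ominus>\<^bsub>?M\<^esub> a \<odot>\<^bsub>?M\<^esub> w)"
      using a b p wc mod_hom_closed[OF \<rho>h]
      by (simp add: mod_hom_smult[OF \<rho>h] M.smult_r_distr M.smult_assoc1 M.M.minus_eq M.smult_r_minus)
    then have "\<rho> (b \<odot>\<^bsub>?M\<^esub> p) \<ominus>\<^bsub>?M\<^esub> (b \<otimes> a) \<odot>\<^bsub>?M\<^esub> w \<in> N" using Ns(4)[OF b a(2)] by simp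
    then show "\<exists>a\<in>carrier R. \<rho> (b \<odot>\<^bsub>?M\<^esub> p) \<ominus>\<^bsub>?M\<^esub> a \<odot>\<^bsub>?M\<^esub> w \<in> N \<and> b \<odot>\<^bsub>ring_mod R\<^esub> r = a \<otimes> c"
      using a b c(1) by (intro bexI[of _ "b \<otimes> a"]) (auto simp: m_assoc)
  qed
  then obtain f where f: "f \<in> mod_hom R ?M (ring_mod R)"
    and fa: "\<And>y. y \<in> carrier ?M ==> \<exists>a\<in>carrier R. \<rho> y \<ominus>\<^bsub>?M\<^esub> a \<odot>\<^bsub>?M\<^esub> w \<in> N \<and> f y = a \<otimes> c" by blast
  have fB: "f y \<in> I" if y: "y \<in> ?B" for y
  proof -
    have yc: "y \<in> carrier ?M" by (rule cob_carrier[OF Qc y])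
    obtain a where a: "a \<in> carrier R" "\<rho> y \<ominus>\<^bsub>?M\<^esub> a \<odot>\<^bsub>?M\<^esub> w \<in> N" "f y = a \<otimes> c" using fa[OF yc] by blast
    have ry: "\<rho> y = y" by (rule \<rho>z[OF cob_cocycles[OF Qc y]])
    have "y \<oplus>\<^bsub>?M\<^esub> \<ominus>\<^bsub>?M\<^esub> (y \<ominus>\<^bsub>?M\<^esub> a \<odot>\<^bsub>?M\<^esub> w) = a \<odot>\<^bsub>?M\<^esub> w"
      using yc a(1) wc by (simp add: M.M.minus_eq M.M.minus_add M.M.r_neg2)
    then have "a \<odot>\<^bsub>?M\<^esub> w \<in> N" using Ns(3)[OF a(2)] Ns(5)[of y] y N(2) ry by (metis subsetD)
    then have "a \<in> m" using a(1) m(2) by (auto simp: A_def)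
    then show ?thesis using a(3) c(3) by simp
  qed
  obtain g where g: "g \<in> mod_hom R (Q$(s + 1)) (ring_mod R)"
    and fg: "\<And>x. x \<in> carrier ?M ==> f x \<ominus> g (diff Q s x) \<in> I"
  proof -
    have "\<exists>g\<in>mod_hom R (Q$(s + 1)) (ring_mod R). \<forall>x\<in>Q$$s. f x \<ominus>\<^bsub>R\<^esub> g (diff Q s x) \<in> I"
    proof (rule dual_exact_mod_regular[OF nr Q _ I(1) _ f])
      show "s0 + int k \<le> s" using s kd' by simp
      fix x assume "x \<in> Q$$(s - 1)"
      then show "f (diff Q (s - 1) x) \<in> I" by (intro fB) (auto simp: coboundaries_def)
    qed (rule dual)
    then show ?thesis using that by blast
  qed
  have fw: "f w \<in> I"
  proof -
    have "diff Q s w = \<zero>\<^bsub>Q$(s + 1)\<^esub>" using w(1) by (simp add: cocycles_def)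
    then have "g (diff Q s w) = \<zero>" using mod_hom_zero[OF mQ rm g] by simp
    moreover have "f w \<in> carrier R" using mod_hom_closed[OF f wc] by simp
    ultimately show ?thesis using fg[OF wc] by (simp add: a_minus_def)
  qed
  \<comment> \<open>The cocycle \<open>w\<close> has coefficient one modulo \<open>A\<close>, so
    \<open>f w\<close> agrees with \<open>c\<close> modulo \<open>I\<close>. But \<open>f w\<close>
    lies in \<open>I\<close>, because it factors modulo \<open>I\<close> through the differential,
    which kills \<open>w\<close>.\<close>
  obtain a where a: "a \<in> carrier R" "w \<ominus>\<^bsub>?M\<^esub> a \<odot>\<^bsub>?M\<^esub> w \<in> N" "f w = a \<otimes> c"
    using fa[OF wc] \<rho>z[OF w(1)] by auto
  have "(\<one> \<ominus> a) \<odot>\<^bsub>?M\<^esub> w = w \<ominus>\<^bsub>?M\<^esub> a \<odot>\<^bsub>?M\<^esub> w"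
    using a(1) wc by (simp add: a_minus_def M.smult_l_distr M.smult_l_minus)
  then have "\<one> \<ominus> a \<in> A" using a by (simp add: A_def)
  then have "(\<one> \<ominus> a) \<otimes> c \<in> I" using m(2) c(3) by auto
  moreover have "c = (\<one> \<ominus> a) \<otimes> c \<oplus> a \<otimes> c" using a(1) c(1) by algebra
  ultimately show False using fw a(3) c(2) idealD(3)[OF Ii] by metis
qed

text \<open>Downward induction from the degrees in which \<open>Q\<close> vanishes, which supplies
  the exactness above \<open>s\<close> that the top cohomology argument requires.\<close>

lemma exact_above_of_dual_exact:
  fixes R (structure)
  assumes nr: "noetherian_cring R" and kd: "krull_dim R \<le> enat d" and Q: "fp_complex R Q"
    and dual: "\<And>s. s0 \<le> s ==> dual_exact R Q s"
    and s: "s0 + int d \<le> s"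
  shows "exact_at Q s"
proof -
  have Qc: "is_complex R Q" using Q by (auto simp: fp_complex_def)
  obtain b where top: "\<And>j. b < j ==> Q$$j = {\<zero>\<^bsub>Q$j\<^esub>}"
    using Q unfolding fp_complex_def by blast
  have "\<forall>i. s0 + int d \<le> i --> b - i < int n --> exact_at Q i" for n
  proof (induction n)
    case 0
    show ?case
    proof (intro allI impI)
      fix i assume "b - i < int 0"
      then show "exact_at Q i" using top[of i] cob_zero[OF Qc, of i] by (auto simp: exact_at_def cocycles_def)
    qed
  next
    case (Suc n)
    show ?case
    proof (intro allI impI)
      fix i assume i: "s0 + int d \<le> i" "b - i < int (Suc n)"
      show "exact_at Q i"
        by (rule exact_of_dual_exact[OF nr kd Q dual i(1)]) (use i Suc in auto)
    qed
  qed
  from this[of "nat (b - s) + 1"] show ?thesis using s by auto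
qed

context perf_t_structure begin

lemma U_exact:
  assumes nr: "noetherian_ring R" and kd: "krull_dim R \<noteq> \<infinity>"
  shows "\<exists>h. \<forall>X\<in>U. \<forall>i\<ge>h. exact_at X i"
proof -
  have nc: "noetherian_cring R" using R nr by (simp add: noetherian_cring_def)
  obtain d where d: "krull_dim R = enat d" using kd by auto
  obtain s0 where s0: "\<And>X (Q :: ('a, 'm) cochain_complex) q s. X \<in> U ==> fp_complex R Q ==> quasi_iso R Q X q ==>
      s0 \<le> s ==> dual_exact R Q s"
    using U_factor by blast
  have "exact_at X i" if X: "X \<in> U" and i: "s0 + int d \<le> i" for X i
  proof -
    obtain Q :: "('a, 'm) cochain_complex" and q where Q: "fp_complex R Q" "quasi_iso R Q X q"
      using perfect_cover[OF UV_obj(2)[OF X]] by blast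
    have "exact_at Q i"
      by (rule exact_above_of_dual_exact[OF nc _ Q(1) s0[OF X Q] i]) (simp_all add: d)
    then show ?thesis using exact_at_quasi_iso[OF _ UV_obj(1)[OF X] Q(2)] Q(1) by (simp add: fp_complex_def)
  qed
  then show ?thesis by blast
qed

end

section \<open>Free resolutions\<close>

text \<open>Homological indexing: \<open>D t\<close> starts at position \<open>t + 1\<close>, where
  the sequence is required to be exact. The module that is resolved is the cokernel of
  \<open>D 0\<close>.\<close>

definition free_res :: "('a, 'b) ring_scheme => (nat => nat) => (nat => (nat => 'a) => nat => 'a) => bool" where
  "free_res R b D \<longleftrightarrow> (\<forall>t. D t \<in> mod_hom R (vec R (b (Suc t))) (vec R (b t)) \<and>
     (\<forall>v\<in>vecs R (b (Suc t)). D t v = (\<lambda>_. \<zero>\<^bsub>R\<^esub>) \<longleftrightarrow>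
        v \<in> D (Suc t) ` vecs R (b (Suc (Suc t)))))"

text \<open>A resolution of R/I: position 0 is the ring itself, and position 1 covers
  \<open>I\<close>.\<close>

definition ideal_res :: "('a, 'b) ring_scheme => 'a set => (nat => nat) =>
    (nat => (nat => 'a) => nat => 'a) => bool" where
  "ideal_res R I b D \<longleftrightarrow> free_res R b D \<and> b 0 = 1 \<and>
     D 0 ` vecs R (b 1) = {v \<in> vecs R 1. v 0 \<in> I}"

text \<open>The identity is null-homotopic in homological degree \<open>t + 1\<close>.\<close>

definition contractible :: "('a, 'b) ring_scheme => (nat => nat) =>
    (nat => (nat => 'a) => nat => 'a) => nat => bool" where
  "contractible R b D t \<longleftrightarrow>
     (\<exists>s\<in>mod_hom R (vec R (b (Suc t))) (vec R (b (Suc (Suc t)))).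
      \<exists>s'\<in>mod_hom R (vec R (b t)) (vec R (b (Suc t))).
      \<forall>v\<in>vecs R (b (Suc t)). v = D (Suc t) (s v) \<oplus>\<^bsub>vec R (b (Suc t))\<^esub> s' (D t v))"

definition contr_at :: "('a, 'b) ring_scheme => ('a, 'm) cochain_complex => int => bool" where
  "contr_at R X i \<longleftrightarrow>
     (\<exists>s\<in>mod_hom R (X$i) (X$(i - 1)).
      \<exists>s'\<in>mod_hom R (X$(i + 1)) (X$i).
      \<forall>x\<in>X$$i. x = diff X (i - 1) (s x) \<oplus>\<^bsub>X$i\<^esub> s' (diff X i x))"

text \<open>The homotopy from the identity to \<open>g f\<close> and the contraction of
  \<open>Q\<close>, conjugated by \<open>f\<close> and \<open>g\<close>, add up to a contraction of
  \<open>H\<close>.\<close>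

lemma contr_at_retract:
  assumes H: "is_complex R H" and Q: "is_complex R Q" and f: "f \<in> chain_maps R H Q" and g: "g \<in> chain_maps R Q H"
    and null: "null_homotopic R H H (\<lambda>i x. x \<ominus>\<^bsub>H$i\<^esub> g i (f i x))" and c: "contr_at R Q i"
  shows "contr_at R H i"
proof -
  have mH: "module R (H$j)" and mQ: "module R (Q$j)" for j using H Q by (auto intro: cx_module)
  obtain s where sh: "\<And>i. s i \<in> mod_hom R (H$i) (H$(i - 1))"
    and s: "\<And>i x. x \<in> H$$i ==>
      x \<ominus>\<^bsub>H$i\<^esub> g i (f i x) = diff H (i - 1) (s i x) \<oplus>\<^bsub>H$i\<^esub> s (i + 1) (diff H i x)"
    using null by (auto simp: null_homotopic_def)
  obtain t t' where th: "t \<in> mod_hom R (Q$i) (Q$(i - 1))"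
    and t'h: "t' \<in> mod_hom R (Q$(i + 1)) (Q$i)"
    and t: "\<And>x. x \<in> Q$$i ==> x = diff Q (i - 1) (t x) \<oplus>\<^bsub>Q$i\<^esub> t' (diff Q i x)"
    using c unfolding contr_at_def by blast
  have sh1: "s (i + 1) \<in> mod_hom R (H$(i + 1)) (H$i)" using sh[of "i + 1"] by simp
  note fh = chain_hom[OF f] and gh = chain_hom[OF g]
  show ?thesis
    unfolding contr_at_def
  proof (intro bexI ballI)
    show "(\<lambda>x. s i x \<oplus>\<^bsub>H$(i - 1)\<^esub> g (i - 1) (t (f i x))) \<in> mod_hom R (H$i) (H$(i - 1))"
      by (rule mod_hom_plus[OF mH sh mod_hom_comp[OF mod_hom_comp[OF fh th] gh]])
    show "(\<lambda>x. s (i + 1) x \<oplus>\<^bsub>H$i\<^esub> g i (t' (f (i + 1) x))) \<in> mod_hom R (H$(i + 1)) (H$i)"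
      by (rule mod_hom_plus[OF mH sh1 mod_hom_comp[OF mod_hom_comp[OF fh t'h] gh]])
    fix x assume x: "x \<in> H$$i"
    interpret H0: module R "H$i" by (rule mH)
    have fx: "f i x \<in> Q$$i" by (rule chain_closed[OF f x])
    have tfx: "t (f i x) \<in> Q$$(i - 1)" by (rule mod_hom_closed[OF th fx])
    have dfx: "diff Q i (f i x) \<in> Q$$(i + 1)" by (rule cx_diff_closed[OF Q refl fx])
    have tdfx: "t' (diff Q i (f i x)) \<in> Q$$i" by (rule mod_hom_closed[OF t'h dfx])
    have dtfx: "diff Q (i - 1) (t (f i x)) \<in> Q$$i" using cx_diff_closed[OF Q _ tfx, of i] by simp
    have sx: "s i x \<in> H$$(i - 1)" by (rule mod_hom_closed[OF sh x])
    have dx: "diff H i x \<in> H$$(i + 1)" by (rule cx_diff_closed[OF H refl x])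
    have sdx: "s (i + 1) (diff H i x) \<in> H$$i" by (rule mod_hom_closed[OF sh1 dx])
    have dsx: "diff H (i - 1) (s i x) \<in> H$$i" using cx_diff_closed[OF H _ sx, of i] by simp
    have gt: "g (i - 1) (t (f i x)) \<in> H$$(i - 1)" by (rule chain_closed[OF g tfx])
    have dgt: "diff H (i - 1) (g (i - 1) (t (f i x))) \<in> H$$i" using cx_diff_closed[OF H _ gt, of i] by simp
    have gfx: "g i (f i x) \<in> H$$i" by (rule chain_closed[OF g fx])
    have gtd: "g i (t' (diff Q i (f i x))) \<in> H$$i" by (rule chain_closed[OF g tdfx])
    have "g i (f i x) = g i (diff Q (i - 1) (t (f i x))) \<oplus>\<^bsub>H$i\<^esub> g i (t' (diff Q i (f i x)))"
      using mod_hom_add[OF gh dtfx tdfx] t[OF fx] by simp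
    also have "g i (diff Q (i - 1) (t (f i x))) = diff H (i - 1) (g (i - 1) (t (f i x)))"
      using chain_diff[OF g _ tfx, of i] by simp
    also have "diff Q i (f i x) = f (i + 1) (diff H i x)" using chain_diff[OF f refl x] by simp
    finally have 1: "g i (f i x) = diff H (i - 1) (g (i - 1) (t (f i x))) \<oplus>\<^bsub>H$i\<^esub> g i (t' (f (i + 1) (diff H i x)))" .
    have 2: "diff H (i - 1) (s i x \<oplus>\<^bsub>H$(i - 1)\<^esub> g (i - 1) (t (f i x))) =
      diff H (i - 1) (s i x) \<oplus>\<^bsub>H$i\<^esub> diff H (i - 1) (g (i - 1) (t (f i x)))"
      using mod_hom_add[OF cx_diff[OF H] sx gt, of i] by simp
    have 3: "f (i + 1) (diff H i x) = diff Q i (f i x)" using chain_diff[OF f refl x] by simp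
    have "x = (x \<ominus>\<^bsub>H$i\<^esub> g i (f i x)) \<oplus>\<^bsub>H$i\<^esub> g i (f i x)"
      using x gfx by (simp add: a_minus_def H0.M.a_assoc H0.M.l_neg)
    then have 4: "x = (diff H (i - 1) (s i x) \<oplus>\<^bsub>H$i\<^esub> s (i + 1) (diff H i x)) \<oplus>\<^bsub>H$i\<^esub>
      (diff H (i - 1) (g (i - 1) (t (f i x))) \<oplus>\<^bsub>H$i\<^esub> g i (t' (f (i + 1) (diff H i x))))"
      using s[OF x] 1 by metis
    show "x = diff H (i - 1) (s i x \<oplus>\<^bsub>H$(i - 1)\<^esub> g (i - 1) (t (f i x))) \<oplus>\<^bsub>H$i\<^esub>
      (s (i + 1) (diff H i x) \<oplus>\<^bsub>H$i\<^esub> g i (t' (f (i + 1) (diff H i x))))"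
      unfolding 2 by (rule trans[OF 4]) (use dsx sdx dgt gtd in \<open>simp add: 3 H0.M.a_ac\<close>)
  qed
qed

section \<open>Resolutions as cochain complexes and the comparison theorem\<close>

definition res_cx :: "('a, 'b) ring_scheme => (nat => nat) => (nat => (nat => 'a) => nat => 'a) => int =>
    ('a, nat => 'a) cochain_complex" where
  "res_cx R b D j = \<lparr>module_at = (\<lambda>i. if i \<le> j then vec R (b (nat (j - i))) else vec R 0),
     diff = (\<lambda>i. if i < j then D (nat (j - i - 1)) else (\<lambda>_ _. \<zero>\<^bsub>R\<^esub>))\<rparr>"

lemma res_cx_simps [simp]:
  "(res_cx R b D j)$i = (if i \<le> j then vec R (b (nat (j - i))) else vec R 0)"
  "diff (res_cx R b D j) i = (if i < j then D (nat (j - i - 1)) else (\<lambda>_ _. \<zero>\<^bsub>R\<^esub>))"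
  by (simp_all add: res_cx_def)

lemma free_resD:
  assumes "free_res R b D"
  shows "D t \<in> mod_hom R (vec R (b (Suc t))) (vec R (b t))"
    "v \<in> vecs R (b (Suc t)) ==> D t v = (\<lambda>_. \<zero>\<^bsub>R\<^esub>) ==> v \<in> D (Suc t) ` vecs R (b (Suc (Suc t)))"
    "w \<in> vecs R (b (Suc (Suc t))) ==> D t (D (Suc t) w) = (\<lambda>_. \<zero>\<^bsub>R\<^esub>)"
proof -
  have D: "D t \<in> mod_hom R (vec R (b (Suc t))) (vec R (b t))"
    "v \<in> vecs R (b (Suc t)) ==> D t v = (\<lambda>_. \<zero>\<^bsub>R\<^esub>) \<longleftrightarrow> v \<in> D (Suc t) ` vecs R (b (Suc (Suc t)))" for t v
    using assms by (auto simp: free_res_def)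
  show "D t \<in> mod_hom R (vec R (b (Suc t))) (vec R (b t))"
    "v \<in> vecs R (b (Suc t)) ==> D t v = (\<lambda>_. \<zero>\<^bsub>R\<^esub>) ==> v \<in> D (Suc t) ` vecs R (b (Suc (Suc t)))"
    using D by blast+
  show "w \<in> vecs R (b (Suc (Suc t))) ==> D t (D (Suc t) w) = (\<lambda>_. \<zero>\<^bsub>R\<^esub>)"
    using D(2)[of "D (Suc t) w" t] mod_hom_closed[OF D(1)[of "Suc t"]] by blast
qed

lemma nat_index: "i < j ==> nat (j - i) = Suc (nat (j - i - 1))" for i j :: int
  by (simp add: Suc_nat_eq_nat_zadd1)

lemma res_cx_complex:
  assumes R: "cring R" and F: "free_res R b D"
  shows "is_complex R (res_cx R b D j)"
  unfolding is_complex_def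
proof (intro allI conjI ballI)
  fix i
  have mv: "module R (vec R n)" for n by (rule module_vec_mod[OF R])
  show "module R ((res_cx R b D j)$i)" using mv by simp
  have z: "(\<lambda>_ _. \<zero>\<^bsub>R\<^esub>) \<in> mod_hom R (vec R n) (vec R m)" for n m
    using mod_hom_const_zero[OF mv[of m]] by simp
  show "diff (res_cx R b D j) i \<in> mod_hom R ((res_cx R b D j)$i) ((res_cx R b D j)$(i + 1))"
    using free_resD(1)[OF F, of "nat (j - i - 1)"] z nat_index[of i j] by (auto simp: algebra_simps)
  fix x assume x: "x \<in> (res_cx R b D j)$$i"
  show "diff (res_cx R b D j) (i + 1) (diff (res_cx R b D j) i x) = \<zero>\<^bsub>(res_cx R b D j)$(i + 2)\<^esub>"
  proof (cases "i + 1 < j")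
    case True
    then have "nat (j - i - 1) = Suc (nat (j - (i + 1) - 1))" "nat (j - i) = Suc (Suc (nat (j - (i + 1) - 1)))"
      using nat_index[of i j] nat_index[of "i + 1" j] by (simp_all add: algebra_simps)
    then show ?thesis using free_resD(3)[OF F, of x "nat (j - (i + 1) - 1)"] x True by simp
  qed simp
qed

lemma res_cx_exact:
  assumes F: "free_res R b D" and i: "i < j"
  shows "exact_at (res_cx R b D j) i"
proof -
  have e: "nat (j - i) = Suc (nat (j - i - 1))" "nat (j - (i - 1)) = Suc (Suc (nat (j - i - 1)))" "nat (j - (i - 1) - 1) = Suc (nat (j - i - 1))"
    using nat_index[OF i] nat_index[of "i - 1" j] i by (simp_all add: algebra_simps)
  then show ?thesis
    using free_resD(2)[OF F, of _ "nat (j - i - 1)"] i by (auto simp: exact_at_def cocycles_def coboundaries_def)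
qed

lemma res_cx_top_coboundaries: "coboundaries (res_cx R b D j) j = D 0 ` vecs R (b 1)"
  by (simp add: coboundaries_def)

text \<open>\<open>contractible\<close> at \<open>t\<close> is about position \<open>t + 1\<close>,
  which is placed in degree \<open>j - (t + 1)\<close>.\<close>

lemma contr_at_res_cx: "contr_at R (res_cx R b D j) (j - int (Suc t)) \<longleftrightarrow> contractible R b D t"
proof -
  have "nat (1 + int t) = Suc t" "nat (2 + int t) = Suc (Suc t)" "nat (int t + 1) = Suc t" "nat (int t + 2) = Suc (Suc t)"
    by (simp_all add: Suc_nat_eq_nat_zadd1[symmetric] nat_add_distrib)
  then show ?thesis
    unfolding contr_at_def contractible_def by (simp add: algebra_simps)
qed

lemma vec_mod_0_carrier: "vecs R 0 = {\<lambda>_. \<zero>\<^bsub>R\<^esub>}"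
  by (auto simp: vec_mod_carrier)

text \<open>The target vanishes above \<open>j\<close>, so zero maps can be used there and only the
  component \<open>f0\<close> is prescribed.\<close>

lemma chain_extension_top:
  assumes F: "is_complex R F" and proj: "\<And>i. fg_proj R (F$i)" and C: "is_complex R C"
    and top: "\<And>i. j < i ==> C$$i = {\<zero>\<^bsub>C$i\<^esub>}"
    and f0: "f0 \<in> mod_hom R (F$j) (C$j)"
    and im: "\<And>v. v \<in> coboundaries F j ==> f0 v \<in> coboundaries C j"
    and ex: "\<And>i. i < j ==> exact_at C i"
  shows "\<exists>g\<in>chain_maps R F C. g j = f0"
proof -
  define f where "f = (\<lambda>i. if i = j then f0 else (\<lambda>_. \<zero>\<^bsub>C$i\<^esub>))"
  have mC: "module R (C$i)" for i by (rule cx_module[OF C])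
  have fh: "f i \<in> mod_hom R (F$i) (C$i)" for i
    using f0 mod_hom_const_zero[OF mC] by (auto simp: f_def)
  have "\<exists>g\<in>chain_maps R F C. \<forall>i\<ge>j. g i = f i"
  proof (rule chain_extension[OF F C proj fh])
    show "f (i + 1) (diff F i x) = diff C i (f i x)" if "j \<le> i" "x \<in> F$$i" for i x
    proof -
      have "f (i + 1) (diff F i x) \<in> C$$(i + 1)"
        by (rule mod_hom_closed[OF fh cx_diff_closed[OF F refl that(2)]])
      moreover have "diff C i (f i x) \<in> C$$(i + 1)"
        by (rule cx_diff_closed[OF C refl mod_hom_closed[OF fh that(2)]])
      ultimately show ?thesis using top[of "i + 1"] that(1) by auto
    qed
    show "f j (diff F (j - 1) x) \<in> coboundaries C j" if "x \<in> F$$(j - 1)" for x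
      using im that by (auto simp: f_def coboundaries_def)
  qed (use ex in auto)
  then obtain g where "g \<in> chain_maps R F C" "\<forall>i\<ge>j. g i = f i" by blast
  then show ?thesis by (intro bexI[of _ g]) (auto simp: f_def)
qed

lemma res_cx_chain_extension:
  assumes R: "cring R" and F: "free_res R b D" and C: "is_complex R C"
    and top: "\<And>i. j < i ==> C$$i = {\<zero>\<^bsub>C$i\<^esub>}"
    and f0: "f0 \<in> mod_hom R (vec R (b 0)) (C$j)"
    and im: "\<And>v. v \<in> D 0 ` vecs R (b 1) ==> f0 v \<in> coboundaries C j"
    and ex: "\<And>i. i < j ==> exact_at C i"
  shows "\<exists>g\<in>chain_maps R (res_cx R b D j) C. g j = f0"
  by (rule chain_extension_top[OF res_cx_complex[OF R F] _ C top])
    (use f0 im ex fg_proj_vec_mod[OF R] in \<open>auto simp: res_cx_top_coboundaries\<close>)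

lemma chain_sub:
  assumes X: "is_complex R X" "is_complex R Y" and f: "f \<in> chain_maps R X Y" and g: "g \<in> chain_maps R X Y"
  shows "(\<lambda>i x. f i x \<ominus>\<^bsub>Y$i\<^esub> g i x) \<in> chain_maps R X Y"
  using mod_hom_sub[OF cx_module[OF X(2)] chain_hom[OF f] chain_hom[OF g]] chain_diff[OF f refl] chain_diff[OF g refl]
    mod_hom_diff[OF cx_module[OF X(2)] cx_module[OF X(2)] cx_diff[OF X(2) refl] chain_closed[OF f] chain_closed[OF g]]
  by (simp add: chain_maps_def)

text \<open>Uniqueness in the comparison theorem: \<open>g\<close> induces the identity on the
  cokernel of \<open>D 0\<close>, so its difference from the identity has coboundary values in the
  top degree.\<close>

lemma res_cx_null:
  assumes R: "cring R" and F: "free_res R b D" and g: "g \<in> chain_maps R (res_cx R b D j) (res_cx R b D j)"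
    and g0: "\<And>v. v \<in> vecs R (b 0) ==> v \<ominus>\<^bsub>vec R (b 0)\<^esub> g j v \<in> D 0 ` vecs R (b 1)"
  shows "null_homotopic R (res_cx R b D j) (res_cx R b D j) (\<lambda>i x. x \<ominus>\<^bsub>(res_cx R b D j)$i\<^esub> g i x)"
proof (rule null_homotopicI[where k = j])
  let ?X = "res_cx R b D j"
  show X: "is_complex R ?X" "is_complex R ?X" by (rule res_cx_complex[OF R F])+
  show "(\<lambda>i x. x \<ominus>\<^bsub>?X$i\<^esub> g i x) \<in> chain_maps R ?X ?X"
    using chain_sub[OF X chain_id g] by simp
  show "fg_proj R (?X$i)" for i using fg_proj_vec_mod[OF R] by simp
  show "?X$$i = {\<zero>\<^bsub>?X$i\<^esub>}" if "j < i" for i using that by (simp add: vec_mod_0_carrier)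
  show "x \<ominus>\<^bsub>?X$j\<^esub> g j x \<in> coboundaries ?X j" if "x \<in> ?X$$j" for x
    using g0[of x] that by (simp add: res_cx_top_coboundaries)
qed (rule res_cx_exact[OF F])

text \<open>\<open>f0\<close> and \<open>g0\<close> present the module resolved by \<open>D'\<close>
  as a direct summand of the one resolved by \<open>D\<close>. The comparison theorem lifts this to
  the resolutions, so that one is a homotopy retract of the other.\<close>

lemma contractible_transfer:
  assumes R: "cring R" and F: "free_res R b D" and H: "free_res R b' D'"
    and f0: "f0 \<in> mod_hom R (vec R (b' 0)) (vec R (b 0))"
    and g0: "g0 \<in> mod_hom R (vec R (b 0)) (vec R (b' 0))"
    and f0im: "\<And>v. v \<in> D' 0 ` vecs R (b' 1) ==> f0 v \<in> D 0 ` vecs R (b 1)"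
    and g0im: "\<And>v. v \<in> D 0 ` vecs R (b 1) ==> g0 v \<in> D' 0 ` vecs R (b' 1)"
    and gf0: "\<And>v. v \<in> vecs R (b' 0) ==> v \<ominus>\<^bsub>vec R (b' 0)\<^esub> g0 (f0 v) \<in> D' 0 ` vecs R (b' 1)"
    and c: "contractible R b D t"
  shows "contractible R b' D' t"
proof -
  let ?X = "res_cx R b D 0" and ?X' = "res_cx R b' D' 0"
  have X: "is_complex R ?X" "is_complex R ?X'" by (rule res_cx_complex[OF R] F H)+
  obtain f where f: "f \<in> chain_maps R ?X' ?X" and fe: "f 0 = f0"
    using res_cx_chain_extension[OF R H X(1), of 0 f0] f0 f0im res_cx_exact[OF F]
    by (auto simp: vec_mod_0_carrier res_cx_top_coboundaries)
  obtain g where g: "g \<in> chain_maps R ?X ?X'" and ge: "g 0 = g0"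
    using res_cx_chain_extension[OF R F X(2), of 0 g0] g0 g0im res_cx_exact[OF H]
    by (auto simp: vec_mod_0_carrier res_cx_top_coboundaries)
  have gf: "(\<lambda>i x. g i (f i x)) \<in> chain_maps R ?X' ?X'"
    using chain_comp_maps[OF f g] unfolding chain_comp_def comp_def .
  have "null_homotopic R ?X' ?X' (\<lambda>i x. x \<ominus>\<^bsub>?X'$i\<^esub> g i (f i x))"
    using res_cx_null[OF R H gf] gf0 fe ge by simp
  then show ?thesis
    using contr_at_retract[OF X(2,1) f g _ , of "0 - int (Suc t)"] c contr_at_res_cx by blast
qed

subsection \<open>Existence over Noetherian rings\<close>

lemma vec_mod_incl:
  "n \<le> m ==> vecs R n \<subseteq> vecs R m" if "cring R"
  using cring.cring_simprules(2)[OF that] by (auto simp: vec_mod_carrier) (metis not_le)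

lemma vec_mod_concat:
  assumes R: "cring R" and f: "f \<in> mod_hom R (vec R k) M" and g: "g \<in> mod_hom R (vec R l) M" and M: "module R M"
  shows "\<exists>h\<in>mod_hom R (vec R (k + l)) M. h ` vecs R (k + l) =
    {f u \<oplus>\<^bsub>M\<^esub> g w | u w. u \<in> vecs R k \<and> w \<in> vecs R l}"
proof -
  interpret cring R by fact
  define p where "p v = (\<lambda>i. if i < k then v i else \<zero>\<^bsub>R\<^esub>)" for v :: "nat => 'a"
  define q where "q v = (\<lambda>i. v (k + i))" for v :: "nat => 'a"
  have ph: "p \<in> mod_hom R (vec R (k + l)) (vec R k)"
    by (rule mod_homI) (auto simp: p_def vec_mod_carrier fun_eq_iff)
  have qh: "q \<in> mod_hom R (vec R (k + l)) (vec R l)"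
    by (rule mod_homI) (auto simp: q_def vec_mod_carrier fun_eq_iff)
  have pq: "\<exists>v\<in>vecs R (k + l). p v = u \<and> q v = w"
    if "u \<in> vecs R k" "w \<in> vecs R l" for u w
    using that by (intro bexI[of _ "\<lambda>i. if i < k then u i else w (i - k)"])
      (auto simp: p_def q_def vec_mod_carrier fun_eq_iff)
  define h where "h v = f (p v) \<oplus>\<^bsub>M\<^esub> g (q v)" for v
  have "h \<in> mod_hom R (vec R (k + l)) M"
    unfolding h_def by (rule mod_hom_plus[OF M mod_hom_comp[OF ph f] mod_hom_comp[OF qh g]])
  moreover have "h ` vecs R (k + l) =
    {f u \<oplus>\<^bsub>M\<^esub> g w | u w. u \<in> vecs R k \<and> w \<in> vecs R l}"
  proof
    show "h ` vecs R (k + l) \<subseteq>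
      {f u \<oplus>\<^bsub>M\<^esub> g w | u w. u \<in> vecs R k \<and> w \<in> vecs R l}"
      using mod_hom_closed[OF ph] mod_hom_closed[OF qh] by (auto simp: h_def)
    show "{f u \<oplus>\<^bsub>M\<^esub> g w | u w. u \<in> vecs R k \<and> w \<in> vecs R l} \<subseteq> h ` vecs R (k + l)"
      using pq by (fastforce simp: h_def)
  qed
  ultimately show ?thesis by blast
qed

lemma mod_hom_image_submodule:
  assumes M: "module R M" and N: "module R N" and f: "f \<in> mod_hom R M N" and H: "submodule H R M"
  shows "submodule (f ` H) R N"
proof -
  interpret M: module R M by fact
  interpret N: module R N by fact
  note Hs = M.submoduleE[OF H]
  have Hc: "x \<in> carrier M" if "x \<in> H" for x using Hs(1) that by auto
  show ?thesis
  proof (rule N.submoduleI)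
    show "f ` H \<subseteq> carrier N" using mod_hom_closed[OF f] Hc by auto
    have "\<zero>\<^bsub>M\<^esub> \<in> H" using submodule.axioms(1)[OF H] subgroup.one_closed by fastforce
    then show "\<zero>\<^bsub>N\<^esub> \<in> f ` H" using mod_hom_zero[OF M N f] by (metis imageI)
  next
    fix a assume "a \<in> f ` H"
    then obtain x where "x \<in> H" "a = f x" by blast
    then show "\<ominus>\<^bsub>N\<^esub> a \<in> f ` H" using mod_hom_minus[OF M N f Hc[of x]] Hs(3)[of x] by (metis imageI)
  next
    fix a b assume "a \<in> f ` H" "b \<in> f ` H"
    then obtain x y where "x \<in> H" "a = f x" "y \<in> H" "b = f y" by blast
    then show "a \<oplus>\<^bsub>N\<^esub> b \<in> f ` H" using mod_hom_add[OF f Hc[of x] Hc[of y]] Hs(5)[of x y] by (metis imageI)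
  next
    fix r a assume "r \<in> carrier R" "a \<in> f ` H"
    then obtain x where "x \<in> H" "a = f x" by blast
    then show "r \<odot>\<^bsub>N\<^esub> a \<in> f ` H" using mod_hom_smult[OF f \<open>r \<in> carrier R\<close> Hc[of x]] Hs(4)[of r x] \<open>r \<in> carrier R\<close> by (metis imageI)
  qed
qed

lemma submodule_ring_mod_ideal:
  assumes R: "cring R" and H: "submodule H R (ring_mod R)"
  shows "ideal H R"
proof -
  interpret V: module R "ring_mod R" by (rule module_ring_mod[OF R])
  note s = V.submoduleE[OF H]
  have "\<zero>\<^bsub>R\<^esub> \<in> H" using submodule.axioms(1)[OF H] subgroup.one_closed by fastforce
  then show ?thesis using s(1,4,5) by (intro cring.ideal_ofI[OF R]) auto
qed

text \<open>The last coordinates of the elements of \<open>N\<close> are those of finitely many elements: take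
  finitely many elements of \<open>N\<close> such that the ideal of last coordinates of their span is maximal.\<close>

lemma (in noetherian_cring) vec_submodule_image:
  "submodule N R (vec R n) ==> \<exists>k. \<exists>h\<in>mod_hom R (vec R k) (vec R n). h ` vecs R k = N"
proof (induction n arbitrary: N)
  case 0
  interpret V: module R "vec R 0" by (rule module_vec_mod[OF cring_axioms])
  note s = V.submoduleE[OF 0]
  have "N = vecs R 0" using s(1,2) by (auto simp: vec_mod_0_carrier)
  then show ?case by (intro exI[of _ 0] bexI[of _ "\<lambda>x. x"] mod_hom_ident) auto
next
  case (Suc n)
  have mv: "module R (vec R m)" for m by (rule module_vec_mod[OF cring_axioms])
  interpret V: module R "vec R (Suc n)" by (rule mv)
  interpret V': module R "vec R n" by (rule mv)
  note s = V.submoduleE[OF Suc.prems]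
  have sc: "v \<in> vecs R (Suc n)" if "v \<in> N" for v using s(1) that by auto
  have N0: "(\<lambda>_. \<zero>) \<in> N" using submodule.axioms(1)[OF Suc.prems] subgroup.one_closed by fastforce
  have incl: "vecs R n \<subseteq> vecs R (Suc n)" using vec_mod_incl[OF cring_axioms] by simp
  \<comment> \<open>The elements with last coordinate zero form a submodule of the free module of
    smaller rank, to which the induction hypothesis applies.\<close>
  define N' where "N' = {v \<in> N. v n = \<zero>}"
  have N'c: "N' \<subseteq> vecs R n"
  proof
    fix v assume "v \<in> N'"
    then have v: "v \<in> vecs R (Suc n)" "v n = \<zero>" using sc by (auto simp: N'_def)
    have "v i = \<zero>" if "n \<le> i" for i using v that by (cases "i = n") (auto simp: vec_mod_carrier)
    then show "v \<in> vecs R n" using v by (auto simp: vec_mod_carrier)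
  qed
  have "submodule N' R (vec R n)"
  proof (rule V'.submoduleI[OF N'c])
    show "\<zero>\<^bsub>vec R n\<^esub> \<in> N'" using N0 by (simp add: N'_def)
    show "\<ominus>\<^bsub>vec R n\<^esub> a \<in> N'" if a: "a \<in> N'" for a
      using s(3)[of a] a N'c sc vec_mod_a_inv[OF cring_axioms, of a n] vec_mod_a_inv[OF cring_axioms, of a "Suc n"]
      by (auto simp: N'_def)
    show "a \<oplus>\<^bsub>vec R n\<^esub> b \<in> N'" if "a \<in> N'" "b \<in> N'" for a b
      using s(5)[of a b] that by (auto simp: N'_def)
    show "a \<odot>\<^bsub>vec R n\<^esub> x \<in> N'" if "a \<in> carrier R" "x \<in> N'" for a x
      using s(4)[of a x] that by (auto simp: N'_def)
  qed
  then obtain k' h' where h': "h' \<in> mod_hom R (vec R k') (vec R n)" and h'N: "h' ` vecs R k' = N'"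
    using Suc.IH by blast
  have h'': "h' \<in> mod_hom R (vec R k') (vec R (Suc n))"
    using h' incl by (intro mod_homI) (auto simp: mod_hom_add[OF h', simplified] mod_hom_smult[OF h', simplified] dest!: mod_hom_closed[OF h'])
  define gen where "gen J \<longleftrightarrow> (\<exists>k. \<exists>g\<in>mod_hom R (vec R k) (vec R (Suc n)). g ` vecs R k \<subseteq> N \<and> J = (\<lambda>u. g u n) ` vecs R k)" for J
  have "\<exists>J. gen J \<and> (\<forall>J'. gen J' --> J \<subseteq> J' --> J' = J)"
  proof (rule ideal_max_ex[of gen])
    show "gen ((\<lambda>u. h' u n) ` vecs R k')" unfolding gen_def using h'' h'N by (auto simp: N'_def)
    show "ideal J R" if J: "gen J" for J
    proof -
      obtain k g where g: "g \<in> mod_hom R (vec R k) (vec R (Suc n))" and J: "J = (\<lambda>u. g u n) ` vecs R k"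
        using J unfolding gen_def by blast
      show ?thesis
        unfolding J by (rule submodule_ring_mod_ideal[OF cring_axioms mod_hom_image_submodule[OF mv module_ring_mod[OF cring_axioms]
          mod_hom_comp[OF g coord_mod_hom[OF cring_axioms]] module.carrier_is_submodule[OF mv]]])
    qed
  qed
  then obtain J where "gen J" and Jmax: "\<And>J'. gen J' ==> J \<subseteq> J' ==> J' = J" by blast
  then obtain k g where g: "g \<in> mod_hom R (vec R k) (vec R (Suc n))" and gN': "g ` vecs R k \<subseteq> N"
    and J: "J = (\<lambda>u. g u n) ` vecs R k" unfolding gen_def by blast
  have gN: "g u \<in> N" if "u \<in> vecs R k" for u using gN' that by blast
  \<comment> \<open>Appending \<open>v\<close> to the finite family leaves the ideal of last
    coordinates unchanged by maximality, so this ideal already contains \<open>v n\<close>.\<close>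
  have surj: "\<exists>u\<in>vecs R k. g u n = v n" if v: "v \<in> N" for v
  proof -
    define l where "l w = w 0 \<odot>\<^bsub>vec R (Suc n)\<^esub> v" for w :: "nat => 'a"
    have vc: "v i \<in> carrier R" for i by (rule vec_mod_coord[OF cring_axioms sc[OF v]])
    have l: "l \<in> mod_hom R (vec R (Suc 0)) (vec R (Suc n))"
      using sc[OF v] by (intro mod_homI) (auto simp: l_def vec_mod_carrier vc l_distr m_assoc)
    obtain h where h: "h \<in> mod_hom R (vec R (k + Suc 0)) (vec R (Suc n))" and him: "h ` vecs R (k + Suc 0) =
      {g u \<oplus>\<^bsub>vec R (Suc n)\<^esub> l w | u w. u \<in> vecs R k \<and> w \<in> vecs R (Suc 0)}"
      using vec_mod_concat[OF cring_axioms g l mv] by blast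
    define J' where "J' = (\<lambda>y. y n) ` h ` vecs R (k + Suc 0)"
    have "h ` vecs R (k + Suc 0) \<subseteq> N"
      unfolding him l_def using gN s(5) s(4)[OF vec_mod_coord[OF cring_axioms] v] by blast
    then have gJ: "gen J'" unfolding gen_def J'_def image_image using h by blast
    have hJ: "g u n \<oplus> w 0 \<otimes> v n \<in> J'" if uw: "u \<in> vecs R k" "w \<in> vecs R (Suc 0)" for u w
    proof -
      have "(g u \<oplus>\<^bsub>vec R (Suc n)\<^esub> l w) n \<in> J'" unfolding J'_def him using uw by blast
      then show ?thesis by (simp add: l_def)
    qed
    have "J \<subseteq> J'"
    proof
      fix y assume "y \<in> J"
      then obtain u where u: "u \<in> vecs R k" "y = g u n" unfolding J by blast
      have "(\<lambda>_. \<zero>) \<in> vecs R (Suc 0)" by (simp add: vec_mod_carrier)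
      from hJ[OF u(1) this] show "y \<in> J'" using vc vec_mod_coord[OF cring_axioms sc[OF gN[OF u(1)]]] by (simp add: u(2))
    qed
    with gJ have e: "J' = J" by (rule Jmax)
    have "(\<lambda>_. \<zero>) \<in> vecs R k" by (simp add: vec_mod_carrier)
    from hJ[OF this unit_vec_carrier[OF cring_axioms]] have "v n \<in> J"
      using mod_hom_zero[OF mv mv g] vc by (simp add: e unit_vec_def)
    then show ?thesis unfolding J by auto
  qed
  obtain h where h: "h \<in> mod_hom R (vec R (k' + k)) (vec R (Suc n))"
    and him: "h ` vecs R (k' + k) =
      {h' u \<oplus>\<^bsub>vec R (Suc n)\<^esub> g w | u w. u \<in> vecs R k' \<and> w \<in> vecs R k}"
    using vec_mod_concat[OF cring_axioms h'' g mv] by blast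
  have "h ` vecs R (k' + k) = N"
  proof
    show "h ` vecs R (k' + k) \<subseteq> N"
      unfolding him using h'N gN s(5) by (auto simp: N'_def)
    show "N \<subseteq> h ` vecs R (k' + k)"
    proof
      fix v assume v: "v \<in> N"
      obtain u where u: "u \<in> vecs R k" "g u n = v n" using surj[OF v] by blast
      have gu: "g u \<in> N" "g u \<in> vecs R (Suc n)" using gN[OF u(1)] sc by auto
      have "v \<oplus>\<^bsub>vec R (Suc n)\<^esub> (\<ominus>\<^bsub>vec R (Suc n)\<^esub> g u) \<in> N" using s(5)[OF v s(3)[OF gu(1)]] .
      moreover have e: "v \<oplus>\<^bsub>vec R (Suc n)\<^esub> (\<ominus>\<^bsub>vec R (Suc n)\<^esub> g u) = (\<lambda>i. v i \<ominus> g u i)"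
        using vec_mod_a_inv[OF cring_axioms gu(2)] by (simp add: a_minus_def)
      moreover have "v n \<ominus> g u n = \<zero>" using u(2) vec_mod_coord[OF cring_axioms sc[OF v]] by (simp add: a_minus_def r_neg)
      ultimately have "(\<lambda>i. v i \<ominus> g u i) \<in> N'" by (simp add: N'_def)
      then have "(\<lambda>i. v i \<ominus> g u i) \<in> h' ` vecs R k'" by (simp only: h'N)
      then obtain w where w': "w \<in> vecs R k'" "(\<lambda>i. v i \<ominus> g u i) = h' w" by (elim imageE)
      have "v = h' w \<oplus>\<^bsub>vec R (Suc n)\<^esub> g u"
        using w'(2)[symmetric] vec_mod_coord[OF cring_axioms sc[OF v]] vec_mod_coord[OF cring_axioms gu(2)]
        by (simp add: fun_eq_iff a_minus_def a_assoc l_neg)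
      then show "v \<in> h ` vecs R (k' + k)" unfolding him using w'(1) u(1) by blast
    qed
  qed
  then show ?case using h by blast
qed

lemma mod_hom_kernel_submodule:
  assumes M: "module R M" and N: "module R N" and f: "f \<in> mod_hom R M N"
  shows "submodule {x \<in> carrier M. f x = \<zero>\<^bsub>N\<^esub>} R M"
proof -
  interpret M: module R M by fact
  interpret N: module R N by fact
  show ?thesis
    using mod_hom_zero[OF M N f] mod_hom_minus[OF M N f] mod_hom_add[OF f] mod_hom_smult[OF f]
    by (intro M.submoduleI) auto
qed

lemma ideal_vec_submodule:
  assumes R: "cring R" and I: "ideal I R"
  shows "submodule {v \<in> vecs R (Suc 0). v 0 \<in> I} R (vec R (Suc 0))"
proof -
  interpret cring R by fact
  interpret V: module R "vec R (Suc 0)" by (rule module_vec_mod[OF R])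
  note D = idealD[OF I]
  show ?thesis
    using D(2) D(4) D(3) D(6) V.M.zero_closed V.M.a_inv_closed V.M.a_closed V.smult_closed
    by (intro V.submoduleI) (auto simp: vec_mod_a_inv[OF R])
qed

text \<open>The condition that kernels have coordinates in \<open>M\<close> is void for \<open>M = R\<close>, and makes the
  resolution minimal if \<open>M\<close> is the maximal ideal of a local ring.\<close>

lemma ideal_res_exists:
  fixes R :: "('a, 'b) ring_scheme"
  assumes R: "cring R" and I: "ideal I R"
    and cover: "\<And>n N. submodule N R (vec R n) ==> \<exists>k. \<exists>h\<in>mod_hom R (vec R k) (vec R n).
      h ` vecs R k = N \<and> (\<forall>v\<in>vecs R k. h v = (\<lambda>_. \<zero>\<^bsub>R\<^esub>) --> (\<forall>i. v i \<in> M))"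
  shows "\<exists>b D. ideal_res R I b D \<and>
    (\<forall>t. \<forall>w\<in>vecs R (b (Suc (Suc t))). \<forall>i. D (Suc t) w i \<in> M)"
proof -
  have mv: "module R (vec R n)" for n by (rule module_vec_mod[OF R])
  \<comment> \<open>A state is a map \<open>h\<close> together with its target rank \<open>n\<close>
    and source rank \<open>k\<close>; \<open>Q\<close> requires the next map to cover the kernel of
    the present one.\<close>
  define P where "P t x \<longleftrightarrow> (case x of (n, k, h) => h \<in> mod_hom R (vec R k) (vec R n) \<and>
      (\<forall>v\<in>vecs R k. h v = (\<lambda>_. \<zero>\<^bsub>R\<^esub>) --> (\<forall>i. v i \<in> M)) \<and>
      (t = 0 --> n = Suc 0 \<and> h ` vecs R k = {v \<in> vecs R (Suc 0). v 0 \<in> I}))"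
    for t :: nat and x :: "nat \<times> nat \<times> ((nat => 'a) => nat => 'a)"
  define Q where "Q x y \<longleftrightarrow> (case x of (n, k, h) => case y of (n', k', h') =>
      n' = k \<and> h' ` vecs R k' = {v \<in> vecs R k. h v = (\<lambda>_. \<zero>\<^bsub>R\<^esub>)})"
    for x y :: "nat \<times> nat \<times> ((nat => 'a) => nat => 'a)"
  have "\<exists>x. \<forall>t. P t (x t) \<and> Q (x t) (x (Suc t))"
  proof (rule dependent_nat_choice)
    obtain k h where "h \<in> mod_hom R (vec R k) (vec R (Suc 0))"
      "h ` vecs R k = {v \<in> vecs R (Suc 0). v 0 \<in> I}"
      "\<forall>v\<in>vecs R k. h v = (\<lambda>_. \<zero>\<^bsub>R\<^esub>) --> (\<forall>i. v i \<in> M)"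
      using cover[OF ideal_vec_submodule[OF R I]] by blast
    then show "\<exists>x. P 0 x" by (intro exI[of _ "(Suc 0, k, h)"]) (simp add: P_def)
  next
    fix x t assume "P t x"
    moreover obtain n k h where x: "x = (n, k, h)" by (cases x)
    ultimately have h: "h \<in> mod_hom R (vec R k) (vec R n)" by (simp add: P_def)
    have "submodule {v \<in> vecs R k. h v = (\<lambda>_. \<zero>\<^bsub>R\<^esub>)} R (vec R k)"
      using mod_hom_kernel_submodule[OF mv mv h] by simp
    from cover[OF this] obtain k' h' where "h' \<in> mod_hom R (vec R k') (vec R k)"
      "h' ` vecs R k' = {v \<in> vecs R k. h v = (\<lambda>_. \<zero>\<^bsub>R\<^esub>)}"
      "\<forall>v\<in>vecs R k'. h' v = (\<lambda>_. \<zero>\<^bsub>R\<^esub>) --> (\<forall>i. v i \<in> M)" by blast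
    then show "\<exists>y. P (Suc t) y \<and> Q x y"
      by (intro exI[of _ "(k, k', h')"]) (simp add: P_def Q_def x)
  qed
  then obtain x where x: "\<And>t. P t (x t)" "\<And>t. Q (x t) (x (Suc t))" by blast
  define b where "b t = fst (x t)" for t
  define D where "D t = snd (snd (x t))" for t
  have xt: "x t = (b t, b (Suc t), D t)" for t
    using x(2)[of t] by (cases "x t"; cases "x (Suc t)") (simp add: Q_def b_def D_def)
  have D: "D t \<in> mod_hom R (vec R (b (Suc t))) (vec R (b t))"
    "\<And>v. v \<in> vecs R (b (Suc t)) ==> D t v = (\<lambda>_. \<zero>\<^bsub>R\<^esub>) ==> v i \<in> M" for t i
    using x(1)[of t] by (simp_all add: xt P_def)
  have ker: "D (Suc t) ` vecs R (b (Suc (Suc t))) = {v \<in> vecs R (b (Suc t)). D t v = (\<lambda>_. \<zero>\<^bsub>R\<^esub>)}" for t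
    using x(2)[of t] by (simp add: xt Q_def)
  have "b 0 = 1" "D 0 ` vecs R (b 1) = {v \<in> vecs R 1. v 0 \<in> I}"
    using x(1)[of 0] by (simp_all add: xt P_def)
  then have "ideal_res R I b D" unfolding ideal_res_def free_res_def ker using D(1) by auto
  moreover have "D (Suc t) w i \<in> M" if "w \<in> vecs R (b (Suc (Suc t)))" for t w i
  proof -
    have "D (Suc t) w \<in> {v \<in> vecs R (b (Suc t)). D t v = (\<lambda>_. \<zero>\<^bsub>R\<^esub>)}" using ker that by blast
    then show ?thesis using D(2) by blast
  qed
  ultimately show ?thesis by blast
qed

lemma (in noetherian_cring) ideal_res_exists_noetherian:
  assumes "ideal I R"
  shows "\<exists>b D. ideal_res R I b D"
proof -
  have "\<exists>k. \<exists>h\<in>mod_hom R (vec R k) (vec R n).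
      h ` vecs R k = N \<and> (\<forall>v\<in>vecs R k. h v = (\<lambda>_. \<zero>\<^bsub>R\<^esub>) --> (\<forall>i. v i \<in> carrier R))"
    if "submodule N R (vec R n)" for n N
    using vec_submodule_image[OF that] vec_mod_coord[OF cring_axioms] by blast
  from ideal_res_exists[OF cring_axioms assms this] show ?thesis by blast
qed

section \<open>Truncating resolutions with a t-structure\<close>

text \<open>The brutal truncation to the degrees from \<open>c\<close> to \<open>j\<close>. For
  \<open>c < j\<close> its cohomology differs from that of the resolution in degree \<open>c\<close>
  only, where the cut leaves cocycles without preimages.\<close>

definition trunc_cx :: "('a, 'b) ring_scheme => (nat => nat) => (nat => (nat => 'a) => nat => 'a) =>
    int => int => ('a, nat => 'a) cochain_complex" where
  "trunc_cx R b D c j =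
    \<lparr>module_at = (\<lambda>i. vec R (if c \<le> i \<and> i \<le> j then b (nat (j - i)) else 0)),
     diff = (\<lambda>i. if c \<le> i then diff (res_cx R b D j) i else (\<lambda>_ _. \<zero>\<^bsub>R\<^esub>))\<rparr>"

lemma trunc_cx_simps [simp]:
  "(trunc_cx R b D c j)$i = vec R (if c \<le> i \<and> i \<le> j then b (nat (j - i)) else 0)"
  "diff (trunc_cx R b D c j) i = (if c \<le> i then diff (res_cx R b D j) i else (\<lambda>_ _. \<zero>\<^bsub>R\<^esub>))"
  by (simp_all add: trunc_cx_def del: res_cx_simps)

lemma trunc_cx_fp:
  assumes R: "cring R" and F: "free_res R b D"
  shows "fp_complex R (trunc_cx R b D c j)"
proof -
  have X: "is_complex R (res_cx R b D j)" by (rule res_cx_complex[OF R F])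
  have mv: "module R (vec R n)" for n by (rule module_vec_mod[OF R])
  have z: "(\<lambda>_ _. \<zero>\<^bsub>R\<^esub>) \<in> mod_hom R (vec R n) (vec R m)" for n m
    using mod_hom_const_zero[OF mv[of m]] by simp
  have e: "(trunc_cx R b D c j)$i = (res_cx R b D j)$i" if "c \<le> i" for i using that by simp
  have "is_complex R (trunc_cx R b D c j)"
    unfolding is_complex_def
  proof (intro allI conjI ballI)
    fix i
    show "module R ((trunc_cx R b D c j)$i)" by (simp add: mv)
    show "diff (trunc_cx R b D c j) i \<in> mod_hom R ((trunc_cx R b D c j)$i) ((trunc_cx R b D c j)$(i + 1))"
    proof (cases "c \<le> i")
      case True
      then show ?thesis using cx_diff[OF X refl, of i] e[of i] e[of "i + 1"] by (simp del: res_cx_simps trunc_cx_simps(1))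
    next
      case False
      then show ?thesis using z by simp
    qed
    fix x assume x: "x \<in> (trunc_cx R b D c j)$$i"
    show "diff (trunc_cx R b D c j) (i + 1) (diff (trunc_cx R b D c j) i x) = \<zero>\<^bsub>(trunc_cx R b D c j)$(i + 2)\<^esub>"
    proof (cases "c \<le> i")
      case True
      then have x': "x \<in> (res_cx R b D j)$$i" using e x by metis
      show ?thesis using True cx_dd[OF X refl refl x'] by (simp del: res_cx_simps(2))
    next
      case False
      have "diff (res_cx R b D j) (i + 1) (\<lambda>_. \<zero>\<^bsub>R\<^esub>) = (\<lambda>_. \<zero>\<^bsub>R\<^esub>)"
        using mod_hom_zero[OF cx_module[OF X] cx_module[OF X] cx_diff[OF X refl], of "i + 1"] by (simp del: res_cx_simps(2) split: if_splits)
      then show ?thesis using False by (simp del: res_cx_simps)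
    qed
  qed
  moreover have "\<forall>i. i < c \<or> j < i --> (trunc_cx R b D c j)$$i = {\<zero>\<^bsub>(trunc_cx R b D c j)$i\<^esub>}"
    by (auto simp: vec_mod_0_carrier)
  moreover have "fg_proj R ((trunc_cx R b D c j)$i)" for i using fg_proj_vec_mod[OF R] by simp
  ultimately show ?thesis unfolding fp_complex_def by blast
qed

lemma iso_chain_quasi_iso:
  assumes X: "is_complex R X" and Y: "is_complex R Y" and f: "f \<in> chain_maps R X Y" and g: "g \<in> chain_maps R Y X"
    and gf: "\<And>i x. x \<in> X$$i ==> g i (f i x) = x"
    and fg: "\<And>i y. y \<in> Y$$i ==> f i (g i y) = y"
  shows "quasi_iso R X Y f"
  unfolding quasi_iso_iff[OF X Y]
proof (intro conjI allI f)
  fix i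
  show "coh_inj X Y f i"
    unfolding coh_inj_def
  proof (intro ballI impI)
    fix x assume "x \<in> cocycles X i" "f i x \<in> coboundaries Y i"
    then show "x \<in> coboundaries X i" using chain_cob[OF g, of "f i x" i] gf[of x i] by (simp add: cocycles_def)
  qed
  show "coh_surj X Y f i"
    unfolding coh_surj_def
  proof
    fix y assume y: "y \<in> cocycles Y i"
    interpret Y0: module R "Y$i" by (rule cx_module[OF Y])
    have "y \<ominus>\<^bsub>Y$i\<^esub> f i (g i y) = \<zero>\<^bsub>Y$i\<^esub>"
      using fg[of y i] cocycles_carrier[OF y] by (simp add: a_minus_def Y0.M.r_neg)
    then show "\<exists>x\<in>cocycles X i. y \<ominus>\<^bsub>Y$i\<^esub> f i x \<in> coboundaries Y i"
      using chain_cocycles[OF Y X g y] cob_zero[OF Y, of i] by (intro bexI[of _ "g i y"]) simp_all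
  qed
qed

context module_universe begin

lemma vec_complex_copy:
  assumes X: "is_complex R X" and v: "\<And>i. X$i = vec R (\<beta> i)"
  shows "\<exists>(Y :: ('a, 'm) cochain_complex) f. is_complex R Y \<and> quasi_iso R X Y f \<and> (\<forall>i. Y$i = fvec (\<beta> i))"
proof -
  define Y :: "('a, 'm) cochain_complex" where "Y = \<lparr>module_at = (\<lambda>i. fvec (\<beta> i)),
    diff = (\<lambda>i x. vec_embed (\<beta> (i + 1)) (diff X i (vec_coord (\<beta> i) x)))\<rparr>"
  have Y_at: "Y$i = fvec (\<beta> i)" and Y_d: "diff Y i x = vec_embed (\<beta> (i + 1)) (diff X i (vec_coord (\<beta> i) x))" for i x
    by (simp_all add: Y_def)
  have dX: "diff X i \<in> mod_hom R (vec R (\<beta> i)) (vec R (\<beta> (i + 1)))" for i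
    using cx_diff[OF X refl, of i] by (simp add: v)
  have dX2: "diff X (i + 1) (diff X i x) = \<zero>\<^bsub>vec R (\<beta> (i + 2))\<^esub>" if "x \<in> vecs R (\<beta> i)" for i x
    using cx_dd[OF X refl refl, of x i] that by (simp add: v)
  have dY: "diff Y i \<in> mod_hom R (fvec (\<beta> i)) (fvec (\<beta> (i + 1)))" for i
    using mod_hom_comp[OF mod_hom_comp[OF fvec(3) dX] fvec(2)] unfolding Y_def by simp
  note cc = mod_hom_closed[OF fvec(3)] and ce = mod_hom_closed[OF fvec(2)] and cd = mod_hom_closed[OF dX]
  have Y: "is_complex R Y"
    unfolding is_complex_def
  proof (intro allI conjI ballI)
    fix i x
    show "module R (Y$i)" by (simp add: Y_at fvec(1))
    show "diff Y i \<in> mod_hom R (Y$i) (Y$(i + 1))" by (simp only: Y_at dY)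
    assume "x \<in> Y$$i"
    then have x: "x \<in> carrier (fvec (\<beta> i))" by (simp add: Y_at)
    have "diff Y (i + 1) (diff Y i x) = vec_embed (\<beta> (i + 2)) (diff X (i + 1) (diff X i (vec_coord (\<beta> i) x)))"
      using fvec(4)[OF cd[OF cc[OF x]]] by (simp add: Y_d add.commute)
    also have "\<dots> = \<zero>\<^bsub>Y$(i + 2)\<^esub>"
      using dX2[OF cc[OF x]] mod_hom_zero[OF module_vec_mod[OF R] fvec(1) fvec(2)] by (simp add: Y_at)
    finally show "diff Y (i + 1) (diff Y i x) = \<zero>\<^bsub>Y$(i + 2)\<^esub>" .
  qed
  have "quasi_iso R X Y (\<lambda>i. vec_embed (\<beta> i))"
  proof (rule iso_chain_quasi_iso[OF X Y])
    show "(\<lambda>i. vec_embed (\<beta> i)) \<in> chain_maps R X Y"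
      by (auto simp: chain_maps_def v Y_at Y_d fvec)
    show "(\<lambda>i. vec_coord (\<beta> i)) \<in> chain_maps R Y X"
      using cc cd by (auto simp: chain_maps_def v Y_at Y_d fvec)
  qed (auto simp: v Y_at fvec)
  then show ?thesis using Y Y_at by blast
qed

end

text \<open>Two pieces of the long exact cohomology sequence: vanishing of the cohomology of
  \<open>X\<close> in degree \<open>i + 1\<close> is the obstruction to surjectivity removed, and
  vanishing in degree \<open>i\<close> the one to injectivity.\<close>

lemma cone_triangle_coh:
  assumes T: "cone_triangle R X Y Z f g h"
  shows "exact_at X (i + 1) ==> coh_surj Y Z g i" "exact_at X i ==> coh_inj Y Z g i"
proof -
  have X: "is_complex R X" and Y: "is_complex R Y" and Z: "is_complex R Z" and f: "f \<in> chain_maps R X Y"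
    and g: "g \<in> chain_maps R Y Z" using T by (auto simp: cone_triangle_def)
  obtain \<phi> where p: "\<phi> \<in> chain_maps R (cone X Y f) Z"
    and bij: "\<And>i. bij_betw (\<phi> i) ((cone X Y f)$$i) (Z$$i)"
    and gp: "\<And>i y. y \<in> Y$$i ==> g i y = \<phi> i (\<zero>\<^bsub>X$(i + 1)\<^esub>, y)"
    using T unfolding cone_triangle_def by blast
  let ?C = "cone X Y f"
  have C: "is_complex R ?C" by (rule cone_complex[OF X Y f])
  have mX: "module R (X$k)" and mY: "module R (Y$k)" and mC: "module R (?C$k)"
    and mZ: "module R (Z$k)" for k
    by (rule cx_module[OF X] cx_module[OF Y] cx_module[OF C] cx_module[OF Z])+
  interpret X1: module R "X$(i + 1)" by (rule mX)
  interpret X2: module R "X$(i + 2)" by (rule mX)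
  interpret Y0: module R "Y$i" by (rule mY)
  interpret Y1: module R "Y$(i + 1)" by (rule mY)
  interpret Z0: module R "Z$i" by (rule mZ)
  have inj: "c = c'" if "c \<in> ?C$$k" "c' \<in> ?C$$k" "\<phi> k c = \<phi> k c'" for c c' k
    using bij[of k] that by (auto simp: bij_betw_def dest: inj_onD)
  have lift: "\<exists>c\<in>?C$$k. z = \<phi> k c" if "z \<in> Z$$k" for z k
  proof -
    have "z \<in> \<phi> k ` ?C$$k" using bij[of k] that unfolding bij_betw_def by (elim conjE) (simp only:)
    then show ?thesis by (rule imageE) (rule bexI)
  qed
  have e: "i + 1 + 1 = i + 2" "i - 1 + 1 = i" "i - 1 + 2 = i + 1" by simp_all
  show "coh_surj Y Z g i" if ex: "exact_at X (i + 1)"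
    unfolding coh_surj_def
  proof
    fix z assume z: "z \<in> cocycles Z i"
    obtain x y where xy: "(x, y) \<in> ?C$$i" "z = \<phi> i (x, y)"
      using lift[OF cocycles_carrier[OF z]] by (metis surj_pair)
    have x: "x \<in> X$$(i + 1)" and y: "y \<in> Y$$i" using xy by auto
    have "\<phi> (i + 1) (diff ?C i (x, y)) = \<phi> (i + 1) \<zero>\<^bsub>?C$(i + 1)\<^esub>"
      using chain_diff[OF p refl xy(1)] xy(2) z mod_hom_zero[OF mC mZ chain_hom[OF p], of "i + 1"]
      by (simp only: cocycles_def mem_Collect_eq)
    then have "diff ?C i (x, y) = \<zero>\<^bsub>?C$(i + 1)\<^esub>"
      using inj[OF cx_diff_closed[OF C refl xy(1)] abelian_monoid.zero_closed[OF moduleD(3)[OF mC]]] by blast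
    then have dx0: "\<ominus>\<^bsub>X$(i + 2)\<^esub> diff X (i + 1) x = \<zero>\<^bsub>X$(i + 2)\<^esub>"
      and fx0: "f (i + 1) x \<oplus>\<^bsub>Y$(i + 1)\<^esub> diff Y i y = \<zero>\<^bsub>Y$(i + 1)\<^esub>" by (simp_all add: e)
    have "diff X (i + 1) x = \<zero>\<^bsub>X$(i + 2)\<^esub>"
      using dx0 cx_diff_closed[OF X _ x, of "i + 2"] by (metis X2.M.minus_minus X2.module_minus_zero e(1))
    then have "x \<in> cocycles X (i + 1)" using x by (simp add: cocycles_def e)
    then obtain x' where x': "x' \<in> X$$i" "x = diff X i x'"
      using ex by (auto simp: exact_at_def elim!: cobE)
    interpret X0: module R "X$i" by (rule mX)
    have fx': "f i x' \<in> Y$$i" by (rule chain_closed[OF f x'(1)])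
    define y' where "y' = y \<oplus>\<^bsub>Y$i\<^esub> f i x'"
    have y': "y' \<in> Y$$i" using y fx' by (simp add: y'_def)
    have "diff Y i y' = diff Y i y \<oplus>\<^bsub>Y$(i + 1)\<^esub> f (i + 1) x"
      using mod_hom_add[OF cx_diff[OF Y refl] y fx'] chain_diff[OF f refl x'(1)] x'(2) by (simp add: y'_def)
    also have "\<dots> = \<zero>\<^bsub>Y$(i + 1)\<^esub>"
      using fx0 chain_closed[OF f x] cx_diff_closed[OF Y refl y] by (simp add: Y1.M.a_comm)
    finally have y'z: "y' \<in> cocycles Y i" using y' by (simp add: cocycles_def)
    \<comment> \<open>The coboundary of \<open>?u\<close> in the cone has first component
      \<open>x\<close>; subtracting it turns \<open>(x, y)\<close> into
      \<open>(\<zero>, y')\<close>, which comes from \<open>Y\<close>.\<close>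
    let ?u = "(\<ominus>\<^bsub>X$i\<^esub> x', \<zero>\<^bsub>Y$(i - 1)\<^esub>)"
    have u: "?u \<in> ?C$$(i - 1)"
      using x'(1) abelian_monoid.zero_closed[OF moduleD(3)[OF mY]] by (simp add: e)
    have du: "diff ?C (i - 1) ?u = (x, \<ominus>\<^bsub>Y$i\<^esub> f i x')"
    proof -
      have "\<ominus>\<^bsub>X$(i + 1)\<^esub> diff X i (\<ominus>\<^bsub>X$i\<^esub> x') = x"
        using mod_hom_minus[OF mX mX cx_diff[OF X refl] x'(1)] x x'(2) by simp
      moreover have "diff Y (i - 1) \<zero>\<^bsub>Y$(i - 1)\<^esub> = \<zero>\<^bsub>Y$i\<^esub>"
        by (rule mod_hom_zero[OF mY mY cx_diff[OF Y]]) simp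
      ultimately show ?thesis using mod_hom_minus[OF mX mY chain_hom[OF f] x'(1)] fx' by (simp add: e)
    qed
    have 0: "(\<zero>\<^bsub>X$(i + 1)\<^esub>, y') \<in> ?C$$i" using y' by simp
    have dux: "(x, \<ominus>\<^bsub>Y$i\<^esub> f i x') \<in> ?C$$i" using x fx' by simp
    have "(x, y) = (x, \<ominus>\<^bsub>Y$i\<^esub> f i x') \<oplus>\<^bsub>?C$i\<^esub> (\<zero>\<^bsub>X$(i + 1)\<^esub>, y')"
      using x y fx' Y0.M.a_lcomm[of "\<ominus>\<^bsub>Y$i\<^esub> f i x'" y "f i x'"] by (simp add: y'_def Y0.M.l_neg)
    then have "z = \<phi> i (diff ?C (i - 1) ?u) \<oplus>\<^bsub>Z$i\<^esub> g i y'"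
      using xy(2) gp[OF y'] mod_hom_add[OF chain_hom[OF p] dux 0] du by simp
    moreover have "\<phi> i (diff ?C (i - 1) ?u) = diff Z (i - 1) (\<phi> (i - 1) ?u)"
      using chain_diff[OF p _ u, of i] by simp
    ultimately have zz: "z = diff Z (i - 1) (\<phi> (i - 1) ?u) \<oplus>\<^bsub>Z$i\<^esub> g i y'" by simp
    have b: "diff Z (i - 1) (\<phi> (i - 1) ?u) \<in> coboundaries Z i"
      by (rule cobI[OF chain_closed[OF p u]]) simp_all
    have "z \<ominus>\<^bsub>Z$i\<^esub> g i y' = diff Z (i - 1) (\<phi> (i - 1) ?u)"
      using cob_carrier[OF Z b] chain_closed[OF g y'] by (simp add: zz a_minus_def Z0.M.a_assoc Z0.M.r_neg)
    then show "\<exists>x\<in>cocycles Y i. z \<ominus>\<^bsub>Z$i\<^esub> g i x \<in> coboundaries Z i"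
      using y'z b by (intro bexI[of _ y']) simp_all
  qed
  show "coh_inj Y Z g i" if ex: "exact_at X i"
    unfolding coh_inj_def
  proof (intro ballI impI)
    fix y assume y: "y \<in> cocycles Y i" and gy: "g i y \<in> coboundaries Z i"
    have yc: "y \<in> Y$$i" by (rule cocycles_carrier[OF y])
    obtain w where w: "w \<in> Z$$(i - 1)" "g i y = diff Z (i - 1) w" using gy by (auto elim: cobE)
    obtain x' y' where xy: "(x', y') \<in> ?C$$(i - 1)" "w = \<phi> (i - 1) (x', y')"
      using lift[OF w(1)] by (metis surj_pair)
    have x': "x' \<in> X$$i" and y': "y' \<in> Y$$(i - 1)" using xy by (auto simp: e)
    have "\<phi> i (diff ?C (i - 1) (x', y')) = \<phi> i (\<zero>\<^bsub>X$(i + 1)\<^esub>, y)"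
      using chain_diff[OF p _ xy(1), of i] w(2) xy(2) gp[OF yc] by simp
    then have "diff ?C (i - 1) (x', y') = (\<zero>\<^bsub>X$(i + 1)\<^esub>, y)"
      using inj[of "diff ?C (i - 1) (x', y')" i "(\<zero>\<^bsub>X$(i + 1)\<^esub>, y)"] cx_diff_closed[OF C _ xy(1), of i] yc by simp
    then have dx0: "\<ominus>\<^bsub>X$(i + 1)\<^esub> diff X i x' = \<zero>\<^bsub>X$(i + 1)\<^esub>"
      and yy: "y = f i x' \<oplus>\<^bsub>Y$i\<^esub> diff Y (i - 1) y'" by (auto simp: e)
    have "diff X i x' = \<zero>\<^bsub>X$(i + 1)\<^esub>"
      using dx0 cx_diff_closed[OF X refl x'] by (metis X1.M.minus_minus X1.module_minus_zero)
    then have "x' \<in> cocycles X i" using x' by (simp add: cocycles_def)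
    then have "f i x' \<in> coboundaries Y i" using ex chain_cob[OF f] by (auto simp: exact_at_def)
    moreover have "diff Y (i - 1) y' \<in> coboundaries Y i" by (rule cobI[OF y']) simp_all
    ultimately show "y \<in> coboundaries Y i" unfolding yy by (rule cob_add[OF Y])
  qed
qed

context perf_t_structure begin

text \<open>Let \<open>X\<close> be the part in degrees \<open>l, \<dots>, j\<close> of the resolution placed with its last term in degree
  \<open>j\<close>, and \<open>X \<rightarrow> Z\<close> its truncation by the t-structure, with \<open>Q \<rightarrow> Z\<close> a bounded projective resolution.
  If \<open>j\<close> is large and \<open>l\<close> is small, then \<open>Z\<close> has the cohomology of \<open>X\<close> in degrees \<open>\<ge> j\<close> and no
  cohomology in degrees \<open>\<le> l\<close>. So the map \<open>X \<rightarrow> Q\<close> extends to the whole resolution \<open>G\<close>, and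
  \<open>G\<close> is a retract of \<open>Q\<close> up to homotopy.\<close>

theorem ideal_res_contractible:
  assumes nr: "noetherian_ring R" and kd: "krull_dim R \<noteq> \<infinity>" and res: "free_res R b D"
  shows "\<exists>T. \<forall>t\<ge>T. contractible R b D t"
proof -
  obtain l where Vl: "\<And>Y i. Y \<in> V ==> i \<le> l ==> exact_at Y i" using V_exact by blast
  obtain h where Uh: "\<And>X i. X \<in> U ==> h \<le> i ==> exact_at X i" using U_exact[OF nr kd] by blast
  \<comment> \<open>From \<open>h\<close> on the complexes in U are exact, so the triangle is
    bijective on cohomology in degree \<open>j\<close> and above. That \<open>j\<close> exceeds
    \<open>l\<close> keeps the cut away from the top cohomology.\<close>
  define j where "j = max h (l + 1)"
  have j: "h \<le> j" "l < j" by (auto simp: j_def)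
  define G where "G = res_cx R b D j"
  define X0 where "X0 = trunc_cx R b D l j"
  have G: "is_complex R G" unfolding G_def by (rule res_cx_complex[OF R res])
  have X0: "fp_complex R X0" unfolding X0_def by (rule trunc_cx_fp[OF R res])
  have X0c: "is_complex R X0" using X0 by (simp add: fp_complex_def)
  obtain X :: "('a, 'm) cochain_complex" and em where X: "is_complex R X" and em: "quasi_iso R X0 X em"
    and X_at: "\<And>i. X$i = fvec (if l \<le> i \<and> i \<le> j then b (nat (j - i)) else 0)"
  proof -
    have "X0$i = vec R (if l \<le> i \<and> i \<le> j then b (nat (j - i)) else 0)" for i by (simp add: X0_def)
    from vec_complex_copy[OF X0c this] show ?thesis using that by blast
  qed
  have "fp_complex R X"
  proof -
    have "carrier (fvec 0) = {\<zero>\<^bsub>fvec 0\<^esub>}" by (simp add: fvec_def vec_mod_0_carrier)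
    then have "\<forall>i. i < l \<or> j < i --> X$$i = {\<zero>\<^bsub>X$i\<^esub>}" by (auto simp: X_at)
    moreover have "\<forall>i. fg_proj R (X$i)" using fg_proj_fvec by (simp add: X_at)
    ultimately show ?thesis unfolding fp_complex_def using X by blast
  qed
  then have "X \<in> obj (Perf R)" using fp_perfect X by simp
  moreover have "\<forall>X\<in>obj (Perf R). \<exists>A\<in>U. \<exists>B\<in>translate (Perf R) (-1) V. \<exists>f g h. dist_tri (Perf R) A X B f g h"
    using bts unfolding bounded_t_structure_def t_structure_def by (elim conjE)
  ultimately obtain A B f g k where A: "A \<in> U" and B: "B \<in> translate (Perf R) (-1) V"
    and tri: "dist_tri (Perf R) A X B f g k" by blast
  have Ac: "is_complex R A" by (rule UV_obj(1)[OF A])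
  have Vc: "V \<subseteq> {X. is_complex R X}" using UV_obj(3) by blast
  note Bt = translateD[OF B Vc]
  obtain X' Y' Z' :: "('a, 'm) cochain_complex" and u v w \<alpha> \<beta> \<gamma> where ct: "cone_triangle R X' Y' Z' u v w"
    and \<alpha>: "iso_mor (derived_base R) A X' \<alpha>" and \<beta>: "iso_mor (derived_base R) X Y' \<beta>"
    and \<gamma>: "iso_mor (derived_base R) B Z' \<gamma>"
    using Perf_dist_tri[OF tri] unfolding derived_dist_tri_def by blast
  have X': "is_complex R X'" and Y': "is_complex R Y'" and Z': "is_complex R Z'" and vc: "v \<in> chain_maps R Y' Z'"
    using ct by (auto simp: cone_triangle_def)
  have AX': "quasi_isomorphic R A X'" by (rule derived_iso_quasi_isomorphic[OF Ac X' \<alpha>])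
  have XY': "quasi_isomorphic R X Y'" by (rule derived_iso_quasi_isomorphic[OF X Y' \<beta>])
  have BZ': "quasi_isomorphic R B Z'" by (rule derived_iso_quasi_isomorphic[OF Bt(1) Z' \<gamma>])
  have exX': "exact_at X' i" if "h \<le> i" for i using Uh[OF A that] exact_at_quasi_isomorphic[OF Ac X' AX'] by simp
  obtain p where p: "quasi_iso R X0 Y' p" using cover_transfer[OF X0 X Y' em XY'] by blast
  obtain Q :: "('a, 'm) cochain_complex" and q0 where Q: "fp_complex R Q" and q0: "quasi_iso R Q B q0"
    using perfect_cover[OF Bt(2)] by blast
  obtain q where q: "quasi_iso R Q Z' q" using cover_transfer[OF Q Bt(1) Z' q0 BZ'] by blast
  have Qc: "is_complex R Q" using Q by (simp add: fp_complex_def)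
  \<comment> \<open>\<open>B\<close> lies in V[-1], so exactness in degree \<open>i\<close> comes
    from an object of V in degree \<open>i - 1\<close>, and the bound \<open>l\<close> is met with
    one degree to spare.\<close>
  have exQl: "exact_at Q i" if "i \<le> l" for i
  proof -
    obtain B' where B': "B' \<in> V" "quasi_isomorphic R B (shift_complex (-1) B')" using Bt(3) by blast
    have B'c: "is_complex R B'" by (rule UV_obj(3)[OF B'(1)])
    have "exact_at B' (i - 1)" using Vl[OF B'(1)] that by simp
    then have "exact_at B i"
      using exact_at_quasi_isomorphic[OF Bt(1) shift_complex_complex[OF B'c] B'(2)] shift_exact_at[OF B'c, of "-1" i] by simp
    then show ?thesis using exact_at_quasi_iso[OF Qc Bt(1) q0] by simp
  qed
  have vp: "chain_comp v p \<in> chain_maps R X0 Z'" by (rule chain_comp_maps[OF quasi_iso_chain[OF p] vc])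
  have vpi: "coh_inj X0 Z' (chain_comp v p) i" and vps: "coh_surj X0 Z' (chain_comp v p) i" if "h \<le> i" for i
    using coh_pre_quasi_iso[OF X0c Y' Z' p vc] cone_triangle_coh[OF ct] exX' that by auto
  obtain m where m: "m \<in> chain_maps R X0 Q" and mh: "chain_homotopic R X0 Z' (chain_comp v p) (chain_comp q m)"
    using lift_quasi_iso[OF X0 Qc Z' q vp] by blast
  note qc = quasi_iso_chain[OF q]
  note qm = chain_comp_maps[OF m qc]
  have qi: "coh_inj Q Z' q i" "coh_surj Q Z' q i" for i using q Qc Z' by (auto simp: quasi_iso_iff)
  have mi: "coh_inj X0 Q m i" if "h \<le> i" for i
    using coh_inj_compD[OF m qc] coh_inj_homotopic[OF Z' X0c vp qm mh] vpi[OF that] by blast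
  have ms: "coh_surj X0 Q m i" if "h \<le> i" for i
    using coh_surj_compD2[OF X0c Qc Z' m qc _ qi(1)] coh_surj_homotopic[OF Z' X0c vp qm mh] vps[OF that] by blast
  have exQj: "exact_at Q i" if "j < i" for i
    unfolding exact_at_def
  proof
    fix z assume z: "z \<in> cocycles Q i"
    obtain x where x: "x \<in> cocycles X0 i" "z \<ominus>\<^bsub>Q$i\<^esub> m i x \<in> coboundaries Q i"
      using bspec[OF ms[of i, unfolded coh_surj_def] z] \<open>j < i\<close> j(1) by auto
    have "x \<in> coboundaries X0 i"
      using x(1) cob_zero[OF X0c, of i] that by (auto simp: cocycles_def X0_def vec_mod_0_carrier)
    then have "m i x \<in> coboundaries Q i" by (rule chain_cob[OF m])
    then show "z \<in> coboundaries Q i"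
      using cob_cong[OF Qc cocycles_carrier[OF z] chain_closed[OF m cocycles_carrier[OF x(1)]] x(2)] by blast
  qed
  have X0G: "X0$i = G$i" "diff X0 i = diff G i" if "l \<le> i" for i
    using that by (simp_all add: X0_def G_def)
  have "\<exists>f\<in>chain_maps R G Q. \<forall>i\<ge>l. f i = m i"
  proof (rule chain_extension[OF G Qc])
    show "fg_proj R (G$i)" for i using fg_proj_vec_mod[OF R] by (simp add: G_def)
    show "m i \<in> mod_hom R (G$i) (Q$i)" if "l \<le> i" for i
      using chain_hom[OF m, of i] X0G[OF that] by simp
    show "m (i + 1) (diff G i x) = diff Q i (m i x)" if "l \<le> i" "x \<in> G$$i" for i x
      using chain_diff[OF m refl, of x i] X0G[OF that(1)] that(2) by simp
    \<comment> \<open>The differential of \<open>G\<close> into degree \<open>l\<close> was cut off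
      in \<open>X0\<close>; its values are mere cocycles there. Exactness of \<open>Q\<close> in
      degree \<open>l\<close> makes their images coboundaries again.\<close>
    show "m l (diff G (l - 1) x) \<in> coboundaries Q l" if x: "x \<in> G$$(l - 1)" for x
    proof -
      have "diff G (l - 1) x \<in> cocycles G l" by (rule cob_cocycles[OF G cobI[OF x]]) simp_all
      then have "diff G (l - 1) x \<in> cocycles X0 l" using X0G[of l] X0G[of "l + 1"] by (simp add: cocycles_def)
      then have "m l (diff G (l - 1) x) \<in> cocycles Q l" by (rule chain_cocycles[OF X0c Qc m])
      then show ?thesis using exQl[of l] by (auto simp: exact_at_def)
    qed
  qed (use exQl in auto)
  then obtain f where f: "f \<in> chain_maps R G Q" and fm: "\<And>i. l \<le> i ==> f i = m i" by blast
  have GX: "coboundaries G j = coboundaries X0 j" using X0G[of "j - 1"] j by (simp add: coboundaries_def)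
  have Gz: "cocycles X0 j = G$$j"
    using j(2) by (auto simp: X0_def G_def cocycles_def)
  have fi: "x \<in> coboundaries G j" if "x \<in> G$$j" "f j x \<in> coboundaries Q j" for x
    using mi[OF j(1)] that fm[of j] j unfolding GX coh_inj_def Gz by auto
  have fs: "\<exists>x\<in>G$$j. z \<ominus>\<^bsub>Q$j\<^esub> f j x \<in> coboundaries Q j" if "z \<in> cocycles Q j" for z
    using ms[OF j(1)] that fm[of j] j unfolding coh_surj_def Gz by auto
  obtain \<rho> where \<rho>h: "\<rho> \<in> mod_hom R (Q$j) (Q$j)"
    and \<rho>Z: "\<And>x. x \<in> Q$$j ==> \<rho> x \<in> cocycles Q j" and \<rho>z: "\<And>z. z \<in> cocycles Q j ==> \<rho> z = z"
    using cocycle_retraction[OF Q exQj] by blast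
  have Qp: "fg_proj R (Q$i)" for i using Q by (simp add: fp_complex_def)
  have mG: "module R (G$i)" and mQ: "module R (Q$i)" for i using G Qc by (auto intro: cx_module)
  interpret Qj: module R "Q$j" by (rule mQ)
  interpret Gj: module R "G$j" by (rule mG)
  note fh = chain_hom[OF f, of j]
  have fc: "f j x \<in> Q$$j" if "x \<in> G$$j" for x by (rule chain_closed[OF f that])
  have \<rho>c: "\<rho> x \<in> Q$$j" if "x \<in> Q$$j" for x by (rule mod_hom_closed[OF \<rho>h that])
  \<comment> \<open>A lift of the inverse of the isomorphism that \<open>f\<close> induces from the
    cohomology of \<open>G\<close> to that of \<open>Q\<close> in degree \<open>j\<close>. The
    retraction \<open>\<rho>\<close> extends it from the cocycles to the whole term of
    \<open>Q\<close>, whose projectivity makes it linear.\<close>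
  have "\<exists>g0\<in>mod_hom R (Q$j) (G$j). \<forall>y\<in>Q$$j.
      \<rho> y \<ominus>\<^bsub>Q$j\<^esub> f j (g0 y) \<in> coboundaries Q j"
  proof (rule fg_proj_select[OF Qp mG, where Q = "\<lambda>y x. \<rho> y \<ominus>\<^bsub>Q$j\<^esub> f j x \<in> coboundaries Q j"])
    show "\<exists>x\<in>G$$j. \<rho> y \<ominus>\<^bsub>Q$j\<^esub> f j x \<in> coboundaries Q j" if "y \<in> Q$$j" for y
      by (rule fs[OF \<rho>Z[OF that]])
  next
    fix y x y' x' assume *: "y \<in> Q$$j" "x \<in> G$$j" "y' \<in> Q$$j" "x' \<in> G$$j"
      "\<rho> y \<ominus>\<^bsub>Q$j\<^esub> f j x \<in> coboundaries Q j" "\<rho> y' \<ominus>\<^bsub>Q$j\<^esub> f j x' \<in> coboundaries Q j"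
    have "\<rho> (y \<oplus>\<^bsub>Q$j\<^esub> y') \<ominus>\<^bsub>Q$j\<^esub> f j (x \<oplus>\<^bsub>G$j\<^esub> x') =
      (\<rho> y \<ominus>\<^bsub>Q$j\<^esub> f j x) \<oplus>\<^bsub>Q$j\<^esub> (\<rho> y' \<ominus>\<^bsub>Q$j\<^esub> f j x')"
      using * fc \<rho>c by (simp add: mod_hom_add[OF \<rho>h] mod_hom_add[OF fh] a_minus_def Qj.M.minus_add Qj.M.a_ac)
    then show "\<rho> (y \<oplus>\<^bsub>Q$j\<^esub> y') \<ominus>\<^bsub>Q$j\<^esub> f j (x \<oplus>\<^bsub>G$j\<^esub> x') \<in> coboundaries Q j"
      using cob_add[OF Qc *(5,6)] by simp
  next
    fix a y x assume *: "a \<in> carrier R" "y \<in> Q$$j" "x \<in> G$$j"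
      "\<rho> y \<ominus>\<^bsub>Q$j\<^esub> f j x \<in> coboundaries Q j"
    have "\<rho> (a \<odot>\<^bsub>Q$j\<^esub> y) \<ominus>\<^bsub>Q$j\<^esub> f j (a \<odot>\<^bsub>G$j\<^esub> x) =
      a \<odot>\<^bsub>Q$j\<^esub> (\<rho> y \<ominus>\<^bsub>Q$j\<^esub> f j x)"
      using * fc \<rho>c by (simp add: mod_hom_smult[OF \<rho>h] mod_hom_smult[OF fh] a_minus_def Qj.smult_r_distr Qj.smult_r_minus)
    then show "\<rho> (a \<odot>\<^bsub>Q$j\<^esub> y) \<ominus>\<^bsub>Q$j\<^esub> f j (a \<odot>\<^bsub>G$j\<^esub> x) \<in> coboundaries Q j"
      using cob_smult[OF Qc *(4,1)] by simp
  qed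
  then obtain g0 where g0: "g0 \<in> mod_hom R (Q$j) (G$j)"
    and g0f: "\<And>y. y \<in> Q$$j ==> \<rho> y \<ominus>\<^bsub>Q$j\<^esub> f j (g0 y) \<in> coboundaries Q j" by blast
  have "\<exists>g\<in>chain_maps R Q G. g j = g0"
  proof (rule chain_extension_top[OF Qc Qp G _ g0])
    show "G$$i = {\<zero>\<^bsub>G$i\<^esub>}" if "j < i" for i using that by (simp add: G_def vec_mod_0_carrier)
    show "g0 y \<in> coboundaries G j" if y: "y \<in> coboundaries Q j" for y
    proof -
      have yc: "y \<in> Q$$j" by (rule cob_carrier[OF Qc y])
      have g0y: "g0 y \<in> G$$j" by (rule mod_hom_closed[OF g0 yc])
      have "y \<ominus>\<^bsub>Q$j\<^esub> f j (g0 y) \<in> coboundaries Q j" using g0f[OF yc] \<rho>z[OF cob_cocycles[OF Qc y]] by simp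
      then have "f j (g0 y) \<in> coboundaries Q j" using cob_cong[OF Qc yc fc[OF g0y]] y by blast
      then show ?thesis by (rule fi[OF g0y])
    qed
    show "exact_at G i" if "i < j" for i unfolding G_def by (rule res_cx_exact[OF res that])
  qed
  then obtain g where g: "g \<in> chain_maps R Q G" and gj: "g j = g0" by blast
  have gf: "(\<lambda>i x. g i (f i x)) \<in> chain_maps R G G"
    using chain_comp_maps[OF f g] unfolding chain_comp_def comp_def .
  have "x \<ominus>\<^bsub>G$j\<^esub> g j (f j x) \<in> coboundaries G j" if x: "x \<in> G$$j" for x
  proof -
    have fx: "f j x \<in> cocycles Q j" using chain_cocycles[OF X0c Qc m, of x j] x Gz fm[of j] j by simp
    have gfx: "g0 (f j x) \<in> G$$j" by (rule mod_hom_closed[OF g0 fc[OF x]])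
    have "f j (x \<ominus>\<^bsub>G$j\<^esub> g0 (f j x)) \<in> coboundaries Q j"
      using g0f[OF fc[OF x]] \<rho>z[OF fx] mod_hom_diff[OF mG mQ fh x gfx] by simp
    then show ?thesis unfolding gj using fi x gfx by simp
  qed
  then have "null_homotopic R G G (\<lambda>i x. x \<ominus>\<^bsub>G$i\<^esub> g i (f i x))"
    using res_cx_null[OF R res gf[unfolded G_def]] by (simp add: G_def res_cx_top_coboundaries)
  note retract = contr_at_retract[OF G Qc f g this]
  obtain a where bot: "\<And>i. i < a ==> Q$$i = {\<zero>\<^bsub>Q$i\<^esub>}"
    using Q unfolding fp_complex_def by blast
  \<comment> \<open>Below \<open>a\<close> the complex \<open>Q\<close> is zero and the zero maps
    contract it; its retract \<open>G\<close> inherits this.\<close>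
  have "contr_at R Q i" if i: "i < a" for i
    unfolding contr_at_def
  proof (intro bexI ballI)
    interpret Qi: module R "Q$i" by (rule mQ)
    fix x assume "x \<in> Q$$i"
    then have x: "x = \<zero>\<^bsub>Q$i\<^esub>" using bot[OF i] by simp
    have "diff Q (i - 1) \<zero>\<^bsub>Q$(i - 1)\<^esub> = \<zero>\<^bsub>Q$i\<^esub>"
      by (rule mod_hom_zero[OF mQ mQ cx_diff[OF Qc]]) simp
    then show "x = diff Q (i - 1) \<zero>\<^bsub>Q$(i - 1)\<^esub> \<oplus>\<^bsub>Q$i\<^esub> \<zero>\<^bsub>Q$i\<^esub>"
      unfolding x by simp
  qed (rule mod_hom_const_zero[OF mQ])+
  then have "contractible R b D t" if "j - int (Suc t) < a" for t
    using retract that contr_at_res_cx[of R b D j t] by (simp add: G_def)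
  then show ?thesis by (intro exI[of _ "nat (j - a)"]) auto
qed

end

section \<open>Base change\<close>

context ring_hom_cring begin

lemma hom_vec: "v \<in> vecs R n ==> h \<circ> v \<in> vecs S n"
  by (auto simp: vec_mod_carrier)

lemma hom_unit_vec: "h \<circ> unit_vec R i = unit_vec S i"
  by (auto simp: unit_vec_def)

text \<open>\<open>L'\<close> is the matrix of \<open>L\<close> with \<open>h\<close> applied to its
  entries.\<close>

lemma base_change_hom:
  assumes L: "L \<in> mod_hom R (vec R n) (vec R p)"
  shows "\<exists>L'\<in>mod_hom S (vec S n) (vec S p). \<forall>v\<in>vecs R n. L' (h \<circ> v) = h \<circ> L v"
proof -
  have R: "cring R" and S: "cring S" by (rule R.cring_axioms S.cring_axioms)+
  have Lu: "L (unit_vec R i) \<in> vecs R p" if "i < n" for i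
    by (rule mod_hom_closed[OF L unit_vec_carrier[OF R that]])
  obtain L' where L': "L' \<in> mod_hom S (vec S n) (vec S p)"
    and L'u: "\<And>i. i < n ==> L' (unit_vec S i) = h \<circ> L (unit_vec R i)"
    using vec_hom_exists[OF S module_vec_mod[OF S, of p], of n "\<lambda>i. h \<circ> L (unit_vec R i)"] hom_vec Lu by auto
  \<comment> \<open>The free module over \<open>S\<close>, made into an \<open>R\<close>-module
    through \<open>h\<close>. Both sides of the claim become \<open>R\<close>-linear maps into it
    and are compared on unit vectors.\<close>
  define M where "M = \<lparr>carrier = vecs S p, monoid.mult = mult (vec S p), one = one (vec S p),
    ring.zero = zero (vec S p), add = add (vec S p), smult = (\<lambda>a. smult (vec S p) (h a))\<rparr>"
  have Ms: "carrier M = vecs S p" "zero M = zero (vec S p)" "add M = add (vec S p)"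
    "smult M = (\<lambda>a. smult (vec S p) (h a))"
    by (simp_all add: M_def)
  interpret V: module S "vec S p" by (rule module_vec_mod[OF S])
  have M: "module R M"
  proof (rule moduleI[OF R])
    show "abelian_group M"
      using V.M.abelian_group_axioms V.M.l_neg
      by (intro abelian_groupI) (auto simp: Ms V.M.a_ac simp del: vec_mod_simps intro: bexI[of _ "\<ominus>\<^bsub>vec S p\<^esub> _"])
  qed (simp_all add: Ms V.smult_l_distr V.smult_r_distr V.smult_assoc1 del: vec_mod_simps)
  have "L' (h \<circ> v) = h \<circ> L v" if v: "v \<in> vecs R n" for v
  proof (rule vec_hom_eqI[OF R M _ _ _ v])
    show "(\<lambda>v. L' (h \<circ> v)) \<in> mod_hom R (vec R n) M"
    proof (rule mod_homI)
      fix v w assume v: "v \<in> vecs R n" and w: "w \<in> vecs R n"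
      show "L' (h \<circ> v) \<in> carrier M" using mod_hom_closed[OF L' hom_vec[OF v]] by (simp add: Ms)
      have "h \<circ> (v \<oplus>\<^bsub>vec R n\<^esub> w) = (h \<circ> v) \<oplus>\<^bsub>vec S n\<^esub> (h \<circ> w)"
        using vec_mod_coord[OF R v] vec_mod_coord[OF R w] by (auto simp: fun_eq_iff)
      then show "L' (h \<circ> (v \<oplus>\<^bsub>vec R n\<^esub> w)) = L' (h \<circ> v) \<oplus>\<^bsub>M\<^esub> L' (h \<circ> w)"
        using mod_hom_add[OF L' hom_vec[OF v] hom_vec[OF w]] by (simp only: Ms)
    next
      fix a v assume a: "a \<in> carrier R" and v: "v \<in> vecs R n"
      have "h \<circ> (a \<odot>\<^bsub>vec R n\<^esub> v) = h a \<odot>\<^bsub>vec S n\<^esub> (h \<circ> v)"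
        using vec_mod_coord[OF R v] a by (auto simp: fun_eq_iff)
      then show "L' (h \<circ> (a \<odot>\<^bsub>vec R n\<^esub> v)) = a \<odot>\<^bsub>M\<^esub> L' (h \<circ> v)"
        using mod_hom_smult[OF L' hom_closed[OF a] hom_vec[OF v]] by (simp only: Ms)
    qed
    show "(\<lambda>v. h \<circ> L v) \<in> mod_hom R (vec R n) M"
    proof (rule mod_homI)
      fix v w assume v: "v \<in> vecs R n" and w: "w \<in> vecs R n"
      show "h \<circ> L v \<in> carrier M" using hom_vec[OF mod_hom_closed[OF L v]] by (simp add: Ms)
      show "h \<circ> L (v \<oplus>\<^bsub>vec R n\<^esub> w) = (h \<circ> L v) \<oplus>\<^bsub>M\<^esub> (h \<circ> L w)"
        using mod_hom_add[OF L v w] vec_mod_coord[OF R mod_hom_closed[OF L v]] vec_mod_coord[OF R mod_hom_closed[OF L w]]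
        by (auto simp: fun_eq_iff Ms)
    next
      fix a v assume a: "a \<in> carrier R" and v: "v \<in> vecs R n"
      show "h \<circ> L (a \<odot>\<^bsub>vec R n\<^esub> v) = a \<odot>\<^bsub>M\<^esub> (h \<circ> L v)"
        using mod_hom_smult[OF L a v] vec_mod_coord[OF R mod_hom_closed[OF L v]] a by (auto simp: fun_eq_iff Ms)
    qed
    show "L' (h \<circ> unit_vec R i) = h \<circ> L (unit_vec R i)" if "i < n" for i
      using L'u[OF that] by (simp only: hom_unit_vec)
  qed
  with L' show ?thesis by blast
qed

lemma base_change_res:
  assumes "\<And>t. D t \<in> mod_hom R (vec R (b (Suc t))) (vec R (b t))"
  shows "\<exists>D'. (\<forall>t. D' t \<in> mod_hom S (vec S (b (Suc t))) (vec S (b t))) \<and>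
    (\<forall>t. \<forall>v\<in>vecs R (b (Suc t)). D' t (h \<circ> v) = h \<circ> D t v)"
proof -
  have "\<forall>t. \<exists>L. L \<in> mod_hom S (vec S (b (Suc t))) (vec S (b t)) \<and>
    (\<forall>v\<in>vecs R (b (Suc t)). L (h \<circ> v) = h \<circ> D t v)"
    using base_change_hom[OF assms] by (simp only: Bex_def) simp
  from choice[OF this] show ?thesis by blast
qed

text \<open>The contraction is an identity between linear maps, to be tested on unit vectors, and
  these are images of unit vectors over \<open>R\<close>. So the transfer holds for every ring
  homomorphism, flat or not.\<close>

lemma base_change_contractible:
  assumes D: "\<And>t. D t \<in> mod_hom R (vec R (b (Suc t))) (vec R (b t))"
    and D': "\<And>t. D' t \<in> mod_hom S (vec S (b (Suc t))) (vec S (b t))"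
    and DD': "\<And>t v. v \<in> vecs R (b (Suc t)) ==> D' t (h \<circ> v) = h \<circ> D t v"
    and c: "contractible R b D t"
  shows "contractible S b D' t"
proof -
  have R: "cring R" and S: "cring S" by (rule R.cring_axioms S.cring_axioms)+
  obtain s s' where s: "s \<in> mod_hom R (vec R (b (Suc t))) (vec R (b (Suc (Suc t))))"
    and s': "s' \<in> mod_hom R (vec R (b t)) (vec R (b (Suc t)))"
    and e: "\<And>v. v \<in> vecs R (b (Suc t)) ==> v = D (Suc t) (s v) \<oplus>\<^bsub>vec R (b (Suc t))\<^esub> s' (D t v)"
    using c unfolding contractible_def by blast
  obtain z where z: "z \<in> mod_hom S (vec S (b (Suc t))) (vec S (b (Suc (Suc t))))"
    and zs: "\<And>v. v \<in> vecs R (b (Suc t)) ==> z (h \<circ> v) = h \<circ> s v"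
    using base_change_hom[OF s] by blast
  obtain z' where z': "z' \<in> mod_hom S (vec S (b t)) (vec S (b (Suc t)))"
    and zs': "\<And>v. v \<in> vecs R (b t) ==> z' (h \<circ> v) = h \<circ> s' v"
    using base_change_hom[OF s'] by blast
  have "v = D' (Suc t) (z v) \<oplus>\<^bsub>vec S (b (Suc t))\<^esub> z' (D' t v)" if v: "v \<in> vecs S (b (Suc t))" for v
  proof (rule vec_hom_eqI[OF S module_vec_mod[OF S] mod_hom_ident _ _ v])
    show "(\<lambda>v. D' (Suc t) (z v) \<oplus>\<^bsub>vec S (b (Suc t))\<^esub> z' (D' t v)) \<in> mod_hom S (vec S (b (Suc t))) (vec S (b (Suc t)))"
      by (rule mod_hom_plus[OF module_vec_mod[OF S] mod_hom_comp[OF z D'] mod_hom_comp[OF D' z']])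
    fix i assume i: "i < b (Suc t)"
    let ?u = "unit_vec R i"
    have u: "?u \<in> vecs R (b (Suc t))" by (rule unit_vec_carrier[OF R i])
    note su = mod_hom_closed[OF s u] and Du = mod_hom_closed[OF D u]
    note c1 = vec_mod_coord[OF R mod_hom_closed[OF D su]] and c2 = vec_mod_coord[OF R mod_hom_closed[OF s' Du]]
    have "h \<circ> ?u = h \<circ> (D (Suc t) (s ?u) \<oplus>\<^bsub>vec R (b (Suc t))\<^esub> s' (D t ?u))" using arg_cong[OF e[OF u], of "\<lambda>v. h \<circ> v"] .
    also have "\<dots> = (h \<circ> D (Suc t) (s ?u)) \<oplus>\<^bsub>vec S (b (Suc t))\<^esub> (h \<circ> s' (D t ?u))" using c1 c2 by (auto simp: fun_eq_iff)
    finally show "unit_vec S i = D' (Suc t) (z (unit_vec S i)) \<oplus>\<^bsub>vec S (b (Suc t))\<^esub> z' (D' t (unit_vec S i))"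
      using zs[OF u] DD'[OF su] DD'[OF u] zs'[OF Du] by (simp only: hom_unit_vec)
  qed
  with z z' show ?thesis unfolding contractible_def by blast
qed

text \<open>By \<open>assoc\<close> each element of \<open>S\<close> generates the same ideal as the
  image of some ring element, which is true of quotients and of localizations alike. An ideal is
  then generated by the image of its contraction.\<close>

lemma noetherian_transfer:
  assumes "noetherian_ring R"
    and assoc: "\<And>b. b \<in> carrier S ==> \<exists>r\<in>carrier R. \<exists>u\<in>carrier S. \<exists>u'\<in>carrier S. b = u \<otimes>\<^bsub>S\<^esub> h r \<and> h r = u' \<otimes>\<^bsub>S\<^esub> b"
  shows "noetherian_ring S"
proof
  fix J assume J: "ideal J S"
  note D = S.idealD[OF J]
  have "ideal {r \<in> carrier R. h r \<in> J} R"
    using D by (intro R.ideal_ofI) auto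
  then obtain A where A: "A \<subseteq> carrier R" "finite A" "{r \<in> carrier R. h r \<in> J} = Idl\<^bsub>R\<^esub> A"
    using noetherian_ring.finetely_gen[OF assms(1)] by blast
  have hA: "h ` A \<subseteq> carrier S" using A(1) by auto
  note G = S.idealD[OF S.genideal_ideal[OF hA]]
  have "Idl\<^bsub>S\<^esub> (h ` A) \<subseteq> J"
  proof (rule S.genideal_minimal[OF J])
    have "A \<subseteq> {r \<in> carrier R. h r \<in> J}" unfolding A(3) by (rule R.genideal_self[OF A(1)])
    then show "h ` A \<subseteq> J" by auto
  qed
  moreover have "Idl\<^bsub>R\<^esub> A \<subseteq> {r \<in> carrier R. h r \<in> Idl\<^bsub>S\<^esub> (h ` A)}"
  proof (rule R.genideal_minimal)
    show "ideal {r \<in> carrier R. h r \<in> Idl\<^bsub>S\<^esub> (h ` A)} R" using G by (intro R.ideal_ofI) auto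
    show "A \<subseteq> {r \<in> carrier R. h r \<in> Idl\<^bsub>S\<^esub> (h ` A)}" using A(1) S.genideal_self[OF hA] by auto
  qed
  then have sub: "{r \<in> carrier R. h r \<in> J} \<subseteq> {r \<in> carrier R. h r \<in> Idl\<^bsub>S\<^esub> (h ` A)}" by (simp only: A(3))
  have "b \<in> Idl\<^bsub>S\<^esub> (h ` A)" if b: "b \<in> J" for b
  proof -
    obtain r u u' where r: "r \<in> carrier R" "u \<in> carrier S" "u' \<in> carrier S" "b = u \<otimes>\<^bsub>S\<^esub> h r" "h r = u' \<otimes>\<^bsub>S\<^esub> b"
      using assoc[OF D(1)[OF b]] by blast
    have "h r \<in> J" using D(6)[OF r(3) b] by (simp only: r(5))
    then have "h r \<in> Idl\<^bsub>S\<^esub> (h ` A)" using subsetD[OF sub, of r] r(1) by simp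
    then show ?thesis using G(6)[OF r(2)] by (simp only: r(4))
  qed
  ultimately have "J = Idl\<^bsub>S\<^esub> (h ` A)" by blast
  then show "\<exists>A\<subseteq>carrier S. finite A \<and> J = Idl\<^bsub>S\<^esub> A" using hA A(2) by (intro exI[of _ "h ` A"]) simp
qed

end

text \<open>Take the least possible number of generators. A relation with a coefficient outside
  \<open>M\<close>, that is with a unit, would allow one generator to be dropped.\<close>

lemma minimal_image:
  fixes B :: "('a, 'b) ring_scheme" (structure)
  assumes B: "cring B" and M0: "\<zero> \<in> M" and M: "\<And>a. a \<in> carrier B ==> a \<notin> M ==> \<exists>u\<in>carrier B. u \<otimes> a = \<one>"
    and ex: "\<exists>k. \<exists>g\<in>mod_hom B (vec B k) (vec B n). g ` vecs B k = N"
  shows "\<exists>k. \<exists>g\<in>mod_hom B (vec B k) (vec B n). g ` vecs B k = N \<and>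
    (\<forall>v\<in>vecs B k. g v = (\<lambda>_. \<zero>) --> (\<forall>i. v i \<in> M))"
proof -
  interpret cring B by fact
  define gens where "gens k \<longleftrightarrow> (\<exists>g\<in>mod_hom B (vec B k) (vec B n). g ` vecs B k = N)" for k
  define k where "k = (LEAST k. gens k)"
  have "gens k" unfolding k_def by (rule LeastI_ex) (use ex in \<open>simp only: gens_def\<close>)
  then obtain g where g: "g \<in> mod_hom B (vec B k) (vec B n)" and gN: "g ` vecs B k = N"
    by (auto simp: gens_def)
  have "v i \<in> M" if v: "v \<in> vecs B k" and gv: "g v = (\<lambda>_. \<zero>)" for v i
  proof (rule ccontr)
    assume iM: "v i \<notin> M"
    then have i: "i < k" using v M0 by (metis vec_mod_carrier not_le)
    obtain u where u: "u \<in> carrier B" "u \<otimes> v i = \<one>" using M[OF vec_mod_coord[OF B v] iM] by blast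
    interpret V: module B "vec B k" by (rule module_vec_mod[OF B])
    interpret W: module B "vec B n" by (rule module_vec_mod[OF B])
    define w where "w = u \<odot>\<^bsub>vec B k\<^esub> v"
    have w: "w \<in> vecs B k" "w i = \<one>" "g w = \<zero>\<^bsub>vec B n\<^esub>"
      using V.smult_closed[OF u(1) v] u mod_hom_smult[OF g u(1) v] gv by (simp_all add: w_def)
    \<comment> \<open>Inserts a zero at position \<open>i\<close>. Subtracting \<open>x i\<close>
      times the relation \<open>w\<close>, whose coordinate there is one, brings any
      \<open>x\<close> into the image of \<open>\<tau>\<close> without changing its value under
      \<open>g\<close>.\<close>
    define \<tau> where "\<tau> z = (\<lambda>j. if j < i then z j else if j = i then \<zero> else z (j - 1))" for z :: "nat => 'a"
    have \<tau>: "\<tau> \<in> mod_hom B (vec B (k - 1)) (vec B k)"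
      using i by (intro mod_homI) (auto simp: \<tau>_def vec_mod_carrier fun_eq_iff)
    have "(\<lambda>z. g (\<tau> z)) ` vecs B (k - 1) = N"
    proof
      show "(\<lambda>z. g (\<tau> z)) ` vecs B (k - 1) \<subseteq> N" using gN mod_hom_closed[OF \<tau>] by auto
      show "N \<subseteq> (\<lambda>z. g (\<tau> z)) ` vecs B (k - 1)"
      proof
        fix y assume "y \<in> N"
        then obtain x where x: "x \<in> vecs B k" "y = g x" using gN by blast
        have xi: "x i \<in> carrier B" by (rule vec_mod_coord[OF B x(1)])
        have xw: "x i \<odot>\<^bsub>vec B k\<^esub> w \<in> vecs B k" by (rule V.smult_closed[OF xi w(1)])
        define x' where "x' = x \<ominus>\<^bsub>vec B k\<^esub> x i \<odot>\<^bsub>vec B k\<^esub> w"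
        have x': "x' \<in> vecs B k" using x(1) xw by (simp add: x'_def del: vec_mod_simps)
        have "x' = (\<lambda>j. x j \<ominus> (x i \<odot>\<^bsub>vec B k\<^esub> w) j)" unfolding x'_def by (rule vec_mod_a_minus[OF B x(1) xw])
        then have "x' i = \<zero>" using xi w(2) by (simp add: a_minus_def r_neg)
        define z where "z = (\<lambda>j. if j < i then x' j else x' (Suc j))"
        have z: "z \<in> vecs B (k - 1)" using x' i by (auto simp: z_def vec_mod_carrier)
        have "\<tau> z = x'" using \<open>x' i = \<zero>\<close> by (auto simp: \<tau>_def z_def fun_eq_iff)
        moreover have "g x' = y"
          using mod_hom_diff[OF V.module_axioms W.module_axioms g x(1) xw] mod_hom_smult[OF g xi w(1)] w(3)
            mod_hom_closed[OF g x(1)] W.smult_r_null[OF xi] by (simp add: x'_def x(2) del: vec_mod_simps)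
        ultimately show "y \<in> (\<lambda>z. g (\<tau> z)) ` vecs B (k - 1)" using z by auto
      qed
    qed
    then have "gens (k - 1)" unfolding gens_def using mod_hom_comp[OF \<tau> g] by blast
    then have "k \<le> k - 1" unfolding k_def by (rule Least_le)
    then show False using i by simp
  qed
  then show ?thesis using g gN by blast
qed

section \<open>Resolutions of ideals under localization\<close>

lemma ideal_resD:
  assumes "ideal_res R I b D"
  shows "free_res R b D" "b 0 = Suc 0" "v \<in> vecs R (b (Suc 0)) ==> D 0 v 0 \<in> I"
    "w \<in> vecs R (Suc 0) ==> w 0 \<in> I ==> w \<in> D 0 ` vecs R (b (Suc 0))"
  using assms by (auto simp: ideal_res_def)

lemma vec_1I: "a \<in> carrier R ==> (\<lambda>i. if i = 0 then a else \<zero>\<^bsub>R\<^esub>) \<in> vecs R (Suc 0)"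
  by (simp add: vec_mod_carrier)

lemma vec_1_eqI:
  "v \<in> vecs R (Suc 0) ==> w \<in> vecs R (Suc 0) ==> v 0 = w 0 ==> v = w"
  by (rule ext) (metis One_nat_def less_one not_le vec_mod_carrier)

lemma ideal_res_preimage:
  assumes "ideal_res R I b D" "y \<in> I" "y \<in> carrier R"
  shows "\<exists>v\<in>vecs R (b (Suc 0)). D 0 v 0 = y"
proof -
  have "(\<lambda>i. if i = 0 then y else \<zero>\<^bsub>R\<^esub>) \<in> D 0 ` vecs R (b (Suc 0))"
    using ideal_resD(4)[OF assms(1) vec_1I[OF assms(3)]] assms(2) by simp
  then obtain v where v: "(\<lambda>i. if i = 0 then y else \<zero>\<^bsub>R\<^esub>) = D 0 v" "v \<in> vecs R (b (Suc 0))" by (rule imageE)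
  have "D 0 v 0 = y" using fun_cong[OF v(1), of 0] by simp
  then show ?thesis using v(2) by blast
qed

context ring_hom_cring begin

lemma hom_vec_smult: "a \<in> carrier R ==> v \<in> vecs R n ==>
    h \<circ> (a \<odot>\<^bsub>vec R n\<^esub> v) = h a \<odot>\<^bsub>vec S n\<^esub> (h \<circ> v)"
  using vec_mod_coord[OF R.cring_axioms] by (auto simp: fun_eq_iff)

lemma hom_vec_minus: "v \<in> vecs R n ==> w \<in> vecs R n ==>
    h \<circ> (v \<ominus>\<^bsub>vec R n\<^esub> w) = (h \<circ> v) \<ominus>\<^bsub>vec S n\<^esub> (h \<circ> w)"
  using vec_mod_coord[OF R.cring_axioms, of v n] vec_mod_coord[OF R.cring_axioms, of w n]
  unfolding vec_mod_a_minus[OF R.cring_axioms] vec_mod_a_minus[OF S.cring_axioms hom_vec hom_vec]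
  by (auto simp: fun_eq_iff a_minus_def)

text \<open>Flatness of localization by hand: a relation over \<open>S\<close> is cleared of
  denominators, solved over \<open>R\<close> and divided back. \<open>S\<close> is described by the
  three properties \<open>inv\<close>, \<open>frac\<close> and \<open>ker\<close> only, so that a
  composite of the localization with an isomorphism is covered too.\<close>

lemma ideal_res_localization:
  assumes P: "primeideal P R"
    and inv: "\<And>s. s \<in> carrier R - P ==> \<exists>u\<in>carrier S. u \<otimes>\<^bsub>S\<^esub> h s = \<one>\<^bsub>S\<^esub>"
    and frac: "\<And>a. a \<in> carrier S ==> \<exists>s\<in>carrier R - P. \<exists>r\<in>carrier R. h s \<otimes>\<^bsub>S\<^esub> a = h r"
    and ker: "\<And>r. r \<in> carrier R ==> h r = \<zero>\<^bsub>S\<^esub> ==> \<exists>t\<in>carrier R - P. t \<otimes> r = \<zero>"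
    and res: "ideal_res R P b D"
    and D': "\<And>t. D' t \<in> mod_hom S (vec S (b (Suc t))) (vec S (b t))"
    and DD': "\<And>t v. v \<in> vecs R (b (Suc t)) ==> D' t (h \<circ> v) = h \<circ> D t v"
  shows "ideal_res S {a \<in> carrier S. \<exists>s\<in>carrier R - P. \<exists>r\<in>P. h s \<otimes>\<^bsub>S\<^esub> a = h r} b D'"
proof -
  have R: "cring R" and S: "cring S" by (rule R.cring_axioms S.cring_axioms)+
  note PD = R.primeD[OF P]
  note F = ideal_resD(1)[OF res] and b0 = ideal_resD(2)[OF res]
  note D = free_resD(1)[OF F]
  have mv: "module S (vec S n)" for n by (rule module_vec_mod[OF S])
  have one: "\<one> \<in> carrier R - P" using PD(2) by simp
  have mult: "s \<otimes> t \<in> carrier R - P" if "s \<in> carrier R - P" "t \<in> carrier R - P" for s t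
    using that PD(4)[of s t] by auto
  \<comment> \<open>A common denominator for the coordinates of a vector.\<close>
  have cd: "\<exists>s\<in>carrier R - P. \<exists>v\<in>vecs R n. h s \<odot>\<^bsub>vec S n\<^esub> w = h \<circ> v" if w: "w \<in> vecs S n" for w n
  proof -
    have wc: "w i \<in> carrier S" for i by (rule vec_mod_coord[OF S w])
    have "\<exists>s\<in>carrier R - P. \<forall>i<k. \<exists>r\<in>carrier R. h s \<otimes>\<^bsub>S\<^esub> w i = h r" for k
    proof (induction k)
      case (Suc k)
      then obtain s where s: "s \<in> carrier R - P" "\<And>i. i < k ==> \<exists>r\<in>carrier R. h s \<otimes>\<^bsub>S\<^esub> w i = h r" by blast
      obtain s' r' where s': "s' \<in> carrier R - P" "r' \<in> carrier R" "h s' \<otimes>\<^bsub>S\<^esub> w k = h r'" using frac[OF wc] by blast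
      have "\<exists>r\<in>carrier R. h (s \<otimes> s') \<otimes>\<^bsub>S\<^esub> w i = h r" if i: "i < Suc k" for i
      proof (cases "i = k")
        case True
        have "h (s \<otimes> s') \<otimes>\<^bsub>S\<^esub> w k = h (s \<otimes> r')" using s s' wc by (simp add: S.m_assoc)
        then show ?thesis using True s s' by blast
      next
        case False
        then obtain r where r: "r \<in> carrier R" "h s \<otimes>\<^bsub>S\<^esub> w i = h r" using s(2)[of i] i by auto
        have "h (s \<otimes> s') \<otimes>\<^bsub>S\<^esub> w i = h s' \<otimes>\<^bsub>S\<^esub> (h s \<otimes>\<^bsub>S\<^esub> w i)" using s(1) s'(1) wc by (simp add: S.m_ac)
        also have "\<dots> = h (s' \<otimes> r)" using s' r by simp
        finally show ?thesis using r s' by blast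
      qed
      then show ?case using mult[OF s(1) s'(1)] by blast
    qed (use one in auto)
    then obtain s where s: "s \<in> carrier R - P" "\<forall>i<n. \<exists>r. r \<in> carrier R \<and> h s \<otimes>\<^bsub>S\<^esub> w i = h r" by (meson bexE)
    then obtain r where r: "\<And>i. i < n ==> r i \<in> carrier R \<and> h s \<otimes>\<^bsub>S\<^esub> w i = h (r i)" by metis
    define v where "v = (\<lambda>i. if i < n then r i else \<zero>)"
    have "v \<in> vecs R n" using r by (simp add: v_def vec_mod_carrier)
    moreover have "h s \<odot>\<^bsub>vec S n\<^esub> w = h \<circ> v"
      using r w s(1) by (auto simp: v_def fun_eq_iff vec_mod_carrier)
    ultimately show ?thesis using s(1) by blast
  qed
  \<comment> \<open>A common annihilator outside \<open>P\<close> for the coordinates of a vector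
    that vanishes in \<open>S\<close>.\<close>
  have kn: "\<exists>t\<in>carrier R - P. t \<odot>\<^bsub>vec R n\<^esub> v = (\<lambda>_. \<zero>)" if v: "v \<in> vecs R n" and hv: "h \<circ> v = (\<lambda>_. \<zero>\<^bsub>S\<^esub>)" for v n
  proof -
    have vc: "v i \<in> carrier R" for i by (rule vec_mod_coord[OF R v])
    have hv0: "h (v i) = \<zero>\<^bsub>S\<^esub>" for i using fun_cong[OF hv, of i] by simp
    have "\<exists>t\<in>carrier R - P. \<forall>i<k. t \<otimes> v i = \<zero>" for k
    proof (induction k)
      case (Suc k)
      then obtain s where s: "s \<in> carrier R - P" "\<And>i. i < k ==> s \<otimes> v i = \<zero>" by blast
      obtain s' where s': "s' \<in> carrier R - P" "s' \<otimes> v k = \<zero>" using ker[OF vc hv0] by blast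
      have "(s \<otimes> s') \<otimes> v i = \<zero>" if i: "i < Suc k" for i
      proof (cases "i = k")
        case True
        then show ?thesis using s s' vc by (simp add: R.m_assoc)
      next
        case False
        then have "s' \<otimes> (s \<otimes> v i) = \<zero>" using s(2)[of i] i s'(1) by simp
        then show ?thesis using s(1) s'(1) vc by (simp add: R.m_ac)
      qed
      then show ?case using mult[OF s(1) s'(1)] by blast
    qed (use one in auto)
    then obtain t where t: "t \<in> carrier R - P" "\<And>i. i < n ==> t \<otimes> v i = \<zero>" by blast
    have "t \<otimes> v i = \<zero>" for i using t v by (cases "i < n") (auto simp: vec_mod_carrier)
    then show ?thesis using t(1) by auto
  qed
  have scale: "a \<odot>\<^bsub>vec S n\<^esub> (c \<odot>\<^bsub>vec S n\<^esub> w) = w"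
    if "w \<in> vecs S n" "a \<otimes>\<^bsub>S\<^esub> c = \<one>\<^bsub>S\<^esub>" "a \<in> carrier S" "c \<in> carrier S" for a c w n
  proof -
    interpret V: module S "vec S n" by (rule mv)
    show ?thesis using V.smult_assoc1[OF that(3,4,1)] V.smult_one[OF that(1)] by (simp only: that(2))
  qed
  have "free_res S b D'"
    unfolding free_res_def
  proof (intro allI conjI ballI D' iffI)
    fix t w assume w: "w \<in> vecs S (b (Suc t))"
    interpret V1: module S "vec S (b t)" by (rule mv)
    interpret W1: module R "vec R (b (Suc t))" by (rule module_vec_mod[OF R])
    {
      assume D0: "D' t w = (\<lambda>_. \<zero>\<^bsub>S\<^esub>)"
      obtain s v where s: "s \<in> carrier R - P" and v: "v \<in> vecs R (b (Suc t))" and e: "h s \<odot>\<^bsub>vec S (b (Suc t))\<^esub> w = h \<circ> v"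
        using cd[OF w] by blast
      have "h \<circ> D t v = h s \<odot>\<^bsub>vec S (b t)\<^esub> D' t w" using DD'[OF v] mod_hom_smult[OF D' _ w, of "h s"] s e by simp
      also have "\<dots> = (\<lambda>_. \<zero>\<^bsub>S\<^esub>)" using D0 s by simp
      finally obtain u where u: "u \<in> carrier R - P" "u \<odot>\<^bsub>vec R (b t)\<^esub> D t v = (\<lambda>_. \<zero>)"
        using kn[OF mod_hom_closed[OF D v]] by blast
      have uv: "u \<odot>\<^bsub>vec R (b (Suc t))\<^esub> v \<in> vecs R (b (Suc t))" using u v by (intro W1.smult_closed) auto
      have "D t (u \<odot>\<^bsub>vec R (b (Suc t))\<^esub> v) = (\<lambda>_. \<zero>)" using mod_hom_smult[OF D _ v, of u] u by simp
      from free_resD(2)[OF F uv this]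
      obtain v' where v': "u \<odot>\<^bsub>vec R (b (Suc t))\<^esub> v = D (Suc t) v'" "v' \<in> vecs R (b (Suc (Suc t)))" by (rule imageE)
      have us: "u \<otimes> s \<in> carrier R" using u s by simp
      obtain z where z: "z \<in> carrier S" "z \<otimes>\<^bsub>S\<^esub> h (u \<otimes> s) = \<one>\<^bsub>S\<^esub>" using inv[OF mult[OF u(1) s]] by blast
      have "h (u \<otimes> s) \<odot>\<^bsub>vec S (b (Suc t))\<^esub> w = h u \<odot>\<^bsub>vec S (b (Suc t))\<^esub> (h s \<odot>\<^bsub>vec S (b (Suc t))\<^esub> w)"
        using u s vec_mod_coord[OF S w] by (simp add: S.m_assoc)
      also have "\<dots> = h \<circ> (u \<odot>\<^bsub>vec R (b (Suc t))\<^esub> v)" using hom_vec_smult[OF _ v, of u] u by (simp only: e) simp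
      also have "\<dots> = D' (Suc t) (h \<circ> v')" unfolding v'(1) by (rule DD'[OF v'(2), symmetric])
      finally have "w = z \<odot>\<^bsub>vec S (b (Suc t))\<^esub> D' (Suc t) (h \<circ> v')"
        using scale[OF w z(2) z(1) hom_closed[OF us]] by simp
      also have "\<dots> = D' (Suc t) (z \<odot>\<^bsub>vec S (b (Suc (Suc t)))\<^esub> (h \<circ> v'))"
        by (rule mod_hom_smult[OF D' z(1) hom_vec[OF v'(2)], symmetric])
      finally show "w \<in> D' (Suc t) ` vecs S (b (Suc (Suc t)))"
        using module.smult_closed[OF mv z(1) hom_vec[OF v'(2)]] by (rule image_eqI)
    }
    assume "w \<in> D' (Suc t) ` vecs S (b (Suc (Suc t)))"
    then obtain w' where w': "w = D' (Suc t) w'" "w' \<in> vecs S (b (Suc (Suc t)))" by (rule imageE)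
    have "D' t (D' (Suc t) w') = \<zero>\<^bsub>vec S (b t)\<^esub>"
    proof (rule vec_hom_eqI[OF S mv mod_hom_comp[OF D' D'] mod_hom_const_zero[OF mv] _ w'(2)])
      fix i assume i: "i < b (Suc (Suc t))"
      note u = unit_vec_carrier[OF R i]
      have "D' t (D' (Suc t) (h \<circ> unit_vec R i)) = h \<circ> D t (D (Suc t) (unit_vec R i))"
        by (simp only: DD'[OF u] DD'[OF mod_hom_closed[OF D u]])
      also have "\<dots> = \<zero>\<^bsub>vec S (b t)\<^esub>" unfolding free_resD(3)[OF F u] by auto
      finally show "D' t (D' (Suc t) (unit_vec S i)) = \<zero>\<^bsub>vec S (b t)\<^esub>" by (simp only: hom_unit_vec)
    qed
    then show "D' t w = (\<lambda>_. \<zero>\<^bsub>S\<^esub>)" using w'(1) by simp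
  qed
  moreover have "D' 0 ` vecs S (b 1) =
    {w \<in> vecs S 1. w 0 \<in> {a \<in> carrier S. \<exists>s\<in>carrier R - P. \<exists>r\<in>P. h s \<otimes>\<^bsub>S\<^esub> a = h r}}" (is "_ = ?W")
  proof
    show "D' 0 ` vecs S (b 1) \<subseteq> ?W"
    proof
      fix y assume "y \<in> D' 0 ` vecs S (b 1)"
      then obtain w where w: "y = D' 0 w" "w \<in> vecs S (b (Suc 0))" by auto
      obtain s v where s: "s \<in> carrier R - P" and v: "v \<in> vecs R (b (Suc 0))" and e: "h s \<odot>\<^bsub>vec S (b (Suc 0))\<^esub> w = h \<circ> v"
        using cd[OF w(2)] by blast
      have y: "y \<in> vecs S (Suc 0)" using mod_hom_closed[OF D' w(2)] b0 w(1) by simp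
      have "h s \<odot>\<^bsub>vec S (b 0)\<^esub> y = D' 0 (h s \<odot>\<^bsub>vec S (b (Suc 0))\<^esub> w)"
        unfolding w(1) by (rule mod_hom_smult[OF D' _ w(2), symmetric]) (use s in auto)
      also have "\<dots> = h \<circ> D 0 v" unfolding e by (rule DD'[OF v])
      finally have "h s \<otimes>\<^bsub>S\<^esub> y 0 = h (D 0 v 0)" by (simp add: fun_eq_iff)
      then show "y \<in> ?W" using ideal_resD(3)[OF res v] s y vec_mod_coord[OF S y] by auto
    qed
    show "?W \<subseteq> D' 0 ` vecs S (b 1)"
    proof
      fix w assume "w \<in> ?W"
      then obtain s r where w: "w \<in> vecs S (Suc 0)" and s: "s \<in> carrier R - P" and r: "r \<in> P" "h s \<otimes>\<^bsub>S\<^esub> w 0 = h r" by auto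
      obtain v where v: "v \<in> vecs R (b (Suc 0))" "D 0 v 0 = r"
        using ideal_res_preimage[OF res r(1)] PD(3) r(1) by blast
      obtain z where z: "z \<in> carrier S" "z \<otimes>\<^bsub>S\<^esub> h s = \<one>\<^bsub>S\<^esub>" using inv[OF s] by blast
      interpret V1: module S "vec S (Suc 0)" by (rule mv)
      note Dv = mod_hom_closed[OF D v(1), unfolded b0]
      have "h s \<odot>\<^bsub>vec S (Suc 0)\<^esub> w = h \<circ> D 0 v"
        by (rule vec_1_eqI[OF V1.smult_closed[OF _ w] hom_vec[OF Dv]]) (use s r(2) v(2) in auto)
      then have "w = z \<odot>\<^bsub>vec S (b 0)\<^esub> D' 0 (h \<circ> v)"
        using scale[OF w z(2,1)] s by (simp only: DD'[OF v(1)] b0) auto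
      also have "\<dots> = D' 0 (z \<odot>\<^bsub>vec S (b (Suc 0))\<^esub> (h \<circ> v))"
        by (rule mod_hom_smult[OF D' z(1) hom_vec[OF v(1)], symmetric])
      finally show "w \<in> D' 0 ` vecs S (b 1)"
        using module.smult_closed[OF mv z(1) hom_vec[OF v(1)]] unfolding One_nat_def by (rule image_eqI)
    qed
  qed
  ultimately show ?thesis unfolding ideal_res_def using b0 by simp
qed

end

context ring_hom_cring begin

text \<open>The residue field is a direct summand of \<open>m / x m\<close>: it is the submodule generated by \<open>x\<close>, and
  \<open>n\<close> gives a complement. So the resolution of \<open>m\<close>, reduced modulo \<open>x\<close> and without its first step, is a
  resolution of \<open>m / x m\<close> that has the resolution of the maximal ideal of \<open>S\<close> as a retract.\<close>

lemma contractible_mod_regular: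
  assumes surj: "h ` carrier R = carrier S"
    and x: "x \<in> carrier R" "h x = \<zero>\<^bsub>S\<^esub>" and ker: "\<And>r. r \<in> carrier R ==> h r = \<zero>\<^bsub>S\<^esub> ==> \<exists>a\<in>carrier R. r = a \<otimes> x"
    and reg: "\<And>a. a \<in> carrier R ==> a \<otimes> x = \<zero> ==> a = \<zero>"
    and m: "ideal m R" "x \<in> m" and n: "ideal n R"
    and split: "\<And>y. y \<in> m ==> \<exists>a\<in>carrier R. \<exists>\<nu>\<in>n. y = a \<otimes> x \<oplus> \<nu>"
    and cancel: "\<And>a. a \<in> carrier R ==> a \<otimes> x \<in> n ==> a \<in> m"
    and res: "ideal_res R m b D" and c: "contractible R b D (Suc t)"
    and H: "ideal_res S (h ` m) b' H"
  shows "contractible S b' H t"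
proof -
  have R: "cring R" and S: "cring S" by (rule R.cring_axioms S.cring_axioms)+
  have mR: "module R (vec R k)" and mS: "module S (vec S k)" for k by (rule module_vec_mod[OF R] module_vec_mod[OF S])+
  note mD = R.idealD[OF m(1)] and nD = R.idealD[OF n]
  note F = ideal_resD(1)[OF res] and b0 = ideal_resD(2)[OF res]
  note D = free_resD(1)[OF F]
  have lift: "\<exists>v\<in>vecs R k. w = h \<circ> v" if w: "w \<in> vecs S k" for w k
  proof -
    have "\<forall>i\<in>{..<k}. \<exists>r. r \<in> carrier R \<and> w i = h r" using w surj by (auto simp: vec_mod_carrier)
    from bchoice[OF this] obtain r where r: "\<And>i. i < k ==> r i \<in> carrier R \<and> w i = h (r i)" by auto
    have "(\<lambda>i. if i < k then r i else \<zero>) \<in> vecs R k" using r by (simp add: vec_mod_carrier)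
    moreover have "w = h \<circ> (\<lambda>i. if i < k then r i else \<zero>)" using r w by (auto simp: fun_eq_iff vec_mod_carrier)
    ultimately show ?thesis by blast
  qed
  have divx: "\<exists>u\<in>vecs R k. v = x \<odot>\<^bsub>vec R k\<^esub> u" if v: "v \<in> vecs R k" and hv: "h \<circ> v = (\<lambda>_. \<zero>\<^bsub>S\<^esub>)" for v k
  proof -
    have "\<forall>i\<in>{..<k}. \<exists>a. a \<in> carrier R \<and> v i = a \<otimes> x"
    proof
      fix i assume "i \<in> {..<k}"
      have "h (v i) = \<zero>\<^bsub>S\<^esub>" using fun_cong[OF hv, of i] by simp
      then show "\<exists>a. a \<in> carrier R \<and> v i = a \<otimes> x" using ker[OF vec_mod_coord[OF R v]] by blast
    qed
    from bchoice[OF this] obtain a where a: "\<And>i. i < k ==> a i \<in> carrier R \<and> v i = a i \<otimes> x" by auto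
    have "(\<lambda>i. if i < k then a i else \<zero>) \<in> vecs R k" using a by (simp add: vec_mod_carrier)
    moreover have "v = x \<odot>\<^bsub>vec R k\<^esub> (\<lambda>i. if i < k then a i else \<zero>)"
      using a v x(1) by (auto simp: fun_eq_iff vec_mod_carrier R.m_comm)
    ultimately show ?thesis by (intro bexI[of _ "\<lambda>i. if i < k then a i else \<zero>"])
  qed
  have xreg: "v = (\<lambda>_. \<zero>)" if v: "v \<in> vecs R k" and xv: "x \<odot>\<^bsub>vec R k\<^esub> v = (\<lambda>_. \<zero>)" for v k
    using reg[OF vec_mod_coord[OF R v]] xv vec_mod_coord[OF R v] x(1) by (auto simp: fun_eq_iff R.m_comm)
  have hx0: "h \<circ> (x \<odot>\<^bsub>vec R k\<^esub> v) = (\<lambda>_. \<zero>\<^bsub>S\<^esub>)" if "v \<in> vecs R k" for v k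
    using hom_vec_smult[OF x(1) that] vec_mod_coord[OF S hom_vec[OF that]] x(2) by simp
  have diff0: "\<exists>u\<in>vecs R k. v \<ominus>\<^bsub>vec R k\<^esub> w = x \<odot>\<^bsub>vec R k\<^esub> u"
    if v: "v \<in> vecs R k" and w: "w \<in> vecs R k" and e: "h \<circ> v = h \<circ> w" for v w k
  proof (rule divx)
    interpret V: module R "vec R k" by (rule mR)
    interpret W: module S "vec S k" by (rule mS)
    show "v \<ominus>\<^bsub>vec R k\<^esub> w \<in> vecs R k" using v w by (simp del: vec_mod_simps)
    show "h \<circ> (v \<ominus>\<^bsub>vec R k\<^esub> w) = (\<lambda>_. \<zero>\<^bsub>S\<^esub>)"
      unfolding hom_vec_minus[OF v w] e using W.M.r_neg[OF hom_vec[OF w]] by (simp only: a_minus_def vec_mod_simps(1))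
  qed
  obtain D' where D'0: "\<And>t. D' t \<in> mod_hom S (vec S (b (Suc t))) (vec S (b t))"
    and DD'0: "\<And>t v. v \<in> vecs R (b (Suc t)) ==> D' t (h \<circ> v) = h \<circ> D t v"
    using base_change_res[of D b, OF D] by blast
  let ?b = "\<lambda>t. b (Suc t)" and ?D = "\<lambda>t. D (Suc t)" and ?D' = "\<lambda>t. D' (Suc t)"
  \<comment> \<open>Dropping the first step lowers the index by one; this is why contractibility is
    assumed at \<open>Suc t\<close> and concluded at \<open>t\<close>.\<close>
  have c': "contractible S ?b ?D' t"
    by (rule base_change_contractible[of ?D ?b ?D', OF D D'0 DD'0]) (use c in \<open>simp add: contractible_def\<close>)+
  \<comment> \<open>A cycle modulo \<open>x\<close> lifts to \<open>v\<close> whose differential is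
    \<open>x u\<close>. As \<open>x\<close> is a nonzerodivisor on free modules, \<open>u\<close> is
    a cycle and so a boundary of some \<open>u'\<close>; then \<open>v - x u'\<close> is a cycle,
    hence a boundary.\<close>
  have F': "free_res S ?b ?D'"
    unfolding free_res_def
  proof (intro allI conjI ballI D'0 iffI)
    fix t w
    assume "w \<in> vecs S (b (Suc (Suc t)))"
    then obtain v where v: "v \<in> vecs R (b (Suc (Suc t)))" and w: "w = h \<circ> v" using lift by blast
    note Dv = mod_hom_closed[OF D v]
    interpret V: module R "vec R (b (Suc (Suc t)))" by (rule mR)
    {
      assume "D' (Suc t) w = (\<lambda>_. \<zero>\<^bsub>S\<^esub>)"
      then have "h \<circ> D (Suc t) v = (\<lambda>_. \<zero>\<^bsub>S\<^esub>)" by (simp only: w DD'0[OF v])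
      from divx[OF Dv this] obtain u where u: "u \<in> vecs R (b (Suc t))" "D (Suc t) v = x \<odot>\<^bsub>vec R (b (Suc t))\<^esub> u" by blast
      have "x \<odot>\<^bsub>vec R (b t)\<^esub> D t u = D t (D (Suc t) v)" unfolding u(2) by (rule mod_hom_smult[OF D x(1) u(1), symmetric])
      then have "D t u = (\<lambda>_. \<zero>)" by (intro xreg[OF mod_hom_closed[OF D u(1)]]) (simp only: free_resD(3)[OF F v])
      from free_resD(2)[OF F u(1) this] obtain u' where u': "u = D (Suc t) u'" "u' \<in> vecs R (b (Suc (Suc t)))" by (rule imageE)
      have xu': "x \<odot>\<^bsub>vec R (b (Suc (Suc t)))\<^esub> u' \<in> vecs R (b (Suc (Suc t)))" by (rule V.smult_closed[OF x(1) u'(2)])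
      interpret W: module R "vec R (b (Suc t))" by (rule mR)
      have "D (Suc t) (v \<ominus>\<^bsub>vec R (b (Suc (Suc t)))\<^esub> x \<odot>\<^bsub>vec R (b (Suc (Suc t)))\<^esub> u') = \<zero>\<^bsub>vec R (b (Suc t))\<^esub>"
        unfolding mod_hom_diff[OF mR mR D v xu'] mod_hom_smult[OF D x(1) u'(2)] u(2) u'(1)[symmetric]
        using W.M.r_neg[OF W.smult_closed[OF x(1) u(1)]] by (simp only: a_minus_def)
      then obtain v2 where v2: "v \<ominus>\<^bsub>vec R (b (Suc (Suc t)))\<^esub> x \<odot>\<^bsub>vec R (b (Suc (Suc t)))\<^esub> u' = D (Suc (Suc t)) v2"
        "v2 \<in> vecs R (b (Suc (Suc (Suc t))))"
        using free_resD(2)[OF F, of "v \<ominus>\<^bsub>vec R (b (Suc (Suc t)))\<^esub> x \<odot>\<^bsub>vec R (b (Suc (Suc t)))\<^esub> u'" "Suc t"] V.M.minus_closed[OF v xu']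
        by (simp only: vec_mod_simps(1)) blast
      interpret W': module S "vec S (b (Suc (Suc t)))" by (rule mS)
      have "w = h \<circ> (v \<ominus>\<^bsub>vec R (b (Suc (Suc t)))\<^esub> x \<odot>\<^bsub>vec R (b (Suc (Suc t)))\<^esub> u')"
        using W'.module_diff_zero[OF hom_vec[OF v]] by (simp only: w hom_vec_minus[OF v xu'] hx0[OF u'(2)] vec_mod_simps(1))
      also have "\<dots> = D' (Suc (Suc t)) (h \<circ> v2)" unfolding v2(1) by (rule DD'0[OF v2(2), symmetric])
      finally show "w \<in> D' (Suc (Suc t)) ` vecs S (b (Suc (Suc (Suc t))))" using hom_vec[OF v2(2)] by (rule image_eqI)
    }
    assume "w \<in> D' (Suc (Suc t)) ` vecs S (b (Suc (Suc (Suc t))))"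
    then obtain w' where w': "w = D' (Suc (Suc t)) w'" "w' \<in> vecs S (b (Suc (Suc (Suc t))))" by (rule imageE)
    then obtain v' where v': "v' \<in> vecs R (b (Suc (Suc (Suc t))))" "w' = h \<circ> v'" using lift by blast
    have "D' (Suc t) w = h \<circ> D (Suc t) (D (Suc (Suc t)) v')"
      by (simp only: w' v'(2) DD'0[OF v'(1)] DD'0[OF mod_hom_closed[OF D v'(1)]])
    then show "D' (Suc t) w = (\<lambda>_. \<zero>\<^bsub>S\<^esub>)" using hom_zero by (simp add: free_resD(3)[OF F v'(1)] comp_def)
  qed
  \<comment> \<open>The surjection from the free module at position 1 onto \<open>m\<close>. Reduced
    modulo \<open>x\<close> it presents \<open>m / x m\<close>.\<close>
  define d where "d v = D 0 v 0" for v
  let ?V = "vec R (b (Suc 0))" and ?W = "vec S (b (Suc 0))"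
  interpret V: module R ?V by (rule mR)
  interpret W: module S ?W by (rule mS)
  interpret W1: module S "vec S (Suc 0)" by (rule mS)
  have D0v: "D 0 v \<in> vecs R (Suc 0)" if "v \<in> carrier ?V" for v using mod_hom_closed[OF D that] b0 by simp
  have dh: "d \<in> mod_hom R ?V (ring_mod R)" unfolding d_def by (rule mod_hom_comp[OF D coord_mod_hom[OF R]])
  have dm: "d v \<in> m" if "v \<in> carrier ?V" for v unfolding d_def by (rule ideal_resD(3)[OF res that])
  have dc: "d v \<in> carrier R" if "v \<in> carrier ?V" for v using mD(1)[OF dm[OF that]] .
  have dadd: "d (v \<oplus>\<^bsub>?V\<^esub> w) = d v \<oplus> d w" and dsub: "d (v \<ominus>\<^bsub>?V\<^esub> w) = d v \<ominus> d w"
    if "v \<in> carrier ?V" "w \<in> carrier ?V" for v w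
    using mod_hom_add[OF dh that] mod_hom_diff[OF mR module_ring_mod[OF R] dh that] by simp_all
  have dsm: "d (a \<odot>\<^bsub>?V\<^esub> v) = a \<otimes> d v" if "a \<in> carrier R" "v \<in> carrier ?V" for a v
    using mod_hom_smult[OF dh that] by simp
  have dker: "v \<in> D (Suc 0) ` vecs R (b (Suc (Suc 0)))" if v: "v \<in> carrier ?V" and z: "d v = \<zero>" for v
  proof (rule free_resD(2)[OF F v])
    interpret V1: module R "vec R (Suc 0)" by (rule mR)
    show "D 0 v = (\<lambda>_. \<zero>)" by (rule vec_1_eqI[OF D0v[OF v] V1.M.zero_closed[simplified]]) (use z in \<open>simp add: d_def\<close>)
  qed
  have dD: "d (D (Suc 0) u) = \<zero>" if "u \<in> vecs R (b (Suc (Suc 0)))" for u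
    by (simp only: d_def free_resD(3)[OF F that])
  have dlift: "\<exists>v\<in>carrier ?V. d v = y" if "y \<in> m" for y
    unfolding d_def by (rule ideal_res_preimage[OF res that mD(1)[OF that]])
  \<comment> \<open>Well-definedness of the projection from \<open>m / x m\<close> to the residue
    field: the coefficient of \<open>x\<close> in a decomposition with remainder in \<open>n\<close>
    is determined modulo \<open>m\<close>. A change of \<open>v\<close> by \<open>x u\<close> alters
    it by \<open>d u\<close>, and \<open>cancel\<close> absorbs the remainder.\<close>
  have key: "c \<ominus> a \<in> m"
    if v: "v \<in> carrier ?V" and w: "w \<in> carrier ?V" and e: "h \<circ> v = h \<circ> w" and a: "a \<in> carrier R" and c: "c \<in> carrier R"
      and \<nu>: "\<nu> \<in> n" and dv: "d v = c \<otimes> x" and dw: "d w = a \<otimes> x \<oplus> \<nu>" for v w a c \<nu>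
  proof -
    obtain u where u: "u \<in> carrier ?V" "v \<ominus>\<^bsub>?V\<^esub> w = x \<odot>\<^bsub>?V\<^esub> u" using diff0[OF v w e] by blast
    have du: "d u \<in> carrier R" by (rule dc[OF u(1)])
    have "\<nu> = c \<otimes> x \<ominus> a \<otimes> x \<ominus> (c \<otimes> x \<ominus> (a \<otimes> x \<oplus> \<nu>))" using x(1) a c nD(1)[OF \<nu>] by algebra
    also have "c \<otimes> x \<ominus> (a \<otimes> x \<oplus> \<nu>) = x \<otimes> d u"
      using dsub[OF v w] dsm[OF x(1) u(1)] by (simp only: u(2) dv dw)
    also have "c \<otimes> x \<ominus> a \<otimes> x \<ominus> x \<otimes> d u = (c \<ominus> a \<ominus> d u) \<otimes> x" using x(1) a c du by algebra
    finally have "c \<ominus> a \<ominus> d u \<in> m" using \<nu> a c du by (intro cancel) simp_all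
    then have "(c \<ominus> a \<ominus> d u) \<oplus> d u \<in> m" using dm[OF u(1)] by (rule mD(3))
    moreover have "(c \<ominus> a \<ominus> d u) \<oplus> d u = c \<ominus> a" using a c du by algebra
    ultimately show ?thesis by simp
  qed
  obtain y where y: "y \<in> carrier ?V" "d y = x" using dlift[OF m(2)] by blast
  \<comment> \<open>The inclusion of the residue field into \<open>m / x m\<close>, sending one to
    the class of \<open>x\<close>.\<close>
  define f0 where "f0 w = w 0 \<odot>\<^bsub>?W\<^esub> (h \<circ> y)" for w :: "nat => 'c"
  have b'0: "b' 0 = Suc 0" by (rule ideal_resD(2)[OF H])
  have f0h: "f0 \<in> mod_hom S (vec S (b' 0)) (vec S (b (Suc 0)))"
    unfolding b'0 f0_def
    using vec_mod_coord[OF S, of _ "Suc 0"] hom_vec[OF y(1)] W.smult_l_distr[OF _ _ hom_vec[OF y(1)]] W.smult_assoc1[OF _ _ hom_vec[OF y(1)]]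
    by (intro mod_homI) (auto simp del: vec_mod_simps simp: vec_mod_simps(2,3)[of S "Suc 0"])
  have f0e: "f0 w = h \<circ> (a \<odot>\<^bsub>?V\<^esub> y)" if "w 0 = h a" "a \<in> carrier R" for w a
    by (simp only: f0_def that(1) hom_vec_smult[OF that(2) y(1)])
  \<comment> \<open>The graph of the projection to the residue field, as a relation because neither
    the lift \<open>v\<close> nor the decomposition of \<open>d v\<close> is unique.
    \<open>fg_proj_select\<close> extracts a linear map from it.\<close>
  define Rel where "Rel w r \<longleftrightarrow> (\<exists>v\<in>carrier ?V. w = h \<circ> v \<and> (\<exists>a\<in>carrier R. \<exists>\<nu>\<in>n. d v = a \<otimes> x \<oplus> \<nu> \<and> r 0 = h a))"
    for w r :: "nat => 'c"
  have RelI: "Rel w r" if "v \<in> carrier ?V" "w = h \<circ> v" "a \<in> carrier R" "\<nu> \<in> n" "d v = a \<otimes> x \<oplus> \<nu>" "r 0 = h a" for w r v a \<nu>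
    unfolding Rel_def using that by blast
  have "\<exists>g0\<in>mod_hom S ?W (vec S (Suc 0)). \<forall>w\<in>carrier ?W. Rel w (g0 w)"
  proof (rule fg_proj_select[OF fg_proj_vec_mod[OF S] mS])
    fix w assume "w \<in> carrier ?W"
    then obtain v where v: "v \<in> carrier ?V" "w = h \<circ> v" using lift by blast
    obtain a \<nu> where a: "a \<in> carrier R" "\<nu> \<in> n" "d v = a \<otimes> x \<oplus> \<nu>" using split[OF dm[OF v(1)]] by blast
    have "Rel w (\<lambda>i. if i = 0 then h a else \<zero>\<^bsub>S\<^esub>)" by (rule RelI[OF v a]) simp
    then show "\<exists>r\<in>vecs S (Suc 0). Rel w r" using vec_1I[OF hom_closed[OF a(1)]] by blast
  next
    fix w r w' r' assume "Rel w r" "Rel w' r'"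
    then obtain v a \<nu> v' a' \<nu>' where v: "v \<in> carrier ?V" "w = h \<circ> v" "a \<in> carrier R" "\<nu> \<in> n" "d v = a \<otimes> x \<oplus> \<nu>" "r 0 = h a"
      and v': "v' \<in> carrier ?V" "w' = h \<circ> v'" "a' \<in> carrier R" "\<nu>' \<in> n" "d v' = a' \<otimes> x \<oplus> \<nu>'" "r' 0 = h a'"
      unfolding Rel_def by blast
    show "Rel (w \<oplus>\<^bsub>?W\<^esub> w') (r \<oplus>\<^bsub>vec S (Suc 0)\<^esub> r')"
    proof (rule RelI[OF V.M.a_closed[OF v(1) v'(1)] _ R.a_closed[OF v(3) v'(3)] nD(3)[OF v(4) v'(4)]])
      show "w \<oplus>\<^bsub>?W\<^esub> w' = h \<circ> (v \<oplus>\<^bsub>?V\<^esub> v')"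
        using vec_mod_coord[OF R v(1)] vec_mod_coord[OF R v'(1)] v(2) v'(2) by (auto simp: fun_eq_iff)
      show "d (v \<oplus>\<^bsub>?V\<^esub> v') = (a \<oplus> a') \<otimes> x \<oplus> (\<nu> \<oplus> \<nu>')"
        unfolding dadd[OF v(1) v'(1)] v(5) v'(5) using v(3) v'(3) x(1) nD(1)[OF v(4)] nD(1)[OF v'(4)] by algebra
    qed (use v v' in simp)
  next
    fix s w r assume s: "s \<in> carrier S" and "Rel w r"
    then obtain v a \<nu> where v: "v \<in> carrier ?V" "w = h \<circ> v" "a \<in> carrier R" "\<nu> \<in> n" "d v = a \<otimes> x \<oplus> \<nu>" "r 0 = h a"
      unfolding Rel_def by blast
    obtain q where q: "q \<in> carrier R" "s = h q" using s surj by blast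
    show "Rel (s \<odot>\<^bsub>?W\<^esub> w) (s \<odot>\<^bsub>vec S (Suc 0)\<^esub> r)"
    proof (rule RelI[OF V.smult_closed[OF q(1) v(1)] _ R.m_closed[OF q(1) v(3)] nD(6)[OF q(1) v(4)]])
      show "s \<odot>\<^bsub>?W\<^esub> w = h \<circ> (q \<odot>\<^bsub>?V\<^esub> v)" by (simp only: hom_vec_smult[OF q(1) v(1)] q(2) v(2))
      show "d (q \<odot>\<^bsub>?V\<^esub> v) = (q \<otimes> a) \<otimes> x \<oplus> q \<otimes> \<nu>"
        unfolding dsm[OF q(1) v(1)] v(5) using v(3) q(1) x(1) nD(1)[OF v(4)] by algebra
    qed (use v q in simp)
  qed
  then obtain g0 where g0h: "g0 \<in> mod_hom S ?W (vec S (Suc 0))" and g0: "\<And>w. w \<in> carrier ?W ==> Rel w (g0 w)" by blast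
  have inH: "r \<in> H 0 ` vecs S (b' (Suc 0))" if "r \<in> vecs S (Suc 0)" "r 0 = h a" "a \<in> m" for r a
    using ideal_resD(4)[OF H that(1)] that(2,3) by simp
  show ?thesis
  proof (rule contractible_transfer[OF S F' ideal_resD(1)[OF H] f0h _ _ _ _ c', unfolded One_nat_def])
    show "g0 \<in> mod_hom S ?W (vec S (b' 0))" unfolding b'0 by (rule g0h)
  next
    fix w assume w: "w \<in> H 0 ` vecs S (b' (Suc 0))"
    then have "w 0 \<in> h ` m" using ideal_resD(3)[OF H] by blast
    then obtain a where a: "a \<in> m" "w 0 = h a" by blast
    have ac: "a \<in> carrier R" by (rule mD(1)[OF a(1)])
    \<comment> \<open>For \<open>a\<close> in \<open>m\<close> the element \<open>a x\<close>
      belongs to \<open>x m\<close>: the vectors \<open>a y\<close> and \<open>x z\<close> have the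
      same image under \<open>d\<close>, and \<open>x z\<close> vanishes modulo
      \<open>x\<close>.\<close>
    obtain z where z: "z \<in> carrier ?V" "d z = a" using dlift[OF a(1)] by blast
    have ay: "a \<odot>\<^bsub>?V\<^esub> y \<in> carrier ?V" and xz: "x \<odot>\<^bsub>?V\<^esub> z \<in> carrier ?V" using ac x(1) y(1) z(1) by (auto simp del: vec_mod_simps)
    have "d (a \<odot>\<^bsub>?V\<^esub> y \<ominus>\<^bsub>?V\<^esub> x \<odot>\<^bsub>?V\<^esub> z) = a \<otimes> x \<ominus> x \<otimes> a"
      by (simp only: dsub[OF ay xz] dsm[OF ac y(1)] dsm[OF x(1) z(1)] y(2) z(2))
    also have "\<dots> = \<zero>" using ac x(1) by algebra
    finally obtain u where u: "a \<odot>\<^bsub>?V\<^esub> y \<ominus>\<^bsub>?V\<^esub> x \<odot>\<^bsub>?V\<^esub> z = D (Suc 0) u" "u \<in> vecs R (b (Suc (Suc 0)))"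
      using dker[OF V.M.minus_closed[OF ay xz]] by blast
    have "f0 w = h \<circ> (a \<odot>\<^bsub>?V\<^esub> y)" using a(2) ac by (rule f0e)
    also have "\<dots> = h \<circ> (a \<odot>\<^bsub>?V\<^esub> y \<ominus>\<^bsub>?V\<^esub> x \<odot>\<^bsub>?V\<^esub> z)"
      using W.module_diff_zero[OF hom_vec[OF ay]] by (simp only: hom_vec_minus[OF ay xz] hx0[OF z(1)] vec_mod_simps(1))
    also have "\<dots> = D' (Suc 0) (h \<circ> u)" unfolding u(1) by (rule DD'0[OF u(2), symmetric])
    finally show "f0 w \<in> D' (Suc 0) ` vecs S (b (Suc (Suc 0)))" using hom_vec[OF u(2)] by (rule image_eqI)
  next
    fix w assume "w \<in> D' (Suc 0) ` vecs S (b (Suc (Suc 0)))"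
    then obtain w' where w': "w = D' (Suc 0) w'" "w' \<in> vecs S (b (Suc (Suc 0)))" by (rule imageE)
    obtain u where u: "u \<in> vecs R (b (Suc (Suc 0)))" "w' = h \<circ> u" using lift[OF w'(2)] by blast
    have Du: "D (Suc 0) u \<in> carrier ?V" by (rule mod_hom_closed[OF D u(1)])
    have w: "w = h \<circ> D (Suc 0) u" by (simp only: w'(1) u(2) DD'0[OF u(1)])
    have wc: "w \<in> carrier ?W" unfolding w by (rule hom_vec[OF Du])
    obtain v a \<nu> where v: "v \<in> carrier ?V" "w = h \<circ> v" "a \<in> carrier R" "\<nu> \<in> n" "d v = a \<otimes> x \<oplus> \<nu>" "g0 w 0 = h a"
      using g0[OF wc] unfolding Rel_def by blast
    have "\<zero> \<ominus> a \<in> m"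
      by (rule key[OF Du v(1) _ v(3) R.zero_closed v(4) _ v(5)]) (use w v(2) dD[OF u(1)] x(1) in simp_all)
    then have "\<ominus> (\<zero> \<ominus> a) \<in> m" by (rule mD(4))
    moreover have "\<ominus> (\<zero> \<ominus> a) = a" using v(3) by algebra
    ultimately show "g0 w \<in> H 0 ` vecs S (b' (Suc 0))" using inH[OF mod_hom_closed[OF g0h wc] v(6)] by simp
  next
    fix w assume "w \<in> vecs S (b' 0)"
    then have w: "w \<in> vecs S (Suc 0)" by (simp only: b'0)
    obtain c where c: "c \<in> carrier R" "w 0 = h c" using vec_mod_coord[OF S w, of 0] surj by (metis imageE)
    have cy: "c \<odot>\<^bsub>?V\<^esub> y \<in> carrier ?V" by (rule V.smult_closed[OF c(1) y(1)])
    have f0w: "f0 w = h \<circ> (c \<odot>\<^bsub>?V\<^esub> y)" using c(2,1) by (rule f0e)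
    have fc: "f0 w \<in> carrier ?W" unfolding f0w by (rule hom_vec[OF cy])
    obtain v a \<nu> where v: "v \<in> carrier ?V" "f0 w = h \<circ> v" "a \<in> carrier R" "\<nu> \<in> n" "d v = a \<otimes> x \<oplus> \<nu>" "g0 (f0 w) 0 = h a"
      using g0[OF fc] unfolding Rel_def by blast
    have "c \<ominus> a \<in> m"
      by (rule key[OF cy v(1) _ v(3) c(1) v(4) _ v(5)]) (use f0w v(2) dsm[OF c(1) y(1)] y(2) in simp_all)
    note gc = mod_hom_closed[OF g0h fc]
    have "(w \<ominus>\<^bsub>vec S (Suc 0)\<^esub> g0 (f0 w)) 0 = h (c \<ominus> a)"
      unfolding vec_mod_a_minus[OF S w gc] using c v(3,6) by (simp add: a_minus_def)
    from inH[OF W1.M.minus_closed[OF w gc] this \<open>c \<ominus> a \<in> m\<close>]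
    show "w \<ominus>\<^bsub>vec S (b' 0)\<^esub> g0 (f0 w) \<in> H 0 ` vecs S (b' (Suc 0))" by (simp only: b'0)
  qed
qed

end

section \<open>Independence of the resolution, and minimal resolutions\<close>

lemma ideal_res_contractible_unique:
  assumes R: "cring R" and F: "ideal_res R I b D" and H: "ideal_res R I b' D'" and c: "contractible R b D t"
  shows "contractible R b' D' t"
proof -
  have b: "b 0 = Suc 0" "b' 0 = Suc 0" by (rule ideal_resD(2)[OF F] ideal_resD(2)[OF H])+
  have im: "D 0 ` vecs R (b 1) = D' 0 ` vecs R (b' 1)"
    using F H by (simp only: ideal_res_def)
  interpret V: module R "vec R (Suc 0)" by (rule module_vec_mod[OF R])
  interpret W: module R "vec R (b' (Suc 0))" by (rule module_vec_mod[OF R])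
  have z: "\<zero>\<^bsub>vec R (Suc 0)\<^esub> \<in> D' 0 ` vecs R (b' 1)"
    using W.M.zero_closed mod_hom_zero[OF module_vec_mod[OF R] module_vec_mod[OF R] free_resD(1)[OF ideal_resD(1)[OF H]], of 0, symmetric]
    unfolding One_nat_def b by (intro image_eqI)
  show ?thesis
  proof (rule contractible_transfer[OF R ideal_resD(1)[OF F] ideal_resD(1)[OF H] _ _ _ _ _ c])
    show "(\<lambda>x. x) \<in> mod_hom R (vec R (b' 0)) (vec R (b 0))" "(\<lambda>x. x) \<in> mod_hom R (vec R (b 0)) (vec R (b' 0))"
      unfolding b by (rule mod_hom_ident)+
    show "v \<ominus>\<^bsub>vec R (b' 0)\<^esub> v \<in> D' 0 ` vecs R (b' 1)" if v: "v \<in> vecs R (b' 0)" for v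
      using V.M.r_neg[OF v[unfolded b]] z unfolding b a_minus_def by (simp only:)
  qed (simp_all only: im)
qed

lemma mod_hom_vec_ideal:
  assumes R: "cring R" and I: "ideal I R" and f: "f \<in> mod_hom R (vec R n) (vec R p)"
    and v: "v \<in> vecs R n" and vI: "\<And>i. v i \<in> I"
  shows "f v j \<in> I"
proof -
  note D = cring.idealD[OF R I]
  have mv: "module R (vec R k)" for k by (rule module_vec_mod[OF R])
  interpret V: module R "vec R n" by (rule mv)
  interpret W: module R "vec R p" by (rule mv)
  have c: "v i \<odot>\<^bsub>vec R n\<^esub> unit_vec R i \<in> vecs R n" if "i < n" for i
    by (rule V.smult_closed[OF vec_mod_coord[OF R v] unit_vec_carrier[OF R that]])
  have "f v = f (finsum (vec R n) (\<lambda>i. v i \<odot>\<^bsub>vec R n\<^esub> unit_vec R i) {..<n})"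
    using dual_basis_vec_mod[OF R, of n] v by (simp only: dual_basis_def)
  also have "\<dots> = finsum (vec R p) (\<lambda>i. f (v i \<odot>\<^bsub>vec R n\<^esub> unit_vec R i)) {..<n}"
    using c by (intro mod_hom_finsum[OF mv mv f]) auto
  finally have fv: "f v = finsum (vec R p) (\<lambda>i. f (v i \<odot>\<^bsub>vec R n\<^esub> unit_vec R i)) {..<n}" .
  have "\<forall>j. finsum (vec R p) (\<lambda>i. f (v i \<odot>\<^bsub>vec R n\<^esub> unit_vec R i)) {..<n} j \<in> I"
  proof (rule finsum_closed_rel[where Q = "\<lambda>y. \<forall>j. y j \<in> I"])
    fix i assume i: "i \<in> {..<n}"
    show "f (v i \<odot>\<^bsub>vec R n\<^esub> unit_vec R i) \<in> vecs R p" using mod_hom_closed[OF f c] i by simp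
    have e: "f (v i \<odot>\<^bsub>vec R n\<^esub> unit_vec R i) = v i \<odot>\<^bsub>vec R p\<^esub> f (unit_vec R i)"
      using i by (intro mod_hom_smult[OF f vec_mod_coord[OF R v] unit_vec_carrier[OF R]]) simp
    show "\<forall>j. f (v i \<odot>\<^bsub>vec R n\<^esub> unit_vec R i) j \<in> I"
      unfolding e using D(7)[OF _ vI] i vec_mod_coord[OF R mod_hom_closed[OF f unit_vec_carrier[OF R]]] by simp
  qed (use D(2,3) W.M.abelian_monoid_axioms in auto)
  then show ?thesis by (simp only: fv)
qed

text \<open>A contractible minimal resolution vanishes in high degrees. As \<open>c\<close> annihilates the entries of
  the differentials, a free module of the resolution vanishes if the next one does.\<close>

lemma minimal_contractible_socle:
  fixes R :: "('a, 'b) ring_scheme" (structure)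
  assumes R: "cring R" and M: "ideal M R" "\<one> \<notin> M" and res: "ideal_res R M b D"
    and min: "\<And>t w i. w \<in> vecs R (b (Suc (Suc t))) ==> D (Suc t) w i \<in> M"
    and con: "contractible R b D (Suc t)"
    and c: "c \<in> carrier R" "c \<noteq> \<zero>" "\<And>m. m \<in> M ==> m \<otimes> c = \<zero>"
  shows "M \<subseteq> {\<zero>}"
proof -
  interpret cring R by fact
  note MD = idealD[OF M(1)]
  note F = ideal_resD(1)[OF res]
  note D = free_resD(1)[OF F]
  have mv: "module R (vec R k)" for k by (rule module_vec_mod[OF R])
  have D0: "D t (\<lambda>_. \<zero>) = (\<lambda>_. \<zero>)" for t using mod_hom_zero[OF mv mv D, of t] by simp
  \<comment> \<open>Both summands of the contraction pass through differentials with entries in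
    \<open>M\<close>, so a unit vector would have all its coordinates in \<open>M\<close>.\<close>
  have "b (Suc (Suc t)) = 0"
  proof (rule ccontr)
    assume "b (Suc (Suc t)) \<noteq> 0"
    then have u: "unit_vec R 0 \<in> vecs R (b (Suc (Suc t)))" by (intro unit_vec_carrier[OF R]) simp
    obtain s s' where s: "s \<in> mod_hom R (vec R (b (Suc (Suc t)))) (vec R (b (Suc (Suc (Suc t)))))"
      and s': "s' \<in> mod_hom R (vec R (b (Suc t))) (vec R (b (Suc (Suc t))))"
      and e: "\<And>v. v \<in> vecs R (b (Suc (Suc t))) ==>
        v = D (Suc (Suc t)) (s v) \<oplus>\<^bsub>vec R (b (Suc (Suc t)))\<^esub> s' (D (Suc t) v)"
      using con unfolding contractible_def by blast
    let ?u = "unit_vec R 0"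
    have "s' (D (Suc t) ?u) 0 \<in> M"
      by (rule mod_hom_vec_ideal[OF R M(1) s' mod_hom_closed[OF D u] min[OF u]])
    then have "D (Suc (Suc t)) (s ?u) 0 \<oplus> s' (D (Suc t) ?u) 0 \<in> M"
      by (rule MD(3)[OF min[OF mod_hom_closed[OF s u]]])
    then have "?u 0 \<in> M" using fun_cong[OF e[OF u], of 0] by simp
    then show False using M(2) by (simp add: unit_vec_def)
  qed
  \<comment> \<open>Descending: if the next free module is zero, the differential out of the present
    one is injective. Yet it kills \<open>c\<close> times a unit vector, since \<open>c\<close>
    annihilates its entries; so the present module is zero as well.\<close>
  have "b (Suc 0) = 0"
  proof (rule inc_induct[of "Suc 0" "Suc (Suc t)" "\<lambda>n. b n = 0"])
    fix n assume "Suc 0 \<le> n" and b: "b (Suc n) = 0"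
    then obtain p where n: "n = Suc p" by (cases n) auto
    show "b n = 0"
    proof (rule ccontr)
      assume "b n \<noteq> 0"
      then have u: "unit_vec R 0 \<in> vecs R (b (Suc p))" unfolding n by (intro unit_vec_carrier[OF R]) simp
      define w where "w = c \<odot>\<^bsub>vec R (b (Suc p))\<^esub> unit_vec R 0"
      have w: "w \<in> vecs R (b (Suc p))" unfolding w_def by (rule module.smult_closed[OF mv c(1) u])
      have "D p (unit_vec R 0) i \<in> M" for i
      proof (cases p)
        case 0
        then show ?thesis
          using ideal_resD(2)[OF res] ideal_resD(3)[OF res, of "unit_vec R 0"] mod_hom_closed[OF D u] u MD(2) by (cases i) (auto simp: vec_mod_carrier)
      next
        case (Suc q)
        then show ?thesis using min u by simp
      qed
      then have "c \<otimes> D p (unit_vec R 0) i = \<zero>" for i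
        using c(3)[of "D p (unit_vec R 0) i"] MD(1)[of "D p (unit_vec R 0) i"] m_comm[OF c(1)] by simp
      then have "D p w = (\<lambda>_. \<zero>)" unfolding w_def mod_hom_smult[OF D c(1) u] by simp
      from free_resD(2)[OF F w this] obtain z where z: "w = D (Suc p) z" "z \<in> vecs R (b (Suc (Suc p)))" by (rule imageE)
      have "z = (\<lambda>_. \<zero>)" using z(2) b n by (simp add: vec_mod_0_carrier)
      then have "w 0 = \<zero>" by (simp add: z(1) D0)
      then show False using c by (simp add: w_def unit_vec_def)
    qed
  qed (simp_all add: \<open>b (Suc (Suc t)) = 0\<close>)
  have "y = \<zero>" if y: "y \<in> M" for y
  proof -
    obtain v where v: "v \<in> vecs R (b (Suc 0))" "D 0 v 0 = y" using ideal_res_preimage[OF res y MD(1)[OF y]] by blast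
    then have "v = (\<lambda>_. \<zero>)" by (simp add: \<open>b (Suc 0) = 0\<close> vec_mod_0_carrier)
    then show ?thesis using v(2) D0 by simp
  qed
  then show ?thesis by blast
qed

section \<open>Quotient rings and the induction along a regular sequence\<close>

lemma ring_hom_factor:
  assumes p: "ring_hom_cring A B p" and q: "ring_hom_cring A C q" and surj: "p ` carrier A = carrier B"
    and ker: "\<And>a. a \<in> carrier A ==> p a = \<zero>\<^bsub>B\<^esub> ==> q a = \<zero>\<^bsub>C\<^esub>"
  shows "\<exists>f. ring_hom_cring B C f \<and> (\<forall>a\<in>carrier A. f (p a) = q a)"
proof -
  interpret p: ring_hom_cring A B p by fact
  interpret q: ring_hom_cring A C q by fact
  define f where "f y = q (inv_into (carrier A) p y)" for y
  have f: "f (p a) = q a" if a: "a \<in> carrier A" for a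
  proof -
    let ?a = "inv_into (carrier A) p (p a)"
    have i: "?a \<in> carrier A" "p ?a = p a" using a by (auto intro: inv_into_into f_inv_into_f)
    have "p (?a \<ominus>\<^bsub>A\<^esub> a) = \<zero>\<^bsub>B\<^esub>" using i a by (simp add: a_minus_def p.S.r_neg)
    then have "q (?a \<ominus>\<^bsub>A\<^esub> a) = \<zero>\<^bsub>C\<^esub>" using i a by (intro ker) simp_all
    then have "q ?a = q a" using i a q.S.minus_equality[of "q ?a" "\<ominus>\<^bsub>C\<^esub> q a"] by (simp add: a_minus_def)
    then show ?thesis by (simp add: f_def)
  qed
  have "f \<in> ring_hom B C"
  proof (rule ring_hom_memI)
    fix x y assume "x \<in> carrier B" "y \<in> carrier B"
    then obtain a b where a: "a \<in> carrier A" "x = p a" and b: "b \<in> carrier A" "y = p b" using surj by blast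
    show "f x \<in> carrier C" using a f by simp
    show "f (x \<otimes>\<^bsub>B\<^esub> y) = f x \<otimes>\<^bsub>C\<^esub> f y" using f[of "a \<otimes>\<^bsub>A\<^esub> b"] a b f by simp
    show "f (x \<oplus>\<^bsub>B\<^esub> y) = f x \<oplus>\<^bsub>C\<^esub> f y" using f[of "a \<oplus>\<^bsub>A\<^esub> b"] a b f by simp
  qed (use f[of "\<one>\<^bsub>A\<^esub>"] in simp)
  then have "ring_hom_cring B C f"
    by (simp add: ring_hom_cring_def ring_hom_cring_axioms_def p.S.cring_axioms q.S.cring_axioms)
  then show ?thesis using f by blast
qed

lemma (in cring) quotient_hom:
  assumes I: "ideal I R"
  shows "ring_hom_cring R (R Quot I) ((+>) I)" "(+>) I ` carrier R = carrier (R Quot I)"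
    "a \<in> carrier R ==> I +> a = \<zero>\<^bsub>R Quot I\<^esub> \<longleftrightarrow> a \<in> I"
    "a \<in> carrier R ==> ideal J R ==> I \<subseteq> J ==> I +> a \<in> (+>) I ` J \<longleftrightarrow> a \<in> J"
proof -
  interpret ideal I R by fact
  show h: "ring_hom_cring R (R Quot I) ((+>) I)" by (rule rcos_ring_hom_cring[OF cring_axioms])
  show "(+>) I ` carrier R = carrier (R Quot I)" by (auto simp: FactRing_def A_RCOSETS_def')
  have z: "\<zero>\<^bsub>R Quot I\<^esub> = I" by (simp add: FactRing_def)
  show k: "I +> a = \<zero>\<^bsub>R Quot I\<^esub> \<longleftrightarrow> a \<in> I" if "a \<in> carrier R" for a
    unfolding z using a_rcos_self[OF that] a_rcos_const[of a] by auto
  interpret q: ring_hom_cring R "R Quot I" "(+>) I" by (rule h)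
  show "I +> a \<in> (+>) I ` J \<longleftrightarrow> a \<in> J" if a: "a \<in> carrier R" and J: "ideal J R" "I \<subseteq> J"
  proof
    assume "I +> a \<in> (+>) I ` J"
    then obtain j where j: "j \<in> J" "I +> a = I +> j" by blast
    have jc: "j \<in> carrier R" by (rule idealD(1)[OF J(1) j(1)])
    have "I +> (a \<ominus> j) = \<zero>\<^bsub>R Quot I\<^esub>" using a jc j(2) by (simp add: a_minus_def q.S.r_neg)
    then have "a \<ominus> j \<in> J" using k[of "a \<ominus> j"] a jc J(2) by auto
    then have "(a \<ominus> j) \<oplus> j \<in> J" by (rule idealD(3)[OF J(1) _ j(1)])
    moreover have "(a \<ominus> j) \<oplus> j = a" using a jc by algebra
    ultimately show "a \<in> J" by simp
  qed blast
qed

text \<open>The hypothesis is stated for the quotient by the zero ideal so that every stage has the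
  same form \<open>R Quot I\<close>, with \<open>I\<close> an ideal of the fixed ring
  \<open>R\<close>. Its ideals then provide the termination of the induction.\<close>

theorem (in noetherian_cring) reg_ideal_of_contractible:
  assumes m: "maximalideal m R" and loc: "\<And>a. a \<in> carrier R ==> a \<notin> m ==> \<exists>u\<in>carrier R. u \<otimes> a = \<one>"
    and base: "\<exists>b D T. ideal_res (R Quot {\<zero>}) ((+>) {\<zero>} ` m) b D \<and> (\<forall>t\<ge>T. contractible (R Quot {\<zero>}) b D t)"
  shows "\<exists>k. reg_ideal k m"
proof -
  have mp: "primeideal m R" by (rule maximal_prime[OF m])
  note mP = primeD[OF mp]
  note mD = idealD[OF mP(1)]
  \<comment> \<open>\<open>K I\<close> is the invariant: \<open>I\<close> comes from a regular
    sequence in \<open>m\<close>, and some resolution of the residue field over R/I is contractible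
    in high degrees.\<close>
  define K where "K I \<longleftrightarrow> I \<subseteq> m \<and> (\<exists>k. reg_ideal k I) \<and>
    (\<exists>b D T. ideal_res (R Quot I) ((+>) I ` m) b D \<and> (\<forall>t\<ge>T. contractible (R Quot I) b D t))" for I
  have "\<exists>I. K I \<and> (\<forall>J. K J --> I \<subseteq> J --> J = I)"
  proof (rule ideal_max_ex[of K])
    show "K {\<zero>}" unfolding K_def using base mD(2) reg_ideal.zero by blast
    show "ideal I R" if "K I" for I using that reg_ideal_ideal unfolding K_def by blast
  qed
  then obtain I where KI: "K I" and Imax: "\<And>J. K J ==> I \<subseteq> J ==> J = I" by blast
  obtain k b D T where Im: "I \<subseteq> m" and k: "reg_ideal k I" and res: "ideal_res (R Quot I) ((+>) I ` m) b D"
    and con: "\<And>t. T \<le> t ==> contractible (R Quot I) b D t" using KI unfolding K_def by blast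
  have I: "ideal I R" by (rule reg_ideal_ideal[OF k])
  have "I = m"
  proof (rule ccontr)
    assume "I \<noteq> m"
    \<comment> \<open>The quotient m/L is simple, hence a copy of the residue field. This
      \<open>L\<close> takes over the part of I + m m together with a complement of the class of
      \<open>x\<close>.\<close>
    have "\<exists>L. (ideal L R \<and> I \<subseteq> L \<and> L \<subset> m) \<and> (\<forall>J. ideal J R \<and> I \<subseteq> J \<and> J \<subset> m --> L \<subseteq> J --> J = L)"
      by (rule ideal_max_ex[where I = I]) (use I Im \<open>I \<noteq> m\<close> in auto)
    then obtain L where L: "ideal L R" "I \<subseteq> L" "L \<subset> m"
      and Lmax: "\<And>J. ideal J R ==> I \<subseteq> J ==> J \<subset> m ==> L \<subseteq> J ==> J = L"
      by (elim exE conjE) (rule that, assumption+, simp)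
    note LD = idealD[OF L(1)]
    have gen: "adjoin L y = m" if y: "y \<in> m" "y \<notin> L" for y
    proof (rule ccontr)
      note a = adjoin_sup[OF L(1) mD(1)[OF y(1)]]
      assume "adjoin L y \<noteq> m"
      then have "adjoin L y \<subset> m" using adjoin_least[OF mP(1) _ y(1), of L] L(3) by auto
      then have "adjoin L y = L" using L(2) a(1) by (intro Lmax[OF adjoin_ideal[OF L(1) mD(1)[OF y(1)]]]) auto
      then show False using a(2) y(2) by simp
    qed
    have cancel: "a \<in> m" if a: "a \<in> carrier R" "a \<otimes> x \<in> L" and x: "x \<in> carrier R" "x \<notin> L" for a x
    proof (rule ccontr)
      assume "a \<notin> m"
      then obtain u where u: "u \<in> carrier R" "u \<otimes> a = \<one>" using loc a(1) by blast
      have "u \<otimes> (a \<otimes> x) = x" using u a x by (simp add: m_assoc[symmetric])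
      then show False using LD(6)[OF u(1) a(2)] x(2) by simp
    qed
    \<comment> \<open>The square of \<open>m\<close> lies in \<open>L\<close>, by Nakayama's
      argument: otherwise \<open>z y\<close> together with \<open>L\<close> would generate
      \<open>y\<close>, and \<open>1 - a z\<close>, which is no element of \<open>m\<close>, would
      multiply \<open>y\<close> into \<open>L\<close>. So \<open>m\<close> is the only prime over
      \<open>L\<close>.\<close>
    have sq: "z \<otimes> y \<in> L" if z: "z \<in> m" and y: "y \<in> m" for z y
    proof (rule ccontr)
      assume zy: "z \<otimes> y \<notin> L"
      note zc = mD(1)[OF z] and yc = mD(1)[OF y]
      have "adjoin L (z \<otimes> y) = m" by (rule gen[OF mD(7)[OF yc z] zy])
      then obtain l a where l: "l \<in> L" and a: "a \<in> carrier R" and e: "y = l \<oplus> a \<otimes> (z \<otimes> y)"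
        using y unfolding adjoin_def by blast
      have lc: "l \<in> carrier R" by (rule LD(1)[OF l])
      have "(\<one> \<ominus> a \<otimes> z) \<otimes> y = y \<ominus> a \<otimes> (z \<otimes> y)" using a zc yc by algebra
      also have "\<dots> = (l \<oplus> a \<otimes> (z \<otimes> y)) \<ominus> a \<otimes> (z \<otimes> y)" using arg_cong[OF e, of "\<lambda>w. w \<ominus> a \<otimes> (z \<otimes> y)"] .
      also have "\<dots> = l" using a zc yc lc by algebra
      finally have "(\<one> \<ominus> a \<otimes> z) \<otimes> y \<in> L" using l by simp
      moreover have "y \<notin> L" using zy LD(6)[OF zc] by blast
      ultimately have "\<one> \<ominus> a \<otimes> z \<in> m" using cancel[of "\<one> \<ominus> a \<otimes> z" y] a zc yc by simp
      then have "(\<one> \<ominus> a \<otimes> z) \<oplus> a \<otimes> z \<in> m" using mD(3) mD(6)[OF a z] by blast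
      moreover have "(\<one> \<ominus> a \<otimes> z) \<oplus> a \<otimes> z = \<one>" using a zc by algebra
      ultimately show False using mP(2) by simp
    qed
    have Lp: "p = m" if p: "primeideal p R" "L \<subseteq> p" for p
    proof (rule maximal_sup[OF m primeD(1)[OF p(1)] _ primeD(2)[OF p(1)]])
      show "m \<subseteq> p" using sq p(2) primeD(4)[OF p(1) mD(1) mD(1)] by blast
    qed
    obtain x0 where x0: "x0 \<in> m" "x0 \<notin> L" using L(3) by blast
    let ?B = "R Quot I" and ?m = "(+>) I ` m"
    note q = quotient_hom[OF I]
    interpret q: ring_hom_cring R ?B "(+>) I" by (rule q(1))
    have B: "cring ?B" by (rule q.S.cring_axioms)
    have m': "ideal ?m ?B" by (rule ring_ideal_imp_quot_ideal[OF I mP(1)])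
    have L': "ideal ((+>) I ` L) ?B" by (rule ring_ideal_imp_quot_ideal[OF I L(1)])
    have nB: "noetherian_cring (R Quot J)" if J: "ideal J R" for J
    proof -
      interpret j: ring_hom_cring R "R Quot J" "(+>) J" by (rule quotient_hom[OF J])
      have "noetherian_ring (R Quot J)"
      proof (rule j.noetherian_transfer)
        show "noetherian_ring R" by unfold_locales
        fix y assume y: "y \<in> carrier (R Quot J)"
        then obtain r where r: "r \<in> carrier R" "y = J +> r" using quotient_hom(2)[OF J] by blast
        have e: "y = \<one>\<^bsub>R Quot J\<^esub> \<otimes>\<^bsub>R Quot J\<^esub> (J +> r)" "J +> r = \<one>\<^bsub>R Quot J\<^esub> \<otimes>\<^bsub>R Quot J\<^esub> y"
          using y r by simp_all
        show "\<exists>r\<in>carrier R. \<exists>u\<in>carrier (R Quot J). \<exists>u'\<in>carrier (R Quot J). y = u \<otimes>\<^bsub>R Quot J\<^esub> (J +> r) \<and> J +> r = u' \<otimes>\<^bsub>R Quot J\<^esub> y"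
          using r(1) j.S.one_closed e by blast
      qed
      then show ?thesis by (simp add: noetherian_cring_def j.S.cring_axioms)
    qed
    \<comment> \<open>In the second alternative, being congruent to \<open>x0\<close> modulo
      \<open>L\<close> keeps the regular element \<open>x\<close> outside \<open>L\<close>.\<close>
    consider (socle) c where "c \<in> carrier R - I" "\<forall>y\<in>m. y \<otimes> c \<in> I"
      | (regular) x where "x \<in> m" "x \<ominus> x0 \<in> L" "\<forall>a\<in>carrier R. a \<otimes> x \<in> I --> a \<in> I"
      using regular_or_socle[OF I mP(1) L(1) _ Lp x0(1)] L(3) by blast
    then show False
    proof cases
      case (regular x)
      have xc: "x \<in> carrier R" by (rule mD(1)[OF regular(1)])
      have xL: "x \<notin> L"
      proof
        assume "x \<in> L"
        then have "x \<ominus> (x \<ominus> x0) \<in> L" using regular(2) by (rule LD(5))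
        moreover have "x \<ominus> (x \<ominus> x0) = x0" using xc mD(1)[OF x0(1)] by algebra
        ultimately show False using x0(2) by simp
      qed
      let ?J = "adjoin I x"
      have J: "ideal ?J R" by (rule adjoin_ideal[OF I xc])
      note IJ = adjoin_sup[OF I xc]
      note j = quotient_hom[OF J]
      have Jm: "?J \<subseteq> m" by (rule adjoin_least[OF mP(1) Im regular(1)])
      obtain f where f: "ring_hom_cring ?B (R Quot ?J) f" and fe: "\<And>a. a \<in> carrier R ==> f (I +> a) = ?J +> a"
      proof -
        have "\<exists>f. ring_hom_cring ?B (R Quot ?J) f \<and> (\<forall>a\<in>carrier R. f (I +> a) = ?J +> a)"
          by (rule ring_hom_factor[OF q(1) j(1) q(2)]) (use q(3) j(3) IJ(1) in auto)
        then show ?thesis by (elim exE conjE) (rule that, assumption, erule bspec)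
      qed
      interpret f: ring_hom_cring ?B "R Quot ?J" f by (rule f)
      have fm: "f ` ?m = (+>) ?J ` m" using fe mD(1) by (force simp: image_image)
      have qC: "\<exists>a\<in>carrier R. y = I +> a" if "y \<in> carrier ?B" for y using that q(2) by blast
      obtain b' H where H: "ideal_res (R Quot ?J) ((+>) ?J ` m) b' H"
        using noetherian_cring.ideal_res_exists_noetherian[OF nB[OF J] ring_ideal_imp_quot_ideal[OF J mP(1)]]
        by (elim exE) simp
      \<comment> \<open>The complement of the residue field in \<open>m / x m\<close> is supplied by
        \<open>L\<close>: \<open>m\<close> is L + (x), and \<open>a x \<in> L\<close> forces
        \<open>a \<in> m\<close>. So the image of \<open>L\<close> plays the role of
        \<open>n\<close>.\<close>
      have "contractible (R Quot ?J) b' H t" if t: "T \<le> t" for t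
      proof (rule f.contractible_mod_regular[where x = "I +> x" and m = ?m and n = "(+>) I ` L"])
        show "f ` carrier ?B = carrier (R Quot ?J)"
          unfolding q(2)[symmetric] j(2)[symmetric] using fe by (force simp: image_image)
        show "I +> x \<in> carrier ?B" using xc by simp
        show "f (I +> x) = \<zero>\<^bsub>R Quot ?J\<^esub>" using fe[OF xc] j(3)[OF xc] IJ(2) by simp
        show "I +> x \<in> ?m" using regular(1) by blast
        show "ideal_res ?B ?m b D" by (rule res)
        show "contractible ?B b D (Suc t)" using con t by simp
        show "ideal_res (R Quot ?J) (f ` ?m) b' H" unfolding fm by (rule H)
      next
        fix y assume y: "y \<in> carrier ?B" "f y = \<zero>\<^bsub>R Quot ?J\<^esub>"
        then obtain a where a: "a \<in> carrier R" "y = I +> a" using qC by blast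
        then have "a \<in> ?J" using y(2) fe[OF a(1)] j(3)[OF a(1)] by simp
        then obtain i c where i: "i \<in> I" "c \<in> carrier R" "a = i \<oplus> c \<otimes> x" unfolding adjoin_def by blast
        have "y = (I +> c) \<otimes>\<^bsub>?B\<^esub> (I +> x)"
          using i a xc q(3)[of i] idealD(1)[OF I i(1)] by simp
        then show "\<exists>c\<in>carrier ?B. y = c \<otimes>\<^bsub>?B\<^esub> (I +> x)" using i(2) by blast
      next
        fix y assume y: "y \<in> carrier ?B" "y \<otimes>\<^bsub>?B\<^esub> (I +> x) = \<zero>\<^bsub>?B\<^esub>"
        then obtain a where a: "a \<in> carrier R" "y = I +> a" using qC by blast
        then have "a \<otimes> x \<in> I" using y(2) q(3)[of "a \<otimes> x"] xc by simp
        then show "y = \<zero>\<^bsub>?B\<^esub>" using a regular(3) q(3) by simp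
      next
        fix y assume "y \<in> ?m"
        then obtain a where a: "a \<in> m" "y = I +> a" by blast
        then obtain l c where l: "l \<in> L" "c \<in> carrier R" "a = l \<oplus> c \<otimes> x"
          using gen[OF regular(1) xL] unfolding adjoin_def by blast
        have "y = (I +> c) \<otimes>\<^bsub>?B\<^esub> (I +> x) \<oplus>\<^bsub>?B\<^esub> (I +> l)"
          using l a xc LD(1)[OF l(1)] by (simp add: q.S.a_comm)
        then show "\<exists>c\<in>carrier ?B. \<exists>\<nu>\<in>(+>) I ` L. y = c \<otimes>\<^bsub>?B\<^esub> (I +> x) \<oplus>\<^bsub>?B\<^esub> \<nu>" using l by blast
      next
        fix y assume y: "y \<in> carrier ?B" "y \<otimes>\<^bsub>?B\<^esub> (I +> x) \<in> (+>) I ` L"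
        then obtain a where a: "a \<in> carrier R" "y = I +> a" using qC by blast
        then have "a \<otimes> x \<in> L" using y(2) q(4)[of "a \<otimes> x", OF _ L(1,2)] xc by simp
        then show "y \<in> ?m" using cancel[OF a(1) _ xc xL] a(2) by blast
      qed (rule m' L')+
      then have "K ?J" unfolding K_def using Jm H reg_ideal.adjoin[OF k xc] regular(3) by blast
      then have "?J = I" using IJ(1) by (rule Imax)
      then show False using IJ(2) L(2) xL by blast
    next
      \<comment> \<open>Every element outside the image of \<open>m\<close> is a unit in the
        quotient, so a minimal resolution exists. It is contractible in high degrees like any other
        one, and the socle element then makes the image of \<open>m\<close> vanish.\<close>
      case (socle c)
      have loc': "\<exists>u\<in>carrier ?B. u \<otimes>\<^bsub>?B\<^esub> a = \<one>\<^bsub>?B\<^esub>" if a: "a \<in> carrier ?B" "a \<notin> ?m" for a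
      proof -
        obtain r where r: "r \<in> carrier R" "a = I +> r" using a(1) q(2) by blast
        then obtain u where u: "u \<in> carrier R" "u \<otimes> r = \<one>" using loc[of r] a(2) by blast
        have "(I +> u) \<otimes>\<^bsub>?B\<^esub> a = \<one>\<^bsub>?B\<^esub>" using r u q.hom_mult[OF u(1) r(1)] by simp
        then show ?thesis using u(1) by blast
      qed
      have "\<exists>b D. ideal_res ?B ?m b D \<and> (\<forall>t. \<forall>w\<in>vecs ?B (b (Suc (Suc t))). \<forall>i. D (Suc t) w i \<in> ?m)"
        by (rule ideal_res_exists[OF B m' minimal_image[OF B q.S.idealD(2)[OF m'] loc' noetherian_cring.vec_submodule_image[OF nB[OF I]]]])
      then obtain b' H where H: "ideal_res ?B ?m b' H"
        and Hmin: "\<And>t w i. w \<in> vecs ?B (b' (Suc (Suc t))) ==> H (Suc t) w i \<in> ?m" by blast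
      have "?m \<subseteq> {\<zero>\<^bsub>?B\<^esub>}"
      proof (rule minimal_contractible_socle[OF B m' _ H Hmin])
        show "\<one>\<^bsub>?B\<^esub> \<notin> ?m" using q(4)[OF one_closed mP(1) Im] mP(2) by simp
        show "contractible ?B b' H (Suc T)" by (rule ideal_res_contractible_unique[OF B res H con]) simp
        show "I +> c \<in> carrier ?B" "I +> c \<noteq> \<zero>\<^bsub>?B\<^esub>" using socle(1) q(3) by auto
        show "y \<otimes>\<^bsub>?B\<^esub> (I +> c) = \<zero>\<^bsub>?B\<^esub>" if y: "y \<in> ?m" for y
        proof -
          obtain a where a: "a \<in> m" "y = I +> a" using y by blast
          then show ?thesis using q(3)[of "a \<otimes> c"] socle mD(1)[OF a(1)] by simp
        qed
      qed
      then have "m \<subseteq> I" using q(3) mD(1) by blast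
      then show False using Im \<open>I \<noteq> m\<close> by blast
    qed
  qed
  then show ?thesis using k by blast
qed

section \<open>Localization\<close>

lemma regular_local_ringI:
  assumes nc: "noetherian_cring A" and m: "maximalideal m A"
    and loc: "\<And>a. a \<in> carrier A ==> a \<notin> m ==> \<exists>u\<in>carrier A. u \<otimes>\<^bsub>A\<^esub> a = \<one>\<^bsub>A\<^esub>"
    and base: "\<exists>b D T. ideal_res (A Quot {\<zero>\<^bsub>A\<^esub>}) ((+>\<^bsub>A\<^esub>) {\<zero>\<^bsub>A\<^esub>} ` m) b D \<and>
      (\<forall>t\<ge>T. contractible (A Quot {\<zero>\<^bsub>A\<^esub>}) b D t)"
  shows "regular_local_ring A"
proof -
  interpret noetherian_cring A by fact
  have mp: "primeideal m A" by (rule maximal_prime[OF m])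
  have prime_le: "p \<subseteq> m" if p: "primeideal p A" for p
  proof
    fix a assume a: "a \<in> p"
    show "a \<in> m"
    proof (rule ccontr)
      assume "a \<notin> m"
      then obtain u where "u \<in> carrier A" "u \<otimes>\<^bsub>A\<^esub> a = \<one>\<^bsub>A\<^esub>" using loc[of a] primeD(3)[OF p] a by blast
      then show False using idealD(6)[OF primeD(1)[OF p] _ a, of u] primeD(2)[OF p] by simp
    qed
  qed
  obtain k where k: "reg_ideal k m" using reg_ideal_of_contractible[OF m loc base] by blast
  have kd: "krull_dim A = enat k" by (rule regular_local_krull_dim[OF m prime_le k])
  have "\<exists>!\<mm>. maximalideal \<mm> A"
  proof (rule ex1I[where a = m])
    show "maximalideal m A" by (rule m)
    fix p assume p: "maximalideal p A"
    note pp = maximal_prime[OF p]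
    show "p = m" using maximal_sup[OF p primeD(1)[OF mp] prime_le[OF pp] primeD(2)[OF mp]] by simp
  qed
  moreover obtain S where "S \<subseteq> carrier A" "finite S" "card S = k" "Idl\<^bsub>A\<^esub> S = m"
    using reg_ideal_generators[OF k primeD(2)[OF mp]] by blast
  ultimately show ?thesis unfolding regular_local_ring_def kd
    using m cring_axioms noetherian_ring_axioms by blast
qed

context ring_hom_cring begin

text \<open>\<open>S\<close> is any ring with the characteristic properties of the localization at
  \<open>P\<close>; the concrete fractions are confined to the verification of \<open>inv\<close>,
  \<open>frac\<close> and \<open>ker\<close>.\<close>

lemma regular_localization:
  assumes nr: "noetherian_ring R" and P: "primeideal P R"
    and inv: "\<And>s. s \<in> carrier R - P ==> \<exists>u\<in>carrier S. u \<otimes>\<^bsub>S\<^esub> h s = \<one>\<^bsub>S\<^esub>"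
    and frac: "\<And>a. a \<in> carrier S ==> \<exists>s\<in>carrier R - P. \<exists>r\<in>carrier R. h s \<otimes>\<^bsub>S\<^esub> a = h r"
    and ker: "\<And>r. r \<in> carrier R ==> h r = \<zero>\<^bsub>S\<^esub> ==> \<exists>t\<in>carrier R - P. t \<otimes> r = \<zero>"
    and res: "ideal_res R P b D" and con: "\<And>t. T \<le> t ==> contractible R b D t"
  shows "regular_local_ring S"
proof -
  note PD = R.primeD[OF P]
  note P_ideal = R.idealD[OF PD(1)]
  define m where "m = {a \<in> carrier S. \<exists>s\<in>carrier R - P. \<exists>r\<in>P. h s \<otimes>\<^bsub>S\<^esub> a = h r}"
  have mult: "s \<otimes> t \<in> carrier R - P" if "s \<in> carrier R - P" "t \<in> carrier R - P" for s t
    using that PD(4)[of s t] by auto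
  have mI: "a \<in> m" if "a \<in> carrier S" "s \<in> carrier R - P" "r \<in> P" "h s \<otimes>\<^bsub>S\<^esub> a = h r" for a s r
    unfolding m_def using that by blast
  have mE: "\<exists>s\<in>carrier R - P. \<exists>r\<in>P. h s \<otimes>\<^bsub>S\<^esub> a = h r" "a \<in> carrier S" if "a \<in> m" for a
    using that unfolding m_def by blast+
  have loc: "\<exists>u\<in>carrier S. u \<otimes>\<^bsub>S\<^esub> a = \<one>\<^bsub>S\<^esub>" if a: "a \<in> carrier S" "a \<notin> m" for a
  proof -
    obtain s r where s: "s \<in> carrier R - P" "r \<in> carrier R" "h s \<otimes>\<^bsub>S\<^esub> a = h r" using frac[OF a(1)] by blast
    have "r \<notin> P" using mI[OF a(1) s(1) _ s(3)] a(2) by blast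
    then obtain u where u: "u \<in> carrier S" "u \<otimes>\<^bsub>S\<^esub> h r = \<one>\<^bsub>S\<^esub>" using inv[of r] s(2) by blast
    then have "(u \<otimes>\<^bsub>S\<^esub> h s) \<otimes>\<^bsub>S\<^esub> a = \<one>\<^bsub>S\<^esub>" using s a by (simp add: S.m_assoc)
    moreover have "u \<otimes>\<^bsub>S\<^esub> h s \<in> carrier S" using u s by simp
    ultimately show ?thesis by blast
  qed
  have one: "\<one> \<in> carrier R - P" using PD(2) by simp
  have m: "ideal m S"
  proof (rule S.ideal_ofI)
    show "\<zero>\<^bsub>S\<^esub> \<in> m" by (rule mI[OF _ one P_ideal(2)]) simp_all
    fix a assume a: "a \<in> m"
    note ac = mE(2)[OF a]
    obtain s r where s: "s \<in> carrier R - P" "r \<in> P" "h s \<otimes>\<^bsub>S\<^esub> a = h r" using mE(1)[OF a] by blast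
    have rc: "r \<in> carrier R" by (rule P_ideal(1)[OF s(2)])
    {
      fix a' assume a': "a' \<in> m"
      note a'c = mE(2)[OF a']
      obtain s' r' where s': "s' \<in> carrier R - P" "r' \<in> P" "h s' \<otimes>\<^bsub>S\<^esub> a' = h r'" using mE(1)[OF a'] by blast
      have r'c: "r' \<in> carrier R" by (rule P_ideal(1)[OF s'(2)])
      have hs: "h s \<in> carrier S" "h s' \<in> carrier S" using s s' by auto
      have "h (s \<otimes> s') \<otimes>\<^bsub>S\<^esub> (a \<oplus>\<^bsub>S\<^esub> a') = h s' \<otimes>\<^bsub>S\<^esub> (h s \<otimes>\<^bsub>S\<^esub> a) \<oplus>\<^bsub>S\<^esub> h s \<otimes>\<^bsub>S\<^esub> (h s' \<otimes>\<^bsub>S\<^esub> a')"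
        using s(1) s'(1) hs ac a'c by (simp add: S.r_distr S.m_ac)
      also have "\<dots> = h (s' \<otimes> r \<oplus> s \<otimes> r')" using s s' rc r'c by simp
      finally show "a \<oplus>\<^bsub>S\<^esub> a' \<in> m"
        using ac a'c s s' P_ideal(3,6) by (intro mI[OF _ mult[OF s(1) s'(1)], of _ "s' \<otimes> r \<oplus> s \<otimes> r'"]) auto
    }
    fix c assume c: "c \<in> carrier S"
    obtain t q where t: "t \<in> carrier R - P" "q \<in> carrier R" "h t \<otimes>\<^bsub>S\<^esub> c = h q" using frac[OF c] by blast
    have hs: "h s \<in> carrier S" "h t \<in> carrier S" using s t by auto
    have "h (s \<otimes> t) \<otimes>\<^bsub>S\<^esub> (c \<otimes>\<^bsub>S\<^esub> a) = (h t \<otimes>\<^bsub>S\<^esub> c) \<otimes>\<^bsub>S\<^esub> (h s \<otimes>\<^bsub>S\<^esub> a)"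
      using s(1) t(1) hs ac c by (simp add: S.m_ac)
    also have "\<dots> = h (q \<otimes> r)" using s t rc by simp
    finally show "c \<otimes>\<^bsub>S\<^esub> a \<in> m" using c ac P_ideal(6)[OF t(2) s(2)] by (intro mI[OF _ mult[OF s(1) t(1)]]) auto
  qed (auto simp: m_def)
  have "\<one>\<^bsub>S\<^esub> \<notin> m"
  proof
    assume "\<one>\<^bsub>S\<^esub> \<in> m"
    then obtain s r where s: "s \<in> carrier R - P" "r \<in> P" "h s \<otimes>\<^bsub>S\<^esub> \<one>\<^bsub>S\<^esub> = h r" using mE(1) by blast
    have rc: "r \<in> carrier R" by (rule P_ideal(1)[OF s(2)])
    have "h (s \<ominus> r) = \<zero>\<^bsub>S\<^esub>" using s rc by (simp add: a_minus_def S.r_neg)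
    then obtain t where t: "t \<in> carrier R - P" "t \<otimes> (s \<ominus> r) = \<zero>" using ker[of "s \<ominus> r"] s(1) rc by auto
    have "t \<otimes> s = t \<otimes> (s \<ominus> r) \<oplus> t \<otimes> r"
    proof -
      have "s \<in> carrier R" "t \<in> carrier R" using t(1) s(1) by auto
      then show ?thesis using rc by algebra
    qed
    then have "t \<otimes> s = t \<otimes> r" unfolding t(2) using t(1) rc by simp
    then have "t \<otimes> s \<in> P" using P_ideal(6)[of t r] t s by simp
    then show False using mult[OF t(1) s(1)] by blast
  qed
  then have mm: "maximalideal m S"
  proof (intro maximalidealI m)
    show "carrier S \<noteq> m" using \<open>\<one>\<^bsub>S\<^esub> \<notin> m\<close> by auto
    fix J assume J: "ideal J S" "m \<subseteq> J" "J \<subseteq> carrier S"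
    show "J = m \<or> J = carrier S"
    proof (rule ccontr)
      assume no: "\<not> ?thesis"
      then obtain a where a: "a \<in> J" "a \<notin> m" using J(2) by blast
      then obtain u where "u \<in> carrier S" "u \<otimes>\<^bsub>S\<^esub> a = \<one>\<^bsub>S\<^esub>" using loc[of a] J(3) by blast
      then have "\<one>\<^bsub>S\<^esub> \<in> J" using S.idealD(6)[OF J(1) _ a(1), of u] by simp
      then show False using S.one_in_ideal[OF J(1)] no by blast
    qed
  qed
  have "noetherian_ring S"
  proof (rule noetherian_transfer[OF nr])
    fix a assume a: "a \<in> carrier S"
    obtain s r where s: "s \<in> carrier R - P" "r \<in> carrier R" "h s \<otimes>\<^bsub>S\<^esub> a = h r" using frac[OF a] by blast
    obtain u where u: "u \<in> carrier S" "u \<otimes>\<^bsub>S\<^esub> h s = \<one>\<^bsub>S\<^esub>" using inv[OF s(1)] by blast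
    have hs: "h s \<in> carrier S" using s by simp
    have "u \<otimes>\<^bsub>S\<^esub> h r = (u \<otimes>\<^bsub>S\<^esub> h s) \<otimes>\<^bsub>S\<^esub> a" unfolding s(3)[symmetric] by (rule S.m_assoc[OF u(1) hs a, symmetric])
    then have "a = u \<otimes>\<^bsub>S\<^esub> h r" unfolding u(2) using a by simp
    then show "\<exists>r\<in>carrier R. \<exists>u\<in>carrier S. \<exists>u'\<in>carrier S. a = u \<otimes>\<^bsub>S\<^esub> h r \<and> h r = u' \<otimes>\<^bsub>S\<^esub> a"
      using s(2) s(3)[symmetric] u(1) hs by blast
  qed
  then have nc: "noetherian_cring S" by (simp add: noetherian_cring_def S.cring_axioms)
  \<comment> \<open>The criterion for local rings starts from the quotient by zero. The composite of
    \<open>h\<close> with this isomorphism again has the three properties, so one base change along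
    it suffices.\<close>
  let ?Q = "S Quot {\<zero>\<^bsub>S\<^esub>}" and ?q = "(+>\<^bsub>S\<^esub>) {\<zero>\<^bsub>S\<^esub>}"
  note q = S.quotient_hom[OF S.zeroideal]
  interpret q: ring_hom_cring S ?Q ?q by (rule q(1))
  have qinj: "a = a'" if "a \<in> carrier S" "a' \<in> carrier S" "?q a = ?q a'" for a a'
  proof -
    have "?q (a \<ominus>\<^bsub>S\<^esub> a') = \<zero>\<^bsub>?Q\<^esub>" using that by (simp add: a_minus_def q.S.r_neg)
    then show ?thesis using q(3)[of "a \<ominus>\<^bsub>S\<^esub> a'"] that S.r_right_minus_eq by simp
  qed
  interpret g: ring_hom_cring R ?Q "\<lambda>r. ?q (h r)"
    using ring_hom_trans[OF homh q.homh] q.S.cring_axioms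
    by (simp add: ring_hom_cring_def ring_hom_cring_axioms_def R.cring_axioms comp_def)
  have qS: "\<exists>a'\<in>carrier S. a = ?q a'" if "a \<in> carrier ?Q" for a using that q(2) by blast
  note F = ideal_resD(1)[OF res]
  obtain D' where D': "\<And>t. D' t \<in> mod_hom ?Q (vec ?Q (b (Suc t))) (vec ?Q (b t))"
    and DD': "\<And>t v. v \<in> vecs R (b (Suc t)) ==> D' t ((\<lambda>r. ?q (h r)) \<circ> v) = (\<lambda>r. ?q (h r)) \<circ> D t v"
    using g.base_change_res[of D b, OF free_resD(1)[OF F]] by blast
  have "ideal_res ?Q {a \<in> carrier ?Q. \<exists>s\<in>carrier R - P. \<exists>r\<in>P. ?q (h s) \<otimes>\<^bsub>?Q\<^esub> a = ?q (h r)} b D'"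
  proof (rule g.ideal_res_localization[OF P _ _ _ res D' DD'])
    fix s assume s: "s \<in> carrier R - P"
    then obtain u where u: "u \<in> carrier S" "u \<otimes>\<^bsub>S\<^esub> h s = \<one>\<^bsub>S\<^esub>" using inv by blast
    then have "?q u \<otimes>\<^bsub>?Q\<^esub> ?q (h s) = \<one>\<^bsub>?Q\<^esub>" using q.hom_mult[of u "h s"] s by simp
    then show "\<exists>u\<in>carrier ?Q. u \<otimes>\<^bsub>?Q\<^esub> ?q (h s) = \<one>\<^bsub>?Q\<^esub>" using u(1) by blast
  next
    fix a assume "a \<in> carrier ?Q"
    then obtain a' where a': "a' \<in> carrier S" "a = ?q a'" using qS by blast
    obtain s r where s: "s \<in> carrier R - P" "r \<in> carrier R" "h s \<otimes>\<^bsub>S\<^esub> a' = h r" using frac[OF a'(1)] by blast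
    have "?q (h s) \<otimes>\<^bsub>?Q\<^esub> a = ?q (h r)" using q.hom_mult[of "h s" a'] s a' by simp
    then show "\<exists>s\<in>carrier R - P. \<exists>r\<in>carrier R. ?q (h s) \<otimes>\<^bsub>?Q\<^esub> a = ?q (h r)" using s by blast
  next
    fix r assume r: "r \<in> carrier R" "?q (h r) = \<zero>\<^bsub>?Q\<^esub>"
    then show "\<exists>t\<in>carrier R - P. t \<otimes> r = \<zero>" using q(3)[of "h r"] ker[of r] by simp
  qed
  moreover have "{a \<in> carrier ?Q. \<exists>s\<in>carrier R - P. \<exists>r\<in>P. ?q (h s) \<otimes>\<^bsub>?Q\<^esub> a = ?q (h r)} = ?q ` m" (is "?M = _")
  proof
    show "?M \<subseteq> ?q ` m"
    proof
      fix a assume "a \<in> ?M"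
      then obtain s r where a: "a \<in> carrier ?Q" and s: "s \<in> carrier R - P" "r \<in> P" "?q (h s) \<otimes>\<^bsub>?Q\<^esub> a = ?q (h r)" by blast
      obtain a' where a': "a' \<in> carrier S" "a = ?q a'" using qS[OF a] by blast
      have hc: "h s \<in> carrier S" "h r \<in> carrier S" using s P_ideal(1) by auto
      have "h s \<otimes>\<^bsub>S\<^esub> a' = h r"
        using s(3) hc a' q.hom_mult[OF hc(1) a'(1)] by (intro qinj) simp_all
      then show "a \<in> ?q ` m" using mI[OF a'(1) s(1,2)] a'(2) by blast
    qed
    show "?q ` m \<subseteq> ?M"
    proof
      fix a assume "a \<in> ?q ` m"
      then obtain a' where a': "a' \<in> m" "a = ?q a'" by blast
      obtain s r where s: "s \<in> carrier R - P" "r \<in> P" "h s \<otimes>\<^bsub>S\<^esub> a' = h r" using mE(1)[OF a'(1)] by blast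
      have "?q (h s) \<otimes>\<^bsub>?Q\<^esub> a = ?q (h r)" using q.hom_mult[of "h s" a'] s a'(2) mE(2)[OF a'(1)] by simp
      then show "a \<in> ?M" using s(1,2) a'(2) mE(2)[OF a'(1)] by blast
    qed
  qed
  ultimately have res': "ideal_res ?Q (?q ` m) b D'" by (simp only:)
  have "contractible ?Q b D' t" if "T \<le> t" for t
    by (rule g.base_change_contractible[OF free_resD(1)[OF F] D' DD' con[OF that]])
  with res' have ex: "\<exists>b D T. ideal_res ?Q (?q ` m) b D \<and> (\<forall>t\<ge>T. contractible ?Q b D t)" by blast
  show ?thesis by (rule regular_local_ringI[OF nc mm loc ex])
qed

end

section \<open>The ring of fractions at a prime ideal\<close>

context
  fixes R :: "('a, 'b) ring_scheme" (structure) and P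
  assumes R: "cring R" and P: "primeideal P R"
begin

interpretation cring R by (rule R)

definition frac_cls :: "'a => 'a => ('a \<times> 'a) set" where
  "frac_cls r s = frac_rel R P `` {(r, s)}"

lemma denominators: "\<one> \<in> carrier R - P"
  "s \<in> carrier R - P ==> t \<in> carrier R - P ==> s \<otimes> t \<in> carrier R - P"
  using primeD(2)[OF P] primeD(4)[OF P, of s t] by auto

lemma frac_rel_iff: "((r, s), (r', s')) \<in> frac_rel R P \<longleftrightarrow>
    r \<in> carrier R \<and> r' \<in> carrier R \<and> s \<in> carrier R - P \<and> s' \<in> carrier R - P \<and>
    (\<exists>t\<in>carrier R - P. t \<otimes> (s' \<otimes> r \<ominus> s \<otimes> r') = \<zero>)"
  by (auto simp: frac_rel_def fractions_def)

lemma frac_rel_equiv: "equiv (fractions R P) (frac_rel R P)"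
proof (rule equivI)
  show "frac_rel R P \<subseteq> fractions R P \<times> fractions R P" by (auto simp: frac_rel_def)
  show "refl_on (fractions R P) (frac_rel R P)"
  proof (rule refl_onI)
    fix x assume "x \<in> fractions R P"
    then obtain r s where x: "x = (r, s)" "r \<in> carrier R" "s \<in> carrier R - P" by (auto simp: fractions_def)
    then have "\<one> \<otimes> (s \<otimes> r \<ominus> s \<otimes> r) = \<zero>" by (simp add: a_minus_def r_neg)
    then show "(x, x) \<in> frac_rel R P" using x denominators(1) by (auto simp only: frac_rel_iff)
  qed
  show "sym (frac_rel R P)"
  proof (rule symI, clarify)
    fix r s r' s' assume *: "((r, s), (r', s')) \<in> frac_rel R P"
    then obtain t where t: "t \<in> carrier R - P" "t \<otimes> (s' \<otimes> r \<ominus> s \<otimes> r') = \<zero>" by (auto simp only: frac_rel_iff)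
    have c: "r \<in> carrier R" "r' \<in> carrier R" "s \<in> carrier R" "s' \<in> carrier R" "t \<in> carrier R" using * t by (auto simp: frac_rel_iff)
    have "t \<otimes> (s \<otimes> r' \<ominus> s' \<otimes> r) = \<ominus> (t \<otimes> (s' \<otimes> r \<ominus> s \<otimes> r'))" using c by algebra
    then show "((r', s'), (r, s)) \<in> frac_rel R P" using * t by (auto simp: frac_rel_iff)
  qed
  show "trans (frac_rel R P)"
  proof (rule transI, clarify)
    fix r s r' s' r'' s'' assume *: "((r, s), (r', s')) \<in> frac_rel R P" "((r', s'), (r'', s'')) \<in> frac_rel R P"
    then obtain t u where t: "t \<in> carrier R - P" "t \<otimes> (s' \<otimes> r \<ominus> s \<otimes> r') = \<zero>"
      and u: "u \<in> carrier R - P" "u \<otimes> (s'' \<otimes> r' \<ominus> s' \<otimes> r'') = \<zero>" by (auto simp only: frac_rel_iff)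
    have c: "r \<in> carrier R" "r' \<in> carrier R" "r'' \<in> carrier R" "s \<in> carrier R" "s' \<in> carrier R" "s'' \<in> carrier R"
      "t \<in> carrier R" "u \<in> carrier R" using * t u by (auto simp: frac_rel_iff)
    \<comment> \<open>The middle denominator \<open>s'\<close> enters the multiplier, as it has to
      be cancelled between the two given relations.\<close>
    have "(t \<otimes> (u \<otimes> s')) \<otimes> (s'' \<otimes> r \<ominus> s \<otimes> r'') =
      (s'' \<otimes> u) \<otimes> (t \<otimes> (s' \<otimes> r \<ominus> s \<otimes> r')) \<oplus> (s \<otimes> t) \<otimes> (u \<otimes> (s'' \<otimes> r' \<ominus> s' \<otimes> r''))" using c by algebra
    also have "\<dots> = \<zero>" using c by (simp only: t(2) u(2)) simp
    finally have "(t \<otimes> (u \<otimes> s')) \<otimes> (s'' \<otimes> r \<ominus> s \<otimes> r'') = \<zero>" .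
    moreover have "t \<otimes> (u \<otimes> s') \<in> carrier R - P" using * t(1) u(1) by (intro denominators(2)) (auto simp: frac_rel_iff)
    ultimately show "((r, s), (r'', s'')) \<in> frac_rel R P" using * unfolding frac_rel_iff by blast
  qed
qed

lemma frac_cls_eq:
  assumes "r \<in> carrier R" "s \<in> carrier R - P" "r' \<in> carrier R" "s' \<in> carrier R - P"
  shows "frac_cls r s = frac_cls r' s' \<longleftrightarrow> (\<exists>t\<in>carrier R - P. t \<otimes> (s' \<otimes> r \<ominus> s \<otimes> r') = \<zero>)"
  unfolding frac_cls_def using assms by (subst eq_equiv_class_iff[OF frac_rel_equiv]) (auto simp: frac_rel_iff fractions_def)

lemma frac_cls_eqI:
  assumes "r \<in> carrier R" "s \<in> carrier R - P" "r' \<in> carrier R" "s' \<in> carrier R - P" "s' \<otimes> r = s \<otimes> r'"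
  shows "frac_cls r s = frac_cls r' s'"
  unfolding frac_cls_eq[OF assms(1-4)] using assms denominators(1) by (auto simp: a_minus_def r_neg intro!: bexI[of _ \<one>])

abbreviation "Loc \<equiv> localization R P"

lemma loc_carrier: "x \<in> carrier Loc \<longleftrightarrow> (\<exists>r s. r \<in> carrier R \<and> s \<in> carrier R - P \<and> x = frac_cls r s)"
  by (auto simp: localization_def quotient_def fractions_def frac_cls_def)

lemma loc_one: "\<one>\<^bsub>Loc\<^esub> = frac_cls \<one> \<one>" and loc_zero: "\<zero>\<^bsub>Loc\<^esub> = frac_cls \<zero> \<one>"
  by (simp_all add: localization_def frac_cls_def)

text \<open>The operations of the localization are unions over all representatives. Compatibility
  with the equivalence collapses such a union to the class computed from one pair of
  representatives.\<close>

lemma loc_op: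
  assumes f: "\<And>r s r' s' p q p' q'. ((r, s), (r', s')) \<in> frac_rel R P ==> ((p, q), (p', q')) \<in> frac_rel R P ==>
      (f r s p q, f r' s' p' q') \<in> frac_rel R P"
    and "r \<in> carrier R" "s \<in> carrier R - P" "p \<in> carrier R" "q \<in> carrier R - P"
  shows "(\<Union>(r, s)\<in>frac_cls r s. \<Union>(p, q)\<in>frac_cls p q. frac_rel R P `` {f r s p q}) = frac_rel R P `` {f r s p q}"
proof -
  note E = frac_rel_equiv
  have "(\<lambda>x y. frac_rel R P `` {f (fst x) (snd x) (fst y) (snd y)}) respects2 frac_rel R P"
  proof (rule congruent2I')
    fix x y z w assume *: "(x, y) \<in> frac_rel R P" "(z, w) \<in> frac_rel R P"
    have "(f (fst x) (snd x) (fst z) (snd z), f (fst y) (snd y) (fst w) (snd w)) \<in> frac_rel R P"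
      using * by (intro f) simp_all
    then show "frac_rel R P `` {f (fst x) (snd x) (fst z) (snd z)} = frac_rel R P `` {f (fst y) (snd y) (fst w) (snd w)}"
      by (rule equiv_class_eq[OF E])
  qed
  from UN_equiv_class2[OF E E this, of "(r, s)" "(p, q)"] show ?thesis
    using assms(2-) by (simp add: frac_cls_def fractions_def case_prod_beta)
qed

lemma loc_mult:
  assumes "r \<in> carrier R" "s \<in> carrier R - P" "p \<in> carrier R" "q \<in> carrier R - P"
  shows "frac_cls r s \<otimes>\<^bsub>Loc\<^esub> frac_cls p q = frac_cls (r \<otimes> p) (s \<otimes> q)"
proof -
  have "(\<Union>(r, s)\<in>frac_cls r s. \<Union>(p, q)\<in>frac_cls p q. frac_rel R P `` {(r \<otimes> p, s \<otimes> q)}) = frac_rel R P `` {(r \<otimes> p, s \<otimes> q)}"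
  proof (rule loc_op[where f = "\<lambda>r s p q. (r \<otimes> p, s \<otimes> q)", OF _ assms])
    fix r s r' s' p q p' q' assume *: "((r, s), (r', s')) \<in> frac_rel R P" "((p, q), (p', q')) \<in> frac_rel R P"
    then obtain t u where t: "t \<in> carrier R - P" "t \<otimes> (s' \<otimes> r \<ominus> s \<otimes> r') = \<zero>"
      and u: "u \<in> carrier R - P" "u \<otimes> (q' \<otimes> p \<ominus> q \<otimes> p') = \<zero>" by (auto simp only: frac_rel_iff)
    have c: "r \<in> carrier R" "r' \<in> carrier R" "s \<in> carrier R" "s' \<in> carrier R" "p \<in> carrier R" "p' \<in> carrier R" "q \<in> carrier R" "q' \<in> carrier R"
      "t \<in> carrier R" "u \<in> carrier R" using * t u by (auto simp: frac_rel_iff)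
    have "(t \<otimes> u) \<otimes> ((s' \<otimes> q') \<otimes> (r \<otimes> p) \<ominus> (s \<otimes> q) \<otimes> (r' \<otimes> p')) =
      (u \<otimes> q' \<otimes> p) \<otimes> (t \<otimes> (s' \<otimes> r \<ominus> s \<otimes> r')) \<oplus> (t \<otimes> s \<otimes> r') \<otimes> (u \<otimes> (q' \<otimes> p \<ominus> q \<otimes> p'))" using c by algebra
    also have "\<dots> = \<zero>" using c by (simp only: t(2) u(2)) simp
    finally have "(t \<otimes> u) \<otimes> ((s' \<otimes> q') \<otimes> (r \<otimes> p) \<ominus> (s \<otimes> q) \<otimes> (r' \<otimes> p')) = \<zero>" .
    then show "((r \<otimes> p, s \<otimes> q), (r' \<otimes> p', s' \<otimes> q')) \<in> frac_rel R P"
      using * denominators(2)[OF t(1) u(1)] denominators(2)[of s q] denominators(2)[of s' q'] unfolding frac_rel_iff by blast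
  qed
  then show ?thesis by (simp add: localization_def frac_cls_def)
qed

lemma loc_add:
  assumes "r \<in> carrier R" "s \<in> carrier R - P" "p \<in> carrier R" "q \<in> carrier R - P"
  shows "frac_cls r s \<oplus>\<^bsub>Loc\<^esub> frac_cls p q = frac_cls (q \<otimes> r \<oplus> s \<otimes> p) (s \<otimes> q)"
proof -
  have "(\<Union>(r, s)\<in>frac_cls r s. \<Union>(p, q)\<in>frac_cls p q. frac_rel R P `` {(q \<otimes> r \<oplus> s \<otimes> p, s \<otimes> q)}) = frac_rel R P `` {(q \<otimes> r \<oplus> s \<otimes> p, s \<otimes> q)}"
  proof (rule loc_op[where f = "\<lambda>r s p q. (q \<otimes> r \<oplus> s \<otimes> p, s \<otimes> q)", OF _ assms])
    fix r s r' s' p q p' q' assume *: "((r, s), (r', s')) \<in> frac_rel R P" "((p, q), (p', q')) \<in> frac_rel R P"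
    then obtain t u where t: "t \<in> carrier R - P" "t \<otimes> (s' \<otimes> r \<ominus> s \<otimes> r') = \<zero>"
      and u: "u \<in> carrier R - P" "u \<otimes> (q' \<otimes> p \<ominus> q \<otimes> p') = \<zero>" by (auto simp only: frac_rel_iff)
    have c: "r \<in> carrier R" "r' \<in> carrier R" "s \<in> carrier R" "s' \<in> carrier R" "p \<in> carrier R" "p' \<in> carrier R" "q \<in> carrier R" "q' \<in> carrier R"
      "t \<in> carrier R" "u \<in> carrier R" using * t u by (auto simp: frac_rel_iff)
    have "(t \<otimes> u) \<otimes> ((s' \<otimes> q') \<otimes> (q \<otimes> r \<oplus> s \<otimes> p) \<ominus> (s \<otimes> q) \<otimes> (q' \<otimes> r' \<oplus> s' \<otimes> p')) =
      (u \<otimes> q \<otimes> q') \<otimes> (t \<otimes> (s' \<otimes> r \<ominus> s \<otimes> r')) \<oplus> (t \<otimes> s \<otimes> s') \<otimes> (u \<otimes> (q' \<otimes> p \<ominus> q \<otimes> p'))" using c by algebra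
    also have "\<dots> = \<zero>" using c by (simp only: t(2) u(2)) simp
    finally have "(t \<otimes> u) \<otimes> ((s' \<otimes> q') \<otimes> (q \<otimes> r \<oplus> s \<otimes> p) \<ominus> (s \<otimes> q) \<otimes> (q' \<otimes> r' \<oplus> s' \<otimes> p')) = \<zero>" .
    moreover have "q \<otimes> r \<oplus> s \<otimes> p \<in> carrier R" "q' \<otimes> r' \<oplus> s' \<otimes> p' \<in> carrier R" using c by simp_all
    ultimately show "((q \<otimes> r \<oplus> s \<otimes> p, s \<otimes> q), (q' \<otimes> r' \<oplus> s' \<otimes> p', s' \<otimes> q')) \<in> frac_rel R P"
      using * denominators(2)[OF t(1) u(1)] denominators(2)[of s q] denominators(2)[of s' q'] unfolding frac_rel_iff by blast
  qed
  then show ?thesis by (simp add: localization_def frac_cls_def)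
qed

lemma loc_cring: "cring Loc"
proof -
  have cI: "frac_cls r s \<in> carrier Loc" if "r \<in> carrier R" "s \<in> carrier R" "s \<notin> P" for r s using that loc_carrier by blast
  have cE: thesis if "x \<in> carrier Loc" "\<And>r s. r \<in> carrier R ==> s \<in> carrier R ==> s \<notin> P ==> x = frac_cls r s ==> thesis" for x thesis
    using that loc_carrier by blast
  note nP = primeD(2)[OF P] denominators(2)[simplified]
  note ops = loc_mult loc_add loc_one loc_zero nP
  show ?thesis
  proof (intro cringI abelian_groupI comm_monoidI)
    show "\<exists>y\<in>carrier Loc. y \<oplus>\<^bsub>Loc\<^esub> x = \<zero>\<^bsub>Loc\<^esub>" if "x \<in> carrier Loc" for x
      using that
    proof (rule cE)
      fix r s assume r: "r \<in> carrier R" "s \<in> carrier R" "s \<notin> P" "x = frac_cls r s"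
      have "frac_cls (\<ominus> r) s \<oplus>\<^bsub>Loc\<^esub> x = \<zero>\<^bsub>Loc\<^esub>"
        using r by (simp add: ops, intro frac_cls_eqI) (simp_all add: nP r_minus l_neg)
      then show ?thesis using cI[OF a_inv_closed r(2,3)] r(1) by blast
    qed
  \<comment> \<open>On representatives each remaining axiom turns into an equation between cross
    products in \<open>R\<close>.\<close>
  qed ((elim cE)?; (simp add: ops cI); (rule frac_cls_eqI); ((simp add: nP; fail) | algebra))+
qed

lemma loc_hom: "ring_hom_cring R Loc (\<lambda>r. frac_cls r \<one>)"
proof -
  have "(\<lambda>r. frac_cls r \<one>) \<in> ring_hom R Loc"
    using loc_carrier denominators(1)
    by (intro ring_hom_memI) (auto simp: loc_mult loc_add loc_one)
  then show ?thesis by (simp add: ring_hom_cring_def ring_hom_cring_axioms_def loc_cring cring_axioms)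
qed

lemma loc_inv:
  assumes "s \<in> carrier R - P"
  shows "\<exists>u\<in>carrier Loc. u \<otimes>\<^bsub>Loc\<^esub> frac_cls s \<one> = \<one>\<^bsub>Loc\<^esub>"
proof (rule bexI)
  show "frac_cls \<one> s \<in> carrier Loc" using assms loc_carrier by blast
  have s: "s \<in> carrier R" using assms by simp
  show "frac_cls \<one> s \<otimes>\<^bsub>Loc\<^esub> frac_cls s \<one> = \<one>\<^bsub>Loc\<^esub>"
    unfolding loc_mult[OF one_closed assms s denominators(1)] loc_one
    by (rule frac_cls_eqI[OF _ denominators(2)[OF assms denominators(1)] one_closed denominators(1)]) (use s in simp_all)
qed

lemma loc_frac:
  assumes "x \<in> carrier Loc"
  shows "\<exists>s\<in>carrier R - P. \<exists>r\<in>carrier R. frac_cls s \<one> \<otimes>\<^bsub>Loc\<^esub> x = frac_cls r \<one>"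
proof -
  obtain r s where r: "r \<in> carrier R" "s \<in> carrier R - P" "x = frac_cls r s" using assms loc_carrier by blast
  have s: "s \<in> carrier R" using r(2) by simp
  have "frac_cls s \<one> \<otimes>\<^bsub>Loc\<^esub> x = frac_cls r \<one>"
    unfolding r(3) loc_mult[OF s denominators(1) r(1,2)]
    by (rule frac_cls_eqI[OF _ denominators(2)[OF denominators(1) r(2)] r(1) denominators(1)]) (use r s in simp_all)
  then show ?thesis using r(1,2) by blast
qed

lemma loc_ker:
  assumes "r \<in> carrier R" "frac_cls r \<one> = \<zero>\<^bsub>Loc\<^esub>"
  shows "\<exists>t\<in>carrier R - P. t \<otimes> r = \<zero>"
  using assms frac_cls_eq[OF assms(1) denominators(1) zero_closed denominators(1)]
  by (simp add: loc_zero a_minus_def)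

end

theorem theorem1p2:
  fixes R :: "('a, 'b) ring_scheme"
  assumes "cring R"
    and "noetherian_ring R"
    and "krull_dim R \<noteq> \<infinity>"
    and "\<not> regular_ring R"
    and "infinite (UNIV :: 'm set)"
    and "\<exists>\<iota> :: 'a \<Rightarrow> 'm. inj_on \<iota> (carrier R)"
  shows "\<not> (\<exists>U V. bounded_t_structure
            (Perf R :: (('a, 'm) cochain_complex, ('a, 'm) roof set) tri_cat) U V)"
proof
  assume "\<exists>U V. bounded_t_structure (Perf R :: (('a, 'm) cochain_complex, ('a, 'm) roof set) tri_cat) U V"
  then obtain U V where bts: "bounded_t_structure (Perf R :: (('a, 'm) cochain_complex, ('a, 'm) roof set) tri_cat) U V" by blast
  obtain \<iota> :: "'a => 'm" where \<iota>: "inj_on \<iota> (carrier R)" using assms(6) by blast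
  interpret perf_t_structure R \<iota> U V
    by (intro perf_t_structure.intro module_universe.intro perf_t_structure_axioms.intro assms \<iota> bts)
  interpret noetherian_cring R using assms by (simp add: noetherian_cring_def)
  have "regular_local_ring (localization R P)" if P: "primeideal P R" for P
  proof -
    obtain b D where res: "ideal_res R P b D" using ideal_res_exists_noetherian[OF primeD(1)[OF P]] by blast
    obtain T where con: "\<And>t. T \<le> t ==> contractible R b D t"
      using ideal_res_contractible[OF assms(2,3) ideal_resD(1)[OF res]] by blast
    show ?thesis
      by (rule ring_hom_cring.regular_localization[OF loc_hom[OF assms(1) P] assms(2) P
            loc_inv[OF assms(1) P] loc_frac[OF assms(1) P] loc_ker[OF assms(1) P] res con])
  qed
  then show False using assms(1,2,4) by (simp add: regular_ring_def)
qed

end
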